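(* A Kähler surface $(M,g,J,\omega)$ is ortho-toric if and only if it admits a hamiltonian $2$-form whose associated Killing vector fields are independent. The Kähler structure is then given (locally) explicitly in terms of two arbitrary functions $F,G$ of one variable by $$g=(\xi-\eta)\Bigl(\frac{d\xi^2}{F(\xi)}-\frac{d\eta^2}{G(\eta)}\Bigr)+\frac{1}{\xi-\eta}\bigl(F(\xi)(dt+\eta\,dz)^2-G(\eta)(dt+\xi\,dz)^2\bigr),$$ $$Jd\xi=\frac{F(\xi)}{\xi-\eta}(dt+\eta\,dz),\quad Jdt=-\frac{\xi\,d\xi}{F(\xi)}-\frac{\eta\,d\eta}{G(\eta)},\quad Jd\eta=\frac{G(\eta)}{\eta-\xi}(dt+\xi\,dz),\quad Jdz=\frac{d\xi}{F(\xi)}+\frac{d\eta}{G(\eta)},$$ $$\omega=d\xi\wedge(dt+\eta\,dz)+d\eta\wedge(dt+\xi\,dz).$$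
   Context: A Kähler surface $(M,g,J,\omega)$ is an oriented Riemannian $4$-manifold with a $g$-orthogonal complex structure $J$ inducing the given orientation and satisfying $\nabla J=0$; $\omega(\cdot,\cdot)=g(J\cdot,\cdot)$. $J$ acts on $1$-forms by $(J\alpha)(X)=-\alpha(JX)$. Anti-selfdual $2$-forms (sections of $\Lambda^-M$) are exactly the trace-free $J$-invariant $2$-forms. An anti-selfdual $2$-form $\Phi$ is a twistor $2$-form if $\nabla\Phi$ is a section of $V^{(0)}M$, where $T^*M\otimes\Lambda^-M=V^{(0)}M\oplus V^{(1)}M$, $V^{(1)}M$ is the kernel of the natural contraction $T^*M\otimes\Lambda^-M\to T^*M$, and $V^{(0)}M\cong T^*M$ is its orthogonal complement. A hamiltonian $2$-form on a Kähler surface is a closed $J$-invariant $2$-form $\varphi$ whose trace-free part $\varphi_0$ is a twistor $2$-form. Write $\varphi=\varphi_0+\frac32\sigma\,\omega$ and $\tilde\varphi=\frac12\varphi_0+\frac14\sigma\,\omega$; $\sigma$ is called the trace of $\tilde\varphi$, and its pfaffian $\pi$ is defined by $\tilde\varphi\wedge\tilde\varphi=\frac14\pi\,\omega\wedge\omega$. The associated Killing vector fields of $\varphi$ are $K_1=J\,\mathrm{grad}_g\sigma$ and $K_2=J\,\mathrm{grad}_g\pi$ (they are always Killing). A Kähler surface is ortho-toric if it admits two independent hamiltonian Killing vector fields with Poisson-commuting momentum maps $\xi+\eta$ and $\xi\eta$ (a momentum map of $K$ being a function $f$ with $K=J\,\mathrm{grad}_gf$) such that $d\xi$ and $d\eta$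 are orthogonal. "Independent" means linearly independent at every point. In the explicit form $t,z$ are local functions defined up to additive constants, and $F,G$ are such that $g$ is positive definite. *)

theory Defs
  imports "HOL-Analysis.Analysis"
begin

section \<open>Smooth maps between open subsets of Euclidean spaces\<close>

text \<open>Intended for open \<open>S\<close>; the derivatives are those at \<open>x\<close>, not relative to \<open>S\<close>.\<close>

primrec Ck_on :: "nat \<Rightarrow> 'a::real_normed_vector set \<Rightarrow> ('a \<Rightarrow> 'b::real_normed_vector) \<Rightarrow> bool" where
  "Ck_on 0 S f \<longleftrightarrow> continuous_on S f"
| "Ck_on (Suc k) S f \<longleftrightarrow>
     (\<forall>x\<in>S. f differentiable (at x)) \<and> (\<forall>v. Ck_on k S (\<lambda>x. frechet_derivative f (at x) v))"

definition smooth_on :: "'a::real_normed_vector set \<Rightarrow> ('a \<Rightarrow> 'b::real_normed_vector) \<Rightarrow> bool" where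
  "smooth_on S f \<longleftrightarrow> (\<forall>k. Ck_on k S f)"


section \<open>Smooth 4-manifolds and tensor fields\<close>

text \<open>A chart is a pair of a domain and a map that is only relevant on this domain. As a manifold
  we take an open subset of a second countable Hausdorff space (for instance the whole space), with
  an atlas that need not be maximal. No connectedness is assumed.\<close>

type_synonym 'a chart = "'a set \<times> ('a \<Rightarrow> real^4)"

definition chart_inv :: "'a chart \<Rightarrow> real^4 \<Rightarrow> 'a" where
  "chart_inv c = inv_into (fst c) (snd c)"

definition chart_img :: "'a chart \<Rightarrow> (real^4) set" where
  "chart_img c = snd c ` fst c"

definition chart :: "'a::topological_space chart \<Rightarrow> bool" where
  "chart c \<longleftrightarrow> open (fst c) \<and> open (chart_img c) \<and>
     homeomorphism (fst c) (chart_img c) (snd c) (chart_inv c)"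

definition transition :: "'a chart \<Rightarrow> 'a chart \<Rightarrow> real^4 \<Rightarrow> real^4" where
  "transition c d = snd d \<circ> chart_inv c"

definition overlap :: "'a chart \<Rightarrow> 'a chart \<Rightarrow> (real^4) set" where
  "overlap c d = snd c ` (fst c \<inter> fst d)"

definition smooth_4manifold ::
  "'a::{t2_space,second_countable_topology} set \<Rightarrow> 'a chart set \<Rightarrow> bool" where
  "smooth_4manifold M A \<longleftrightarrow> (\<Union>c\<in>A. fst c) = M \<and> (\<forall>c\<in>A. chart c) \<and>
     (\<forall>c\<in>A. \<forall>d\<in>A. smooth_on (overlap c d) (transition c d))"

text \<open>A tensor field assigns to each chart \<open>c\<close> of the atlas its components as functions of the
  coordinates, defined on \<open>chart_img c\<close>. With \<open>e i = axis i 1\<close>: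
  a bilinear form \<open>B\<close> has components \<open>B $ i $ j = B (e i, e j)\<close>, an endomorphism \<open>J\<close> has the matrix
  of \<open>v \<mapsto> J *v v\<close>, and a covector \<open>\<alpha>\<close> has components \<open>\<alpha> $ i = \<alpha> (e i)\<close>.\<close>

type_synonym ('a, 'v) field = "'a chart \<Rightarrow> real^4 \<Rightarrow> 'v"

definition bilinear_field :: "'a chart set \<Rightarrow> ('a, real^4^4) field \<Rightarrow> bool" where
  "bilinear_field A B \<longleftrightarrow> (\<forall>c\<in>A. smooth_on (chart_img c) (B c)) \<and>
     (\<forall>c\<in>A. \<forall>d\<in>A. \<forall>x\<in>overlap c d. let P = jacobian (transition c d) (at x) in
        B c x = transpose P ** B d (transition c d x) ** P)"

definition endo_field :: "'a chart set \<Rightarrow> ('a, real^4^4) field \<Rightarrow> bool" where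
  "endo_field A J \<longleftrightarrow> (\<forall>c\<in>A. smooth_on (chart_img c) (J c)) \<and>
     (\<forall>c\<in>A. \<forall>d\<in>A. \<forall>x\<in>overlap c d. let P = jacobian (transition c d) (at x) in
        P ** J c x = J d (transition c d x) ** P)"

definition vector_field :: "'a chart set \<Rightarrow> ('a, real^4) field \<Rightarrow> bool" where
  "vector_field A K \<longleftrightarrow> (\<forall>c\<in>A. smooth_on (chart_img c) (K c)) \<and>
     (\<forall>c\<in>A. \<forall>d\<in>A. \<forall>x\<in>overlap c d.
        K d (transition c d x) = jacobian (transition c d) (at x) *v K c x)"

definition local_rep :: "('a \<Rightarrow> real) \<Rightarrow> ('a, real) field" where
  "local_rep f = (\<lambda>c. f \<circ> chart_inv c)"

definition smooth_function :: "'a chart set \<Rightarrow> ('a \<Rightarrow> real) \<Rightarrow> bool" where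
  "smooth_function A f \<longleftrightarrow> (\<forall>c\<in>A. smooth_on (chart_img c) (local_rep f c))"


section \<open>Pointwise linear algebra\<close>

definition pos_def :: "real^4^4 \<Rightarrow> bool" where
  "pos_def B \<longleftrightarrow> transpose B = B \<and> (\<forall>v. v \<noteq> 0 \<longrightarrow> v \<bullet> (B *v v) > 0)"

definition alternating :: "real^4^4 \<Rightarrow> bool" where
  "alternating \<phi> \<longleftrightarrow> transpose \<phi> = - \<phi>"

text \<open>\<open>\<omega> (X, Y) = g (J X, Y)\<close> and \<open>(J \<alpha>) (X) = - \<alpha> (J X)\<close>.\<close>

definition kahler_form :: "real^4^4 \<Rightarrow> real^4^4 \<Rightarrow> real^4^4" where
  "kahler_form g J = (\<chi> i j. \<Sum>k\<in>UNIV. J $ k $ i * g $ k $ j)"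

definition J_covector :: "real^4^4 \<Rightarrow> real^4 \<Rightarrow> real^4" where
  "J_covector J \<alpha> = (\<chi> i. - (\<Sum>k\<in>UNIV. \<alpha> $ k * J $ k $ i))"

definition covector_inner :: "real^4^4 \<Rightarrow> real^4 \<Rightarrow> real^4 \<Rightarrow> real" where
  "covector_inner g \<alpha> \<beta> = \<alpha> \<bullet> (matrix_inv g *v \<beta>)"

definition wedge :: "real^4 \<Rightarrow> real^4 \<Rightarrow> real^4^4" where
  "wedge \<alpha> \<beta> = (\<chi> i j. \<alpha> $ i * \<beta> $ j - \<alpha> $ j * \<beta> $ i)"

definition square :: "real^4 \<Rightarrow> real^4^4" where
  "square \<alpha> = (\<chi> i j. \<alpha> $ i * \<alpha> $ j)"

text \<open>A 4-form is represented by its value on \<open>(e 1, e 2, e 3, e 4)\<close>; this is the wedge product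
  of two 2-forms.\<close>

definition wedge2 :: "real^4^4 \<Rightarrow> real^4^4 \<Rightarrow> real" where
  "wedge2 \<phi> \<psi> =
     \<phi> $ 1 $ 2 * \<psi> $ 3 $ 4 - \<phi> $ 1 $ 3 * \<psi> $ 2 $ 4 + \<phi> $ 1 $ 4 * \<psi> $ 2 $ 3 +
     \<phi> $ 3 $ 4 * \<psi> $ 1 $ 2 - \<phi> $ 2 $ 4 * \<psi> $ 1 $ 3 + \<phi> $ 2 $ 3 * \<psi> $ 1 $ 4"

text \<open>Normalized so that the products \<open>\<epsilon> i \<and> \<epsilon> j\<close> (\<open>i < j\<close>) of an orthonormal coframe are
  orthonormal.\<close>

definition form_inner :: "real^4^4 \<Rightarrow> real^4^4 \<Rightarrow> real^4^4 \<Rightarrow> real" where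
  "form_inner g \<phi> \<psi> = (1/2) * (\<Sum>i\<in>UNIV. \<Sum>j\<in>UNIV. \<Sum>k\<in>UNIV. \<Sum>l\<in>UNIV.
     matrix_inv g $ i $ k * matrix_inv g $ j $ l * \<phi> $ i $ j * \<psi> $ k $ l)"

text \<open>Anti-selfdual forms: \<open>*\<Phi> = - \<Phi>\<close>, where \<open>\<alpha> \<and> *\<Phi> = \<langle>\<alpha>, \<Phi>\<rangle> vol\<close> and \<open>vol = \<omega> \<and> \<omega> / 2\<close> is the
  volume form of \<open>g\<close> for the orientation induced by \<open>J\<close>.\<close>

definition anti_selfdual :: "real^4^4 \<Rightarrow> real^4^4 \<Rightarrow> real^4^4 \<Rightarrow> bool" where
  "anti_selfdual g J \<Phi> \<longleftrightarrow> alternating \<Phi> \<and>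
     (\<forall>\<alpha>. alternating \<alpha> \<longrightarrow>
        wedge2 \<alpha> \<Phi> = - form_inner g \<alpha> \<Phi> * (wedge2 (kahler_form g J) (kahler_form g J) / 2))"

text \<open>An element \<open>T\<close> of the tensor product of covectors and 2-forms has components
  \<open>T $ i $ j $ k\<close>, where \<open>T $ i\<close> is a 2-form.\<close>

definition tensor_inner :: "real^4^4 \<Rightarrow> real^4^4^4 \<Rightarrow> real^4^4^4 \<Rightarrow> real" where
  "tensor_inner g S T =
     (\<Sum>i\<in>UNIV. \<Sum>j\<in>UNIV. matrix_inv g $ i $ j * form_inner g (S $ i) (T $ j))"

definition contraction :: "real^4^4 \<Rightarrow> real^4^4^4 \<Rightarrow> real^4" where
  "contraction g T = (\<chi> k. \<Sum>i\<in>UNIV. \<Sum>j\<in>UNIV. matrix_inv g $ i $ j * T $ i $ j $ k)"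

definition V1 :: "real^4^4 \<Rightarrow> real^4^4 \<Rightarrow> (real^4^4^4) set" where
  "V1 g J = {T. (\<forall>i. anti_selfdual g J (T $ i)) \<and> contraction g T = 0}"

definition V0 :: "real^4^4 \<Rightarrow> real^4^4 \<Rightarrow> (real^4^4^4) set" where
  "V0 g J = {T. (\<forall>i. anti_selfdual g J (T $ i)) \<and> (\<forall>S\<in>V1 g J. tensor_inner g S T = 0)}"


section \<open>Differential operators in coordinates\<close>

definition pd :: "4 \<Rightarrow> (real^4 \<Rightarrow> real) \<Rightarrow> real^4 \<Rightarrow> real" where
  "pd i f x = frechet_derivative f (at x) (axis i 1)"

definition differential :: "(real^4 \<Rightarrow> real) \<Rightarrow> real^4 \<Rightarrow> real^4" where
  "differential f x = (\<chi> i. pd i f x)"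

definition grad :: "(real^4 \<Rightarrow> real^4^4) \<Rightarrow> (real^4 \<Rightarrow> real) \<Rightarrow> real^4 \<Rightarrow> real^4" where
  "grad g f x = matrix_inv (g x) *v differential f x"

text \<open>\<open>christoffel g k i j\<close> is the Levi-Civita symbol with upper index \<open>k\<close>.\<close>

definition christoffel :: "(real^4 \<Rightarrow> real^4^4) \<Rightarrow> 4 \<Rightarrow> 4 \<Rightarrow> 4 \<Rightarrow> real^4 \<Rightarrow> real" where
  "christoffel g k i j x = (1/2) * (\<Sum>l\<in>UNIV. matrix_inv (g x) $ k $ l *
     (pd i (\<lambda>y. g y $ j $ l) x + pd j (\<lambda>y. g y $ i $ l) x - pd l (\<lambda>y. g y $ i $ j) x))"

text \<open>The first index of a covariant derivative is the direction of differentiation.\<close>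

definition nabla_form ::
  "(real^4 \<Rightarrow> real^4^4) \<Rightarrow> (real^4 \<Rightarrow> real^4^4) \<Rightarrow> real^4 \<Rightarrow> real^4^4^4" where
  "nabla_form g \<phi> x = (\<chi> i j k. pd i (\<lambda>y. \<phi> y $ j $ k) x
     - (\<Sum>l\<in>UNIV. christoffel g l i j x * \<phi> x $ l $ k)
     - (\<Sum>l\<in>UNIV. christoffel g l i k x * \<phi> x $ j $ l))"

definition nabla_endo ::
  "(real^4 \<Rightarrow> real^4^4) \<Rightarrow> (real^4 \<Rightarrow> real^4^4) \<Rightarrow> real^4 \<Rightarrow> real^4^4^4" where
  "nabla_endo g J x = (\<chi> i j k. pd i (\<lambda>y. J y $ j $ k) x
     + (\<Sum>l\<in>UNIV. christoffel g j i l x * J x $ l $ k)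
     - (\<Sum>l\<in>UNIV. christoffel g l i k x * J x $ j $ l))"

text \<open>Nijenhuis tensor \<open>[J X, J Y] - J [J X, Y] - J [X, J Y] - [X, Y]\<close> with \<open>X = e i\<close>, \<open>Y = e j\<close>.\<close>

definition nijenhuis :: "(real^4 \<Rightarrow> real^4^4) \<Rightarrow> real^4 \<Rightarrow> real^4^4^4" where
  "nijenhuis J x = (\<chi> i j k. \<Sum>l\<in>UNIV.
       J x $ l $ i * pd l (\<lambda>y. J y $ k $ j) x - J x $ l $ j * pd l (\<lambda>y. J y $ k $ i) x
     + J x $ k $ l * (pd j (\<lambda>y. J y $ l $ i) x - pd i (\<lambda>y. J y $ l $ j) x))"

definition d_form :: "(real^4 \<Rightarrow> real^4^4) \<Rightarrow> real^4 \<Rightarrow> real^4^4^4" where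
  "d_form \<phi> x = (\<chi> i j k. pd i (\<lambda>y. \<phi> y $ j $ k) x + pd j (\<lambda>y. \<phi> y $ k $ i) x
     + pd k (\<lambda>y. \<phi> y $ i $ j) x)"

definition lie_metric ::
  "(real^4 \<Rightarrow> real^4) \<Rightarrow> (real^4 \<Rightarrow> real^4^4) \<Rightarrow> real^4 \<Rightarrow> real^4^4" where
  "lie_metric K g x = (\<chi> i j. \<Sum>l\<in>UNIV. K x $ l * pd l (\<lambda>y. g y $ i $ j) x
     + g x $ l $ j * pd i (\<lambda>y. K y $ l) x + g x $ i $ l * pd j (\<lambda>y. K y $ l) x)"


section \<open>Kaehler surfaces\<close>

text \<open>The orientation is the one induced by \<open>J\<close>, so it is not a separate datum. That \<open>J\<close> is a
  complex structure is expressed by the vanishing of its Nijenhuis tensor.\<close>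

definition kahler_surface :: "'a::{t2_space,second_countable_topology} set \<Rightarrow> 'a chart set \<Rightarrow>
    ('a, real^4^4) field \<Rightarrow> ('a, real^4^4) field \<Rightarrow> bool" where
  "kahler_surface M A g J \<longleftrightarrow>
     smooth_4manifold M A \<and> bilinear_field A g \<and> endo_field A J \<and>
     (\<forall>c\<in>A. \<forall>x\<in>chart_img c.
        pos_def (g c x) \<and>
        J c x ** J c x = - mat 1 \<and>
        transpose (J c x) ** g c x ** J c x = g c x \<and>
        nijenhuis (J c) x = 0 \<and>
        nabla_endo (g c) (J c) x = 0)"

definition J_grad ::
  "('a, real^4^4) field \<Rightarrow> ('a, real^4^4) field \<Rightarrow> ('a, real) field \<Rightarrow> ('a, real^4) field" where
  "J_grad g J f = (\<lambda>c x. J c x *v grad (g c) (f c) x)"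

definition killing_field :: "'a chart set \<Rightarrow> ('a, real^4^4) field \<Rightarrow> ('a, real^4) field \<Rightarrow> bool" where
  "killing_field A g K \<longleftrightarrow> vector_field A K \<and>
     (\<forall>c\<in>A. \<forall>x\<in>chart_img c. lie_metric (K c) (g c) x = 0)"

definition momentum_map :: "'a chart set \<Rightarrow> ('a, real^4^4) field \<Rightarrow> ('a, real^4^4) field \<Rightarrow>
    ('a, real^4) field \<Rightarrow> ('a \<Rightarrow> real) \<Rightarrow> bool" where
  "momentum_map A g J K f \<longleftrightarrow>
     (\<forall>c\<in>A. \<forall>x\<in>chart_img c. K c x = J_grad g J (local_rep f) c x)"

definition independent_fields ::
  "'a chart set \<Rightarrow> ('a, real^4) field \<Rightarrow> ('a, real^4) field \<Rightarrow> bool" where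
  "independent_fields A K L \<longleftrightarrow> (\<forall>c\<in>A. \<forall>x\<in>chart_img c.
     \<forall>a b. a *\<^sub>R K c x + b *\<^sub>R L c x = 0 \<longrightarrow> a = 0 \<and> b = 0)"

text \<open>The Poisson bracket is \<open>\<omega> (X f, X h)\<close>, where \<open>X f = J grad f\<close>.\<close>

definition poisson_commute :: "'a chart set \<Rightarrow> ('a, real^4^4) field \<Rightarrow> ('a, real^4^4) field \<Rightarrow>
    ('a \<Rightarrow> real) \<Rightarrow> ('a \<Rightarrow> real) \<Rightarrow> bool" where
  "poisson_commute A g J f h \<longleftrightarrow> (\<forall>c\<in>A. \<forall>x\<in>chart_img c.
     J_grad g J (local_rep f) c x \<bullet>
       (kahler_form (g c x) (J c x) *v J_grad g J (local_rep h) c x) = 0)"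


section \<open>Hamiltonian 2-forms\<close>

text \<open>For a 2-form \<open>\<phi> = \<phi>\<^sub>0 + (3/2) \<sigma> \<omega>\<close> with \<open>\<phi>\<^sub>0\<close> trace-free, that is, orthogonal to \<open>\<omega>\<close>.\<close>

definition sigma ::
  "('a, real^4^4) field \<Rightarrow> ('a, real^4^4) field \<Rightarrow> ('a, real^4^4) field \<Rightarrow> ('a, real) field" where
  "sigma g J \<phi> = (\<lambda>c x. let \<omega> = kahler_form (g c x) (J c x) in
     (2/3) * (form_inner (g c x) (\<phi> c x) \<omega> / form_inner (g c x) \<omega> \<omega>))"

definition trace_free_part ::
  "('a, real^4^4) field \<Rightarrow> ('a, real^4^4) field \<Rightarrow> ('a, real^4^4) field \<Rightarrow> ('a, real^4^4) field" where
  "trace_free_part g J \<phi> =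
     (\<lambda>c x. \<phi> c x - (3/2 * sigma g J \<phi> c x) *\<^sub>R kahler_form (g c x) (J c x))"

definition normalized_form ::
  "('a, real^4^4) field \<Rightarrow> ('a, real^4^4) field \<Rightarrow> ('a, real^4^4) field \<Rightarrow> ('a, real^4^4) field" where
  "normalized_form g J \<phi> = (\<lambda>c x. (1/2) *\<^sub>R trace_free_part g J \<phi> c x
     + (1/4 * sigma g J \<phi> c x) *\<^sub>R kahler_form (g c x) (J c x))"

text \<open>The solution \<open>\<pi>\<close> of \<open>\<psi> \<and> \<psi> = (1/4) \<pi> \<omega> \<and> \<omega>\<close>, where \<open>\<psi>\<close> is the normalized form.\<close>

definition pfaffian ::
  "('a, real^4^4) field \<Rightarrow> ('a, real^4^4) field \<Rightarrow> ('a, real^4^4) field \<Rightarrow> ('a, real) field" where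
  "pfaffian g J \<phi> = (\<lambda>c x. let \<omega> = kahler_form (g c x) (J c x); \<psi> = normalized_form g J \<phi> c x in
     4 * wedge2 \<psi> \<psi> / wedge2 \<omega> \<omega>)"

definition twistor_form :: "'a chart set \<Rightarrow> ('a, real^4^4) field \<Rightarrow> ('a, real^4^4) field \<Rightarrow>
    ('a, real^4^4) field \<Rightarrow> bool" where
  "twistor_form A g J \<Phi> \<longleftrightarrow> bilinear_field A \<Phi> \<and>
     (\<forall>c\<in>A. \<forall>x\<in>chart_img c. anti_selfdual (g c x) (J c x) (\<Phi> c x) \<and>
        nabla_form (g c) (\<Phi> c) x \<in> V0 (g c x) (J c x))"

definition hamiltonian_form :: "'a chart set \<Rightarrow> ('a, real^4^4) field \<Rightarrow> ('a, real^4^4) field \<Rightarrow>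
    ('a, real^4^4) field \<Rightarrow> bool" where
  "hamiltonian_form A g J \<phi> \<longleftrightarrow> bilinear_field A \<phi> \<and>
     (\<forall>c\<in>A. \<forall>x\<in>chart_img c.
        alternating (\<phi> c x) \<and>
        d_form (\<phi> c) x = 0 \<and>
        transpose (J c x) ** \<phi> c x ** J c x = \<phi> c x) \<and>
     twistor_form A g J (trace_free_part g J \<phi>)"

definition associated_field1 ::
  "('a, real^4^4) field \<Rightarrow> ('a, real^4^4) field \<Rightarrow> ('a, real^4^4) field \<Rightarrow> ('a, real^4) field" where
  "associated_field1 g J \<phi> = J_grad g J (sigma g J \<phi>)"

definition associated_field2 ::
  "('a, real^4^4) field \<Rightarrow> ('a, real^4^4) field \<Rightarrow> ('a, real^4^4) field \<Rightarrow> ('a, real^4) field" where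
  "associated_field2 g J \<phi> = J_grad g J (pfaffian g J \<phi>)"


section \<open>Ortho-toric surfaces\<close>

definition orthotoric_by :: "'a chart set \<Rightarrow> ('a, real^4^4) field \<Rightarrow> ('a, real^4^4) field \<Rightarrow>
    ('a \<Rightarrow> real) \<Rightarrow> ('a \<Rightarrow> real) \<Rightarrow> bool" where
  "orthotoric_by A g J \<xi> \<eta> \<longleftrightarrow> smooth_function A \<xi> \<and> smooth_function A \<eta> \<and>
     (\<exists>K L. killing_field A g K \<and> killing_field A g L \<and> independent_fields A K L \<and>
        momentum_map A g J K (\<lambda>p. \<xi> p + \<eta> p) \<and> momentum_map A g J L (\<lambda>p. \<xi> p * \<eta> p)) \<and>
     poisson_commute A g J (\<lambda>p. \<xi> p + \<eta> p) (\<lambda>p. \<xi> p * \<eta> p) \<and>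
     (\<forall>c\<in>A. \<forall>x\<in>chart_img c. covector_inner (g c x)
        (differential (local_rep \<xi> c) x) (differential (local_rep \<eta> c) x) = 0)"

definition orthotoric ::
  "'a chart set \<Rightarrow> ('a, real^4^4) field \<Rightarrow> ('a, real^4^4) field \<Rightarrow> bool" where
  "orthotoric A g J \<longleftrightarrow> (\<exists>\<xi> \<eta>. orthotoric_by A g J \<xi> \<eta>)"

text \<open>Here \<open>a, b\<close> are the values of \<open>\<xi>, \<eta>\<close> and \<open>d\<xi>, d\<eta>, dt, dz\<close> are covectors at one point.\<close>

definition orthotoric_metric :: "(real \<Rightarrow> real) \<Rightarrow> (real \<Rightarrow> real) \<Rightarrow> real \<Rightarrow> real \<Rightarrow>
    real^4 \<Rightarrow> real^4 \<Rightarrow> real^4 \<Rightarrow> real^4 \<Rightarrow> real^4^4" where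
  "orthotoric_metric F G a b d\<xi> d\<eta> dt dz =
     (a - b) *\<^sub>R ((1 / F a) *\<^sub>R square d\<xi> - (1 / G b) *\<^sub>R square d\<eta>)
     + (1 / (a - b)) *\<^sub>R (F a *\<^sub>R square (dt + b *\<^sub>R dz) - G b *\<^sub>R square (dt + a *\<^sub>R dz))"

definition orthotoric_form :: "'a chart set \<Rightarrow> ('a, real^4^4) field \<Rightarrow> ('a, real^4^4) field \<Rightarrow>
    'a set \<Rightarrow> ('a \<Rightarrow> real) \<Rightarrow> ('a \<Rightarrow> real) \<Rightarrow> ('a \<Rightarrow> real) \<Rightarrow> ('a \<Rightarrow> real) \<Rightarrow>
    (real \<Rightarrow> real) \<Rightarrow> (real \<Rightarrow> real) \<Rightarrow> bool" where
  "orthotoric_form A g J U \<xi> \<eta> t z F G \<longleftrightarrow>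
     (\<forall>c\<in>A. \<forall>p\<in>U \<inter> fst c.
        let x = snd c p; a = \<xi> p; b = \<eta> p;
            d\<xi> = differential (local_rep \<xi> c) x; d\<eta> = differential (local_rep \<eta> c) x;
            dt = differential (local_rep t c) x; dz = differential (local_rep z c) x
        in a \<noteq> b \<and> F a \<noteq> 0 \<and> G b \<noteq> 0 \<and>
           g c x = orthotoric_metric F G a b d\<xi> d\<eta> dt dz \<and>
           J_covector (J c x) d\<xi> = (F a / (a - b)) *\<^sub>R (dt + b *\<^sub>R dz) \<and>
           J_covector (J c x) dt = - (a / F a) *\<^sub>R d\<xi> - (b / G b) *\<^sub>R d\<eta> \<and>
           J_covector (J c x) d\<eta> = (G b / (b - a)) *\<^sub>R (dt + a *\<^sub>R dz) \<and>
           J_covector (J c x) dz = (1 / F a) *\<^sub>R d\<xi> + (1 / G b) *\<^sub>R d\<eta> \<and>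
           kahler_form (g c x) (J c x) = wedge d\<xi> (dt + b *\<^sub>R dz) + wedge d\<eta> (dt + a *\<^sub>R dz))"

definition smooth_function_on :: "'a chart set \<Rightarrow> 'a set \<Rightarrow> ('a \<Rightarrow> real) \<Rightarrow> bool" where
  "smooth_function_on A U f \<longleftrightarrow> (\<forall>c\<in>A. smooth_on (snd c ` (U \<inter> fst c)) (local_rep f c))"

end

theory Submission
  imports Defs
begin

text \<open>
  Write \<open>a = \<xi>\<close>, \<open>b = \<eta>\<close>. Both sides of the equivalence amount to the same second order condition on a
  pair of functions for which \<open>da, J da, db, J db\<close> are orthogonal: the Hessian of \<open>a\<close> equals
    \<open>k (da\<^sup>2 + (J da)\<^sup>2) + (2 da db - 2 J da J db + |da|\<^sup>2 / |db|\<^sup>2 (db\<^sup>2 + (J db)\<^sup>2)) / (2 (a - b))\<close>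
  for some function \<open>k\<close>, and similarly for \<open>b\<close>. This is the predicate \<open>normal_hess\<close>.

  Ortho-toric surfaces satisfy it (\<open>orthotoric_normal_hess\<close>). The field \<open>J grad f\<close> is Killing if and only if the
  Hessian of \<open>f\<close> is \<open>J\<close>-invariant (\<open>killing_iff\<close>). Invariance of the Hessians of \<open>a + b\<close> and \<open>a b\<close>, together with the
  derivatives of \<open>\<langle>da, db\<rangle> = 0\<close> and of \<open>\<langle>J da, db\<rangle> = 0\<close>, which is the Poisson commutation, is a system of linear
  equations for the entries of the two Hessians, and its solutions are the normal forms.

  So do hamiltonian 2-forms \<open>\<phi>\<close> with independent Killing fields. An element of \<open>V0\<close> is the twistor tensor of a
  covector (\<open>V0_iff\<close>), and closedness of \<open>\<phi>\<close> forces this covector to be \<open>d\<sigma>\<close>. Hence the covariant derivative of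
  \<open>\<Psi> = \<phi> - \<sigma> \<omega>\<close>, twice the normalized form, is an explicit expression in \<open>d\<sigma>\<close>. Its endomorphism \<open>Q\<close> satisfies
  \<open>Q\<^sup>2 - \<sigma> Q + \<pi> = 0\<close> (\<open>cayley_hamilton\<close>), so the candidates for \<open>a\<close> and \<open>b\<close> are the eigenvalues of \<open>Q\<close>; they are
  distinct, since at a zero of the discriminant \<open>d\<pi>\<close> is a multiple of \<open>d\<sigma>\<close> (\<open>discriminant_pos\<close>). Differentiating the
  pfaffian gives \<open>d\<pi> = \<sigma> d\<sigma> - Q d\<sigma>\<close>, which makes \<open>da\<close> and \<open>db\<close> eigenvectors of \<open>Q\<close> and therefore orthogonal
  (\<open>eigen\<close>). Differentiating \<open>Q da = a da\<close> gives the normal form up to the entries of the Hessian on the plane of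
  \<open>da\<close> and \<open>J da\<close> (\<open>weak_hess\<close>). These are not visible at first order; they follow from \<open>d\<^sup>2 = 0\<close>, applied to
  \<open>J da / |da|\<^sup>2\<close> and to \<open>(a - b) |da|\<^sup>2\<close> (\<open>weak_hess_diagonal\<close>, \<open>weak_hess_offdiagonal\<close>).

  Everything else follows from the normal form. The Hessians of \<open>a + b\<close> and \<open>a b\<close> are invariant, so these
  functions are momentum maps of Killing fields (\<open>normal_hess_killing\<close>). With \<open>\<omega>\<^sub>a = da \<and> J da / |da|\<^sup>2\<close> and
  \<open>\<omega>\<^sub>b = db \<and> J db / |db|\<^sup>2\<close>, the form \<open>a \<omega>\<^sub>a + b \<omega>\<^sub>b + (a + b) \<omega>\<close> is hamiltonian with trace \<open>a + b\<close> and pfaffian \<open>a b\<close>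
  (\<open>pair_form_closed\<close>, \<open>pair_form_twistor\<close>). The differential of \<open>(a - b) |da|\<^sup>2\<close> is a multiple of \<open>da\<close>
  (\<open>differential_F\<close>), so this is a function \<open>F (a)\<close>; likewise \<open>(b - a) |db|\<^sup>2 = G (b)\<close>. Two combinations of \<open>J da\<close> and
  \<open>J db\<close> are closed (\<open>zform_closed\<close>), hence locally \<open>dt\<close> and \<open>dz\<close>, and in terms of \<open>da, db, dt, dz\<close> the orthogonal
  decompositions of \<open>g\<close> and \<open>\<omega>\<close> are the explicit formulas (\<open>explicit_form\<close>).

  Conversely, for given \<open>F\<close> and \<open>G\<close> the explicit formulas define a Kaehler structure: this is a computation
  with the components in the coordinates \<open>\<xi>, \<eta>, t, z\<close> (\<open>explicit_orthotoric\<close>).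
\<close>

section \<open>Smooth maps\<close>

lemma frechet_derivative_cong_open:
  assumes "open S" "x \<in> S" "\<And>y. y \<in> S \<Longrightarrow> f y = g y"
  shows "frechet_derivative f (at x) = frechet_derivative g (at x)"
proof -
  have "(f has_derivative D) (at x) \<longleftrightarrow> (g has_derivative D) (at x)" for D
    using assms by (metis has_derivative_transform_within_open)
  then show ?thesis unfolding frechet_derivative_def by simp
qed

lemma differentiable_cong_open:
  assumes "open S" "x \<in> S" "\<And>y. y \<in> S \<Longrightarrow> f y = g y" "f differentiable (at x)"
  shows "g differentiable (at x)"
  using assms unfolding differentiable_def by (metis has_derivative_transform_within_open)

lemma Ck_on_cong:
  assumes "open S" "\<And>y. y \<in> S \<Longrightarrow> f y = g y" "Ck_on k S f"
  shows "Ck_on k S g"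
  using assms(2,3)
proof (induction k arbitrary: f g)
  case 0
  then show ?case using continuous_on_cong by fastforce
next
  case (Suc k)
  have "Ck_on k S (\<lambda>x. frechet_derivative g (at x) v)" for v
  proof (rule Suc.IH)
    show "Ck_on k S (\<lambda>x. frechet_derivative f (at x) v)" using Suc.prems by simp
    show "frechet_derivative f (at y) v = frechet_derivative g (at y) v" if "y \<in> S" for y
      using frechet_derivative_cong_open[OF assms(1) that, of f g] Suc.prems(1) by simp
  qed
  moreover have "g differentiable (at x)" if "x \<in> S" for x
    using differentiable_cong_open[OF assms(1) that, of f g] Suc.prems that by auto
  ultimately show ?case by simp
qed

lemma Ck_on_mono:
  assumes "Ck_on (Suc k) S f"
  shows "Ck_on k S f"
  using assms
proof (induction k arbitrary: f)
  case 0
  then show ?case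
    by (auto intro!: continuous_at_imp_continuous_on dest: differentiable_imp_continuous_within)
next
  case (Suc k)
  then show ?case by (metis Ck_on.simps(2))
qed

lemma Ck_on_subset:
  assumes "T \<subseteq> S" "Ck_on k S f"
  shows "Ck_on k T f"
  using assms by (induction k arbitrary: f) (auto intro: continuous_on_subset)

lemma Ck_on_const: "Ck_on k S (\<lambda>x. c)"
proof (induction k arbitrary: c)
  case (Suc k)
  then show ?case by (simp add: frechet_derivative_const)
qed simp

lemma Ck_on_linear:
  assumes "bounded_linear L" "open S" "Ck_on k S f"
  shows "Ck_on k S (\<lambda>x. L (f x))"
  using assms(3)
proof (induction k arbitrary: f)
  case 0
  then show ?case using assms(1) by (simp add: bounded_linear.continuous_on)
next
  case (Suc k)
  have D: "((\<lambda>x. L (f x)) has_derivative (\<lambda>v. L (frechet_derivative f (at x) v))) (at x)"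
    if "x \<in> S" for x
    using Suc.prems that by (intro bounded_linear.has_derivative[OF assms(1)])
      (simp add: frechet_derivative_works[symmetric])
  have "Ck_on k S (\<lambda>x. frechet_derivative (\<lambda>x. L (f x)) (at x) v)" for v
  proof (rule Ck_on_cong[OF assms(2)])
    show "Ck_on k S (\<lambda>x. L (frechet_derivative f (at x) v))"
      using Suc by simp
    show "L (frechet_derivative f (at y) v) = frechet_derivative (\<lambda>x. L (f x)) (at y) v"
      if "y \<in> S" for y using frechet_derivative_at[OF D[OF that]] by metis
  qed
  then show ?case using D by (auto simp: differentiable_def)
qed

lemma Ck_on_add:
  assumes "open S" "Ck_on k S f" "Ck_on k S g"
  shows "Ck_on k S (\<lambda>x. f x + g x)"
  using assms(2,3)
proof (induction k arbitrary: f g)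
  case 0
  then show ?case by (simp add: continuous_on_add)
next
  case (Suc k)
  have D: "((\<lambda>x. f x + g x) has_derivative
      (\<lambda>v. frechet_derivative f (at x) v + frechet_derivative g (at x) v)) (at x)"
    if "x \<in> S" for x
    using Suc.prems that by (intro has_derivative_add)
      (simp_all add: frechet_derivative_works[symmetric])
  have "Ck_on k S (\<lambda>x. frechet_derivative (\<lambda>x. f x + g x) (at x) v)" for v
  proof (rule Ck_on_cong[OF assms(1)])
    show "Ck_on k S (\<lambda>x. frechet_derivative f (at x) v + frechet_derivative g (at x) v)"
      using Suc by simp
    show "frechet_derivative f (at y) v + frechet_derivative g (at y) v
        = frechet_derivative (\<lambda>x. f x + g x) (at y) v"
      if "y \<in> S" for y using frechet_derivative_at[OF D[OF that]] by metis
  qed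
  then show ?case using D by (auto simp: differentiable_def)
qed

lemma Ck_on_bilinear:
  assumes "bounded_bilinear B" "open S" "Ck_on k S f" "Ck_on k S g"
  shows "Ck_on k S (\<lambda>x. B (f x) (g x))"
  using assms(3,4)
proof (induction k arbitrary: f g)
  case 0
  then show ?case using assms(1) by (simp add: bounded_bilinear.continuous_on)
next
  case (Suc k)
  have D: "((\<lambda>x. B (f x) (g x)) has_derivative
      (\<lambda>v. B (f x) (frechet_derivative g (at x) v) + B (frechet_derivative f (at x) v) (g x))) (at x)"
    if "x \<in> S" for x
    using Suc.prems that by (intro bounded_bilinear.FDERIV[OF assms(1)])
      (simp_all add: frechet_derivative_works[symmetric])
  have "Ck_on k S (\<lambda>x. frechet_derivative (\<lambda>x. B (f x) (g x)) (at x) v)" for v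
  proof (rule Ck_on_cong[OF assms(2)])
    show "Ck_on k S (\<lambda>x. B (f x) (frechet_derivative g (at x) v)
        + B (frechet_derivative f (at x) v) (g x))"
      using Suc.prems Ck_on_mono[OF Suc.prems(1)] Ck_on_mono[OF Suc.prems(2)]
      by (intro Ck_on_add assms Suc.IH) auto
    show "B (f y) (frechet_derivative g (at y) v) + B (frechet_derivative f (at y) v) (g y)
        = frechet_derivative (\<lambda>x. B (f x) (g x)) (at y) v"
      if "y \<in> S" for y using frechet_derivative_at[OF D[OF that]] by metis
  qed
  then show ?case using D by (auto simp: differentiable_def)
qed

lemma Ck_on_sum:
  assumes "open S" "\<And>i. i \<in> I \<Longrightarrow> Ck_on k S (f i)"
  shows "Ck_on k S (\<lambda>x. \<Sum>i\<in>I. f i x)"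
  using assms(2)
  by (induction I rule: infinite_finite_induct) (auto intro!: Ck_on_const Ck_on_add[OF assms(1)])

text \<open>The chain rule turns a derivative of the composition into a sum, over a basis of the middle space,
  of products of derivatives of \<open>g\<close> with partial derivatives of \<open>f\<close> composed with \<open>g\<close>. The induction
  hypothesis applies to the latter.\<close>

lemma Ck_on_compose:
  fixes f :: "'b::euclidean_space \<Rightarrow> 'c::real_normed_vector"
  assumes "open S" "open T" "\<And>x. x \<in> S \<Longrightarrow> g x \<in> T" "Ck_on k T f" "Ck_on k S g"
  shows "Ck_on k S (\<lambda>x. f (g x))"
  using assms(4,5)
proof (induction k arbitrary: f)
  case 0
  then show ?case using assms(3) by (auto intro: continuous_on_compose2)
next
  case (Suc k)
  let ?f' = "\<lambda>y. frechet_derivative f (at y)" and ?g' = "\<lambda>y. frechet_derivative g (at y)"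
  have D: "((\<lambda>x. f (g x)) has_derivative (\<lambda>v. ?f' (g x) (?g' x v))) (at x)" if "x \<in> S" for x
  proof -
    have "(g has_derivative ?g' x) (at x)" "(f has_derivative ?f' (g x)) (at (g x))"
      using Suc.prems that assms(3) by (simp_all add: frechet_derivative_works[symmetric])
    then show ?thesis by (rule has_derivative_compose)
  qed
  have E: "?f' (g x) w = (\<Sum>i\<in>Basis. (w \<bullet> i) *\<^sub>R ?f' (g x) i)" if "x \<in> S" for x w
  proof -
    have "linear (?f' (g x))"
      using Suc.prems that assms(3) by (simp add: linear_frechet_derivative)
    then have "?f' (g x) (\<Sum>i\<in>Basis. (w \<bullet> i) *\<^sub>R i) = (\<Sum>i\<in>Basis. (w \<bullet> i) *\<^sub>R ?f' (g x) i)"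
      by (simp add: linear_sum linear_scale)
    then show ?thesis by (simp add: euclidean_representation)
  qed
  have "Ck_on k S (\<lambda>x. frechet_derivative (\<lambda>x. f (g x)) (at x) v)" for v
  proof (rule Ck_on_cong[OF assms(1)])
    show "Ck_on k S (\<lambda>x. \<Sum>i\<in>Basis. (?g' x v \<bullet> i) *\<^sub>R ?f' (g x) i)"
    proof (intro Ck_on_sum assms(1) Ck_on_bilinear[OF bounded_bilinear_scaleR])
      show "Ck_on k S (\<lambda>x. ?g' x v \<bullet> i)" for i
        using Suc.prems by (intro Ck_on_linear[OF bounded_linear_inner_left] assms(1)) simp
      show "Ck_on k S (\<lambda>x. ?f' (g x) i)" for i
        using Suc.prems Ck_on_mono by (intro Suc.IH) auto
    qed
    show "(\<Sum>i\<in>Basis. (?g' y v \<bullet> i) *\<^sub>R ?f' (g y) i) = frechet_derivative (\<lambda>x. f (g x)) (at y) v"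
      if "y \<in> S" for y using frechet_derivative_at[OF D[OF that]] E[OF that] by metis
  qed
  then show ?case using D by (auto simp: differentiable_def)
qed

lemma Ck_on_id: "Ck_on k S (\<lambda>x. x)"
proof (cases k)
  case (Suc n)
  have "frechet_derivative (\<lambda>x::'a. x) (at x) = (\<lambda>v. v)" for x
    using frechet_derivative_at[OF has_derivative_ident] by metis
  then show ?thesis using Suc by (simp add: Ck_on_const)
qed simp

text \<open>The derivatives of \<open>inverse\<close> and \<open>sqrt\<close> are expressed by the functions themselves, so each order of
  differentiability implies the next one.\<close>

lemma Ck_on_inverse: "Ck_on k {r::real. r \<noteq> 0} inverse"
proof (induction k)
  case 0
  then show ?case by (simp add: continuous_on_inverse)
next
  case (Suc k)
  have o: "open {r::real. r \<noteq> 0}" by (simp add: open_Collect_neq)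
  have D: "(inverse has_derivative (\<lambda>v. - (inverse x * v * inverse x))) (at x)"
    if "x \<in> {r::real. r \<noteq> 0}" for x
    using that by (intro has_derivative_inverse') simp
  have "Ck_on k {r. r \<noteq> 0} (\<lambda>x. frechet_derivative inverse (at x) v)" for v :: real
  proof (rule Ck_on_cong[OF o])
    show "Ck_on k {r. r \<noteq> 0} (\<lambda>x. (- v) * (inverse x * inverse x))"
      by (intro Ck_on_bilinear[OF bounded_bilinear_mult] Suc.IH o Ck_on_const)
    show "(- v) * (inverse y * inverse y) = frechet_derivative inverse (at y) v"
      if "y \<in> {r. r \<noteq> 0}" for y
      using frechet_derivative_at[OF D[OF that], symmetric] by simp
  qed
  then show ?case using D by (auto simp: differentiable_def)
qed

lemma Ck_on_sqrt: "Ck_on k {r::real. r > 0} sqrt"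
proof (induction k)
  case 0
  then show ?case by (simp add: continuous_on_real_sqrt)
next
  case (Suc k)
  have o: "open {r::real. r > 0}" by (simp add: open_Collect_less)
  have o': "open {r::real. r \<noteq> 0}" by (simp add: open_Collect_neq)
  have D: "(sqrt has_derivative (\<lambda>v. v * (inverse (sqrt x) / 2))) (at x)"
    if "x \<in> {r::real. r > 0}" for x
  proof -
    have "(sqrt has_derivative (*) (inverse (sqrt x) / 2)) (at x)"
      using DERIV_real_sqrt[of x] that by (simp add: has_field_derivative_def)
    then show ?thesis by (rule has_derivative_eq_rhs) (simp add: fun_eq_iff)
  qed
  have "Ck_on k {r. r > 0} (\<lambda>x. frechet_derivative sqrt (at x) v)" for v :: real
  proof (rule Ck_on_cong[OF o])
    show "Ck_on k {r. r > 0} (\<lambda>x. (v/2) * inverse (sqrt x))"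
      by (intro Ck_on_bilinear[OF bounded_bilinear_mult] Ck_on_compose[OF o o' _ Ck_on_inverse Suc.IH]
          o Ck_on_const) auto
    show "(v/2) * inverse (sqrt y) = frechet_derivative sqrt (at y) v"
      if "y \<in> {r. r > 0}" for y
      using frechet_derivative_at[OF D[OF that], symmetric] by simp
  qed
  then show ?case using D by (auto simp: differentiable_def)
qed

named_theorems smooth_intros

lemma smooth_on_cong:
  assumes "open S" "\<And>y. y \<in> S \<Longrightarrow> f y = g y" "smooth_on S f"
  shows "smooth_on S g"
  using assms Ck_on_cong unfolding smooth_on_def by blast

lemma smooth_on_subset: "T \<subseteq> S \<Longrightarrow> smooth_on S f \<Longrightarrow> smooth_on T f"
  using Ck_on_subset unfolding smooth_on_def by blast

lemma smooth_on_const [smooth_intros]: "smooth_on S (\<lambda>x. c)"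
  by (simp add: smooth_on_def Ck_on_const)

lemma smooth_on_id [smooth_intros]: "smooth_on S (\<lambda>x. x)"
  by (simp add: smooth_on_def Ck_on_id)

lemma smooth_on_linear:
  assumes "bounded_linear L" "open S" "smooth_on S f"
  shows "smooth_on S (\<lambda>x. L (f x))"
  using assms Ck_on_linear unfolding smooth_on_def by blast

lemma smooth_on_bilinear:
  assumes "bounded_bilinear B" "open S" "smooth_on S f" "smooth_on S g"
  shows "smooth_on S (\<lambda>x. B (f x) (g x))"
  using assms Ck_on_bilinear unfolding smooth_on_def by blast

lemma smooth_on_add [smooth_intros]:
  assumes "open S" "smooth_on S f" "smooth_on S g"
  shows "smooth_on S (\<lambda>x. f x + g x)"
  using assms Ck_on_add unfolding smooth_on_def by blast

lemma smooth_on_minus [smooth_intros]: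
  assumes "open S" "smooth_on S f"
  shows "smooth_on S (\<lambda>x. - f x)"
  using smooth_on_linear[OF bounded_linear_minus[OF bounded_linear_ident] assms] .

lemma smooth_on_diff [smooth_intros]:
  assumes "open S" "smooth_on S f" "smooth_on S g"
  shows "smooth_on S (\<lambda>x. f x - g x)"
  using smooth_on_add[OF assms(1,2) smooth_on_minus[OF assms(1,3)]] by simp

lemma smooth_on_mult [smooth_intros]:
  fixes f g :: "_ \<Rightarrow> real"
  assumes "open S" "smooth_on S f" "smooth_on S g"
  shows "smooth_on S (\<lambda>x. f x * g x)"
  using smooth_on_bilinear[OF bounded_bilinear_mult assms] .

lemma smooth_on_scaleR [smooth_intros]:
  assumes "open S" "smooth_on S f" "smooth_on S g"
  shows "smooth_on S (\<lambda>x. f x *\<^sub>R g x)"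
  using smooth_on_bilinear[OF bounded_bilinear_scaleR assms] .

lemma smooth_on_inner [smooth_intros]:
  assumes "open S" "smooth_on S f" "smooth_on S g"
  shows "smooth_on S (\<lambda>x. f x \<bullet> g x)"
  using smooth_on_bilinear[OF bounded_bilinear_inner assms] .

lemma smooth_on_sum [smooth_intros]:
  assumes "open S" "\<And>i. i \<in> I \<Longrightarrow> smooth_on S (f i)"
  shows "smooth_on S (\<lambda>x. \<Sum>i\<in>I. f i x)"
  using assms Ck_on_sum unfolding smooth_on_def by metis

lemma smooth_on_prod [smooth_intros]:
  fixes f :: "_ \<Rightarrow> _ \<Rightarrow> real"
  assumes "open S" "\<And>i. i \<in> I \<Longrightarrow> smooth_on S (f i)"
  shows "smooth_on S (\<lambda>x. \<Prod>i\<in>I. f i x)"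
  using assms(2)
  by (induction I rule: infinite_finite_induct) (auto intro!: smooth_intros assms(1))

lemma smooth_on_compose:
  fixes f :: "'b::euclidean_space \<Rightarrow> 'c::real_normed_vector"
  assumes "open S" "open T" "\<And>x. x \<in> S \<Longrightarrow> g x \<in> T" "smooth_on T f" "smooth_on S g"
  shows "smooth_on S (\<lambda>x. f (g x))"
  using assms Ck_on_compose unfolding smooth_on_def by blast

lemma smooth_on_inverse [smooth_intros]:
  fixes f :: "_ \<Rightarrow> real"
  assumes "open S" "smooth_on S f" "\<And>x. x \<in> S \<Longrightarrow> f x \<noteq> 0"
  shows "smooth_on S (\<lambda>x. inverse (f x))"
  using smooth_on_compose[OF assms(1), of "{r. r \<noteq> 0}" f inverse] assms Ck_on_inverse
  by (simp add: smooth_on_def open_Collect_neq)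

lemma smooth_on_divide [smooth_intros]:
  fixes f g :: "_ \<Rightarrow> real"
  assumes "open S" "smooth_on S f" "smooth_on S g" "\<And>x. x \<in> S \<Longrightarrow> g x \<noteq> 0"
  shows "smooth_on S (\<lambda>x. f x / g x)"
  unfolding divide_inverse by (intro smooth_intros assms)

lemma smooth_on_sqrt:
  fixes f :: "_ \<Rightarrow> real"
  assumes "open S" "smooth_on S f" "\<And>x. x \<in> S \<Longrightarrow> f x > 0"
  shows "smooth_on S (\<lambda>x. sqrt (f x))"
  using smooth_on_compose[OF assms(1), of "{r. r > 0}" f sqrt] assms Ck_on_sqrt
  by (simp add: smooth_on_def open_Collect_less)

lemma smooth_on_power [smooth_intros]:
  fixes f :: "_ \<Rightarrow> real"
  assumes "open S" "smooth_on S f"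
  shows "smooth_on S (\<lambda>x. f x ^ n)"
  by (induction n) (auto intro!: smooth_intros assms)

lemma smooth_on_nth [smooth_intros]:
  assumes "open S" "smooth_on S f"
  shows "smooth_on S (\<lambda>x. f x $ i)"
  using smooth_on_linear[OF bounded_linear_vec_nth assms] .

lemma smooth_on_vec [smooth_intros]:
  fixes f :: "'n::finite \<Rightarrow> 'b::real_normed_vector \<Rightarrow> 'a::real_normed_vector"
  assumes "open S" "\<And>i. smooth_on S (f i)"
  shows "smooth_on S (\<lambda>x. \<chi> i. f i x)"
proof -
  have *: "(\<chi> i. f i x) = (\<Sum>j\<in>UNIV. (\<chi> i. if i = j then f j x else 0))" for x
    by (simp add: vec_eq_iff)
  have "bounded_linear (\<lambda>v::'a. (\<chi> i. if i = j then v else 0) :: 'a^'n)" for j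
  proof (rule bounded_linear_intro[where K=1])
    show "norm ((\<chi> i. if i = j then v else 0) :: 'a^'n) \<le> norm v * 1" for v :: 'a
    proof -
      have "norm ((\<chi> i. if i = j then v else 0) :: 'a^'n) \<le> (\<Sum>i\<in>UNIV. norm (((\<chi> i. if i = j then v else 0) :: 'a^'n) $ i))"
        unfolding norm_vec_def by (rule L2_set_le_sum) auto
      also have "\<dots> = norm v" by (simp add: if_distrib[of norm] cong: if_cong)
      finally show ?thesis by simp
    qed
  qed (auto simp: vec_eq_iff)
  from smooth_on_linear[OF this assms(1) assms(2)]
  show ?thesis unfolding * by (intro smooth_intros assms(1)) auto
qed

lemma smooth_on_vec_iff:
  fixes f :: "'b::real_normed_vector \<Rightarrow> 'a::real_normed_vector^'n"
  assumes "open S"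
  shows "smooth_on S f \<longleftrightarrow> (\<forall>i. smooth_on S (\<lambda>x. f x $ i))"
proof
  assume "\<forall>i. smooth_on S (\<lambda>x. f x $ i)"
  then have "smooth_on S (\<lambda>x. \<chi> i. f x $ i)" by (intro smooth_on_vec assms) auto
  then show "smooth_on S f" by simp
qed (auto intro: smooth_intros assms)

lemma smooth_on_differentiable:
  "smooth_on S f \<Longrightarrow> x \<in> S \<Longrightarrow> f differentiable (at x)"
  unfolding smooth_on_def by (metis Ck_on.simps(2))

lemma smooth_on_frechet:
  "smooth_on S f \<Longrightarrow> smooth_on S (\<lambda>x. frechet_derivative f (at x) v)"
  unfolding smooth_on_def by (metis Ck_on.simps(2))

lemma smooth_on_continuous: "smooth_on S f \<Longrightarrow> continuous_on S f"
  unfolding smooth_on_def by (metis Ck_on.simps(1))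

lemma smooth_onI_derivative:
  assumes "\<And>x. x \<in> S \<Longrightarrow> f differentiable (at x)"
    "\<And>v. smooth_on S (\<lambda>x. frechet_derivative f (at x) v)"
  shows "smooth_on S f"
proof -
  have "Ck_on (Suc k) S f" for k using assms unfolding smooth_on_def by simp
  then show ?thesis unfolding smooth_on_def using Ck_on_mono by blast
qed

section \<open>Calculus in coordinates\<close>

text \<open>A partial derivative for maps with vector values, so that forms and matrices can be differentiated
  as a whole.\<close>

definition dd :: "4 \<Rightarrow> (real^4 \<Rightarrow> 'b::real_normed_vector) \<Rightarrow> real^4 \<Rightarrow> 'b" where
  "dd i f x = frechet_derivative f (at x) (axis i 1)"

lemma pd_eq_dd: "pd = dd"
  by (simp add: fun_eq_iff pd_def dd_def)

lemma dd_eq: "(f has_derivative D) (at x) \<Longrightarrow> dd i f x = D (axis i 1)"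
  unfolding dd_def by (metis frechet_derivative_at)

lemma dd_cong:
  assumes "open S" "x \<in> S" "\<And>y. y \<in> S \<Longrightarrow> f y = g y"
  shows "dd i f x = dd i g x"
  unfolding dd_def using frechet_derivative_cong_open[OF assms] by simp

lemma differential_cong:
  assumes "open S" "x \<in> S" "\<And>y. y \<in> S \<Longrightarrow> f y = g y"
  shows "differential f x = differential g x"
  unfolding differential_def pd_eq_dd using dd_cong[OF assms] by simp

lemma frechet_derivative_dd:
  assumes "f differentiable (at x)"
  shows "frechet_derivative f (at x) v = (\<Sum>i\<in>UNIV. v $ i *\<^sub>R dd i f x)"
proof -
  have lin: "linear (frechet_derivative f (at x))"
    using assms by (rule linear_frechet_derivative)
  have "v = (\<Sum>i\<in>UNIV. v $ i *\<^sub>R axis i 1)"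
    using basis_expansion[of v] by (simp add: scalar_mult_eq_scaleR)
  then have "frechet_derivative f (at x) v
      = frechet_derivative f (at x) (\<Sum>i\<in>UNIV. v $ i *\<^sub>R axis i 1)" by simp
  also have "\<dots> = (\<Sum>i\<in>UNIV. v $ i *\<^sub>R dd i f x)"
    unfolding dd_def linear_sum[OF lin] linear_scale[OF lin] ..
  finally show ?thesis .
qed

lemma dd_const: "dd i (\<lambda>x. c) x = 0"
  by (simp add: dd_def frechet_derivative_const)

lemma dd_linear:
  assumes "bounded_linear L" "f differentiable (at x)"
  shows "dd i (\<lambda>x. L (f x)) x = L (dd i f x)"
proof -
  have "((\<lambda>x. L (f x)) has_derivative (\<lambda>v. L (frechet_derivative f (at x) v))) (at x)"
    using assms by (intro bounded_linear.has_derivative[OF assms(1)])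
      (simp add: frechet_derivative_works[symmetric])
  from dd_eq[OF this] show ?thesis by (simp add: dd_def)
qed

lemma dd_bilinear:
  assumes "bounded_bilinear B" "f differentiable (at x)" "g differentiable (at x)"
  shows "dd i (\<lambda>x. B (f x) (g x)) x = B (dd i f x) (g x) + B (f x) (dd i g x)"
proof -
  have "((\<lambda>x. B (f x) (g x)) has_derivative
      (\<lambda>v. B (f x) (frechet_derivative g (at x) v) + B (frechet_derivative f (at x) v) (g x))) (at x)"
    using assms by (intro bounded_bilinear.FDERIV[OF assms(1)])
      (simp_all add: frechet_derivative_works[symmetric])
  from dd_eq[OF this] show ?thesis by (simp add: dd_def)
qed

lemma dd_add:
  assumes "f differentiable (at x)" "g differentiable (at x)"
  shows "dd i (\<lambda>x. f x + g x) x = dd i f x + dd i g x"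
proof -
  have "((\<lambda>x. f x + g x) has_derivative
      (\<lambda>v. frechet_derivative f (at x) v + frechet_derivative g (at x) v)) (at x)"
    using assms by (intro has_derivative_add) (simp_all add: frechet_derivative_works[symmetric])
  from dd_eq[OF this] show ?thesis by (simp add: dd_def)
qed

lemma dd_minus:
  assumes "f differentiable (at x)"
  shows "dd i (\<lambda>x. - f x) x = - dd i f x"
  using dd_linear[OF bounded_linear_minus[OF bounded_linear_ident] assms] .

lemma dd_diff:
  assumes "f differentiable (at x)" "g differentiable (at x)"
  shows "dd i (\<lambda>x. f x - g x) x = dd i f x - dd i g x"
proof -
  have "(\<lambda>x. - g x) differentiable (at x)" using assms(2) by simp
  from dd_add[OF assms(1) this] dd_minus[OF assms(2)] show ?thesis by simp
qed

lemmas dd_mult = dd_bilinear[OF bounded_bilinear_mult]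
lemmas dd_scaleR = dd_bilinear[OF bounded_bilinear_scaleR]
lemmas dd_inner = dd_bilinear[OF bounded_bilinear_inner]
lemmas dd_nth = dd_linear[OF bounded_linear_vec_nth]

lemma dd_inverse:
  fixes f :: "real^4 \<Rightarrow> real"
  assumes "f differentiable (at x)" "f x \<noteq> 0"
  shows "dd i (\<lambda>x. inverse (f x)) x = - dd i f x / (f x)\<^sup>2"
proof -
  have "((\<lambda>x. inverse (f x)) has_derivative
      (\<lambda>v. - (inverse (f x) * frechet_derivative f (at x) v * inverse (f x)))) (at x)"
    using assms by (intro Deriv.has_derivative_inverse) (simp_all add: frechet_derivative_works[symmetric])
  from dd_eq[OF this] show ?thesis using assms(2) by (simp add: dd_def power2_eq_square field_simps)
qed

lemma dd_divide:
  fixes f g :: "real^4 \<Rightarrow> real"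
  assumes "f differentiable (at x)" "g differentiable (at x)" "g x \<noteq> 0"
  shows "dd i (\<lambda>x. f x / g x) x = (dd i f x * g x - f x * dd i g x) / (g x)\<^sup>2"
proof -
  have "(\<lambda>x. inverse (g x)) differentiable (at x)"
    using assms by (intro differentiable_inverse) auto
  then show ?thesis unfolding divide_inverse
    using assms by (simp add: dd_mult dd_inverse) (simp add: field_simps power2_eq_square)
qed

lemma dd_compose:
  fixes f :: "real^4 \<Rightarrow> 'b::real_normed_vector" and h :: "real^4 \<Rightarrow> real^4"
  assumes "h differentiable (at x)" "f differentiable (at (h x))"
  shows "dd i (\<lambda>x. f (h x)) x = (\<Sum>j\<in>UNIV. dd i h x $ j *\<^sub>R dd j f (h x))"
proof -
  have "(h has_derivative frechet_derivative h (at x)) (at x)"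
    using assms(1) by (simp only: frechet_derivative_works)
  moreover have "(f has_derivative frechet_derivative f (at (h x))) (at (h x))"
    using assms(2) by (simp only: frechet_derivative_works)
  ultimately have "((\<lambda>x. f (h x)) has_derivative
      (\<lambda>v. frechet_derivative f (at (h x)) (frechet_derivative h (at x) v))) (at x)"
    by (rule has_derivative_compose)
  from dd_eq[OF this] show ?thesis
    unfolding frechet_derivative_dd[OF assms(2)] dd_def[of _ h, symmetric] .
qed

lemma smooth_on_dd [smooth_intros]: "smooth_on S f \<Longrightarrow> smooth_on S (dd i f)"
  using smooth_on_frechet unfolding dd_def by blast

lemma smooth_on_differential [smooth_intros]:
  "open S \<Longrightarrow> smooth_on S f \<Longrightarrow> smooth_on S (differential f)"
  by (subst smooth_on_vec_iff) (auto simp: differential_def pd_eq_dd intro: smooth_on_dd)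

text \<open>Two applications of the mean value theorem. The second difference is symmetric in \<open>i\<close> and \<open>j\<close>, so
  both mixed derivatives are its limit.\<close>

lemma second_difference:
  fixes f :: "real^4 \<Rightarrow> real"
  assumes "open S" "smooth_on S f" "cball x r \<subseteq> S" "h > 0" "2 * h \<le> r"
  obtains y where "dist y x \<le> 2 * h" 
    "f (x + h *\<^sub>R axis i 1 + h *\<^sub>R axis j 1) - f (x + h *\<^sub>R axis i 1) - f (x + h *\<^sub>R axis j 1) + f x
      = h * h * dd j (dd i f) y"
proof -
  let ?u = "axis i 1 :: real^4" and ?v = "axis j 1 :: real^4"
  have near: "dist (x + s *\<^sub>R ?u + t *\<^sub>R ?v) x \<le> 2 * h" if "0 \<le> s" "s \<le> h" "0 \<le> t" "t \<le> h" for s t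
  proof -
    have "norm (s *\<^sub>R ?u + t *\<^sub>R ?v) \<le> s + t"
      using that norm_triangle_ineq[of "s *\<^sub>R ?u" "t *\<^sub>R ?v"] by simp
    then show ?thesis using that by (simp add: dist_norm add.assoc)
  qed
  have inS: "x + s *\<^sub>R ?u + t *\<^sub>R ?v \<in> S" if "0 \<le> s" "s \<le> h" "0 \<le> t" "t \<le> h" for s t
    using near[OF that] assms(3,5) by (auto simp: subset_iff dist_commute)
  have der: "((\<lambda>s. F (z + s *\<^sub>R axis k 1)) has_real_derivative dd k F (z + s *\<^sub>R axis k 1)) (at s)"
    if "smooth_on S F" "z + s *\<^sub>R axis k 1 \<in> S" for F :: "real^4 \<Rightarrow> real" and z s k
  proof -
    have "(F has_derivative frechet_derivative F (at (z + s *\<^sub>R axis k 1))) (at (z + s *\<^sub>R axis k 1))"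
      using smooth_on_differentiable[OF that] by (simp add: frechet_derivative_works[symmetric])
    moreover have "((\<lambda>s. z + s *\<^sub>R axis k 1 :: real^4) has_derivative (\<lambda>s. s *\<^sub>R axis k 1)) (at s)"
      by (auto intro!: derivative_eq_intros)
    ultimately have "((\<lambda>s. F (z + s *\<^sub>R axis k 1)) has_derivative
        (\<lambda>t. frechet_derivative F (at (z + s *\<^sub>R axis k 1)) (t *\<^sub>R axis k 1))) (at s)"
      by (rule has_derivative_compose[rotated])
    moreover have "linear (frechet_derivative F (at (z + s *\<^sub>R axis k 1)))"
      using smooth_on_differentiable[OF that] by (rule linear_frechet_derivative)
    ultimately show ?thesis
      by (simp add: has_field_derivative_def dd_def linear_scale mult.commute[of _ "frechet_derivative _ _ _"])
  qed
  let ?phi = "\<lambda>s. f (x + h *\<^sub>R ?v + s *\<^sub>R ?u) - f (x + s *\<^sub>R ?u)"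
  let ?phi' = "\<lambda>s. dd i f (x + h *\<^sub>R ?v + s *\<^sub>R ?u) - dd i f (x + s *\<^sub>R ?u)"
  have "(?phi has_real_derivative ?phi' s) (at s)" if "0 \<le> s" "s \<le> h" for s
    using inS[OF that, of h] inS[OF that, of 0] assms(4)
    by (intro DERIV_diff der assms) (auto simp: algebra_simps)
  from MVT2[OF assms(4), of ?phi ?phi'] this obtain s where s: "0 < s" "s < h" "?phi h - ?phi 0 = h * ?phi' s"
    by auto
  let ?psi = "\<lambda>t. dd i f (x + s *\<^sub>R ?u + t *\<^sub>R ?v)"
  have "(?psi has_real_derivative dd j (dd i f) (x + s *\<^sub>R ?u + t *\<^sub>R ?v)) (at t)" if "0 \<le> t" "t \<le> h" for t
    using inS[of s t] s that by (intro der smooth_on_dd assms) auto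
  from MVT2[OF assms(4), of ?psi, OF this] obtain t where
    t: "0 < t" "t < h" "?psi h - ?psi 0 = h * dd j (dd i f) (x + s *\<^sub>R ?u + t *\<^sub>R ?v)"
    by auto
  have "?phi h - ?phi 0 = h * (?psi h - ?psi 0)" using s by (simp add: algebra_simps)
  then have "?phi h - ?phi 0 = h * h * dd j (dd i f) (x + s *\<^sub>R ?u + t *\<^sub>R ?v)" using t by simp
  then show thesis using that[of "x + s *\<^sub>R ?u + t *\<^sub>R ?v"] near[of s t] s t
    by (simp add: algebra_simps)
qed

lemma dd_commute_real:
  fixes f :: "real^4 \<Rightarrow> real"
  assumes "open S" "smooth_on S f" "x \<in> S"
  shows "dd i (dd j f) x = dd j (dd i f) x"
proof (rule ccontr)
  let ?A = "dd i (dd j f)" and ?B = "dd j (dd i f)"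
  define e where "e = dist (?A x) (?B x) / 2"
  assume "\<not> ?thesis"
  then have e: "e > 0" by (simp add: e_def)
  have c: "continuous (at x) ?A" "continuous (at x) ?B"
    using smooth_on_continuous[OF smooth_on_dd[OF smooth_on_dd[OF assms(2)]]] assms
    by (metis continuous_on_eq_continuous_at)+
  from c[unfolded continuous_at_eps_delta] e obtain d1 d2 where
    d: "d1 > 0" "\<And>y. dist y x < d1 \<Longrightarrow> dist (?A y) (?A x) < e"
       "d2 > 0" "\<And>y. dist y x < d2 \<Longrightarrow> dist (?B y) (?B x) < e" by metis
  obtain r where r: "r > 0" "cball x r \<subseteq> S" using assms open_contains_cball by blast
  define h where "h = min r (min d1 d2) / 3"
  have h: "h > 0" "2 * h \<le> r" "2 * h < d1" "2 * h < d2" using r d by (auto simp: h_def)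
  obtain y where y: "dist y x \<le> 2 * h" 
    "f (x + h *\<^sub>R axis i 1 + h *\<^sub>R axis j 1) - f (x + h *\<^sub>R axis i 1) - f (x + h *\<^sub>R axis j 1) + f x
      = h * h * ?B y" using second_difference[OF assms(1,2) r(2) h(1,2)] by metis
  obtain z where z: "dist z x \<le> 2 * h" 
    "f (x + h *\<^sub>R axis j 1 + h *\<^sub>R axis i 1) - f (x + h *\<^sub>R axis j 1) - f (x + h *\<^sub>R axis i 1) + f x
      = h * h * ?A z" using second_difference[OF assms(1,2) r(2) h(1,2)] by metis
  have "x + h *\<^sub>R axis j 1 + h *\<^sub>R axis i 1 = x + h *\<^sub>R axis i 1 + h *\<^sub>R axis j (1::real)"
    by (simp add: algebra_simps)
  from z(2)[unfolded this] have "h * h * ?A z = h * h * ?B y" using y(2) by linarith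
  then have "?A z = ?B y" using h(1) by simp
  moreover have "dist (?A z) (?A x) < e" "dist (?B y) (?B x) < e" using d h y(1) z(1) by auto
  ultimately have "dist (?A x) (?B x) < e + e" by (metis dist_triangle_less_add dist_commute)
  then show False by (simp add: e_def)
qed

lemma dd_commute:
  fixes f :: "real^4 \<Rightarrow> real^'n"
  assumes "open S" "smooth_on S f" "x \<in> S"
  shows "dd i (dd j f) x = dd j (dd i f) x"
proof -
  have *: "dd i (dd j f) x $ k = dd i (dd j (\<lambda>y. f y $ k)) x" for i j k
  proof -
    have "dd i (dd j f) x $ k = dd i (\<lambda>y. dd j f y $ k) x"
      by (rule dd_nth[symmetric]) (rule smooth_on_differentiable[OF smooth_on_dd[OF assms(2)] assms(3)])
    also have "\<dots> = dd i (dd j (\<lambda>y. f y $ k)) x"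
      by (rule dd_cong[OF assms(1,3)], rule dd_nth[symmetric]) (rule smooth_on_differentiable[OF assms(2)])
    finally show ?thesis .
  qed
  have "smooth_on S (\<lambda>y. f y $ k)" for k using assms by (intro smooth_intros)
  from dd_commute_real[OF assms(1) this assms(3)] show ?thesis by (simp add: vec_eq_iff *)
qed

text \<open>The potential is the integral of the form along rays from the centre.\<close>

lemma poincare:
  fixes \<theta> :: "real^4 \<Rightarrow> real^4"
  assumes sm: "smooth_on (ball p r) \<theta>"
    and closed: "\<And>x i j. x \<in> ball p r \<Longrightarrow> dd i \<theta> x $ j = dd j \<theta> x $ i"
  obtains f where "smooth_on (ball p r) f" "\<And>x. x \<in> ball p r \<Longrightarrow> differential f x = \<theta> x"
proof -
  let ?B = "ball p r" and ?y = "\<lambda>x s. p + s *\<^sub>R (x - p)"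
  let ?D = "\<lambda>y. frechet_derivative \<theta> (at y)"
  \<comment> \<open>The gradient in \<open>x\<close> of the integrand of \<open>f\<close>, by closedness; it is also the derivative of
    \<open>s \<theta> (p + s (x - p))\<close> in \<open>s\<close>, so its integral is \<open>\<theta> x\<close>.\<close>
  define w where "w x s = \<theta> (?y x s) + s *\<^sub>R ?D (?y x s) (x - p)" for x s
  define f where "f x = integral (cbox 0 1) (\<lambda>s. \<theta> (?y x s) \<bullet> (x - p))" for x
  have inB: "?y x s \<in> ?B" if "x \<in> ?B" "s \<in> cbox 0 1" for x and s :: real
  proof -
    have "norm (s *\<^sub>R (x - p)) \<le> norm (x - p)" using that(2) by (simp add: mult_left_le_one_le)
    then show ?thesis using that(1) by (simp add: dist_norm norm_minus_commute)
  qed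
  have D: "(\<theta> has_derivative ?D y) (at y)" if "y \<in> ?B" for y
    using smooth_on_differentiable[OF sm that] by (simp add: frechet_derivative_works[symmetric])
  have exp: "?D y v = (\<Sum>i\<in>UNIV. v $ i *\<^sub>R dd i \<theta> y)" if "y \<in> ?B" for y v
    using frechet_derivative_dd smooth_on_differentiable[OF sm that] by blast
  have sym: "?D y u \<bullet> v = ?D y v \<bullet> u" if "y \<in> ?B" for y u v
  proof -
    have "?D y u \<bullet> v = (\<Sum>j\<in>UNIV. \<Sum>i\<in>UNIV. u $ i * dd i \<theta> y $ j * v $ j)"
      by (simp add: exp[OF that] inner_vec_def sum_distrib_right)
    also have "\<dots> = (\<Sum>i\<in>UNIV. \<Sum>j\<in>UNIV. v $ j * dd j \<theta> y $ i * u $ i)"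
      by (subst sum.swap) (simp add: closed[OF that] mult_ac)
    also have "\<dots> = ?D y v \<bullet> u"
      by (simp add: exp[OF that] inner_vec_def sum_distrib_right)
    finally show ?thesis .
  qed
  have der1: "((\<lambda>x. \<theta> (?y x s) \<bullet> (x - p)) has_derivative blinfun_apply (blinfun_inner_right (w x s)))
      (at x within ?B)" if "x \<in> ?B" "s \<in> cbox 0 1" for x s
  proof -
    have "((\<lambda>x. ?y x s) has_derivative (\<lambda>v. s *\<^sub>R v)) (at x within ?B)"
      by (auto intro!: derivative_eq_intros)
    from has_derivative_compose[OF this D[OF inB[OF that]]]
    have "((\<lambda>x. \<theta> (?y x s)) has_derivative (\<lambda>v. ?D (?y x s) (s *\<^sub>R v))) (at x within ?B)" .
    moreover have "((\<lambda>x. x - p) has_derivative (\<lambda>v. v)) (at x within ?B)"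
      by (auto intro!: derivative_eq_intros)
    ultimately have "((\<lambda>x. \<theta> (?y x s) \<bullet> (x - p)) has_derivative
      (\<lambda>v. \<theta> (?y x s) \<bullet> v + ?D (?y x s) (s *\<^sub>R v) \<bullet> (x - p))) (at x within ?B)"
      by (rule has_derivative_inner)
    moreover have "?D (?y x s) (s *\<^sub>R v) \<bullet> (x - p) = s *\<^sub>R ?D (?y x s) (x - p) \<bullet> v" for v
      using sym[OF inB[OF that], of "s *\<^sub>R v" "x - p"] by simp
    ultimately show ?thesis
      by (auto simp: w_def inner_add_left elim!: has_derivative_eq_rhs)
  qed
  have Dcont: "continuous_on ?B (\<lambda>y. dd i \<theta> y)" for i
    by (intro smooth_on_continuous smooth_on_dd sm)
  have ycont: "continuous_on (?B \<times> cbox 0 1) (\<lambda>(x,s). ?y x s)"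
    by (auto simp: case_prod_unfold intro!: continuous_intros)
  have yim: "(\<lambda>(x,s). ?y x s) ` (?B \<times> cbox 0 1) \<subseteq> ?B"
  proof (rule image_subsetI)
    fix z :: "(real^4) \<times> real" assume "z \<in> ?B \<times> cbox 0 1"
    then show "(case z of (x, s) \<Rightarrow> ?y x s) \<in> ?B" using inB[of "fst z" "snd z"] by (cases z) simp
  qed
  have thcont: "continuous_on (?B \<times> cbox 0 1) (\<lambda>z. \<theta> (?y (fst z) (snd z)))"
    using continuous_on_compose2[OF smooth_on_continuous[OF sm] ycont yim]
    by (simp add: case_prod_unfold)
  have ddcont: "continuous_on (?B \<times> cbox 0 1) (\<lambda>z. dd i \<theta> (?y (fst z) (snd z)))" for i
    using continuous_on_compose2[OF Dcont ycont yim]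
    by (simp add: case_prod_unfold)
  have wcont: "continuous_on (?B \<times> cbox 0 1) (\<lambda>(x,s). w x s)"
  proof (rule continuous_on_eq)
    show "continuous_on (?B \<times> cbox 0 1) (\<lambda>z. \<theta> (?y (fst z) (snd z))
        + snd z *\<^sub>R (\<Sum>i\<in>UNIV. (fst z - p) $ i *\<^sub>R dd i \<theta> (?y (fst z) (snd z))))"
      by (intro continuous_intros thcont ddcont)
    show "\<theta> (?y (fst z) (snd z)) + snd z *\<^sub>R (\<Sum>i\<in>UNIV. (fst z - p) $ i *\<^sub>R dd i \<theta> (?y (fst z) (snd z)))
       = (case z of (x,s) \<Rightarrow> w x s)" if "z \<in> ?B \<times> cbox 0 1" for z
      using that exp inB by (auto simp: w_def)
  qed
  have bl: "continuous_on (?B \<times> cbox 0 1) (\<lambda>(x,s). blinfun_inner_right (w x s))"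
    using bounded_linear.continuous_on[OF bounded_linear_blinfun_inner_right wcont]
    by (simp add: case_prod_unfold)
  have int: "(\<lambda>s. \<theta> (?y x s) \<bullet> (x - p)) integrable_on cbox 0 1" if "x \<in> ?B" for x
  proof (intro integrable_continuous continuous_intros)
    show "continuous_on (cbox 0 1) (\<lambda>s. \<theta> (?y x s))"
      using inB[OF that] by (intro continuous_on_compose2[OF smooth_on_continuous[OF sm]] continuous_intros) auto
  qed
  have wint: "((\<lambda>s. w x s) has_integral \<theta> x) (cbox 0 1)" if "x \<in> ?B" for x
  proof -
    have "((\<lambda>s. w x s) has_integral (1 *\<^sub>R \<theta> (?y x 1) - 0 *\<^sub>R \<theta> (?y x 0))) {0..1}"
    proof (rule fundamental_theorem_of_calculus)
      fix s :: real assume s: "s \<in> {0..1}"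
      have "((\<lambda>s. ?y x s) has_derivative (\<lambda>t. t *\<^sub>R (x - p))) (at s within {0..1})"
        by (auto intro!: derivative_eq_intros)
      from has_derivative_compose[OF this D[OF inB[OF that]]] s
      have "((\<lambda>s. \<theta> (?y x s)) has_derivative (\<lambda>t. ?D (?y x s) (t *\<^sub>R (x - p)))) (at s within {0..1})"
        by simp
      moreover have "linear (?D (?y x s))"
        using has_derivative_linear[OF D[OF inB[OF that]]] s by simp
      ultimately have "((\<lambda>s. \<theta> (?y x s)) has_vector_derivative ?D (?y x s) (x - p)) (at s within {0..1})"
        by (simp add: has_vector_derivative_def linear_scale)
      then have "((\<lambda>s. s *\<^sub>R \<theta> (?y x s)) has_vector_derivative s *\<^sub>R ?D (?y x s) (x - p) + 1 *\<^sub>R \<theta> (?y x s)) (at s within {0..1})"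
        by (intro has_vector_derivative_scaleR) (auto intro!: derivative_eq_intros)
      then show "((\<lambda>s. s *\<^sub>R \<theta> (?y x s)) has_vector_derivative w x s) (at s within {0..1})"
        by (simp add: w_def add.commute)
    qed auto
    then show ?thesis by simp
  qed
  have df: "(f has_derivative (\<lambda>v. \<theta> x \<bullet> v)) (at x)" if "x \<in> ?B" for x
  proof -
    have "(f has_derivative blinfun_apply (integral (cbox 0 1) (\<lambda>s. blinfun_inner_right (w x s)))) (at x within ?B)"
      unfolding f_def using that
      by (intro leibniz_rule[OF der1 int bl that convex_ball]) auto
    moreover have "integral (cbox 0 1) (\<lambda>s. blinfun_inner_right (w x s)) = blinfun_inner_right (\<theta> x)"
      using has_integral_linear[OF wint[OF that] bounded_linear_blinfun_inner_right]
      by (simp add: o_def integral_unique)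
    ultimately show ?thesis using that at_within_open[OF that open_ball] by simp
  qed
  show thesis
  proof
    show dif: "differential f x = \<theta> x" if "x \<in> ?B" for x
      using dd_eq[OF df[OF that]] by (simp add: differential_def pd_eq_dd vec_eq_iff inner_axis)
    show "smooth_on ?B f"
    proof (rule smooth_onI_derivative)
      show "f differentiable (at x)" if "x \<in> ?B" for x using df[OF that] differentiable_def by blast
      show "smooth_on ?B (\<lambda>x. frechet_derivative f (at x) v)" for v
      proof (rule smooth_on_cong[OF open_ball])
        show "smooth_on ?B (\<lambda>x. \<theta> x \<bullet> v)" by (intro smooth_intros open_ball sm)
        show "\<theta> x \<bullet> v = frechet_derivative f (at x) v" if "x \<in> ?B" for x
          using frechet_derivative_at[OF df[OF that]] by metis
      qed
    qed
  qed
qed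

text \<open>A function whose differential is a multiple of that of the k-th component of a local
  diffeomorphism is locally a function of this component. The derivative of this function of one
  variable is the multiple, and the multiple is again of the same kind because \<open>d\<^sup>2 f = 0\<close>; so
  smoothness follows by iteration.\<close>

lemma functions_of_coordinate:
  fixes \<Psi> :: "real^4 \<Rightarrow> real^4"
  assumes S: "open S" "x0 \<in> S" and sm: "smooth_on S \<Psi>"
    and inj: "\<And>v. frechet_derivative \<Psi> (at x0) v = 0 \<Longrightarrow> v = 0"
  obtains U where "open U" "x0 \<in> U" "U \<subseteq> S" "\<And>k. open ((\<lambda>x. \<Psi> x $ k) ` U)"
    "\<And>k f. smooth_on U f \<Longrightarrow>
      (\<And>x. x \<in> U \<Longrightarrow> \<exists>l. differential f x = l *\<^sub>R differential (\<lambda>x. \<Psi> x $ k) x) \<Longrightarrow>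
      \<exists>F. smooth_on ((\<lambda>x. \<Psi> x $ k) ` U) F \<and> (\<forall>x\<in>U. f x = F (\<Psi> x $ k))"
proof -
  let ?D = "\<lambda>x. frechet_derivative \<Psi> (at x)"
  define D where "D x = (\<Sum>i\<in>UNIV. blinfun_scaleR_left (dd i \<Psi> x) o\<^sub>L blinfun_inner_right (axis i (1::real) :: real^4))" for x
  have D_apply: "blinfun_apply (D x) = ?D x" if "x \<in> S" for x
  proof
    fix v
    have "blinfun_apply (D x) v = (\<Sum>i\<in>UNIV. v $ i *\<^sub>R dd i \<Psi> x)"
      by (simp add: D_def blinfun.sum_left inner_axis')
    then show "blinfun_apply (D x) v = ?D x v"
      using frechet_derivative_dd[OF smooth_on_differentiable[OF sm that]] by simp
  qed
  have der: "(\<Psi> has_derivative blinfun_apply (D x)) (at x)" if "x \<in> S" for x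
    using smooth_on_differentiable[OF sm that] D_apply[OF that] by (simp add: frechet_derivative_works[symmetric])
  have cont: "continuous_on S D"
  proof -
    have "continuous_on S (\<lambda>x. blinfun_scaleR_left (dd i \<Psi> x) o\<^sub>L blinfun_inner_right (axis i 1) :: (real^4) \<Rightarrow>\<^sub>L (real^4))" for i
      by (rule bounded_linear.continuous_on[OF bounded_linear_compose[OF bounded_bilinear.bounded_linear_left[OF bounded_bilinear_blinfun_compose] bounded_linear_blinfun_scaleR_left]])
         (intro smooth_on_continuous smooth_on_dd sm)
    then show ?thesis unfolding D_def by (intro continuous_on_sum) auto
  qed
  have lin: "linear (?D x0)" using smooth_on_differentiable[OF sm S(2)] by (rule linear_frechet_derivative)
  have "inj (?D x0)" using inj by (simp add: linear_injective_0[OF lin])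
  then obtain L where L: "linear L" "L \<circ> ?D x0 = id"
    using linear_injective_left_inverse[OF lin] by blast
  have "Blinfun L o\<^sub>L D x0 = id_blinfun"
    using L(2) D_apply[OF S(2)] bounded_linear_Blinfun_apply[OF linear_conv_bounded_linear[THEN iffD1, OF L(1)]]
    by (intro blinfun_eqI) (simp add: fun_eq_iff)
  from inverse_function_theorem[OF S(1) der cont S(2) this]
  obtain U' V g g' where UV: "open U'" "U' \<subseteq> S" "x0 \<in> U'" "open V" "\<Psi> x0 \<in> V" 
    "homeomorphism U' V \<Psi> g" "\<And>y. y \<in> V \<Longrightarrow> (g has_derivative (g' y)) (at y)"
    "\<And>y. y \<in> V \<Longrightarrow> g' y = inv (blinfun_apply (D (g y)))"
    "\<And>y. y \<in> V \<Longrightarrow> bij (blinfun_apply (D (g y)))" by metis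
  let ?y0 = "\<Psi> x0"
  have gV: "g y \<in> U'" "\<Psi> (g y) = y" if "y \<in> V" for y
    using UV(6) that by (auto simp: homeomorphism_def)
  have gU: "\<Psi> x \<in> V" "g (\<Psi> x) = x" if "x \<in> U'" for x
    using UV(6) that by (auto simp: homeomorphism_def)
  have Dg': "?D (g y) (g' y w) = w" if "y \<in> V" for y w
    using UV(8,9)[OF that] D_apply gV[OF that] UV(2) by (metis bij_inv_eq_iff subsetD)
  obtain e where e: "e > 0" "ball ?y0 e \<subseteq> V" using UV(4,5) open_contains_ball by blast
  define d where "d = e / 4"
  have d: "d > 0" using e by (simp add: d_def)
  \<comment> \<open>A cube in the image: it is convex, and each coordinate maps it onto an interval.\<close>
  define W where "W = {y::real^4. \<forall>i. \<bar>y $ i - ?y0 $ i\<bar> < d}"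
  have y0W: "?y0 \<in> W" using d by (simp add: W_def)
  have WV: "W \<subseteq> V"
  proof
    fix y assume y: "y \<in> W"
    have "norm (y - ?y0) \<le> (\<Sum>i\<in>UNIV. \<bar>(y - ?y0) $ i\<bar>)" by (rule norm_le_l1_cart)
    also have "\<dots> < (\<Sum>i\<in>(UNIV::4 set). d)" using y by (intro sum_strict_mono) (auto simp: W_def)
    finally have "dist ?y0 y < e" by (simp add: d_def dist_norm norm_minus_commute)
    then show "y \<in> V" using e by auto
  qed
  have Wbox: "W = box (?y0 - (\<chi> i. d)) (?y0 + (\<chi> i. d))"
    by (auto simp: W_def mem_box_cart abs_less_iff) (smt (verit))+
  have Wop: "open W" and Wcv: "convex W" unfolding Wbox by auto
  define U where "U = U' \<inter> \<Psi> -` W"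
  have Uop: "open U" unfolding U_def
    using UV(1,2) Wop continuous_on_subset[OF smooth_on_continuous[OF sm]]
    by (intro continuous_open_preimage) auto
  have UW: "\<Psi> x \<in> W" "x \<in> U'" if "x \<in> U" for x using that by (auto simp: U_def)
  have WU: "g y \<in> U" if "y \<in> W" for y using gV[of y] that WV by (auto simp: U_def)
  \<comment> \<open>The segment through the centre of the cube parallel to the k-th axis.\<close>
  define \<sigma> where "\<sigma> k s = ?y0 + (s - ?y0 $ k) *\<^sub>R axis k 1" for k s
  have \<sigma>W: "\<sigma> k s \<in> W \<longleftrightarrow> \<bar>s - ?y0 $ k\<bar> < d" for k s
    using d by (auto simp: \<sigma>_def W_def axis_def)
  have \<sigma>k: "\<sigma> k s $ k = s" for k s by (simp add: \<sigma>_def)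
  have img: "(\<lambda>x. \<Psi> x $ k) ` U = {s. \<bar>s - ?y0 $ k\<bar> < d}" for k
  proof (intro equalityI subsetI)
    fix s assume "s \<in> {s. \<bar>s - ?y0 $ k\<bar> < d}"
    then have "\<sigma> k s \<in> W" by (simp add: \<sigma>W)
    then have "g (\<sigma> k s) \<in> U" "\<Psi> (g (\<sigma> k s)) $ k = s" using WU gV WV \<sigma>k by auto
    then show "s \<in> (\<lambda>x. \<Psi> x $ k) ` U" by (metis imageI)
  qed (use UW W_def in auto)
  have opimg: "open ((\<lambda>x. \<Psi> x $ k) ` U)" for k
  proof -
    have "{s. \<bar>s - ?y0 $ k\<bar> < d} = ball (?y0 $ k) d" by (auto simp: dist_real_def)
    then show ?thesis unfolding img by simp
  qed
  have key: "((\<lambda>y. f (g y)) has_derivative (\<lambda>w. l (g y) * w $ k)) (at y)"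
    if f: "smooth_on U f" "\<And>x. x \<in> U \<Longrightarrow> differential f x = l x *\<^sub>R differential (\<lambda>x. \<Psi> x $ k) x"
      and y: "y \<in> W" for f l y k
  proof -
    have gy: "g y \<in> U" "g y \<in> S" "y \<in> V" using WU[OF y] UW UV(2) WV y by auto
    have df: "(f has_derivative frechet_derivative f (at (g y))) (at (g y))"
      using smooth_on_differentiable[OF f(1) gy(1)] by (simp add: frechet_derivative_works[symmetric])
    have "frechet_derivative f (at (g y)) w = l (g y) * ?D (g y) w $ k" for w
    proof -
      have "dd i f (g y) = l (g y) * dd i \<Psi> (g y) $ k" for i
      proof -
        have "dd i f (g y) = differential f (g y) $ i" by (simp add: differential_def pd_eq_dd)
        also have "\<dots> = l (g y) * dd i (\<lambda>x. \<Psi> x $ k) (g y)"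
          unfolding f(2)[OF gy(1)] by (simp add: differential_def pd_eq_dd)
        finally show ?thesis using dd_nth[OF smooth_on_differentiable[OF sm gy(2)]] by simp
      qed
      then show ?thesis
        using frechet_derivative_dd[OF smooth_on_differentiable[OF sm gy(2)]]
          frechet_derivative_dd[OF smooth_on_differentiable[OF f(1) gy(1)]]
        by (simp add: sum_distrib_left mult_ac)
    qed
    with has_derivative_compose[OF UV(7)[OF gy(3)] df] show ?thesis
      using Dg'[OF gy(3)] by simp
  qed
  have F: "f x = f (g (\<sigma> k (\<Psi> x $ k)))"
    if f: "smooth_on U f" "\<And>x. x \<in> U \<Longrightarrow> differential f x = l x *\<^sub>R differential (\<lambda>x. \<Psi> x $ k) x"
      and x: "x \<in> U" for f l k x
  proof -
    let ?s = "\<Psi> x $ k"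
    let ?pr = "\<lambda>y::real^4. y + (?s - y $ k) *\<^sub>R axis k 1"
    have s: "\<bar>?s - ?y0 $ k\<bar> < d" using UW[OF x] by (simp add: W_def)
    have prW: "?pr y \<in> W" if "y \<in> W" for y
      using that s by (auto simp: W_def axis_def)
    \<comment> \<open>Fixing the k-th coordinate gives a function with zero derivative on the cube.\<close>
    have "((\<lambda>y. f (g (?pr y))) has_derivative (\<lambda>w. 0)) (at y within W)" if "y \<in> W" for y
    proof -
      have "(?pr has_derivative (\<lambda>w. w - w $ k *\<^sub>R axis k 1)) (at y within W)"
        by (auto intro!: derivative_eq_intros bounded_linear.has_derivative[OF bounded_linear_vec_nth] simp: fun_eq_iff)
      from has_derivative_compose[OF this key[OF f prW[OF that]]] show ?thesis by simp
    qed
    from has_derivative_zero_unique[OF Wcv _ UW(1)[OF x] y0W, of "\<lambda>y. f (g (?pr y))"] this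
    have "f (g (?pr (\<Psi> x))) = f (g (?pr ?y0))" by auto
    then show ?thesis using gU(2)[OF UW(2)[OF x]] by (simp add: \<sigma>_def)
  qed
  have CkF: "Ck_on n ((\<lambda>x. \<Psi> x $ k) ` U) (\<lambda>s. f (g (\<sigma> k s)))"
    if f: "smooth_on U f" "\<And>x. x \<in> U \<Longrightarrow> \<exists>l. differential f x = l *\<^sub>R differential (\<lambda>x. \<Psi> x $ k) x" for n k f
    using f
  proof (induction n arbitrary: f)
    case 0
    let ?h = "\<lambda>x. \<Psi> x $ k"
    obtain l where l: "\<And>x. x \<in> U \<Longrightarrow> differential f x = l x *\<^sub>R differential ?h x" using 0 by metis
    have "continuous_on W (\<lambda>y. f (g y))"
      using key[OF 0(1) l] by (meson continuous_at_imp_continuous_on has_derivative_continuous)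
    moreover have "continuous_on {s. \<bar>s - ?y0 $ k\<bar> < d} (\<sigma> k)"
      unfolding \<sigma>_def by (intro continuous_intros)
    ultimately have "continuous_on {s. \<bar>s - ?y0 $ k\<bar> < d} (\<lambda>s. f (g (\<sigma> k s)))"
      by (rule continuous_on_compose2) (auto simp: \<sigma>W)
    then show ?case by (simp add: img)
  next
    case (Suc n)
    let ?h = "\<lambda>x. \<Psi> x $ k"
    define l where "l x = (differential f x \<bullet> differential ?h x) / (differential ?h x \<bullet> differential ?h x)" for x
    have smU: "smooth_on U \<Psi>" using smooth_on_subset[OF _ sm] UW UV(2) by blast
    have smh: "smooth_on U ?h" by (intro smooth_intros smU Uop)
    have dh0: "differential ?h x \<noteq> 0" if "x \<in> U" for x
    proof
      assume 0: "differential ?h x = 0"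
      have xx: "\<Psi> x \<in> V" "g (\<Psi> x) = x" using gU UW that by auto
      have "dd i \<Psi> x $ k = 0" for i
        using 0 dd_nth[OF smooth_on_differentiable[OF sm], of x i k] that UV(2) UW(2)
        by (auto simp: differential_def pd_eq_dd vec_eq_iff)
      then have "?D x w $ k = 0" for w
        using frechet_derivative_dd[OF smooth_on_differentiable[OF sm], of x] that UV(2) UW(2)
        by (auto simp: subset_iff)
      from this[of "g' (\<Psi> x) (axis k 1)"] Dg'[OF xx(1)] xx(2) show False by simp
    qed
    have l: "differential f x = l x *\<^sub>R differential ?h x" if "x \<in> U" for x
      using Suc.prems(2)[OF that] dh0[OF that] by (auto simp: l_def)
    have sml: "smooth_on U l"
      unfolding l_def using Uop smU smh Suc.prems(1) dh0 by (intro smooth_intros) auto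
    have dl: "\<exists>m. differential l x = m *\<^sub>R differential ?h x" if x: "x \<in> U" for x
    proof -
      have dij: "dd i l x * dd j ?h x + l x * dd i (dd j ?h) x = dd i (dd j f) x" for i j
      proof -
        have "dd i (dd j f) x = dd i (\<lambda>y. l y * dd j ?h y) x"
        proof (rule dd_cong[OF Uop x])
          fix y assume "y \<in> U"
          from l[OF this] show "dd j f y = l y * dd j ?h y"
            by (simp add: vec_eq_iff differential_def pd_eq_dd)
        qed
        also have "\<dots> = dd i l x * dd j ?h x + l x * dd i (dd j ?h) x"
          using smooth_on_differentiable[OF _ x] sml smooth_on_dd[OF smh] by (intro dd_mult) auto
        finally show ?thesis by simp
      qed
      have e: "dd i l x * dd j ?h x = dd j l x * dd i ?h x" for i j
        using dij[of i j] dij[of j i] dd_commute_real[OF Uop smh x, of i j]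
          dd_commute_real[OF Uop Suc.prems(1) x, of i j] by simp
      let ?n = "differential ?h x \<bullet> differential ?h x"
      have "?n *\<^sub>R differential l x = (differential l x \<bullet> differential ?h x) *\<^sub>R differential ?h x"
        by (auto simp: vec_eq_iff differential_def pd_eq_dd inner_vec_def sum_distrib_left sum_distrib_right e mult_ac
            intro!: sum.cong)
      then have "differential l x = ((differential l x \<bullet> differential ?h x) / ?n) *\<^sub>R differential ?h x"
        using dh0[OF x] by (metis (no_types, lifting) divide_inverse_commute inner_eq_zero_iff scaleR_scaleR scaleR_one left_inverse)
      then show ?thesis by blast
    qed
    have der: "((\<lambda>s. f (g (\<sigma> k s))) has_derivative (\<lambda>t. l (g (\<sigma> k s)) * t)) (at s)"
      if "s \<in> ?h ` U" for s
    proof -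
      have "(\<sigma> k has_derivative (\<lambda>t. t *\<^sub>R axis k 1)) (at s)"
        unfolding \<sigma>_def by (auto intro!: derivative_eq_intros)
      moreover have "\<sigma> k s \<in> W" using that by (simp only: img) (simp add: \<sigma>W)
      ultimately show ?thesis
        using has_derivative_compose[OF _ key[OF Suc.prems(1) l]] by fastforce
    qed
    have "Ck_on n (?h ` U) (\<lambda>s. frechet_derivative (\<lambda>s. f (g (\<sigma> k s))) (at s) v)" for v
    proof (rule Ck_on_cong[OF opimg])
      show "Ck_on n (?h ` U) (\<lambda>s. l (g (\<sigma> k s)) * v)"
        by (intro Ck_on_bilinear[OF bounded_bilinear_mult] opimg Ck_on_const Suc.IH sml dl)
      show "l (g (\<sigma> k s)) * v = frechet_derivative (\<lambda>s. f (g (\<sigma> k s))) (at s) v" if "s \<in> ?h ` U" for s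
        using frechet_derivative_at[OF der[OF that]] by metis
    qed
    then show ?case using der by (auto simp: differentiable_def simp del: image_iff)
  qed
  show thesis
  proof
    show "open U" "x0 \<in> U" "U \<subseteq> S" using Uop y0W UV by (auto simp: U_def)
    show "open ((\<lambda>x. \<Psi> x $ k) ` U)" for k by (rule opimg)
    fix k f
    assume f: "smooth_on U f" "\<And>x. x \<in> U \<Longrightarrow> \<exists>l. differential f x = l *\<^sub>R differential (\<lambda>x. \<Psi> x $ k) x"
    then obtain l where l: "\<And>x. x \<in> U \<Longrightarrow> differential f x = l x *\<^sub>R differential (\<lambda>x. \<Psi> x $ k) x" by metis
    show "\<exists>F. smooth_on ((\<lambda>x. \<Psi> x $ k) ` U) F \<and> (\<forall>x\<in>U. f x = F (\<Psi> x $ k))"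
      using CkF[OF f] F[OF f(1) l] by (intro exI[of _ "\<lambda>s. f (g (\<sigma> k s))"]) (auto simp: smooth_on_def)
  qed
qed

section \<open>Hermitian linear algebra at a point\<close>

lemma matrix_inv_mult:
  fixes B :: "real^'n^'n"
  assumes "invertible B"
  shows "matrix_inv B ** B = mat 1" "B ** matrix_inv B = mat 1"
  using someI_ex[OF assms[unfolded invertible_def]] by (auto simp: matrix_inv_def)

lemma matrix_inv_eqI:
  fixes B :: "real^'n^'n"
  assumes "C ** B = mat 1"
  shows "matrix_inv B = C"
proof -
  have "invertible B" using assms matrix_left_right_inverse invertible_def by blast
  then show ?thesis
    by (metis assms matrix_inv_mult(2) matrix_mul_assoc matrix_mul_lid matrix_mul_rid)
qed

lemma pos_def_invertible: "pos_def B \<Longrightarrow> invertible B"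
  unfolding invertible_left_inverse matrix_left_invertible_ker pos_def_def
  by (metis inner_zero_right less_irrefl)

lemma pos_def_sym:
  assumes "pos_def B"
  shows "B $ i $ j = B $ j $ i"
proof -
  have "transpose B $ j $ i = B $ j $ i" using assms by (simp add: pos_def_def)
  then show ?thesis by (simp add: transpose_def)
qed

lemma pos_def_inv_sym:
  assumes "pos_def B"
  shows "transpose (matrix_inv B) = matrix_inv B"
proof -
  have "transpose (matrix_inv B) ** B = transpose (B ** matrix_inv B)"
    using assms by (simp add: matrix_transpose_mul pos_def_def)
  then have "transpose (matrix_inv B) ** B = mat 1"
    using matrix_inv_mult(2)[OF pos_def_invertible[OF assms]] by simp
  then show ?thesis using matrix_inv_eqI by metis
qed

text \<open>The components of a bilinear form in the basis given by the columns of \<open>P\<close>. For the Jacobian of a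
  change of charts this is the pullback.\<close>

definition pull :: "real^4^4 \<Rightarrow> real^4^4 \<Rightarrow> real^4^4" where
  "pull P B = transpose P ** B ** P"

lemma pull_component: "pull P B $ a $ b = (\<Sum>i\<in>UNIV. \<Sum>j\<in>UNIV. P $ i $ a * P $ j $ b * B $ i $ j)"
  unfolding pull_def matrix_matrix_mult_def transpose_def
  by (simp add: sum_distrib_left sum_distrib_right) (subst sum.swap, simp add: mult_ac)

lemma pull_bilinear: "pull P B $ a $ b = column a P \<bullet> (B *v column b P)"
  unfolding pull_component
  by (simp add: inner_vec_def column_def matrix_vector_mult_def sum_distrib_left mult_ac)

lemma pull_add: "pull P (A + B) = pull P A + pull P B"
  by (simp add: vec_eq_iff pull_component sum.distrib distrib_left)

lemma pull_diff: "pull P (A - B) = pull P A - pull P B"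
  by (simp add: vec_eq_iff pull_component sum_subtractf right_diff_distrib)

lemma pull_scaleR: "pull P (c *\<^sub>R B) = c *\<^sub>R pull P B"
  by (simp add: vec_eq_iff pull_component sum_distrib_left mult_ac)

lemma pull_sum: "pull P (\<Sum>i\<in>I. B i) = (\<Sum>i\<in>I. pull P (B i))"
  by (induction I rule: infinite_finite_induct) (simp_all add: pull_add, simp_all add: pull_def)

lemma pull_pull: "pull P (pull Q B) = pull (Q ** P) B"
  by (simp add: pull_def matrix_transpose_mul matrix_mul_assoc)

lemma pull_mat1: "pull (mat 1) B = B"
  by (simp add: pull_def)

lemma pull_transpose: "transpose (pull P B) = pull P (transpose B)"
  by (simp add: pull_def matrix_transpose_mul matrix_mul_assoc)

lemma pull_inverse:
  assumes "invertible P"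
  shows "pull P (pull (matrix_inv P) B) = B" "pull (matrix_inv P) (pull P B) = B"
  using matrix_inv_mult[OF assms] by (simp_all add: pull_pull pull_mat1)

lemma pull_inj: "invertible P \<Longrightarrow> pull P A = pull P B \<Longrightarrow> A = B"
  using pull_inverse(2) by metis

lemma alternating_pull:
  assumes "alternating \<phi>"
  shows "alternating (pull P \<phi>)"
  using assms unfolding alternating_def
  by (simp add: pull_transpose) (simp add: vec_eq_iff pull_component sum_negf)

lemma alternating_nth:
  assumes "alternating \<phi>"
  shows "\<phi> $ i $ j = - \<phi> $ j $ i"
proof -
  have "transpose \<phi> $ j $ i = - \<phi> $ j $ i" using assms by (simp add: alternating_def)
  then show ?thesis by (simp add: transpose_def)
qed

lemma alternating_diag: "alternating \<phi> \<Longrightarrow> \<phi> $ i $ i = 0"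
  using alternating_nth[of \<phi> i i] by simp

lemma alternatingI:
  assumes "\<And>i j. \<phi> $ i $ j = - \<phi> $ j $ i"
  shows "alternating \<phi>"
proof -
  have "transpose \<phi> $ j $ i = (- \<phi>) $ j $ i" for i j
    using assms[of i j] by (simp add: transpose_def)
  then show ?thesis unfolding alternating_def vec_eq_iff by blast
qed

lemma wedge2_add_left: "wedge2 (\<phi> + \<phi>') \<psi> = wedge2 \<phi> \<psi> + wedge2 \<phi>' \<psi>"
  by (simp add: wedge2_def algebra_simps)
lemma wedge2_add_right: "wedge2 \<phi> (\<psi> + \<psi>') = wedge2 \<phi> \<psi> + wedge2 \<phi> \<psi>'"
  by (simp add: wedge2_def algebra_simps)
lemma wedge2_scaleR_left: "wedge2 (c *\<^sub>R \<phi>) \<psi> = c * wedge2 \<phi> \<psi>"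
  by (simp add: wedge2_def algebra_simps)
lemma wedge2_scaleR_right: "wedge2 \<phi> (c *\<^sub>R \<psi>) = c * wedge2 \<phi> \<psi>"
  by (simp add: wedge2_def algebra_simps)

lemma wedge2_wedge_cases:
  "wedge2 (wedge a b) (wedge a c) = 0" "wedge2 (wedge a b) (wedge c a) = 0"
  "wedge2 (wedge b a) (wedge a c) = 0" "wedge2 (wedge b a) (wedge c a) = 0"
  "wedge2 (wedge a c) (wedge b d) = - wedge2 (wedge a b) (wedge c d)"
  "wedge2 (wedge a d) (wedge b c) = wedge2 (wedge a b) (wedge c d)"
  "wedge2 (wedge c d) (wedge a b) = wedge2 (wedge a b) (wedge c d)"
  unfolding wedge2_def wedge_def vec_lambda_beta by (simp_all add: algebra_simps)

text \<open>The scalar is the determinant of \<open>P\<close>.\<close>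

lemma wedge2_pull:
  obtains c where "\<And>\<alpha> \<beta>. alternating \<alpha> \<Longrightarrow> alternating \<beta> \<Longrightarrow> wedge2 (pull P \<alpha>) (pull P \<beta>) = c * wedge2 \<alpha> \<beta>"
proof
  define m where "m a b = wedge (P $ a) (P $ b)" for a b
  define c where "c = wedge2 (m 1 2) (m 3 4)"
  fix \<alpha> \<beta> :: "real^4^4" assume alt: "alternating \<alpha>" "alternating \<beta>"
  have exp: "pull P \<alpha> = \<alpha> $ 1 $ 2 *\<^sub>R m 1 2 + \<alpha> $ 1 $ 3 *\<^sub>R m 1 3 + \<alpha> $ 1 $ 4 *\<^sub>R m 1 4
     + \<alpha> $ 2 $ 3 *\<^sub>R m 2 3 + \<alpha> $ 2 $ 4 *\<^sub>R m 2 4 + \<alpha> $ 3 $ 4 *\<^sub>R m 3 4"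
    if "alternating \<alpha>" for \<alpha>
  proof -
    note [simp] = alternating_diag[OF that] alternating_nth[OF that, of 2 1] alternating_nth[OF that, of 3 1]
      alternating_nth[OF that, of 4 1] alternating_nth[OF that, of 3 2] alternating_nth[OF that, of 4 2]
      alternating_nth[OF that, of 4 3]
    show ?thesis
      unfolding vec_eq_iff[of "pull P \<alpha>"] vec_eq_iff[of "pull P \<alpha> $ _"]
      by (intro allI) (simp add: pull_component sum_4 m_def wedge_def algebra_simps)
  qed
  have n: "wedge2 (m 1 2) (m 3 4) = c" "wedge2 (m 1 3) (m 2 4) = - c" "wedge2 (m 1 4) (m 2 3) = c"
     "wedge2 (m 2 3) (m 1 4) = c" "wedge2 (m 2 4) (m 1 3) = - c" "wedge2 (m 3 4) (m 1 2) = c"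
    unfolding c_def m_def unfolding wedge2_def wedge_def vec_lambda_beta by (simp_all add: algebra_simps)
  have z: "wedge2 (m a b) (m a' b') = 0" if "a = a' \<or> a = b' \<or> b = a' \<or> b = b'" for a b a' b'
    using that unfolding m_def by (elim disjE) (simp_all only: wedge2_wedge_cases(1-4))
  show "wedge2 (pull P \<alpha>) (pull P \<beta>) = c * wedge2 \<alpha> \<beta>"
    unfolding exp[OF alt(1)] exp[OF alt(2)]
    by (simp add: wedge2_add_left wedge2_add_right wedge2_scaleR_left wedge2_scaleR_right n z)
       (simp add: wedge2_def algebra_simps)
qed

lemma wedge2_pull_nonzero:
  assumes "invertible P"
  obtains c where "c \<noteq> 0"
    "\<And>\<alpha> \<beta>. alternating \<alpha> \<Longrightarrow> alternating \<beta> \<Longrightarrow> wedge2 (pull P \<alpha>) (pull P \<beta>) = c * wedge2 \<alpha> \<beta>"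
proof -
  obtain c where c: "\<And>\<alpha> \<beta>. alternating \<alpha> \<Longrightarrow> alternating \<beta> \<Longrightarrow> wedge2 (pull P \<alpha>) (pull P \<beta>) = c * wedge2 \<alpha> \<beta>"
    using wedge2_pull[of P] by blast
  let ?Q = "matrix_inv P"
  let ?\<alpha> = "(\<chi> i j. if i = 1 \<and> j = 2 \<or> i = 3 \<and> j = 4 then 1 else if i = 2 \<and> j = 1 \<or> i = 4 \<and> j = 3 then -1 else 0) :: real^4^4"
  have alt: "alternating ?\<alpha>" by (rule alternatingI) auto
  have "wedge2 (pull P (pull ?Q ?\<alpha>)) (pull P (pull ?Q ?\<alpha>)) = c * wedge2 (pull ?Q ?\<alpha>) (pull ?Q ?\<alpha>)"
    by (intro c alternating_pull alt)
  then have "wedge2 ?\<alpha> ?\<alpha> = c * wedge2 (pull ?Q ?\<alpha>) (pull ?Q ?\<alpha>)" using pull_inverse(1)[OF assms] by simp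
  moreover have "wedge2 ?\<alpha> ?\<alpha> = 2" by (simp add: wedge2_def)
  ultimately have "c \<noteq> 0" by auto
  then show thesis using that c by blast
qed

lemma kahler_form_eq: "kahler_form g J = transpose J ** g"
  by (simp add: vec_eq_iff kahler_form_def matrix_matrix_mult_def transpose_def)

lemma J_covector_eq: "J_covector J \<alpha> = - (transpose J *v \<alpha>)"
  by (simp add: vec_eq_iff J_covector_def matrix_vector_mult_def transpose_def mult.commute)

lemma trace_transpose_mult: "trace (transpose A ** B) = (\<Sum>i\<in>UNIV. \<Sum>j\<in>UNIV. A $ i $ j * B $ i $ j)"
  for A B :: "real^'n^'n"
  unfolding trace_def matrix_matrix_mult_def transpose_def by (simp, subst sum.swap, rule refl)

text \<open>As a trace of a product of matrices, the inner product is visibly compatible with a change of basis.\<close>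

lemma form_inner_trace:
  "form_inner g \<phi> \<psi> = (1/2) * trace (transpose \<phi> ** (matrix_inv g ** \<psi> ** transpose (matrix_inv g)))"
proof -
  have "(matrix_inv g ** \<psi> ** transpose (matrix_inv g)) $ i $ j
    = (\<Sum>k\<in>UNIV. \<Sum>l\<in>UNIV. matrix_inv g $ i $ k * matrix_inv g $ j $ l * \<psi> $ k $ l)" for i j
    unfolding matrix_matrix_mult_def transpose_def
    by (simp add: sum_distrib_left sum_distrib_right mult_ac) (subst sum.swap, rule refl)
  then show ?thesis
    unfolding form_inner_def trace_transpose_mult by (simp add: sum_distrib_left mult_ac)
qed

lemma matrix_inv_pull:
  assumes "invertible P" "invertible g"
  shows "matrix_inv (pull P g) = matrix_inv P ** matrix_inv g ** transpose (matrix_inv P)"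
proof (rule matrix_inv_eqI)
  let ?Q = "matrix_inv P"
  have "transpose ?Q ** transpose P = mat 1"
    using matrix_inv_mult(2)[OF assms(1)] by (metis matrix_transpose_mul transpose_mat)
  then have "?Q ** matrix_inv g ** transpose ?Q ** pull P g = ?Q ** (matrix_inv g ** g) ** P"
    unfolding pull_def by (metis (no_types, lifting) matrix_mul_assoc matrix_mul_rid)
  then show "?Q ** matrix_inv g ** transpose ?Q ** pull P g = mat 1"
    using matrix_inv_mult[OF assms(1)] matrix_inv_mult[OF assms(2)] by (simp add: matrix_mul_assoc[symmetric])
qed

lemma form_inner_pull:
  assumes "invertible P" "invertible g"
  shows "form_inner (pull P g) (pull P \<phi>) (pull P \<psi>) = form_inner g \<phi> \<psi>"
proof -
  let ?Q = "matrix_inv P" and ?h = "matrix_inv g"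
  have 1: "P ** ?Q = mat 1" "?Q ** P = mat 1" using matrix_inv_mult[OF assms(1)] by auto
  have 2: "transpose ?Q ** transpose P = mat 1" using 1 by (metis matrix_transpose_mul transpose_mat)
  have "matrix_inv (pull P g) ** pull P \<psi> ** transpose (matrix_inv (pull P g))
    = ?Q ** ?h ** (transpose ?Q ** transpose P) ** \<psi> ** (P ** ?Q) ** transpose ?h ** transpose ?Q"
    unfolding matrix_inv_pull[OF assms] by (simp add: pull_def matrix_transpose_mul matrix_mul_assoc)
  also have "\<dots> = ?Q ** (?h ** \<psi> ** transpose ?h) ** transpose ?Q" unfolding 1 2 by (simp add: matrix_mul_assoc)
  finally have "transpose (pull P \<phi>) ** (matrix_inv (pull P g) ** pull P \<psi> ** transpose (matrix_inv (pull P g)))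
    = transpose P ** transpose \<phi> ** (P ** ?Q) ** (?h ** \<psi> ** transpose ?h) ** transpose ?Q"
    by (simp add: pull_def matrix_transpose_mul matrix_mul_assoc)
  also have "\<dots> = transpose P ** (transpose \<phi> ** (?h ** \<psi> ** transpose ?h) ** transpose ?Q)"
    unfolding 1 by (simp add: matrix_mul_assoc)
  finally have "trace (transpose (pull P \<phi>) ** (matrix_inv (pull P g) ** pull P \<psi> ** transpose (matrix_inv (pull P g))))
    = trace (transpose \<phi> ** (?h ** \<psi> ** transpose ?h) ** (transpose ?Q ** transpose P))"
    by (metis trace_mul_sym matrix_mul_assoc)
  then show ?thesis unfolding form_inner_trace 2 by simp
qed

lemma form_inner_add_left: "form_inner g (\<phi> + \<phi>') \<psi> = form_inner g \<phi> \<psi> + form_inner g \<phi>' \<psi>"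
  by (simp add: form_inner_def algebra_simps sum.distrib)
lemma form_inner_add_right: "form_inner g \<phi> (\<psi> + \<psi>') = form_inner g \<phi> \<psi> + form_inner g \<phi> \<psi>'"
  by (simp add: form_inner_def algebra_simps sum.distrib)
lemma form_inner_scaleR_left: "form_inner g (c *\<^sub>R \<phi>) \<psi> = c * form_inner g \<phi> \<psi>"
  by (simp add: form_inner_def sum_distrib_left mult_ac)
lemma form_inner_scaleR_right: "form_inner g \<phi> (c *\<^sub>R \<psi>) = c * form_inner g \<phi> \<psi>"
  by (simp add: form_inner_def sum_distrib_left mult_ac)
lemma form_inner_sum_left: "form_inner g (\<Sum>i\<in>I. \<phi> i) \<psi> = (\<Sum>i\<in>I. form_inner g (\<phi> i) \<psi>)"
  by (induction I rule: infinite_finite_induct) (auto simp: form_inner_add_left, auto simp: form_inner_def)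
lemma form_inner_sum_right: "form_inner g \<phi> (\<Sum>i\<in>I. \<psi> i) = (\<Sum>i\<in>I. form_inner g \<phi> (\<psi> i))"
  by (induction I rule: infinite_finite_induct) (auto simp: form_inner_add_right, auto simp: form_inner_def)

definition std_J :: "real^4^4" where
  "std_J = (\<chi> i j. if i = 2 \<and> j = 1 \<or> i = 4 \<and> j = 3 then 1
     else if i = 1 \<and> j = 2 \<or> i = 3 \<and> j = 4 then -1 else 0)"

lemma std_J_nth:
  "std_J $ 1 $ 1 = 0" "std_J $ 1 $ 2 = -1" "std_J $ 1 $ 3 = 0" "std_J $ 1 $ 4 = 0"
  "std_J $ 2 $ 1 = 1" "std_J $ 2 $ 2 = 0" "std_J $ 2 $ 3 = 0" "std_J $ 2 $ 4 = 0"
  "std_J $ 3 $ 1 = 0" "std_J $ 3 $ 2 = 0" "std_J $ 3 $ 3 = 0" "std_J $ 3 $ 4 = -1"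
  "std_J $ 4 $ 1 = 0" "std_J $ 4 $ 2 = 0" "std_J $ 4 $ 3 = 1" "std_J $ 4 $ 4 = 0"
  by (simp_all add: std_J_def)

text \<open>The columns of \<open>P\<close> form a unitary basis: \<open>P\<close> identifies the tangent space with the standard
  hermitian space.\<close>

definition frame :: "real^4^4 \<Rightarrow> real^4^4 \<Rightarrow> real^4^4 \<Rightarrow> bool" where
  "frame g J P \<longleftrightarrow> invertible P \<and> pull P g = mat 1 \<and> J ** P = P ** std_J"

definition hermitian :: "real^4^4 \<Rightarrow> real^4^4 \<Rightarrow> bool" where
  "hermitian g J \<longleftrightarrow> pos_def g \<and> J ** J = - mat 1 \<and> transpose J ** g ** J = g"

text \<open>The basis is \<open>u, J u, w, J w\<close>, where \<open>u\<close> is a unit vector and \<open>w\<close> a unit vector orthogonal to \<open>u\<close>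
  and \<open>J u\<close>.\<close>

lemma frame_exists:
  assumes "hermitian g J"
  obtains P where "frame g J P"
proof -
  have pd: "pos_def g" and JJ: "J ** J = - mat 1" and JgJ: "transpose J ** g ** J = g"
    using assms by (auto simp: hermitian_def)
  define m where "m v w = v \<bullet> (g *v w)" for v w
  have msym: "m v w = m w v" for v w
    unfolding m_def using pd by (metis dot_lmul_matrix inner_commute pos_def_def transpose_matrix_vector)
  have mpos: "m v v > 0" if "v \<noteq> 0" for v using pd that by (simp add: m_def pos_def_def)
  have J2: "J *v (J *v v) = - v" for v
  proof -
    have "J *v (J *v v) = (- mat 1) *v v" by (simp add: matrix_vector_mul_assoc JJ)
    also have "\<dots> = - v"
      using matrix_vector_mult_diff_rdistrib[of 0 "mat 1" v] by simp
    finally show ?thesis .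
  qed
  have mJ: "m (J *v v) (J *v w) = m v w" for v w
  proof -
    have "m v w = v \<bullet> (transpose J *v (g *v (J *v w)))"
      unfolding m_def by (subst JgJ[symmetric]) (simp add: matrix_vector_mul_assoc[symmetric] del: transpose_matrix_vector)
    then show ?thesis unfolding m_def by (metis dot_lmul_matrix inner_commute transpose_matrix_vector)
  qed
  have mneg: "m (- v) w = - m v w" for v w by (simp add: m_def)
  have mJ0: "m (J *v v) v = 0" for v
    using mJ[of "J *v v" v] msym[of v "J *v v"] by (simp add: J2 mneg)
  have norm: "\<exists>u. m u u = 1 \<and> (\<exists>c. u = c *\<^sub>R v)" if "v \<noteq> 0" for v
    using mpos[OF that]
    by (intro exI[of _ "(1 / sqrt (m v v)) *\<^sub>R v"]) (auto simp: m_def matrix_vector_mult_scaleR)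
  have "axis 1 1 \<noteq> (0 :: real^4)" by simp
  from norm[OF this] obtain e1 where e1: "m e1 e1 = 1" by blast
  define e2 where "e2 = J *v e1"
  have "dim {g *v e1, g *v e2} \<le> card {g *v e1, g *v e2}" by (intro dim_le_card) (auto intro: span_base)
  also have "\<dots> \<le> 2" by (simp add: card_insert_le_m1)
  finally have "dim {g *v e1, g *v e2} < DIM(real^4)" by simp
  then obtain w where w: "w \<noteq> 0" "\<And>y. y \<in> span {g *v e1, g *v e2} \<Longrightarrow> orthogonal w y"
    using orthogonal_to_subspace_exists by blast
  obtain e3 c where e3: "m e3 e3 = 1" "e3 = c *\<^sub>R w" using norm[OF w(1)] by blast
  have e31: "m e3 e1 = 0" "m e3 e2 = 0"
    using w(2)[of "g *v e1"] w(2)[of "g *v e2"] by (auto simp: m_def e3(2) orthogonal_def span_base)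
  define e4 where "e4 = J *v e3"
  have J: "J *v e1 = e2" "J *v e2 = - e1" "J *v e3 = e4" "J *v e4 = - e3"
    by (simp_all add: e2_def e4_def J2)
  have m22: "m e2 e2 = 1" "m e4 e4 = 1" "m e2 e1 = 0" "m e4 e3 = 0" "m e4 e2 = 0"
    using mJ e1 e3 e31 mJ0 by (auto simp: e2_def e4_def)
  have m41: "m e4 e1 = 0"
    using mJ[of e4 e1] e31 by (simp add: J mneg)
  define P :: "real^4^4" where "P = (\<chi> i j. (if j = 1 then e1 else if j = 2 then e2 else if j = 3 then e3 else e4) $ i)"
  have col: "column 1 P = e1" "column 2 P = e2" "column 3 P = e3" "column 4 P = e4"
    by (simp_all add: P_def column_def vec_eq_iff)
  have e: "pull P g $ a $ b = m (column a P) (column b P)" for a b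
    by (simp add: pull_bilinear m_def)
  have pg: "pull P g = mat 1"
    unfolding vec_eq_iff[of "pull P g"] vec_eq_iff[of "pull P g $ _"] forall_4 e col
    using e1 e3 e31 m22 m41 msym by (auto simp: mat_def)
  have "(transpose P ** g) ** P = mat 1" using pg by (simp add: pull_def)
  then have inv: "invertible P" using invertible_left_inverse by blast
  have "J ** P = P ** std_J"
  proof -
    have c: "column a (J ** P) = J *v column a P" for a
      by (simp add: vec_eq_iff column_def matrix_matrix_mult_def matrix_vector_mult_def)
    have d: "column a (P ** std_J) = (\<Sum>k\<in>UNIV. std_J $ k $ a *\<^sub>R column k P)" for a
      by (simp add: vec_eq_iff column_def matrix_matrix_mult_def mult.commute)
    have "column a (J ** P) = column a (P ** std_J)" for a
    proof -
      have "\<forall>a. column a (J ** P) = column a (P ** std_J)"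
        unfolding forall_4 c d sum_4 col std_J_nth J by simp
      then show ?thesis by blast
    qed
    then show ?thesis by (simp add: vec_eq_iff column_def)
  qed
  then show thesis using that pg inv by (simp add: frame_def)
qed

context
  fixes g J P :: "real^4^4"
  assumes fr: "frame g J P" and sym: "transpose g = g" and ginv: "invertible g"
begin

lemma frame_kahler: "pull P (kahler_form g J) = kahler_form (mat 1) std_J"
proof -
  have "pull P (kahler_form g J) = transpose (J ** P) ** (g ** P)"
    by (simp add: pull_def kahler_form_eq matrix_transpose_mul matrix_mul_assoc)
  also have "J ** P = P ** std_J" using fr by (simp add: frame_def)
  also have "transpose (P ** std_J) ** (g ** P) = transpose std_J ** pull P g"
    by (simp add: pull_def matrix_transpose_mul matrix_mul_assoc)
  finally show ?thesis using fr by (simp add: frame_def kahler_form_eq)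
qed

lemma frame_inv: "matrix_inv g = P ** transpose P"
proof -
  let ?Q = "matrix_inv P"
  have i: "invertible P" "pull P g = mat 1" using fr by (auto simp: frame_def)
  have 1: "P ** ?Q = mat 1" "?Q ** P = mat 1" using matrix_inv_mult[OF i(1)] by auto
  have 2: "transpose ?Q ** transpose P = mat 1" using 1 by (metis matrix_transpose_mul transpose_mat)
  have "mat 1 = ?Q ** matrix_inv g ** transpose ?Q"
    using matrix_inv_pull[OF i(1) ginv] i(2) matrix_inv_eqI[of "mat 1" "mat 1 :: real^4^4"] by simp
  then have "P ** transpose P = (P ** ?Q) ** matrix_inv g ** (transpose ?Q ** transpose P)"
    by (metis matrix_mul_assoc matrix_mul_rid)
  then show ?thesis unfolding 1 2 by simp
qed

lemma frame_form_inner: "form_inner g \<phi> \<psi> = form_inner (mat 1) (pull P \<phi>) (pull P \<psi>)"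
  using form_inner_pull[of P g \<phi> \<psi>] fr ginv by (simp add: frame_def)

lemma frame_endo: "pull P (transpose J ** B) = transpose std_J ** pull P B"
proof -
  have "pull P (transpose J ** B) = transpose (J ** P) ** B ** P"
    by (simp add: pull_def matrix_transpose_mul matrix_mul_assoc)
  also have "J ** P = P ** std_J" using fr by (simp add: frame_def)
  finally show ?thesis by (simp add: pull_def matrix_transpose_mul matrix_mul_assoc)
qed

lemma frame_J_invariant:
  assumes "transpose J ** B ** J = B"
  shows "transpose std_J ** pull P B ** std_J = pull P B"
proof -
  have "pull P B = transpose (J ** P) ** B ** (J ** P)"
    unfolding pull_def by (subst assms[symmetric]) (simp add: matrix_transpose_mul matrix_mul_assoc)
  also have "J ** P = P ** std_J" using fr by (simp add: frame_def)
  also have "transpose (P ** std_J) ** B ** (P ** std_J) = transpose std_J ** pull P B ** std_J"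
    by (simp add: pull_def matrix_transpose_mul matrix_mul_assoc)
  finally show ?thesis by (rule HOL.sym)
qed

lemma alternating_kahler:
  assumes JJ: "J ** J = - mat 1" and JgJ: "transpose J ** g ** J = g"
  shows "alternating (kahler_form g J)"
proof -
  have "transpose J ** g ** (J ** J) = g ** J" using JgJ by (simp add: matrix_mul_assoc)
  then have "- (transpose J ** g) = g ** J" unfolding JJ
    by (simp add: vec_eq_iff matrix_matrix_mult_def mat_def if_distrib cong: if_cong)
  then show ?thesis
    unfolding alternating_def kahler_form_eq by (simp add: matrix_transpose_mul sym)
qed

end

lemma std_kahler_nth:
  "kahler_form (mat 1) std_J $ i $ j = std_J $ j $ i"
  by (simp add: kahler_form_eq) (simp add: transpose_def)

lemma matrix_inv_mat1: "matrix_inv (mat 1) = (mat 1 :: real^'n^'n)"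
  by (rule matrix_inv_eqI) simp

lemma std_form_inner:
  "form_inner (mat 1) \<phi> \<psi> = (1/2) * (\<Sum>i\<in>UNIV. \<Sum>j\<in>UNIV. \<phi> $ i $ j * \<psi> $ i $ j)"
  by (simp add: form_inner_trace matrix_inv_mat1 trace_transpose_mult)

lemma wedge2_std_kahler: "wedge2 (kahler_form (mat 1) std_J) (kahler_form (mat 1) std_J) = 2"
  by (simp add: wedge2_def std_kahler_nth std_J_nth)

text \<open>The two sides of the defining equation scale by the same factor, since \<open>\<omega> \<and> \<omega>\<close> is also a product
  of 2-forms.\<close>

lemma frame_anti_selfdual:
  assumes fr: "frame g J P" and g: "hermitian g J"
  shows "anti_selfdual g J \<Phi> \<longleftrightarrow> anti_selfdual (mat 1) std_J (pull P \<Phi>)"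
proof -
  have pd: "pos_def g" "transpose g = g" "invertible g" and J: "J ** J = - mat 1" "transpose J ** g ** J = g"
    using g pos_def_invertible by (auto simp: hermitian_def pos_def_def)
  have iP: "invertible P" using fr by (simp add: frame_def)
  obtain c where c: "c \<noteq> 0"
    "\<And>\<alpha> \<beta>. alternating \<alpha> \<Longrightarrow> alternating \<beta> \<Longrightarrow> wedge2 (pull P \<alpha>) (pull P \<beta>) = c * wedge2 \<alpha> \<beta>"
    using wedge2_pull_nonzero[OF iP] by blast
  let ?w = "kahler_form g J" and ?std = "kahler_form (mat 1) std_J"
  have pw: "pull P ?w = ?std" by (rule frame_kahler[OF fr pd(2,3)])
  have aw: "alternating ?w" by (rule alternating_kahler[OF fr pd(2,3) J])
  have alt: "alternating \<alpha> \<longleftrightarrow> alternating (pull P \<alpha>)" for \<alpha>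
    using alternating_pull pull_inverse(2)[OF iP] by metis
  have eq: "wedge2 \<alpha> \<Phi> = - form_inner g \<alpha> \<Phi> * (wedge2 ?w ?w / 2) \<longleftrightarrow>
     wedge2 (pull P \<alpha>) (pull P \<Phi>) = - form_inner (mat 1) (pull P \<alpha>) (pull P \<Phi>) * (wedge2 ?std ?std / 2)"
    if "alternating \<alpha>" "alternating \<Phi>" for \<alpha>
  proof -
    have "- form_inner (mat 1) (pull P \<alpha>) (pull P \<Phi>) * (wedge2 ?std ?std / 2)
      = c * (- form_inner g \<alpha> \<Phi> * (wedge2 ?w ?w / 2))"
      unfolding pw[symmetric] c(2)[OF aw aw] frame_form_inner[OF fr pd(2,3)] by simp
    then show ?thesis unfolding c(2)[OF that] using c(1) by (metis mult_cancel_left)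
  qed
  show ?thesis
  proof
    assume L: "anti_selfdual g J \<Phi>"
    show "anti_selfdual (mat 1) std_J (pull P \<Phi>)"
      unfolding anti_selfdual_def
    proof (intro conjI allI impI)
      show "alternating (pull P \<Phi>)" using L alt by (simp add: anti_selfdual_def)
      fix \<alpha> :: "real^4^4" assume a: "alternating \<alpha>"
      let ?a = "pull (matrix_inv P) \<alpha>"
      have "alternating ?a" using a by (rule alternating_pull)
      moreover from this L have "wedge2 ?a \<Phi> = - form_inner g ?a \<Phi> * (wedge2 ?w ?w / 2)" "alternating \<Phi>"
        by (auto simp: anti_selfdual_def)
      ultimately show "wedge2 \<alpha> (pull P \<Phi>) = - form_inner (mat 1) \<alpha> (pull P \<Phi>) * (wedge2 ?std ?std / 2)"
        using eq[of ?a] pull_inverse(1)[OF iP] by simp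
    qed
  next
    assume R: "anti_selfdual (mat 1) std_J (pull P \<Phi>)"
    show "anti_selfdual g J \<Phi>"
      unfolding anti_selfdual_def using R eq alt by (auto simp: anti_selfdual_def)
  qed
qed

lemma std_anti_selfdual:
  "anti_selfdual (mat 1) std_J \<Phi> \<longleftrightarrow>
     alternating \<Phi> \<and> \<Phi> $ 3 $ 4 = - \<Phi> $ 1 $ 2 \<and> \<Phi> $ 2 $ 4 = \<Phi> $ 1 $ 3 \<and> \<Phi> $ 2 $ 3 = - \<Phi> $ 1 $ 4"
  (is "?L \<longleftrightarrow> ?R")
proof
  assume L: ?L
  then have a: "alternating \<Phi>" by (simp add: anti_selfdual_def)
  note [simp] = alternating_nth[OF a, of 2 1] alternating_nth[OF a, of 3 1]
      alternating_nth[OF a, of 4 1] alternating_nth[OF a, of 3 2] alternating_nth[OF a, of 4 2]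
      alternating_nth[OF a, of 4 3]
  have *: "wedge2 \<alpha> \<Phi> = - form_inner (mat 1) \<alpha> \<Phi>" if "alternating \<alpha>" for \<alpha>
    using L that by (simp add: anti_selfdual_def wedge2_std_kahler)
  define E :: "4 \<Rightarrow> 4 \<Rightarrow> real^4^4" where "E a b = wedge (axis a 1) (axis b 1)" for a b
  have alt: "alternating (E a b)" for a b
    by (rule alternatingI) (simp add: E_def wedge_def)
  from *[OF alt[of 1 2]] *[OF alt[of 1 3]] *[OF alt[of 1 4]] show ?R
    using a by (simp add: wedge2_def std_form_inner sum_4 E_def wedge_def axis_def)
next
  assume R: ?R
  then have a: "alternating \<Phi>" and b: "\<Phi> $ 3 $ 4 = - \<Phi> $ 1 $ 2" "\<Phi> $ 2 $ 4 = \<Phi> $ 1 $ 3" "\<Phi> $ 2 $ 3 = - \<Phi> $ 1 $ 4"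
    by auto
  show ?L
    unfolding anti_selfdual_def
  proof (intro conjI allI impI)
    fix \<alpha> :: "real^4^4" assume c: "alternating \<alpha>"
    show "wedge2 \<alpha> \<Phi> = - form_inner (mat 1) \<alpha> \<Phi> * (wedge2 (kahler_form (mat 1) std_J) (kahler_form (mat 1) std_J) / 2)"
      unfolding wedge2_std_kahler unfolding std_form_inner sum_4 wedge2_def
      using alternating_nth[OF a, of 2 1] alternating_nth[OF a, of 3 1]
      alternating_nth[OF a, of 4 1] alternating_nth[OF a, of 3 2] alternating_nth[OF a, of 4 2]
      alternating_nth[OF a, of 4 3] alternating_nth[OF c, of 2 1] alternating_nth[OF c, of 3 1]
      alternating_nth[OF c, of 4 1] alternating_nth[OF c, of 3 2] alternating_nth[OF c, of 4 2]
      alternating_nth[OF c, of 4 3] alternating_diag[OF a] alternating_diag[OF c] b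
      by (simp add: algebra_simps)
  qed (rule a)
qed

lemma std_J_invariant:
  assumes "alternating B" "transpose std_J ** B ** std_J = B"
  shows "B $ 2 $ 4 = B $ 1 $ 3" "B $ 2 $ 3 = - B $ 1 $ 4"
proof -
  have "(transpose std_J ** B ** std_J) $ 1 $ 3 = B $ 1 $ 3" "(transpose std_J ** B ** std_J) $ 1 $ 4 = B $ 1 $ 4"
    using assms(2) by auto
  then show "B $ 2 $ 4 = B $ 1 $ 3" "B $ 2 $ 3 = - B $ 1 $ 4"
    by (simp_all add: matrix_matrix_mult_def transpose_def sum_4 std_J_nth)
qed

lemma hermitianD:
  assumes "hermitian g J"
  shows "pos_def g" "transpose g = g" "invertible g" "J ** J = - mat 1" "transpose J ** g ** J = g"
  using assms pos_def_invertible by (auto simp: hermitian_def pos_def_def)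

lemma alternating_kahler_form: "hermitian g J \<Longrightarrow> alternating (kahler_form g J)"
  by (metis alternating_kahler frame_exists hermitianD(2-5))

text \<open>In a unitary frame, invariance and orthogonality to \<open>\<omega>\<close> are the linear equations that characterize
  anti-selfdual forms.\<close>

lemma anti_selfdualI:
  assumes g: "hermitian g J" and a: "alternating \<Phi>" and J: "transpose J ** \<Phi> ** J = \<Phi>"
    and tr: "form_inner g \<Phi> (kahler_form g J) = 0"
  shows "anti_selfdual g J \<Phi>"
proof -
  note h = hermitianD[OF g]
  obtain P where P: "frame g J P" using frame_exists[OF g] .
  note std = std_J_invariant[OF alternating_pull[OF a] frame_J_invariant[OF P h(2,3) J]]
  have a': "alternating (pull P \<Phi>)" by (rule alternating_pull[OF a])
  have "form_inner (mat 1) (pull P \<Phi>) (kahler_form (mat 1) std_J) = 0"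
    using tr frame_form_inner[OF P h(2,3)] frame_kahler[OF P h(2,3)] by simp
  then have "pull P \<Phi> $ 3 $ 4 = - pull P \<Phi> $ 1 $ 2"
    using alternating_nth[OF a', of 2 1] alternating_nth[OF a', of 4 3]
    by (simp add: std_form_inner sum_4 std_kahler_nth std_J_nth)
  then show ?thesis unfolding frame_anti_selfdual[OF P g] std_anti_selfdual using std a' by simp
qed

lemma kahler_norm:
  assumes g: "hermitian g J"
  shows "form_inner g (kahler_form g J) (kahler_form g J) = 2"
    "wedge2 (kahler_form g J) (kahler_form g J) \<noteq> 0"
proof -
  note h = hermitianD[OF g]
  obtain P where P: "frame g J P" using frame_exists[OF g] .
  show "form_inner g (kahler_form g J) (kahler_form g J) = 2"
    unfolding frame_form_inner[OF P h(2,3)] frame_kahler[OF P h(2,3)]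
    by (simp add: std_form_inner sum_4 std_kahler_nth std_J_nth)
  obtain c where c: "\<And>\<alpha> \<beta>. alternating \<alpha> \<Longrightarrow> alternating \<beta> \<Longrightarrow> wedge2 (pull P \<alpha>) (pull P \<beta>) = c * wedge2 \<alpha> \<beta>"
    using wedge2_pull[of P] by blast
  show "wedge2 (kahler_form g J) (kahler_form g J) \<noteq> 0"
    using c[OF alternating_kahler_form[OF g] alternating_kahler_form[OF g]] wedge2_std_kahler
    unfolding frame_kahler[OF P h(2,3)] by auto
qed

text \<open>Both sides are quadratic in the four entries that an invariant 2-form has in a unitary frame.\<close>

lemma wedge2_square:
  assumes g: "hermitian g J" and a: "alternating \<Psi>" and J: "transpose J ** \<Psi> ** J = \<Psi>"
  shows "2 * wedge2 \<Psi> \<Psi> = ((form_inner g \<Psi> (kahler_form g J))\<^sup>2 - form_inner g \<Psi> \<Psi>)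
     * wedge2 (kahler_form g J) (kahler_form g J)"
proof -
  note h = hermitianD[OF g]
  obtain P where P: "frame g J P" using frame_exists[OF g] .
  obtain c where c: "c \<noteq> 0"
    "\<And>\<alpha> \<beta>. alternating \<alpha> \<Longrightarrow> alternating \<beta> \<Longrightarrow> wedge2 (pull P \<alpha>) (pull P \<beta>) = c * wedge2 \<alpha> \<beta>"
    using wedge2_pull_nonzero P unfolding frame_def by metis
  have a': "alternating (pull P \<Psi>)" by (rule alternating_pull[OF a])
  note std = std_J_invariant[OF a' frame_J_invariant[OF P h(2,3) J]]
  have "2 * wedge2 (pull P \<Psi>) (pull P \<Psi>) = ((form_inner (mat 1) (pull P \<Psi>) (kahler_form (mat 1) std_J))\<^sup>2
      - form_inner (mat 1) (pull P \<Psi>) (pull P \<Psi>)) * wedge2 (kahler_form (mat 1) std_J) (kahler_form (mat 1) std_J)"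
    unfolding wedge2_std_kahler unfolding std_form_inner sum_4 std_kahler_nth std_J_nth wedge2_def
    using std alternating_nth[OF a', of 2 1] alternating_nth[OF a', of 3 1]
      alternating_nth[OF a', of 4 1] alternating_nth[OF a', of 3 2] alternating_nth[OF a', of 4 2]
      alternating_nth[OF a', of 4 3] alternating_diag[OF a']
    by (simp add: algebra_simps power2_eq_square)
  then show ?thesis
    unfolding frame_form_inner[OF P h(2,3)] frame_kahler[OF P h(2,3), symmetric]
      c(2)[OF a a] c(2)[OF alternating_kahler_form[OF g] alternating_kahler_form[OF g]]
    using c(1) by simp
qed

text \<open>The endomorphism of an invariant 2-form is a hermitian complex \<open>2 \<times> 2\<close> matrix. It has trace \<open>s\<close> and its
  determinant is the pfaffian, so its eigenvalues are the roots of \<open>t\<^sup>2 - s t + (s\<^sup>2 - |\<Psi>|\<^sup>2) / 2\<close>.\<close>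

lemma cayley_hamilton:
  assumes g: "hermitian g J" and a: "alternating \<Psi>" and J: "transpose J ** \<Psi> ** J = \<Psi>"
  defines "Q \<equiv> - (transpose J ** \<Psi>)" and "s \<equiv> form_inner g \<Psi> (kahler_form g J)"
  shows "Q ** matrix_inv g ** Q - s *\<^sub>R Q + ((s\<^sup>2 - form_inner g \<Psi> \<Psi>) / 2) *\<^sub>R g = 0"
proof -
  note h = hermitianD[OF g]
  obtain P where P: "frame g J P" using frame_exists[OF g] .
  have iP: "invertible P" "pull P g = mat 1" using P by (auto simp: frame_def)
  let ?S = "pull P \<Psi>"
  have a': "alternating ?S" by (rule alternating_pull[OF a])
  note std = std_J_invariant[OF a' frame_J_invariant[OF P h(2,3) J]]
  define R where "R = pull P Q"
  have R: "R = - (transpose std_J ** ?S)"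
  proof -
    have "R = - pull P (transpose J ** \<Psi>)"
      unfolding R_def Q_def using pull_scaleR[of P "-1"] by simp
    then show ?thesis unfolding frame_endo[OF P h(2,3)] .
  qed
  have RR: "pull P (Q ** matrix_inv g ** Q) = R ** R"
    unfolding frame_inv[OF P h(2,3)] R_def by (simp add: pull_def matrix_mul_assoc)
  have s: "s = form_inner (mat 1) ?S (kahler_form (mat 1) std_J)" "form_inner g \<Psi> \<Psi> = form_inner (mat 1) ?S ?S"
    unfolding s_def frame_form_inner[OF P h(2,3)] frame_kahler[OF P h(2,3)] by auto
  have s1: "s = ?S $ 1 $ 2 + ?S $ 3 $ 4"
    unfolding s std_form_inner sum_4 std_kahler_nth std_J_nth
    using alternating_nth[OF a', of 2 1] alternating_nth[OF a', of 4 3] by simp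
  have s2: "form_inner g \<Psi> \<Psi> = (?S $ 1 $ 2)\<^sup>2 + (?S $ 3 $ 4)\<^sup>2 + 2 * (?S $ 1 $ 3)\<^sup>2 + 2 * (?S $ 1 $ 4)\<^sup>2"
    unfolding s std_form_inner sum_4
    using std alternating_nth[OF a', of 2 1] alternating_nth[OF a', of 3 1]
      alternating_nth[OF a', of 4 1] alternating_nth[OF a', of 3 2] alternating_nth[OF a', of 4 2]
      alternating_nth[OF a', of 4 3] alternating_diag[OF a']
    by (simp add: power2_eq_square)
  have "R ** R - s *\<^sub>R R + ((s\<^sup>2 - form_inner g \<Psi> \<Psi>) / 2) *\<^sub>R mat 1 = 0"
    unfolding s2 unfolding s1
    unfolding R vec_eq_iff forall_4
    using std alternating_nth[OF a', of 2 1] alternating_nth[OF a', of 3 1]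
      alternating_nth[OF a', of 4 1] alternating_nth[OF a', of 3 2] alternating_nth[OF a', of 4 2]
      alternating_nth[OF a', of 4 3] alternating_diag[OF a']
    by (simp add: matrix_matrix_mult_def transpose_def mat_def sum_4 std_J_nth power2_eq_square field_simps)
  then have "pull P (Q ** matrix_inv g ** Q - s *\<^sub>R Q + ((s\<^sup>2 - form_inner g \<Psi> \<Psi>) / 2) *\<^sub>R g) = pull P 0"
    unfolding pull_add pull_diff pull_scaleR RR iP(2) R_def[symmetric] by (simp add: pull_def)
  then show ?thesis using pull_inj[OF iP(1)] by blast
qed

section \<open>Twistor tensors\<close>

text \<open>The components of a tensor in the basis given by the columns of \<open>P\<close>.\<close>

definition tpull :: "real^4^4 \<Rightarrow> real^4^4^4 \<Rightarrow> real^4^4^4" where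
  "tpull P T = (\<chi> a. \<Sum>i\<in>UNIV. P $ i $ a *\<^sub>R pull P (T $ i))"

text \<open>Up to a constant factor this is the image of \<open>J \<beta>\<close> under the adjoint of the contraction.\<close>

definition twistor_tensor :: "real^4^4 \<Rightarrow> real^4^4 \<Rightarrow> real^4 \<Rightarrow> real^4^4^4" where
  "twistor_tensor g J \<beta> = (\<chi> i. (1/2) *\<^sub>R (wedge \<beta> (J_covector J (g $ i)) - wedge (J_covector J \<beta>) (g $ i))
     - (\<beta> $ i / 2) *\<^sub>R kahler_form g J)"

lemma sum_rotate3: "(\<Sum>i\<in>I. \<Sum>j\<in>J. \<Sum>k\<in>K. f i j k) = (\<Sum>k\<in>K. \<Sum>i\<in>I. \<Sum>j\<in>J. f i j k)"
proof -
  have "(\<Sum>i\<in>I. \<Sum>j\<in>J. \<Sum>k\<in>K. f i j k) = (\<Sum>i\<in>I. \<Sum>k\<in>K. \<Sum>j\<in>J. f i j k)"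
    by (rule sum.cong[OF refl], rule sum.swap)
  also have "\<dots> = (\<Sum>k\<in>K. \<Sum>i\<in>I. \<Sum>j\<in>J. f i j k)" by (rule sum.swap)
  finally show ?thesis .
qed

lemma tpull_tpull: "tpull P (tpull Q T) = tpull (Q ** P) T"
  unfolding tpull_def
  by (simp add: vec_eq_iff[of "\<chi> a. (\<Sum>i\<in>UNIV. _ i a *\<^sub>R _ i)"] pull_sum pull_scaleR pull_pull
      matrix_matrix_mult_def scaleR_sum_left scaleR_sum_right mult.commute) (subst sum.swap, simp add: matrix_matrix_mult_def)

lemma tpull_mat1: "tpull (mat 1) T = T"
  unfolding tpull_def vec_eq_iff[of _ T] pull_mat1 by (simp add: mat_def if_distrib[of "\<lambda>c. c *\<^sub>R _"] cong: if_cong)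

lemma tpull_inverse:
  assumes "invertible P"
  shows "tpull P (tpull (matrix_inv P) T) = T" "tpull (matrix_inv P) (tpull P T) = T"
  using matrix_inv_mult[OF assms] by (simp_all add: tpull_tpull tpull_mat1)

lemma wedge_linear:
  "wedge (u + v) w = wedge u w + wedge v w" "wedge w (u + v) = wedge w u + wedge w v"
  "wedge (c *\<^sub>R u) w = c *\<^sub>R wedge u w" "wedge w (c *\<^sub>R u) = c *\<^sub>R wedge w u"
  "wedge (- u) w = - wedge u w" "wedge w (- u) = - wedge w u" "wedge u u = 0"
  by (simp_all add: wedge_def vec_eq_iff algebra_simps)

lemma wedge_sum: "wedge w (\<Sum>i\<in>I. u i) = (\<Sum>i\<in>I. wedge w (u i))"
  by (induction I rule: infinite_finite_induct) (simp_all add: wedge_linear, simp_all add: wedge_def vec_eq_iff)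

lemma alternating_wedge: "alternating (wedge u v)"
  by (rule alternatingI) (simp add: wedge_def)

lemma pull_wedge: "pull P (wedge u v) = wedge (transpose P *v u) (transpose P *v v)"
proof -
  have "pull P (wedge u v) $ a $ b = (\<Sum>i\<in>UNIV. P $ i $ a * u $ i) * (\<Sum>j\<in>UNIV. P $ j $ b * v $ j)
     - (\<Sum>i\<in>UNIV. P $ i $ b * u $ i) * (\<Sum>j\<in>UNIV. P $ j $ a * v $ j)" for a b
    unfolding pull_component sum_product wedge_def
    by (simp add: right_diff_distrib sum_subtractf) (subst (2) sum.swap, simp add: mult_ac)
  then show ?thesis
    by (simp add: vec_eq_iff wedge_def matrix_vector_mult_def transpose_def del: transpose_matrix_vector)
qed

lemma J_covector_linear:
  "J_covector J (u + v) = J_covector J u + J_covector J v" "J_covector J (c *\<^sub>R u) = c *\<^sub>R J_covector J u"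
  "J_covector J (- u) = - J_covector J u" "J_covector J (u - v) = J_covector J u - J_covector J v"
  "J_covector J 0 = 0"
  by (simp_all add: J_covector_def vec_eq_iff algebra_simps sum.distrib sum_subtractf sum_distrib_left sum_negf)

lemma J_covector_sum: "J_covector J (\<Sum>i\<in>I. u i) = (\<Sum>i\<in>I. J_covector J (u i))"
  by (induction I rule: infinite_finite_induct) (simp_all add: J_covector_linear)

lemma J_covector_pull:
  assumes "J ** P = P ** J'"
  shows "J_covector J' (transpose P *v \<alpha>) = transpose P *v J_covector J \<alpha>"
proof -
  have "transpose J' ** transpose P = transpose P ** transpose J"
    using assms by (metis matrix_transpose_mul)
  then have "transpose J' *v (transpose P *v \<alpha>) = transpose P *v (transpose J *v \<alpha>)"
    unfolding matrix_vector_mul_assoc by simp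
  moreover have "transpose P *v (- w) = - (transpose P *v w)" for w :: "real^4"
    using matrix_vector_mult_scaleR[of "transpose P" "-1" w] by (simp del: transpose_matrix_vector)
  ultimately show ?thesis unfolding J_covector_eq by (simp del: transpose_matrix_vector)
qed

lemma tpull_twistor_tensor:
  assumes "J ** P = P ** J'" "pull P g = g'" "pull P (kahler_form g J) = kahler_form g' J'" "transpose g = g"
  shows "tpull P (twistor_tensor g J \<beta>) = twistor_tensor g' J' (transpose P *v \<beta>)"
proof -
  let ?t = "\<lambda>v. transpose P *v v"
  have row: "(\<Sum>i\<in>UNIV. P $ i $ a *\<^sub>R ?t (g $ i)) = g' $ a" for a
  proof -
    have "(\<Sum>i\<in>UNIV. P $ i $ a *\<^sub>R ?t (g $ i)) $ b = pull P g $ a $ b" for b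
      unfolding pull_component
      by (simp add: matrix_vector_mult_def transpose_def sum_distrib_left mult_ac del: transpose_matrix_vector)
    then show ?thesis using assms(2) by (simp add: vec_eq_iff)
  qed
  have "(\<Sum>i\<in>UNIV. P $ i $ a *\<^sub>R pull P (twistor_tensor g J \<beta> $ i)) = twistor_tensor g' J' (?t \<beta>) $ a" for a
  proof -
    have "P $ i $ a *\<^sub>R pull P (twistor_tensor g J \<beta> $ i) =
      (1/2) *\<^sub>R (wedge (?t \<beta>) (J_covector J' (P $ i $ a *\<^sub>R ?t (g $ i)))
        - wedge (J_covector J' (?t \<beta>)) (P $ i $ a *\<^sub>R ?t (g $ i))) - (P $ i $ a * \<beta> $ i / 2) *\<^sub>R kahler_form g' J'" for i
      unfolding twistor_tensor_def J_covector_linear wedge_linear J_covector_pull[OF assms(1)]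
      by (simp add: pull_diff pull_scaleR pull_wedge assms(3) del: transpose_matrix_vector) (simp add: algebra_simps del: transpose_matrix_vector)
    then have "(\<Sum>i\<in>UNIV. P $ i $ a *\<^sub>R pull P (twistor_tensor g J \<beta> $ i)) =
      (1/2) *\<^sub>R (wedge (?t \<beta>) (J_covector J' (\<Sum>i\<in>UNIV. P $ i $ a *\<^sub>R ?t (g $ i)))
        - wedge (J_covector J' (?t \<beta>)) (\<Sum>i\<in>UNIV. P $ i $ a *\<^sub>R ?t (g $ i)))
      - ((\<Sum>i\<in>UNIV. P $ i $ a * \<beta> $ i) / 2) *\<^sub>R kahler_form g' J'"
      by (simp add: sum_subtractf scaleR_sum_right[symmetric] scaleR_sum_left[symmetric] wedge_sum J_covector_sum sum_divide_distrib[symmetric] del: transpose_matrix_vector)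
    then show ?thesis unfolding row
      by (simp add: twistor_tensor_def matrix_vector_mult_def transpose_def del: transpose_matrix_vector)
  qed
  then show ?thesis by (simp add: tpull_def vec_eq_iff)
qed

lemma contraction_tpull:
  assumes "matrix_inv g = P ** transpose P"
  shows "contraction (mat 1) (tpull P T) = transpose P *v contraction g T"
proof -
  have h: "matrix_inv g $ i $ j = (\<Sum>a\<in>UNIV. P $ i $ a * P $ j $ a)" for i j
    unfolding assms by (simp add: matrix_matrix_mult_def transpose_def)
  have "contraction (mat 1) (tpull P T) $ c = (\<Sum>a\<in>UNIV. tpull P T $ a $ a $ c)" for c
    unfolding contraction_def matrix_inv_mat1
    by (simp add: mat_def if_distrib[of "\<lambda>x. x * _"] cong: if_cong)
  also have "\<dots> c = (\<Sum>a\<in>UNIV. \<Sum>i\<in>UNIV. \<Sum>j\<in>UNIV. \<Sum>k\<in>UNIV. P $ i $ a * P $ j $ a * P $ k $ c * T $ i $ j $ k)" for c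
    by (simp add: tpull_def pull_component sum_distrib_left mult_ac)
  also have "\<dots> c = (\<Sum>k\<in>UNIV. \<Sum>i\<in>UNIV. \<Sum>j\<in>UNIV. \<Sum>a\<in>UNIV. P $ i $ a * P $ j $ a * P $ k $ c * T $ i $ j $ k)" for c
  proof -
    have "(\<Sum>a\<in>UNIV. \<Sum>i\<in>UNIV. \<Sum>j\<in>UNIV. \<Sum>k\<in>UNIV. f a i j k) = (\<Sum>k\<in>UNIV. \<Sum>i\<in>UNIV. \<Sum>j\<in>UNIV. \<Sum>a\<in>UNIV. f a i j k)"
      for f :: "4 \<Rightarrow> 4 \<Rightarrow> 4 \<Rightarrow> 4 \<Rightarrow> real"
    proof -
      have "(\<Sum>a\<in>UNIV. \<Sum>i\<in>UNIV. \<Sum>j\<in>UNIV. \<Sum>k\<in>UNIV. f a i j k) = (\<Sum>a\<in>UNIV. \<Sum>k\<in>UNIV. \<Sum>i\<in>UNIV. \<Sum>j\<in>UNIV. f a i j k)"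
        by (rule sum.cong[OF refl]) (rule sum_rotate3)
      also have "\<dots> = (\<Sum>k\<in>UNIV. \<Sum>a\<in>UNIV. \<Sum>i\<in>UNIV. \<Sum>j\<in>UNIV. f a i j k)" by (rule sum.swap)
      also have "\<dots> = (\<Sum>k\<in>UNIV. \<Sum>i\<in>UNIV. \<Sum>j\<in>UNIV. \<Sum>a\<in>UNIV. f a i j k)"
        by (rule sum.cong[OF refl]) (rule sum_rotate3[symmetric])
      finally show ?thesis .
    qed
    then show ?thesis .
  qed
  also have "\<dots> c = (transpose P *v contraction g T) $ c" for c
    by (simp add: contraction_def h matrix_vector_mult_def transpose_def sum_distrib_left sum_distrib_right mult_ac
        del: transpose_matrix_vector)
  finally show ?thesis by (simp add: vec_eq_iff)
qed

lemma tensor_inner_tpull: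
  assumes "matrix_inv g = P ** transpose P"
    and "\<And>\<phi> \<psi>. form_inner g \<phi> \<psi> = form_inner (mat 1) (pull P \<phi>) (pull P \<psi>)"
  shows "tensor_inner g S T = tensor_inner (mat 1) (tpull P S) (tpull P T)"
proof -
  have h: "matrix_inv g $ i $ j = (\<Sum>a\<in>UNIV. P $ i $ a * P $ j $ a)" for i j
    unfolding assms(1) by (simp add: matrix_matrix_mult_def transpose_def)
  have "tensor_inner (mat 1) (tpull P S) (tpull P T)
     = (\<Sum>a\<in>UNIV. form_inner (mat 1) (tpull P S $ a) (tpull P T $ a))"
    unfolding tensor_inner_def matrix_inv_mat1
    by (simp add: mat_def if_distrib[of "\<lambda>x. x * _"] cong: if_cong)
  also have "\<dots> = (\<Sum>a\<in>UNIV. \<Sum>i\<in>UNIV. \<Sum>j\<in>UNIV. P $ i $ a * P $ j $ a * form_inner g (S $ i) (T $ j))"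
    by (simp add: tpull_def form_inner_sum_left form_inner_sum_right form_inner_scaleR_left form_inner_scaleR_right
        assms(2) sum_distrib_left mult_ac) (simp add: sum_4)
  also have "\<dots> = (\<Sum>i\<in>UNIV. \<Sum>j\<in>UNIV. \<Sum>a\<in>UNIV. P $ i $ a * P $ j $ a * form_inner g (S $ i) (T $ j))"
    by (subst sum.swap, rule sum.cong[OF refl], rule sum.swap)
  also have "\<dots> = tensor_inner g S T"
    by (simp add: tensor_inner_def h sum_distrib_right)
  finally show ?thesis by simp
qed

lemma anti_selfdual_std_cases:
  assumes "anti_selfdual (mat 1) std_J \<Phi>"
  shows "\<Phi> $ 2 $ 1 = - \<Phi> $ 1 $ 2" "\<Phi> $ 3 $ 1 = - \<Phi> $ 1 $ 3" "\<Phi> $ 4 $ 1 = - \<Phi> $ 1 $ 4"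
   "\<Phi> $ 3 $ 2 = \<Phi> $ 1 $ 4" "\<Phi> $ 4 $ 2 = - \<Phi> $ 1 $ 3" "\<Phi> $ 4 $ 3 = \<Phi> $ 1 $ 2"
   "\<Phi> $ 3 $ 4 = - \<Phi> $ 1 $ 2" "\<Phi> $ 2 $ 4 = \<Phi> $ 1 $ 3" "\<Phi> $ 2 $ 3 = - \<Phi> $ 1 $ 4" "\<Phi> $ i $ i = 0"
  using assms[unfolded std_anti_selfdual] alternating_nth[of \<Phi> 2 1] alternating_nth[of \<Phi> 3 1] alternating_nth[of \<Phi> 4 1]
    alternating_nth[of \<Phi> 3 2] alternating_nth[of \<Phi> 4 2] alternating_nth[of \<Phi> 4 3] alternating_diag[of \<Phi> i]
  by simp_all

lemma std_twistor_tensor_nth: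
  "twistor_tensor (mat 1) std_J \<beta> $ i = (1/2) *\<^sub>R (wedge \<beta> (\<chi> k. - std_J $ i $ k)
     - wedge (\<chi> k. \<Sum>l\<in>UNIV. - (\<beta> $ l * std_J $ l $ k)) (axis i 1)) - (\<beta> $ i / 2) *\<^sub>R transpose std_J"
proof -
  have "(mat 1 :: real^4^4) $ i = axis i 1" by (simp add: mat_def axis_def vec_eq_iff)
  moreover have "J_covector std_J (axis i 1) = (\<chi> k. - std_J $ i $ k)"
    by (simp add: J_covector_def axis_def if_distrib[of "\<lambda>x. x * _"] cong: if_cong)
  ultimately show ?thesis
    by (simp add: twistor_tensor_def kahler_form_eq J_covector_def sum_negf)
qed

lemma std_twistor_tensor_asd: "anti_selfdual (mat 1) std_J (twistor_tensor (mat 1) std_J \<beta> $ i)"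
proof -
  have "\<forall>i. anti_selfdual (mat 1) std_J (twistor_tensor (mat 1) std_J \<beta> $ i)"
    unfolding forall_4 std_anti_selfdual std_twistor_tensor_nth
    by (intro conjI alternatingI[unfolded atomize_all forall_4])
      (simp_all add: wedge_def axis_def sum_4 std_J_nth transpose_def field_simps)
  then show ?thesis by blast
qed

lemma std_contraction: "contraction (mat 1) T = (\<chi> k. \<Sum>i\<in>UNIV. T $ i $ i $ k)"
  unfolding contraction_def matrix_inv_mat1
  by (simp add: mat_def if_distrib[of "\<lambda>x. x * _"] cong: if_cong)

lemma std_tensor_inner: "tensor_inner (mat 1) S T = (\<Sum>i\<in>UNIV. form_inner (mat 1) (S $ i) (T $ i))"
  unfolding tensor_inner_def matrix_inv_mat1
  by (simp add: mat_def if_distrib[of "\<lambda>x. x * _"] cong: if_cong)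

lemma std_asd_inner:
  assumes "anti_selfdual (mat 1) std_J S" "anti_selfdual (mat 1) std_J T"
  shows "form_inner (mat 1) S T = 2 * (S $ 1 $ 2 * T $ 1 $ 2 + S $ 1 $ 3 * T $ 1 $ 3 + S $ 1 $ 4 * T $ 1 $ 4)"
  unfolding std_form_inner sum_4 anti_selfdual_std_cases[OF assms(1)] anti_selfdual_std_cases[OF assms(2)]
  by simp

lemma std_twistor_tensor_orthogonal:
  assumes "S \<in> V1 (mat 1) std_J"
  shows "tensor_inner (mat 1) S (twistor_tensor (mat 1) std_J \<beta>) = 0"
proof -
  have S: "anti_selfdual (mat 1) std_J (S $ i)" "contraction (mat 1) S = 0" for i using assms by (auto simp: V1_def)
  note c = anti_selfdual_std_cases[OF S(1)]
  have "\<forall>k. contraction (mat 1) S $ k = 0" using S(2) by simp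
  then have k: "S $ 2 $ 1 $ 2 + S $ 3 $ 1 $ 3 + S $ 4 $ 1 $ 4 = 0" "S $ 1 $ 1 $ 2 + S $ 3 $ 1 $ 4 - S $ 4 $ 1 $ 3 = 0"
     "S $ 1 $ 1 $ 3 - S $ 2 $ 1 $ 4 + S $ 4 $ 1 $ 2 = 0" "S $ 1 $ 1 $ 4 + S $ 2 $ 1 $ 3 - S $ 3 $ 1 $ 2 = 0"
    unfolding forall_4 std_contraction vec_lambda_beta sum_4 c by simp_all
  have "tensor_inner (mat 1) S (twistor_tensor (mat 1) std_J \<beta>) =
     \<beta> $ 1 * (S $ 1 $ 1 $ 2 + S $ 3 $ 1 $ 4 - S $ 4 $ 1 $ 3) + \<beta> $ 2 * (S $ 2 $ 1 $ 2 + S $ 3 $ 1 $ 3 + S $ 4 $ 1 $ 4)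
     + \<beta> $ 3 * (S $ 1 $ 1 $ 4 + S $ 2 $ 1 $ 3 - S $ 3 $ 1 $ 2) + \<beta> $ 4 * (- (S $ 1 $ 1 $ 3 - S $ 2 $ 1 $ 4 + S $ 4 $ 1 $ 2))"
    unfolding std_tensor_inner std_asd_inner[OF S(1) std_twistor_tensor_asd]
    unfolding std_twistor_tensor_nth sum_4
    by (simp add: wedge_def axis_def std_J_nth transpose_def sum_4 field_simps)
  then show ?thesis using k by simp
qed

lemma std_V0: "T \<in> V0 (mat 1) std_J \<longleftrightarrow> (\<exists>\<beta>. T = twistor_tensor (mat 1) std_J \<beta>)"
proof
  assume L: "T \<in> V0 (mat 1) std_J"
  then have T: "anti_selfdual (mat 1) std_J (T $ i)" for i by (simp add: V0_def)
  define C where "C = contraction (mat 1) T"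
  \<comment> \<open>Chosen so that \<open>T\<close> and the twistor tensor of \<open>\<beta>\<close> have the same contraction. Their difference \<open>S\<close>
    lies in \<open>V1\<close>, hence is orthogonal to both of them and to itself.\<close>
  define \<beta> :: "real^4" where "\<beta> = (\<chi> i. (2/3) * (if i = 1 then C $ 2 else if i = 2 then - C $ 1 else if i = 3 then C $ 4 else - C $ 3))"
  have \<beta>: "\<beta> $ 1 = 2/3 * C $ 2" "\<beta> $ 2 = - 2/3 * C $ 1" "\<beta> $ 3 = 2/3 * C $ 4" "\<beta> $ 4 = - 2/3 * C $ 3"
    by (simp_all add: \<beta>_def)
  let ?W = "twistor_tensor (mat 1) std_J \<beta>"
  have cW: "contraction (mat 1) ?W = C"
    unfolding vec_eq_iff forall_4 std_contraction vec_lambda_beta sum_4 std_twistor_tensor_nth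
    by (simp add: wedge_def axis_def std_J_nth transpose_def sum_4 \<beta> field_simps)
  define S where "S = T - ?W"
  have Sasd: "anti_selfdual (mat 1) std_J (S $ i)" for i
  proof -
    have 1: "alternating (T $ i - ?W $ i)"
    proof (rule alternatingI)
      have a: "alternating (T $ i)" "alternating (?W $ i)"
        using T[of i] std_twistor_tensor_asd[of \<beta> i] unfolding std_anti_selfdual by auto
      show "(T $ i - ?W $ i) $ j $ k = - (T $ i - ?W $ i) $ k $ j" for j k
        using alternating_nth[OF a(1), of j k] alternating_nth[OF a(2), of j k] by simp
    qed
    show ?thesis
      using 1 T[of i] std_twistor_tensor_asd[of \<beta> i] unfolding std_anti_selfdual S_def by simp
  qed
  have "contraction (mat 1) S = contraction (mat 1) T - contraction (mat 1) ?W"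
    by (simp add: S_def std_contraction vec_eq_iff sum_subtractf)
  then have SV: "S \<in> V1 (mat 1) std_J" using Sasd cW C_def by (simp add: V1_def)
  have "tensor_inner (mat 1) S S = tensor_inner (mat 1) S T - tensor_inner (mat 1) S ?W"
    unfolding std_tensor_inner std_form_inner
    by (simp add: S_def right_diff_distrib sum_subtractf diff_divide_distrib)
  also have "\<dots> = 0" using L SV std_twistor_tensor_orthogonal[OF SV] by (simp add: V0_def)
  finally have "(\<Sum>i\<in>UNIV. 2 * ((S $ i $ 1 $ 2)\<^sup>2 + (S $ i $ 1 $ 3)\<^sup>2 + (S $ i $ 1 $ 4)\<^sup>2)) = 0"
    unfolding std_tensor_inner std_asd_inner[OF Sasd Sasd] power2_eq_square .
  then have "\<forall>i\<in>UNIV. 2 * ((S $ i $ 1 $ 2)\<^sup>2 + (S $ i $ 1 $ 3)\<^sup>2 + (S $ i $ 1 $ 4)\<^sup>2) = 0"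
    by (subst (asm) sum_nonneg_eq_0_iff) auto
  then have "(S $ i $ 1 $ 2)\<^sup>2 + (S $ i $ 1 $ 3)\<^sup>2 + (S $ i $ 1 $ 4)\<^sup>2 = 0" for i
    by (metis UNIV_I mult_eq_0_iff zero_neq_numeral)
  then have z: "S $ i $ 1 $ 2 = 0 \<and> S $ i $ 1 $ 3 = 0 \<and> S $ i $ 1 $ 4 = 0" for i
    by (smt (verit) zero_le_power2 zero_eq_power2)
  have "S = 0"
    unfolding vec_eq_iff[of S] vec_eq_iff[of "S $ _"] vec_eq_iff[of "S $ _ $ _"] forall_4
    using z anti_selfdual_std_cases[OF Sasd] by simp
  then show "\<exists>\<beta>. T = twistor_tensor (mat 1) std_J \<beta>" by (auto simp: S_def)
next
  assume "\<exists>\<beta>. T = twistor_tensor (mat 1) std_J \<beta>"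
  then show "T \<in> V0 (mat 1) std_J"
    using std_twistor_tensor_orthogonal std_twistor_tensor_asd by (auto simp: V0_def)
qed

lemma tpull_asd:
  assumes P: "frame g J P" and g: "hermitian g J"
  shows "(\<forall>i. anti_selfdual g J (T $ i)) \<longleftrightarrow> (\<forall>i. anti_selfdual (mat 1) std_J (tpull P T $ i))"
proof -
  have iP: "invertible P" using P by (simp add: frame_def)
  have lin: "anti_selfdual (mat 1) std_J (\<Sum>i\<in>UNIV. c i *\<^sub>R B i)"
    if "\<And>i. anti_selfdual (mat 1) std_J (B i)" for c :: "4 \<Rightarrow> real" and B
  proof -
    have "alternating (\<Sum>i\<in>UNIV. c i *\<^sub>R B i)"
    proof (rule alternatingI)
      fix j k
      have "B i $ j $ k = - B i $ k $ j" for i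
        using that[of i] unfolding std_anti_selfdual by (metis alternating_nth)
      then show "(\<Sum>i\<in>UNIV. c i *\<^sub>R B i) $ j $ k = - (\<Sum>i\<in>UNIV. c i *\<^sub>R B i) $ k $ j"
        by (simp add: sum_negf[symmetric])
    qed
    then show ?thesis using that unfolding std_anti_selfdual by (simp add: sum_negf[symmetric])
  qed
  show ?thesis
  proof
    assume "\<forall>i. anti_selfdual g J (T $ i)"
    then show "\<forall>i. anti_selfdual (mat 1) std_J (tpull P T $ i)"
      unfolding frame_anti_selfdual[OF P g] by (auto simp: tpull_def intro!: lin)
  next
    let ?Q = "matrix_inv P"
    assume R: "\<forall>i. anti_selfdual (mat 1) std_J (tpull P T $ i)"
    have "pull P (T $ i) = (\<Sum>a\<in>UNIV. ?Q $ a $ i *\<^sub>R tpull P T $ a)" for i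
    proof -
      have "T $ i = (\<Sum>a\<in>UNIV. ?Q $ a $ i *\<^sub>R pull ?Q (tpull P T $ a))"
        using tpull_inverse(2)[OF iP, of T] by (metis (no_types, lifting) sum.cong tpull_def vec_lambda_beta)
      then have "pull P (T $ i) = pull P (\<Sum>a\<in>UNIV. ?Q $ a $ i *\<^sub>R pull ?Q (tpull P T $ a))" by simp
      then show ?thesis by (simp add: pull_sum pull_scaleR pull_inverse[OF iP])
    qed
    then show "\<forall>i. anti_selfdual g J (T $ i)"
      unfolding frame_anti_selfdual[OF P g] using lin R by simp
  qed
qed

text \<open>The space \<open>V1\<close> is the kernel of the contraction, so its complement is the image of the adjoint map.
  The computation takes place in a unitary frame.\<close>

lemma V0_iff:
  assumes g: "hermitian g J"
  shows "T \<in> V0 g J \<longleftrightarrow> (\<exists>\<beta>. T = twistor_tensor g J \<beta>)"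
proof -
  note h = hermitianD[OF g]
  obtain P where P: "frame g J P" using frame_exists[OF g] .
  have iP: "invertible P" "pull P g = mat 1" "J ** P = P ** std_J" using P by (auto simp: frame_def)
  let ?Q = "matrix_inv P"
  have tQ: "transpose P *v v = 0 \<longleftrightarrow> v = 0" "transpose P *v (transpose ?Q *v v) = v" for v :: "real^4"
  proof -
    have 1: "transpose P ** transpose ?Q = mat 1" "transpose ?Q ** transpose P = mat 1"
      using matrix_inv_mult[OF iP(1)] by (metis matrix_transpose_mul transpose_mat)+
    show "transpose P *v (transpose ?Q *v v) = v" unfolding matrix_vector_mul_assoc 1 by simp
    show "transpose P *v v = 0 \<longleftrightarrow> v = 0"
      using 1(2) by (metis matrix_vector_mul_assoc matrix_vector_mul_lid matrix_vector_mult_0_right)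
  qed
  have V1: "S \<in> V1 g J \<longleftrightarrow> tpull P S \<in> V1 (mat 1) std_J" for S
    unfolding V1_def mem_Collect_eq tpull_asd[OF P g] contraction_tpull[OF frame_inv[OF P h(2,3)]] tQ(1) ..
  have V0: "T \<in> V0 g J \<longleftrightarrow> tpull P T \<in> V0 (mat 1) std_J"
  proof -
    have "(\<forall>S\<in>V1 g J. tensor_inner g S T = 0) \<longleftrightarrow> (\<forall>S\<in>V1 (mat 1) std_J. tensor_inner (mat 1) S (tpull P T) = 0)"
      unfolding tensor_inner_tpull[OF frame_inv[OF P h(2,3)] frame_form_inner[OF P h(2,3)]]
      using V1 tpull_inverse(1)[OF iP(1)] by metis
    then show ?thesis unfolding V0_def mem_Collect_eq tpull_asd[OF P g] by simp
  qed
  have tw: "tpull P (twistor_tensor g J \<beta>) = twistor_tensor (mat 1) std_J (transpose P *v \<beta>)" for \<beta>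
    by (rule tpull_twistor_tensor[OF iP(3,2) frame_kahler[OF P h(2,3)] h(2)])
  show ?thesis
  proof
    assume "T \<in> V0 g J"
    then obtain \<beta> where "tpull P T = twistor_tensor (mat 1) std_J \<beta>" using V0 std_V0 by blast
    then have "tpull P T = tpull P (twistor_tensor g J (transpose ?Q *v \<beta>))" unfolding tw tQ(2) .
    then show "\<exists>\<beta>. T = twistor_tensor g J \<beta>" using tpull_inverse(2)[OF iP(1)] by metis
  qed (use V0 std_V0 tw in blast)
qed

text \<open>The alternation of the twistor tensor of \<open>\<beta>\<close> is \<open>- 3/2 \<beta> \<and> \<omega>\<close>, and the wedge product with \<open>\<omega>\<close>
  is injective on covectors.\<close>

lemma twistor_tensor_alternation:
  assumes g: "hermitian g J" and \<omega>: "\<omega> = kahler_form g J"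
    and eq: "\<And>i j k. (twistor_tensor g J \<beta> $ i + (3/2 * s $ i) *\<^sub>R \<omega>) $ j $ k
      + (twistor_tensor g J \<beta> $ j + (3/2 * s $ j) *\<^sub>R \<omega>) $ k $ i
      + (twistor_tensor g J \<beta> $ k + (3/2 * s $ k) *\<^sub>R \<omega>) $ i $ j = 0"
  shows "\<beta> = s"
proof -
  note h = hermitianD[OF g]
  obtain P where P: "frame g J P" using frame_exists[OF g] .
  have iP: "invertible P" "pull P g = mat 1" "J ** P = P ** std_J" using P by (auto simp: frame_def)
  let ?t = "\<lambda>v. transpose P *v v" and ?W = "twistor_tensor g J \<beta>" and ?o = "kahler_form (mat 1) std_J"
  define T where "T = (\<chi> i. ?W $ i + (3/2 * s $ i) *\<^sub>R \<omega>)"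
  have TT: "tpull P T = (\<chi> i. twistor_tensor (mat 1) std_J (?t \<beta>) $ i + (3/2 * ?t s $ i) *\<^sub>R ?o)"
  proof -
    have "P $ i $ a *\<^sub>R pull P (T $ i) = P $ i $ a *\<^sub>R pull P (?W $ i) + (3/2 * (P $ i $ a * s $ i)) *\<^sub>R ?o" for i a
      by (simp add: T_def pull_add pull_scaleR \<omega> frame_kahler[OF P h(2,3)] scaleR_add_right)
    then have "tpull P T $ a = tpull P ?W $ a + (3/2 * ?t s $ a) *\<^sub>R ?o" for a
      by (simp add: tpull_def sum.distrib scaleR_sum_left[symmetric] sum_distrib_left
        matrix_vector_mult_def transpose_def sum_divide_distrib del: transpose_matrix_vector)
    then show ?thesis
      unfolding tpull_twistor_tensor[OF iP(3,2) frame_kahler[OF P h(2,3)] h(2)] by (simp add: vec_eq_iff del: transpose_matrix_vector)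
  qed
  have eqT: "T $ i $ j $ k + T $ j $ k $ i + T $ k $ i $ j = 0" for i j k using eq[of i j k] by (simp add: T_def)
  have comp: "tpull P T $ a $ b $ c = (\<Sum>i\<in>UNIV. \<Sum>j\<in>UNIV. \<Sum>k\<in>UNIV. P $ i $ a * P $ j $ b * P $ k $ c * T $ i $ j $ k)" for a b c
    by (simp add: tpull_def pull_component sum_distrib_left mult_ac)
  have "tpull P T $ a $ b $ c + tpull P T $ b $ c $ a + tpull P T $ c $ a $ b
     = (\<Sum>i\<in>UNIV. \<Sum>j\<in>UNIV. \<Sum>k\<in>UNIV. P $ i $ a * P $ j $ b * P $ k $ c * (T $ i $ j $ k + T $ j $ k $ i + T $ k $ i $ j))" for a b c
  proof -
    have "tpull P T $ b $ c $ a = (\<Sum>i\<in>UNIV. \<Sum>j\<in>UNIV. \<Sum>k\<in>UNIV. P $ i $ a * P $ j $ b * P $ k $ c * T $ j $ k $ i)"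
      unfolding comp by (subst sum_rotate3) (simp add: mult_ac)
    moreover have "tpull P T $ c $ a $ b = (\<Sum>i\<in>UNIV. \<Sum>j\<in>UNIV. \<Sum>k\<in>UNIV. P $ i $ a * P $ j $ b * P $ k $ c * T $ k $ i $ j)"
      unfolding comp by (subst (2) sum_rotate3) (simp add: mult_ac)
    ultimately show ?thesis unfolding comp[of a b c] by (simp add: distrib_left sum.distrib)
  qed
  then have z: "tpull P T $ a $ b $ c + tpull P T $ b $ c $ a + tpull P T $ c $ a $ b = 0" for a b c
    by (simp add: eqT)
  have "?t \<beta> = ?t s"
    unfolding vec_eq_iff forall_4
    using z[of 1 3 4] z[of 2 3 4] z[of 1 2 3] z[of 1 2 4]
    unfolding TT vec_lambda_beta vector_add_component std_twistor_tensor_nth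
    by (simp add: wedge_def axis_def std_J_nth std_kahler_nth transpose_def sum_4 field_simps del: transpose_matrix_vector)
  then have "transpose (matrix_inv P) *v ?t \<beta> = transpose (matrix_inv P) *v ?t s" by simp
  moreover have "transpose (matrix_inv P) ** transpose P = mat 1"
    using matrix_inv_mult(2)[OF iP(1)] by (metis matrix_transpose_mul transpose_mat)
  ultimately show "\<beta> = s" unfolding matrix_vector_mul_assoc by simp
qed

section \<open>The Levi-Civita connection in a chart\<close>

lemma bounded_bilinear_matrix: "bounded_bilinear ((**) :: real^4^4 \<Rightarrow> real^4^4 \<Rightarrow> real^4^4)"
  unfolding bilinear_conv_bounded_bilinear[symmetric] bilinear_def
  by (auto intro!: linearI simp: matrix_add_ldistrib vec_eq_iff matrix_matrix_mult_def algebra_simps sum.distrib sum_distrib_left)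

lemma bounded_bilinear_matrix_vector: "bounded_bilinear ((*v) :: real^4^4 \<Rightarrow> real^4 \<Rightarrow> real^4)"
  unfolding bilinear_conv_bounded_bilinear[symmetric] bilinear_def
  by (auto intro!: linearI simp: vec_eq_iff matrix_vector_mult_def algebra_simps sum.distrib sum_distrib_left)

lemma bounded_linear_transpose: "bounded_linear (transpose :: real^4^4 \<Rightarrow> real^4^4)"
  unfolding linear_conv_bounded_linear[symmetric]
  by (rule linearI) (auto simp: vec_eq_iff transpose_def)

lemma bounded_bilinear_wedge: "bounded_bilinear wedge"
  unfolding bilinear_conv_bounded_bilinear[symmetric] bilinear_def
  by (auto intro!: linearI simp: wedge_linear)

lemma bounded_linear_trace: "bounded_linear (trace :: real^4^4 \<Rightarrow> real)"
  unfolding linear_conv_bounded_linear[symmetric]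
  by (rule linearI) (auto simp: trace_def sum.distrib sum_distrib_left)

interpretation mm: bounded_bilinear "(**) :: real^4^4 \<Rightarrow> real^4^4 \<Rightarrow> real^4^4"
  by (rule bounded_bilinear_matrix)
interpretation mv: bounded_bilinear "(*v) :: real^4^4 \<Rightarrow> real^4 \<Rightarrow> real^4"
  by (rule bounded_bilinear_matrix_vector)
lemmas tr_add = linear_add[OF bounded_linear.linear, OF bounded_linear_transpose]
lemmas tr_diff = linear_diff[OF bounded_linear.linear, OF bounded_linear_transpose]
lemmas tr_minus = linear_neg[OF bounded_linear.linear, OF bounded_linear_transpose]
lemmas trc_add = linear_add[OF bounded_linear.linear, OF bounded_linear_trace]
lemmas trc_diff = linear_diff[OF bounded_linear.linear, OF bounded_linear_trace]

lemmas dd_mm = dd_bilinear[OF bounded_bilinear_matrix]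
lemmas dd_mv = dd_bilinear[OF bounded_bilinear_matrix_vector]
lemmas dd_transpose = dd_linear[OF bounded_linear_transpose]
lemmas dd_wedge = dd_bilinear[OF bounded_bilinear_wedge]
lemmas smooth_on_mm [smooth_intros] = smooth_on_bilinear[OF bounded_bilinear_matrix]
lemmas smooth_on_mv [smooth_intros] = smooth_on_bilinear[OF bounded_bilinear_matrix_vector]
lemmas smooth_on_transpose [smooth_intros] = smooth_on_linear[OF bounded_linear_transpose]
lemmas smooth_on_wedge [smooth_intros] = smooth_on_bilinear[OF bounded_bilinear_wedge]
lemmas smooth_on_trace [smooth_intros] = smooth_on_linear[OF bounded_linear_trace]

lemma smooth_on_J_covector [smooth_intros]:
  assumes "open S" "smooth_on S J" "smooth_on S \<alpha>"
  shows "smooth_on S (\<lambda>x. J_covector (J x) (\<alpha> x))"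
  unfolding J_covector_eq by (intro smooth_intros assms)

lemma smooth_on_kahler_form [smooth_intros]:
  assumes "open S" "smooth_on S g" "smooth_on S J"
  shows "smooth_on S (\<lambda>x. kahler_form (g x) (J x))"
  unfolding kahler_form_eq by (intro smooth_intros assms)

lemma smooth_on_det:
  fixes B :: "_ \<Rightarrow> real^4^4"
  assumes "open S" "smooth_on S B"
  shows "smooth_on S (\<lambda>x. det (B x))"
  unfolding det_def by (intro smooth_intros assms)

lemma matrix_inv_cramer:
  fixes B :: "real^4^4"
  assumes "invertible B"
  shows "matrix_inv B $ i $ j = det (\<chi> r c. if c = i then axis j 1 $ r else B $ r $ c) / det B"
proof -
  have "B *v (matrix_inv B *v axis j 1) = axis j 1"
    by (simp add: matrix_vector_mul_assoc matrix_inv_mult[OF assms])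
  moreover have "det B \<noteq> 0" using assms invertible_det_nz by blast
  ultimately have "matrix_inv B *v axis j 1 = (\<chi> k. det (\<chi> r c. if c = k then axis j 1 $ r else B $ r $ c) / det B)"
    using cramer by blast
  then have "(matrix_inv B *v axis j 1) $ i = det (\<chi> r c. if c = i then axis j 1 $ r else B $ r $ c) / det B"
    by simp
  then show ?thesis by (simp add: matrix_vector_mul_component inner_axis)
qed

text \<open>By Cramer's rule the entries of the inverse are quotients of polynomials in the entries.\<close>

lemma smooth_on_matrix_inv [smooth_intros]:
  fixes B :: "_ \<Rightarrow> real^4^4"
  assumes "open S" "smooth_on S B" "\<And>x. x \<in> S \<Longrightarrow> invertible (B x)"
  shows "smooth_on S (\<lambda>x. matrix_inv (B x))"
  unfolding smooth_on_vec_iff[OF assms(1)]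
proof (intro allI)
  fix i j :: 4
  have "smooth_on S (\<lambda>x. \<chi> r c. if c = i then axis j 1 $ r else B x $ r $ c)"
  proof (intro smooth_on_vec assms(1))
    show "smooth_on S (\<lambda>x. if c = i then axis j 1 $ r else B x $ r $ c)" for r c
      by (cases "c = i") (auto intro!: smooth_intros assms)
  qed
  then have "smooth_on S (\<lambda>x. det (\<chi> r c. if c = i then axis j 1 $ r else B x $ r $ c) / det (B x))"
    using assms(3) invertible_det_nz by (intro smooth_on_divide smooth_on_det assms(1,2)) auto
  then show "smooth_on S (\<lambda>x. matrix_inv (B x) $ i $ j)"
    by (rule smooth_on_cong[OF assms(1), rotated]) (simp add: matrix_inv_cramer[OF assms(3)])
qed

text \<open>The components of the metric and of the complex structure in one chart with image \<open>S\<close>. All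
  differential geometry below takes place in such a chart.\<close>

locale hermitian_chart =
  fixes S :: "(real^4) set" and g J :: "real^4 \<Rightarrow> real^4^4"
  assumes open_S: "open S" and smooth_g: "smooth_on S g" and smooth_J: "smooth_on S J"
    and herm: "\<And>x. x \<in> S \<Longrightarrow> hermitian (g x) (J x)"
begin

abbreviation h :: "real^4 \<Rightarrow> real^4^4" where "h x \<equiv> matrix_inv (g x)"
abbreviation Jc :: "real^4 \<Rightarrow> real^4 \<Rightarrow> real^4" where "Jc x \<equiv> J_covector (J x)"
abbreviation \<omega> :: "real^4 \<Rightarrow> real^4^4" where "\<omega> x \<equiv> kahler_form (g x) (J x)"

text \<open>The connection matrix \<open>\<Gamma> i\<close> and the covariant derivatives \<open>nF i\<close> and \<open>nC i\<close> of bilinear forms and of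
  covectors in the i-th coordinate direction.\<close>

definition \<Gamma> :: "4 \<Rightarrow> real^4 \<Rightarrow> real^4^4" where "\<Gamma> i x = (\<chi> k j. christoffel g k i j x)"

definition nF :: "4 \<Rightarrow> (real^4 \<Rightarrow> real^4^4) \<Rightarrow> real^4 \<Rightarrow> real^4^4" where
  "nF i B x = dd i B x - transpose (\<Gamma> i x) ** B x - B x ** \<Gamma> i x"

definition nC :: "4 \<Rightarrow> (real^4 \<Rightarrow> real^4) \<Rightarrow> real^4 \<Rightarrow> real^4" where
  "nC i \<alpha> x = dd i \<alpha> x - transpose (\<Gamma> i x) *v \<alpha> x"

definition hess :: "(real^4 \<Rightarrow> real) \<Rightarrow> real^4 \<Rightarrow> real^4^4" where
  "hess f x = (\<chi> i. nC i (differential f) x)"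

lemma diffble: "smooth_on S f \<Longrightarrow> x \<in> S \<Longrightarrow> f differentiable (at x)"
  by (rule smooth_on_differentiable)

lemma at_point:
  assumes "x \<in> S"
  shows "transpose (g x) = g x" "invertible (g x)" "J x ** J x = - mat 1" "transpose (J x) ** g x ** J x = g x"
    "transpose (h x) = h x" "h x ** g x = mat 1" "g x ** h x = mat 1" "pos_def (g x)"
  using hermitianD[OF herm[OF assms]] pos_def_inv_sym matrix_inv_mult by auto

lemma g_J: "x \<in> S \<Longrightarrow> g x ** J x = - (transpose (J x) ** g x)"
proof -
  assume x: "x \<in> S"
  have "transpose (J x) ** g x ** (J x ** J x) = g x ** J x"
    unfolding matrix_mul_assoc at_point(4)[OF x] ..
  then show ?thesis unfolding at_point(3)[OF x] by (simp add: mm.minus_right)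
qed

lemma J_h: "x \<in> S \<Longrightarrow> J x ** h x = - (h x ** transpose (J x))"
proof -
  assume x: "x \<in> S"
  have "J x ** h x = h x ** (g x ** J x) ** h x"
    by (simp add: matrix_mul_assoc at_point[OF x])
  also have "\<dots> = - (h x ** transpose (J x) ** (g x ** h x))"
    unfolding g_J[OF x] by (simp add: mm.minus_left mm.minus_right matrix_mul_assoc)
  finally show ?thesis by (simp add: at_point[OF x])
qed

lemma smooth_h: "smooth_on S h"
  using at_point(2) by (intro smooth_intros open_S smooth_g)

lemma Jc_Jc: "x \<in> S \<Longrightarrow> Jc x (Jc x \<alpha>) = - \<alpha>"
proof -
  assume x: "x \<in> S"
  have "transpose (J x) ** transpose (J x) = - mat 1"
    using at_point(3)[OF x] by (metis matrix_transpose_mul tr_minus transpose_mat)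
  then show ?thesis
    unfolding J_covector_eq by (simp add: mv.minus_right matrix_vector_mul_assoc mv.minus_left del: transpose_matrix_vector)
qed

lemma inner_h_sym: "x \<in> S \<Longrightarrow> \<alpha> \<bullet> (h x *v \<beta>) = \<beta> \<bullet> (h x *v \<alpha>)"
  using at_point(5) by (metis dot_lmul_matrix inner_commute transpose_matrix_vector)

lemma h_Jc: "x \<in> S \<Longrightarrow> h x *v Jc x \<alpha> = J x *v (h x *v \<alpha>)"
  unfolding J_covector_eq
  by (simp add: mv.minus_right matrix_vector_mul_assoc J_h mv.minus_left del: transpose_matrix_vector)

lemma inner_Jc: "\<alpha> \<bullet> (J x *v v) = - (Jc x \<alpha> \<bullet> v)"
  unfolding J_covector_eq by (simp add: dot_lmul_matrix)

lemma inner_Jc_Jc: "x \<in> S \<Longrightarrow> Jc x \<alpha> \<bullet> (h x *v Jc x \<beta>) = \<alpha> \<bullet> (h x *v \<beta>)"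
  by (simp add: h_Jc inner_Jc Jc_Jc)

lemma inner_Jc_self: "x \<in> S \<Longrightarrow> \<alpha> \<bullet> (h x *v Jc x \<alpha>) = 0"
  using inner_h_sym[of x \<alpha> "Jc x \<alpha>"] by (simp add: h_Jc inner_Jc)

lemma dd_g_entry:
  assumes x: "x \<in> S"
  shows "pd i (\<lambda>y. g y $ j $ k) x = dd i g x $ j $ k"
proof -
  have 1: "dd i (\<lambda>y. g y $ j $ k) x = dd i (\<lambda>y. g y $ j) x $ k"
    using diffble[OF _ x] by (intro dd_nth) (auto intro!: smooth_intros open_S smooth_g)
  have 2: "dd i (\<lambda>y. g y $ j) x = dd i g x $ j"
    using diffble[OF _ x] by (intro dd_nth) (auto intro!: smooth_intros open_S smooth_g)
  show ?thesis unfolding pd_eq_dd 1 2 ..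
qed

lemma pd_entry:
  assumes x: "x \<in> S" and B: "smooth_on S B"
  shows "pd i (\<lambda>y. B y $ j $ k :: real) x = dd i B x $ j $ k"
proof -
  have 1: "dd i (\<lambda>y. B y $ j $ k) x = dd i (\<lambda>y. B y $ j) x $ k"
    using diffble[OF _ x] by (intro dd_nth) (auto intro!: smooth_intros open_S B)
  have 2: "dd i (\<lambda>y. B y $ j) x = dd i B x $ j"
    using diffble[OF _ x] by (intro dd_nth) (auto intro!: smooth_intros open_S B)
  show ?thesis unfolding pd_eq_dd 1 2 ..
qed

lemma dd_g_sym: "x \<in> S \<Longrightarrow> dd i g x $ j $ k = dd i g x $ k $ j"
proof -
  assume x: "x \<in> S"
  have "dd i g x = dd i (\<lambda>y. transpose (g y)) x"
    by (rule dd_cong[OF open_S x]) (simp add: at_point)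
  also have "\<dots> = transpose (dd i g x)" by (rule dd_transpose[OF diffble[OF smooth_g x]])
  finally have "dd i g x $ j $ k = transpose (dd i g x) $ j $ k" by simp
  then show ?thesis by (simp add: transpose_def)
qed

lemma torsion_free: "x \<in> S \<Longrightarrow> \<Gamma> i x $ k $ j = \<Gamma> j x $ k $ i"
  by (simp add: \<Gamma>_def christoffel_def dd_g_entry dd_g_sym[of x _ i j] add_ac)

lemma lowered_christoffel:
  assumes x: "x \<in> S"
  shows "(g x ** \<Gamma> i x) $ k $ j = (dd i g x $ j $ k + dd j g x $ i $ k - dd k g x $ i $ j) / 2"
proof -
  define v where "v = (\<chi> l. (dd i g x $ j $ l + dd j g x $ i $ l - dd l g x $ i $ j) / 2)"
  have "\<Gamma> i x $ m $ j = (h x *v v) $ m" for m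
    by (simp add: \<Gamma>_def christoffel_def dd_g_entry[OF x] v_def matrix_vector_mult_def sum_distrib_left)
  then have "(g x ** \<Gamma> i x) $ k $ j = (g x *v (h x *v v)) $ k"
    by (simp add: matrix_matrix_mult_def matrix_vector_mult_def)
  also have "\<dots> = v $ k" by (simp add: matrix_vector_mul_assoc at_point[OF x])
  finally show ?thesis by (simp add: v_def)
qed

lemma dd_g: "x \<in> S \<Longrightarrow> dd i g x = transpose (\<Gamma> i x) ** g x + g x ** \<Gamma> i x"
proof -
  assume x: "x \<in> S"
  have "transpose (\<Gamma> i x) ** g x = transpose (g x ** \<Gamma> i x)"
    using at_point(1)[OF x] by (simp add: matrix_transpose_mul)
  then have "(transpose (\<Gamma> i x) ** g x) $ j $ k = (g x ** \<Gamma> i x) $ k $ j" for j k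
    by (simp add: transpose_def)
  then show ?thesis
    by (simp add: vec_eq_iff lowered_christoffel[OF x] dd_g_sym[OF x, of _ i] dd_g_sym[OF x, of i])
       (simp add: dd_g_sym[OF x] field_simps)
qed

lemma dd_h:
  assumes x: "x \<in> S"
  shows "dd i h x = - (\<Gamma> i x ** h x + h x ** transpose (\<Gamma> i x))"
proof -
  have "dd i (\<lambda>y. h y ** g y) x = dd i (\<lambda>y. mat 1) x"
    by (rule dd_cong[OF open_S x]) (simp add: at_point)
  then have "dd i h x ** g x + h x ** dd i g x = 0"
    using dd_mm[OF diffble[OF smooth_h x] diffble[OF smooth_g x]] by (simp add: dd_const)
  then have "dd i h x ** g x = - (h x ** dd i g x)" by (simp add: eq_neg_iff_add_eq_0)
  then have "dd i h x ** (g x ** h x) = - (h x ** dd i g x) ** h x" by (simp add: matrix_mul_assoc)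
  then have "dd i h x = - (h x ** dd i g x ** h x)" by (simp add: at_point[OF x] mm.minus_left)
  also have "\<dots> = - (h x ** transpose (\<Gamma> i x) ** (g x ** h x) + h x ** g x ** \<Gamma> i x ** h x)"
    unfolding dd_g[OF x] by (simp add: mm.add_left mm.add_right matrix_mul_assoc)
  finally show ?thesis by (simp add: at_point[OF x] add.commute)
qed

lemma nabla_endo_nth:
  assumes x: "x \<in> S"
  shows "nabla_endo g J x $ i = dd i J x + \<Gamma> i x ** J x - J x ** \<Gamma> i x"
  by (simp add: vec_eq_iff nabla_endo_def pd_entry[OF x smooth_J] matrix_matrix_mult_def \<Gamma>_def mult.commute)

text \<open>Lowering an index gives a condition without the inverse metric.\<close>

lemma parallel_iff_lowered:
  assumes x: "x \<in> S"
  shows "nabla_endo g J x = 0 \<longleftrightarrow>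
    (\<forall>i. g x ** dd i J x + (g x ** \<Gamma> i x) ** J x + transpose (J x) ** (g x ** \<Gamma> i x) = 0)"
proof -
  have "g x ** dd i J x + (g x ** \<Gamma> i x) ** J x + transpose (J x) ** (g x ** \<Gamma> i x) = g x ** nabla_endo g J x $ i" for i
  proof -
    have "g x ** (J x ** \<Gamma> i x) = - (transpose (J x) ** (g x ** \<Gamma> i x))"
      unfolding matrix_mul_assoc g_J[OF x] by (simp add: mm.minus_left)
    then show ?thesis
      unfolding nabla_endo_nth[OF x] by (simp add: mm.add_right mm.diff_right matrix_mul_assoc)
  qed
  moreover have "g x ** B = 0 \<longleftrightarrow> B = 0" for B :: "real^4^4"
  proof
    assume "g x ** B = 0"
    then have "h x ** (g x ** B) = 0" by simp
    then show "B = 0" by (simp add: matrix_mul_assoc at_point(6)[OF x])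
  qed simp
  ultimately show ?thesis by (simp add: vec_eq_iff[of "nabla_endo g J x"])
qed

end

locale kahler_chart = hermitian_chart S g J
  for S :: "(real^4) set" and g J :: "real^4 \<Rightarrow> real^4^4" +
  assumes parallel_J: "\<And>x. x \<in> S \<Longrightarrow> nabla_endo g J x = 0"
begin

lemma dd_J:
  assumes x: "x \<in> S"
  shows "dd i J x = J x ** \<Gamma> i x - \<Gamma> i x ** J x"
proof -
  have "dd i J x + \<Gamma> i x ** J x - J x ** \<Gamma> i x = 0"
    using parallel_J[OF x] nabla_endo_nth[OF x, of i] by simp
  then show ?thesis by (simp add: eq_diff_eq)
qed

lemma nabla_form_eq: "x \<in> S \<Longrightarrow> smooth_on S \<phi> \<Longrightarrow> nabla_form g \<phi> x $ i = nF i \<phi> x"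
  by (simp add: vec_eq_iff nF_def nabla_form_def pd_entry matrix_matrix_mult_def \<Gamma>_def transpose_def mult.commute)

lemma nF_add:
  assumes "x \<in> S" "smooth_on S A" "smooth_on S B"
  shows "nF i (\<lambda>x. A x + B x) x = nF i A x + nF i B x"
  unfolding nF_def dd_add[OF diffble diffble, OF assms(2,1) assms(3,1)]
  by (simp add: mm.add_left mm.add_right)

lemma nF_scaleR:
  assumes "x \<in> S" "smooth_on S f" "smooth_on S B"
  shows "nF i (\<lambda>x. f x *\<^sub>R B x) x = dd i f x *\<^sub>R B x + f x *\<^sub>R nF i B x"
  unfolding nF_def dd_scaleR[OF diffble diffble, OF assms(2,1) assms(3,1)]
  by (simp add: mm.scaleR_left mm.scaleR_right algebra_simps)

lemma nF_cong: "x \<in> S \<Longrightarrow> (\<And>y. y \<in> S \<Longrightarrow> A y = B y) \<Longrightarrow> nF i A x = nF i B x"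
  unfolding nF_def using dd_cong[OF open_S, of x A B] by simp

lemma nC_cong: "x \<in> S \<Longrightarrow> (\<And>y. y \<in> S \<Longrightarrow> A y = B y) \<Longrightarrow> nC i A x = nC i B x"
  unfolding nC_def using dd_cong[OF open_S, of x A B] by simp

lemma nC_add:
  assumes "x \<in> S" "smooth_on S \<alpha>" "smooth_on S \<beta>"
  shows "nC i (\<lambda>x. \<alpha> x + \<beta> x) x = nC i \<alpha> x + nC i \<beta> x"
  unfolding nC_def dd_add[OF diffble diffble, OF assms(2,1) assms(3,1)]
  by (simp add: mv.add_right)

lemma nC_scaleR:
  assumes "x \<in> S" "smooth_on S f" "smooth_on S \<alpha>"
  shows "nC i (\<lambda>x. f x *\<^sub>R \<alpha> x) x = dd i f x *\<^sub>R \<alpha> x + f x *\<^sub>R nC i \<alpha> x"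
  unfolding nC_def dd_scaleR[OF diffble diffble, OF assms(2,1) assms(3,1)]
  by (simp add: mv.scaleR_right algebra_simps del: transpose_matrix_vector)

lemma nF_g: "x \<in> S \<Longrightarrow> nF i g x = 0"
  by (simp add: nF_def dd_g)

lemma nF_J_mult:
  assumes x: "x \<in> S" and B: "smooth_on S B"
  shows "nF i (\<lambda>x. transpose (J x) ** B x) x = transpose (J x) ** nF i B x"
proof -
  have "smooth_on S (\<lambda>x. transpose (J x))" by (intro smooth_intros open_S smooth_J)
  note d = dd_mm[OF diffble[OF this x] diffble[OF B x], of i] dd_transpose[OF diffble[OF smooth_J x]]
  show ?thesis
    unfolding nF_def d dd_J[OF x]
    by (simp add: tr_diff matrix_transpose_mul mm.diff_left mm.diff_right matrix_mul_assoc)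
qed

lemma nF_kahler: "x \<in> S \<Longrightarrow> nF i \<omega> x = 0"
  unfolding kahler_form_eq using nF_J_mult[OF _ smooth_g] by (simp add: nF_g)

lemma nC_Jc:
  assumes x: "x \<in> S" and \<alpha>: "smooth_on S \<alpha>"
  shows "nC i (\<lambda>x. Jc x (\<alpha> x)) x = Jc x (nC i \<alpha> x)"
proof -
  have s: "smooth_on S (\<lambda>x. transpose (J x))" by (intro smooth_intros open_S smooth_J)
  have "smooth_on S (\<lambda>x. transpose (J x) *v \<alpha> x)" by (rule smooth_on_mv[OF open_S s \<alpha>])
  note d = dd_minus[OF diffble[OF this x], of i] dd_mv[OF diffble[OF s x] diffble[OF \<alpha> x], of i] dd_transpose[OF diffble[OF smooth_J x]]
  show ?thesis
    unfolding nC_def J_covector_eq d dd_J[OF x]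
    by (simp add: tr_diff matrix_transpose_mul mv.diff_left mv.diff_right mv.minus_right matrix_vector_mul_assoc mm.diff_left del: transpose_matrix_vector)
qed

lemma dd_inner_h:
  assumes x: "x \<in> S" and \<alpha>: "smooth_on S \<alpha>" and \<beta>: "smooth_on S \<beta>"
  shows "dd i (\<lambda>x. \<alpha> x \<bullet> (h x *v \<beta> x)) x = nC i \<alpha> x \<bullet> (h x *v \<beta> x) + \<alpha> x \<bullet> (h x *v nC i \<beta> x)"
proof -
  have "smooth_on S (\<lambda>x. h x *v \<beta> x)" by (intro smooth_intros open_S smooth_h \<beta>)
  note d = dd_inner[OF diffble[OF \<alpha> x] diffble[OF this x], of i] dd_mv[OF diffble[OF smooth_h x] diffble[OF \<beta> x], of i]
  have "(transpose (\<Gamma> i x) *v \<alpha> x) \<bullet> (h x *v \<beta> x) = \<alpha> x \<bullet> (\<Gamma> i x ** h x *v \<beta> x)"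
    by (simp add: dot_lmul_matrix matrix_vector_mul_assoc)
  then show ?thesis
    unfolding d dd_h[OF x] nC_def
    by (simp add: inner_diff_left inner_diff_right inner_add_left inner_add_right mv.add_left mv.minus_left mv.diff_left mv.diff_right
        matrix_vector_mul_assoc del: transpose_matrix_vector)
qed

lemma nF_wedge:
  assumes x: "x \<in> S" and \<alpha>: "smooth_on S \<alpha>" and \<beta>: "smooth_on S \<beta>"
  shows "nF i (\<lambda>x. wedge (\<alpha> x) (\<beta> x)) x = wedge (nC i \<alpha> x) (\<beta> x) + wedge (\<alpha> x) (nC i \<beta> x)"
proof -
  have "transpose B ** wedge u v + wedge u v ** B = wedge (transpose B *v u) v + wedge u (transpose B *v v)" for B u v
    by (simp add: vec_eq_iff wedge_def matrix_matrix_mult_def matrix_vector_mult_def transpose_def algebra_simps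
        sum.distrib sum_subtractf sum_distrib_left del: transpose_matrix_vector)
  note e = this[of "\<Gamma> i x" "\<alpha> x" "\<beta> x"]
  have "dd i (\<lambda>x. wedge (\<alpha> x) (\<beta> x)) x = wedge (dd i \<alpha> x) (\<beta> x) + wedge (\<alpha> x) (dd i \<beta> x)"
    by (rule dd_wedge[OF diffble[OF \<alpha> x] diffble[OF \<beta> x]])
  then show ?thesis
    unfolding nF_def nC_def using e
    by (simp add: bounded_bilinear.diff_left[OF bounded_bilinear_wedge] bounded_bilinear.diff_right[OF bounded_bilinear_wedge]
        algebra_simps del: transpose_matrix_vector)
qed

lemma nC_QH:
  assumes x: "x \<in> S" and Q: "smooth_on S Q" and \<alpha>: "smooth_on S \<alpha>"
  shows "nC i (\<lambda>x. Q x *v (h x *v \<alpha> x)) x = nF i Q x *v (h x *v \<alpha> x) + Q x *v (h x *v nC i \<alpha> x)"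
proof -
  have s: "smooth_on S (\<lambda>x. h x *v \<alpha> x)" by (intro smooth_intros open_S smooth_h \<alpha>)
  note d = dd_mv[OF diffble[OF Q x] diffble[OF s x], of i] dd_mv[OF diffble[OF smooth_h x] diffble[OF \<alpha> x], of i]
  show ?thesis
    unfolding nC_def nF_def d dd_h[OF x]
    by (simp add: mv.add_left mv.diff_left mv.add_right mv.diff_right mv.minus_left mv.minus_right matrix_vector_mul_assoc
        mm.add_right mm.diff_right mm.add_left mm.diff_left matrix_mul_assoc del: transpose_matrix_vector)
qed

lemma dd_form_inner:
  assumes x: "x \<in> S" and \<phi>: "smooth_on S \<phi>" and \<psi>: "smooth_on S \<psi>"
  shows "dd i (\<lambda>x. form_inner (g x) (\<phi> x) (\<psi> x)) x
    = form_inner (g x) (nF i \<phi> x) (\<psi> x) + form_inner (g x) (\<phi> x) (nF i \<psi> x)"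
proof -
  have tphi: "smooth_on S (\<lambda>x. transpose (\<phi> x))" by (intro smooth_intros open_S \<phi>)
  have hp: "smooth_on S (\<lambda>x. h x ** \<psi> x)" by (intro smooth_intros open_S \<psi> smooth_h)
  have hph: "smooth_on S (\<lambda>x. h x ** \<psi> x ** h x)" by (intro smooth_intros open_S \<psi> smooth_h)
  have all: "smooth_on S (\<lambda>x. transpose (\<phi> x) ** (h x ** \<psi> x ** h x))" by (intro smooth_intros open_S \<phi> \<psi> smooth_h)
  have fi: "form_inner (g x) A B = (1/2) * trace (transpose A ** (h x ** B ** h x))" if "x \<in> S" for x A B
    unfolding form_inner_trace by (simp add: at_point[OF that])
  have "dd i (\<lambda>x. form_inner (g x) (\<phi> x) (\<psi> x)) x
     = dd i (\<lambda>x. (1/2) *\<^sub>R trace (transpose (\<phi> x) ** (h x ** \<psi> x ** h x))) x"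
    by (rule dd_cong[OF open_S x]) (simp add: fi)
  also have "\<dots> = (1/2) *\<^sub>R trace (dd i (\<lambda>x. transpose (\<phi> x) ** (h x ** \<psi> x ** h x)) x)"
    by (rule dd_linear[OF bounded_linear_compose[OF bounded_linear_scaleR_right bounded_linear_trace] diffble[OF all x]])
  also have "dd i (\<lambda>x. transpose (\<phi> x) ** (h x ** \<psi> x ** h x)) x =
      transpose (dd i \<phi> x) ** (h x ** \<psi> x ** h x)
      + transpose (\<phi> x) ** ((dd i h x ** \<psi> x + h x ** dd i \<psi> x) ** h x + h x ** \<psi> x ** dd i h x)"
    unfolding dd_mm[OF diffble[OF tphi x] diffble[OF hph x]] dd_mm[OF diffble[OF hp x] diffble[OF smooth_h x]]
      dd_mm[OF diffble[OF smooth_h x] diffble[OF \<psi> x]] dd_transpose[OF diffble[OF \<phi> x]] ..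
  also have "dd i \<phi> x = nF i \<phi> x + (transpose (\<Gamma> i x) ** \<phi> x + \<phi> x ** \<Gamma> i x)" by (simp add: nF_def)
  also have "dd i \<psi> x = nF i \<psi> x + (transpose (\<Gamma> i x) ** \<psi> x + \<psi> x ** \<Gamma> i x)" by (simp add: nF_def)
  also have "dd i h x = - (\<Gamma> i x ** h x + h x ** transpose (\<Gamma> i x))" by (rule dd_h[OF x])
  finally have "dd i (\<lambda>x. form_inner (g x) (\<phi> x) (\<psi> x)) x =
     (1/2) * (trace (transpose (nF i \<phi> x) ** (h x ** \<psi> x ** h x)) + trace (transpose (\<phi> x) ** (h x ** nF i \<psi> x ** h x))
      + (trace (transpose (\<Gamma> i x) ** (transpose (\<phi> x) ** h x ** \<psi> x ** h x)) - trace ((transpose (\<phi> x) ** h x ** \<psi> x ** h x) ** transpose (\<Gamma> i x))))"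
    by (simp add: tr_add tr_minus matrix_transpose_mul mm.add_left mm.add_right mm.minus_left mm.minus_right trc_add trc_diff
        matrix_mul_assoc mm.diff_left mm.diff_right algebra_simps)
  also have "trace (transpose (\<Gamma> i x) ** (transpose (\<phi> x) ** h x ** \<psi> x ** h x))
     = trace ((transpose (\<phi> x) ** h x ** \<psi> x ** h x) ** transpose (\<Gamma> i x))" by (rule trace_mul_sym)
  finally show ?thesis by (simp add: fi[OF x] matrix_mul_assoc)
qed

lemma d_form_eq:
  assumes x: "x \<in> S" and \<phi>: "smooth_on S \<phi>" and a: "alternating (\<phi> x)"
  shows "d_form \<phi> x $ i $ j $ k = nF i \<phi> x $ j $ k + nF j \<phi> x $ k $ i + nF k \<phi> x $ i $ j"
proof -
  have t: "(transpose (\<Gamma> a x) ** \<phi> x) $ b $ c = - (\<phi> x ** \<Gamma> a x) $ c $ b" for a b c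
    by (simp add: matrix_matrix_mult_def transpose_def sum_negf[symmetric] mult.commute[of "\<Gamma> _ _ $ _ $ _"])
       (rule sum.cong, simp_all add: alternating_nth[OF a, of _ c])
  have s: "(\<phi> x ** \<Gamma> a x) $ b $ c = (\<phi> x ** \<Gamma> c x) $ b $ a" for a b c
    by (simp add: matrix_matrix_mult_def torsion_free[OF x, of a _ c])
  show ?thesis
    using s[of i j k] s[of j k i] s[of k i j]
    by (simp add: d_form_def pd_entry[OF x \<phi>] nF_def t)
qed

text \<open>The connection is torsion-free, so it computes exterior derivatives.\<close>

lemma d_covector:
  assumes x: "x \<in> S"
  shows "dd i \<alpha> x $ j - dd j \<alpha> x $ i = nC i \<alpha> x $ j - nC j \<alpha> x $ i"
proof -
  have "(transpose (\<Gamma> i x) *v \<alpha> x) $ j = (transpose (\<Gamma> j x) *v \<alpha> x) $ i"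
    by (simp add: matrix_vector_mult_def transpose_def torsion_free[OF x, of i _ j] del: transpose_matrix_vector)
  then show ?thesis by (simp add: nC_def del: transpose_matrix_vector)
qed

lemma dd_differential:
  assumes "x \<in> S" "smooth_on S f"
  shows "dd i (differential f) x $ j = dd i (dd j f) x"
proof -
  have "dd i (differential f) x $ j = dd i (\<lambda>y. differential f y $ j) x"
    using diffble[OF smooth_on_differential[OF open_S assms(2)] assms(1)] by (rule dd_nth[symmetric])
  then show ?thesis by (simp add: differential_def pd_eq_dd)
qed

lemma hess_nth: "hess f x $ i = nC i (differential f) x"
  by (simp add: hess_def)

lemma hess_sym:
  assumes x: "x \<in> S" and f: "smooth_on S f"
  shows "hess f x $ i $ j = hess f x $ j $ i"
  using d_covector[OF x, of i "differential f" j] dd_commute_real[OF open_S f x, of i j]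
  by (simp add: hess_nth dd_differential[OF x f])

lemma hess_transpose: "x \<in> S \<Longrightarrow> smooth_on S f \<Longrightarrow> transpose (hess f x) = hess f x"
  by (simp add: vec_eq_iff transpose_def hess_sym)

text \<open>The Lie derivative of the metric is the symmetrized covariant derivative of the field, and
  \<open>\<nabla> (J grad f) = J (\<nabla> grad f)\<close> because \<open>J\<close> is parallel.\<close>

lemma lie_metric_J_grad:
  assumes x: "x \<in> S" and f: "smooth_on S f"
  shows "lie_metric (\<lambda>x. J x *v grad g f x) g x $ i $ j = Jc x (hess f x $ i) $ j + Jc x (hess f x $ j) $ i"
proof -
  define K where "K = (\<lambda>x. J x *v grad g f x)"
  let ?df = "differential f"
  have sd: "smooth_on S ?df" by (intro smooth_intros open_S f)
  have hdf: "smooth_on S (\<lambda>x. h x *v ?df x)" by (intro smooth_intros open_S sd smooth_h)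
  have Keq: "K = (\<lambda>x. J x *v (h x *v ?df x))" by (simp add: K_def grad_def)
  have sK: "smooth_on S K" unfolding Keq by (intro smooth_intros open_S smooth_J hdf)
  have "dd i K x = J x *v (h x *v nC i ?df x) - \<Gamma> i x *v K x" for i
    unfolding Keq dd_mv[OF diffble[OF smooth_J x] diffble[OF hdf x]] dd_mv[OF diffble[OF smooth_h x] diffble[OF sd x]]
      dd_J[OF x] dd_h[OF x] nC_def
    by (simp add: mv.add_left mv.diff_left mv.add_right mv.diff_right mv.minus_left mv.minus_right matrix_vector_mul_assoc
        mm.add_right mm.diff_right mm.add_left mm.diff_left matrix_mul_assoc del: transpose_matrix_vector)
  moreover have "g x *v (J x *v (h x *v w)) = Jc x w" for w
  proof -
    have "g x ** J x ** h x = - transpose (J x)"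
      unfolding g_J[OF x] by (simp add: mm.minus_left matrix_mul_assoc[symmetric] at_point[OF x])
    then show ?thesis
      unfolding J_covector_eq matrix_vector_mul_assoc
      by (simp add: matrix_mul_assoc mv.minus_left del: transpose_matrix_vector)
  qed
  ultimately have gdK: "g x *v dd i K x = Jc x (hess f x $ i) - g x ** \<Gamma> i x *v K x" for i
    by (simp add: mv.diff_right matrix_vector_mul_assoc hess_nth)
  have dK: "pd i (\<lambda>y. K y $ l) x = dd i K x $ l" for i l
    unfolding pd_eq_dd by (rule dd_nth[OF diffble[OF sK x]])
  have 1: "(\<Sum>l\<in>UNIV. g x $ l $ j * dd i K x $ l) = (g x *v dd i K x) $ j" for i j
    using at_point(8)[OF x] by (simp add: matrix_vector_mult_def pos_def_sym[of _ j])
  have 2: "(\<Sum>l\<in>UNIV. g x $ i $ l * dd j K x $ l) = (g x *v dd j K x) $ i" for i j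
    by (simp add: matrix_vector_mult_def)
  have 3: "(\<Sum>l\<in>UNIV. K x $ l * (g x ** \<Gamma> l x) $ i $ j) = (g x ** \<Gamma> j x *v K x) $ i" for i j
    by (simp add: matrix_vector_mult_def matrix_matrix_mult_def torsion_free[OF x, of _ _ j] mult.commute)
  have 4: "(transpose (\<Gamma> l x) ** g x) $ i $ j = (g x ** \<Gamma> l x) $ j $ i" for l
  proof -
    have "transpose (\<Gamma> l x) ** g x = transpose (g x ** \<Gamma> l x)"
      by (simp add: matrix_transpose_mul at_point[OF x])
    then show ?thesis by (simp add: transpose_def)
  qed
  have "lie_metric K g x $ i $ j = (\<Sum>l\<in>UNIV. K x $ l * dd l g x $ i $ j)
      + (\<Sum>l\<in>UNIV. g x $ l $ j * dd i K x $ l) + (\<Sum>l\<in>UNIV. g x $ i $ l * dd j K x $ l)"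
    by (simp add: lie_metric_def pd_entry[OF x smooth_g] dK sum.distrib)
  also have "\<dots> = (g x ** \<Gamma> i x *v K x) $ j + (g x ** \<Gamma> j x *v K x) $ i + (g x *v dd i K x) $ j + (g x *v dd j K x) $ i"
    unfolding 1 2 dd_g[OF x] by (simp add: 4 distrib_left sum.distrib 3)
  also have "\<dots> = Jc x (hess f x $ i) $ j + Jc x (hess f x $ j) $ i" unfolding gdK by simp
  finally show ?thesis by (simp add: K_def)
qed

text \<open>Hence \<open>J grad f\<close> is Killing exactly if the Hessian of \<open>f\<close>, as an endomorphism, commutes with \<open>J\<close>.\<close>

lemma killing_iff:
  assumes x: "x \<in> S" and f: "smooth_on S f"
  shows "lie_metric (\<lambda>x. J x *v grad g f x) g x = 0 \<longleftrightarrow> transpose (J x) ** hess f x ** J x = hess f x"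
proof -
  let ?H = "hess f x" and ?J = "J x"
  have t: "transpose (?H ** ?J) = transpose ?J ** ?H" by (simp add: matrix_transpose_mul hess_transpose[OF x f])
  have tJ: "transpose ?J ** transpose ?J = - mat 1"
    using at_point(3)[OF x] by (metis matrix_transpose_mul tr_minus transpose_mat)
  have e: "Jc x (?H $ i) $ j = - (?H ** ?J) $ i $ j" for i j
    by (simp add: J_covector_def matrix_matrix_mult_def)
  have "(?H ** ?J) $ j $ i = transpose (?H ** ?J) $ i $ j" for i j by (simp add: transpose_def)
  then have "lie_metric (\<lambda>x. J x *v grad g f x) g x $ i $ j = - (?H ** ?J + transpose ?J ** ?H) $ i $ j" for i j
    unfolding lie_metric_J_grad[OF x f] e t[symmetric] by simp
  then have "lie_metric (\<lambda>x. J x *v grad g f x) g x = - (?H ** ?J + transpose ?J ** ?H)" by (simp add: vec_eq_iff)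
  moreover have "- (A + B) = 0 \<longleftrightarrow> A = - B" for A B :: "real^4^4"
    using neg_equal_0_iff_equal[of "A + B"] eq_neg_iff_add_eq_0[of A B] by blast
  ultimately have "lie_metric (\<lambda>x. J x *v grad g f x) g x = 0 \<longleftrightarrow> ?H ** ?J = - (transpose ?J ** ?H)"
    by (simp only:)
  also have "\<dots> \<longleftrightarrow> transpose ?J ** ?H ** ?J = ?H"
  proof
    assume "?H ** ?J = - (transpose ?J ** ?H)"
    then have "transpose ?J ** (?H ** ?J) = - (transpose ?J ** transpose ?J ** ?H)"
      by (simp add: mm.minus_right matrix_mul_assoc)
    then show "transpose ?J ** ?H ** ?J = ?H" by (simp add: tJ mm.minus_left matrix_mul_assoc)
  next
    assume "transpose ?J ** ?H ** ?J = ?H"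
    then have "transpose ?J ** transpose ?J ** (?H ** ?J) = transpose ?J ** ?H" by (metis matrix_mul_assoc)
    then show "?H ** ?J = - (transpose ?J ** ?H)" unfolding tJ by (simp add: mm.minus_left) (metis minus_minus)
  qed
  finally show ?thesis .
qed

end

section \<open>Pairs of functions with orthogonal differentials\<close>

definition outer :: "real^4 \<Rightarrow> real^4 \<Rightarrow> real^4^4" where
  "outer u v = (\<chi> i j. u $ i * v $ j)"

lemma outer_eval: "X \<bullet> (outer u v *v Y) = (u \<bullet> X) * (v \<bullet> Y)"
  unfolding sum_product inner_vec_def matrix_vector_mult_def outer_def inner_real_def
  by (simp add: sum_distrib_left mult_ac)

lemma inner_transpose: "u \<bullet> (transpose B *v w) = (B *v u) \<bullet> w" for B :: "real^'n^'m"
  by (metis dot_lmul_matrix inner_commute transpose_matrix_vector)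

lemma wedge_outer: "wedge u v = outer u v - outer v u"
  by (simp add: vec_eq_iff wedge_def outer_def mult.commute)

lemma dual_basis_invertible:
  fixes E u :: "4 \<Rightarrow> real^4"
  assumes d: "\<And>i j. u i \<bullet> E j = (if i = j then n i else 0)" "\<And>i. n i \<noteq> 0"
  shows "invertible (\<chi> i j. E j $ i)"
proof -
  have "(\<chi> i. (1 / n i) *\<^sub>R u i) ** (\<chi> i j. E j $ i) = mat 1"
  proof -
    have "((\<chi> i. (1 / n i) *\<^sub>R u i) ** (\<chi> i j. E j $ i)) $ i $ j = (1 / n i) * (u i \<bullet> E j)" for i j
      by (simp add: matrix_matrix_mult_def inner_vec_def sum_distrib_left)
    then show ?thesis using d by (simp add: vec_eq_iff mat_def)
  qed
  then show ?thesis using invertible_left_inverse by blast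
qed

lemma bilinear_eq_on_basis:
  fixes E u :: "4 \<Rightarrow> real^4"
  assumes d: "\<And>i j. u i \<bullet> E j = (if i = j then n i else 0)" "\<And>i. n i \<noteq> 0"
    and eq: "\<And>i j. E i \<bullet> (B *v E j) = E i \<bullet> (C *v E j)"
  shows "B = C"
proof -
  have "column a (\<chi> i j. E j $ i) = E a" for a by (simp add: column_def vec_eq_iff)
  then have "pull (\<chi> i j. E j $ i) B $ a $ b = pull (\<chi> i j. E j $ i) C $ a $ b" for a b
    by (simp only: pull_bilinear eq)
  then have "pull (\<chi> i j. E j $ i) B = pull (\<chi> i j. E j $ i) C" by (simp add: vec_eq_iff)
  then show ?thesis by (rule pull_inj[OF dual_basis_invertible[OF d]])
qed

definition select4 :: "'v \<Rightarrow> 'v \<Rightarrow> 'v \<Rightarrow> 'v \<Rightarrow> 4 \<Rightarrow> 'v" where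
  "select4 a b c d i = (if i = 1 then a else if i = 2 then b else if i = 3 then c else d)"

lemma select4: "select4 a b c d 1 = a" "select4 a b c d 2 = b" "select4 a b c d 3 = c" "select4 a b c d 4 = d"
  by (simp_all add: select4_def)

context kahler_chart
begin

definition sqnorm :: "(real^4 \<Rightarrow> real) \<Rightarrow> real^4 \<Rightarrow> real" where
  "sqnorm a x = differential a x \<bullet> (h x *v differential a x)"

definition dJ :: "(real^4 \<Rightarrow> real) \<Rightarrow> real^4 \<Rightarrow> real^4" where
  "dJ a x = Jc x (differential a x)"

text \<open>The condition on \<open>J da\<close> says that \<open>a\<close> and \<open>b\<close> Poisson-commute. Then \<open>da, J da, db, J db\<close> is an
  orthogonal coframe.\<close>

definition orth_pair :: "(real^4 \<Rightarrow> real) \<Rightarrow> (real^4 \<Rightarrow> real) \<Rightarrow> bool" where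
  "orth_pair a b \<longleftrightarrow> smooth_on S a \<and> smooth_on S b \<and> (\<forall>x\<in>S. a x \<noteq> b x \<and>
     differential a x \<noteq> 0 \<and> differential b x \<noteq> 0 \<and>
     differential a x \<bullet> (h x *v differential b x) = 0 \<and> dJ a x \<bullet> (h x *v differential b x) = 0)"

lemma h_pos:
  assumes x: "x \<in> S" and v: "v \<noteq> 0"
  shows "v \<bullet> (h x *v v) > 0"
proof -
  let ?w = "h x *v v"
  have gw: "g x *v ?w = v" by (simp add: matrix_vector_mul_assoc at_point[OF x])
  then have "?w \<noteq> 0" using v by auto
  then have "?w \<bullet> (g x *v ?w) > 0" using at_point(8)[OF x] by (simp add: pos_def_def)
  then show ?thesis by (simp add: gw inner_commute)
qed

context
  fixes a b assumes ab: "orth_pair a b"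
begin

lemma smooth_a: "smooth_on S a" and smooth_b: "smooth_on S b"
  using ab by (auto simp: orth_pair_def)

lemma smooth_da: "smooth_on S (differential a)" and smooth_db: "smooth_on S (differential b)"
  by (intro smooth_intros open_S smooth_a smooth_b)+

lemma smooth_dJa: "smooth_on S (dJ a)" and smooth_dJb: "smooth_on S (dJ b)"
  unfolding dJ_def by (intro smooth_intros open_S smooth_da smooth_db smooth_J)+

lemma smooth_p: "smooth_on S (sqnorm a)" and smooth_q: "smooth_on S (sqnorm b)"
  unfolding sqnorm_def by (intro smooth_intros open_S smooth_da smooth_db smooth_h)+

lemma pair_pos:
  assumes x: "x \<in> S"
  shows "sqnorm a x > 0" "sqnorm b x > 0" "a x - b x \<noteq> 0" "b x - a x \<noteq> 0" "sqnorm a x \<noteq> 0" "sqnorm b x \<noteq> 0"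
  using ab x h_pos[OF x, of "differential a x"] h_pos[OF x, of "differential b x"]
  by (auto simp: orth_pair_def sqnorm_def)

lemma pairings:
  assumes x: "x \<in> S"
  defines "E1 \<equiv> h x *v differential a x" and "E2 \<equiv> h x *v dJ a x"
    and "E3 \<equiv> h x *v differential b x" and "E4 \<equiv> h x *v dJ b x"
  shows "differential a x \<bullet> E1 = sqnorm a x" "differential a x \<bullet> E2 = 0" "differential a x \<bullet> E3 = 0" "differential a x \<bullet> E4 = 0"
    "dJ a x \<bullet> E1 = 0" "dJ a x \<bullet> E2 = sqnorm a x" "dJ a x \<bullet> E3 = 0" "dJ a x \<bullet> E4 = 0"
    "differential b x \<bullet> E1 = 0" "differential b x \<bullet> E2 = 0" "differential b x \<bullet> E3 = sqnorm b x" "differential b x \<bullet> E4 = 0"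
    "dJ b x \<bullet> E1 = 0" "dJ b x \<bullet> E2 = 0" "dJ b x \<bullet> E3 = 0" "dJ b x \<bullet> E4 = sqnorm b x"
proof -
  let ?a = "differential a x" and ?b = "differential b x"
  have 1: "?a \<bullet> (h x *v ?b) = 0" "dJ a x \<bullet> (h x *v ?b) = 0" using ab x by (auto simp: orth_pair_def)
  have 2: "?a \<bullet> (h x *v dJ b x) = 0"
  proof -
    have "?a \<bullet> (h x *v dJ b x) = - (Jc x (dJ a x) \<bullet> (h x *v dJ b x))" by (simp add: dJ_def Jc_Jc[OF x])
    also have "\<dots> = - (dJ a x \<bullet> (h x *v ?b))" unfolding dJ_def inner_Jc_Jc[OF x] ..
    finally show ?thesis using 1 by simp
  qed
  have 3: "dJ a x \<bullet> (h x *v dJ b x) = 0" using 1 by (simp add: dJ_def inner_Jc_Jc[OF x])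
  note s = inner_h_sym[OF x]
  show "differential a x \<bullet> E1 = sqnorm a x" "differential b x \<bullet> E3 = sqnorm b x"
    by (simp_all add: E1_def E3_def sqnorm_def)
  show "dJ a x \<bullet> E2 = sqnorm a x" "dJ b x \<bullet> E4 = sqnorm b x"
    by (simp_all add: E2_def E4_def sqnorm_def dJ_def inner_Jc_Jc[OF x])
  show "differential a x \<bullet> E2 = 0" "differential b x \<bullet> E4 = 0"
    by (simp_all add: E2_def E4_def dJ_def inner_Jc_self[OF x])
  show "dJ a x \<bullet> E1 = 0" "dJ b x \<bullet> E3 = 0"
    unfolding E1_def E3_def by (subst s, simp add: dJ_def inner_Jc_self[OF x])+
  show "differential a x \<bullet> E3 = 0" "dJ a x \<bullet> E3 = 0" using 1 by (auto simp: E3_def)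
  show "differential a x \<bullet> E4 = 0" "dJ a x \<bullet> E4 = 0" using 2 3 by (auto simp: E4_def)
  show "differential b x \<bullet> E1 = 0" "dJ b x \<bullet> E1 = 0" "differential b x \<bullet> E2 = 0" "dJ b x \<bullet> E2 = 0"
    unfolding E1_def E2_def using 1 2 3 s by metis+
qed

definition cov4 :: "real^4 \<Rightarrow> 4 \<Rightarrow> real^4" where
  "cov4 x = select4 (differential a x) (dJ a x) (differential b x) (dJ b x)"
definition vec4 :: "real^4 \<Rightarrow> 4 \<Rightarrow> real^4" where
  "vec4 x = select4 (h x *v differential a x) (h x *v dJ a x) (h x *v differential b x) (h x *v dJ b x)"
definition norm4 :: "real^4 \<Rightarrow> 4 \<Rightarrow> real" where
  "norm4 x = select4 (sqnorm a x) (sqnorm a x) (sqnorm b x) (sqnorm b x)"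

lemma dual4:
  assumes x: "x \<in> S"
  shows "cov4 x i \<bullet> vec4 x j = (if i = j then norm4 x i else 0)" "norm4 x i \<noteq> 0"
proof -
  have "\<forall>i j. cov4 x i \<bullet> vec4 x j = (if i = j then norm4 x i else 0)"
    unfolding forall_4 cov4_def vec4_def norm4_def select4 by (simp add: pairings[OF x])
  then show "cov4 x i \<bullet> vec4 x j = (if i = j then norm4 x i else 0)" by blast
  have "\<forall>i. norm4 x i \<noteq> 0" unfolding forall_4 norm4_def select4 using pair_pos[OF x] by simp
  then show "norm4 x i \<noteq> 0" by blast
qed

lemma bilinear_eqI:
  assumes x: "x \<in> S"
    and "\<forall>i j. vec4 x i \<bullet> (B *v vec4 x j) = vec4 x i \<bullet> (C *v vec4 x j)"
  shows "B = C"
  using bilinear_eq_on_basis[OF dual4[OF x]] assms by blast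

lemma J_vec4:
  assumes x: "x \<in> S"
  shows "J x *v vec4 x 1 = vec4 x 2" "J x *v vec4 x 2 = - vec4 x 1" "J x *v vec4 x 3 = vec4 x 4" "J x *v vec4 x 4 = - vec4 x 3"
  unfolding vec4_def select4 h_Jc[OF x, symmetric]
  by (simp_all add: dJ_def Jc_Jc[OF x] mv.minus_right)

lemma metric_decomp:
  assumes x: "x \<in> S"
  shows "g x = (1 / sqnorm a x) *\<^sub>R (outer (differential a x) (differential a x) + outer (dJ a x) (dJ a x))
     + (1 / sqnorm b x) *\<^sub>R (outer (differential b x) (differential b x) + outer (dJ b x) (dJ b x))"
proof (rule bilinear_eqI[OF x])
  have g: "g x *v vec4 x i = cov4 x i" for i
  proof -
    have "\<forall>i. g x *v vec4 x i = cov4 x i"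
      unfolding forall_4 vec4_def cov4_def select4 by (simp add: matrix_vector_mul_assoc at_point[OF x])
    then show ?thesis by blast
  qed
  show "\<forall>i j. vec4 x i \<bullet> (g x *v vec4 x j) = vec4 x i \<bullet>
      (((1 / sqnorm a x) *\<^sub>R (outer (differential a x) (differential a x) + outer (dJ a x) (dJ a x))
      + (1 / sqnorm b x) *\<^sub>R (outer (differential b x) (differential b x) + outer (dJ b x) (dJ b x))) *v vec4 x j)"
    unfolding g mv.add_left mv.scaleR_left inner_add_right inner_scaleR_right outer_eval
    unfolding forall_4 vec4_def cov4_def select4 using pair_pos[OF x]
    by (simp add: pairings[OF x] inner_commute[of "h x *v _"])
qed

lemma kahler_decomp:
  assumes x: "x \<in> S"
  shows "\<omega> x = (1 / sqnorm a x) *\<^sub>R wedge (differential a x) (dJ a x) + (1 / sqnorm b x) *\<^sub>R wedge (differential b x) (dJ b x)"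
proof (rule bilinear_eqI[OF x])
  have g: "g x *v vec4 x i = cov4 x i" for i
  proof -
    have "\<forall>i. g x *v vec4 x i = cov4 x i"
      unfolding forall_4 vec4_def cov4_def select4 by (simp add: matrix_vector_mul_assoc at_point[OF x])
    then show ?thesis by blast
  qed
  have w: "v \<bullet> (\<omega> x *v w) = (J x *v v) \<bullet> (g x *v w)" for v w
    by (simp add: kahler_form_eq matrix_vector_mul_assoc[symmetric] inner_transpose del: transpose_matrix_vector)
  show "\<forall>i j. vec4 x i \<bullet> (\<omega> x *v vec4 x j) = vec4 x i \<bullet>
      (((1 / sqnorm a x) *\<^sub>R wedge (differential a x) (dJ a x) + (1 / sqnorm b x) *\<^sub>R wedge (differential b x) (dJ b x)) *v vec4 x j)"
    unfolding w g wedge_outer mv.add_left mv.diff_left mv.scaleR_left inner_add_right inner_diff_right inner_scaleR_right outer_eval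
    unfolding forall_4 J_vec4[OF x] unfolding vec4_def cov4_def select4 using pair_pos[OF x]
    by (simp add: pairings[OF x] inner_commute[of "h x *v _"])
qed

end

lemma orth_pair_sym: "orth_pair a b \<Longrightarrow> orth_pair b a"
proof -
  assume ab: "orth_pair a b"
  have "differential b x \<bullet> (h x *v differential a x) = 0 \<and> dJ b x \<bullet> (h x *v differential a x) = 0" if "x \<in> S" for x
    using pairings[OF ab that] by simp
  then show "orth_pair b a" using ab by (auto simp: orth_pair_def)
qed

text \<open>The part of the Hessian of \<open>a\<close> that is determined by first order data.\<close>

definition mixed :: "(real^4 \<Rightarrow> real) \<Rightarrow> (real^4 \<Rightarrow> real) \<Rightarrow> real^4 \<Rightarrow> 4 \<Rightarrow> real^4" where
  "mixed a b x i = (1 / (2 * (a x - b x))) *\<^sub>R (differential a x $ i *\<^sub>R differential b x + differential b x $ i *\<^sub>R differential a x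
     - dJ a x $ i *\<^sub>R dJ b x - dJ b x $ i *\<^sub>R dJ a x
     + (sqnorm a x / sqnorm b x) *\<^sub>R (differential b x $ i *\<^sub>R differential b x + dJ b x $ i *\<^sub>R dJ b x))"

text \<open>The normal form of the Hessian of \<open>a\<close>: all entries but one are determined by the first
  order data. Everything about ortho-toric surfaces follows from this formula and its counterpart
  for \<open>b\<close>.\<close>

definition normal_hess :: "(real^4 \<Rightarrow> real) \<Rightarrow> (real^4 \<Rightarrow> real) \<Rightarrow> real^4 \<Rightarrow> real \<Rightarrow> bool" where
  "normal_hess a b x k \<longleftrightarrow> (\<forall>i. nC i (differential a) x =
     k *\<^sub>R (differential a x $ i *\<^sub>R differential a x + dJ a x $ i *\<^sub>R dJ a x) + mixed a b x i)"

lemma hess_add: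
  assumes "x \<in> S" "smooth_on S a" "smooth_on S b"
  shows "hess (\<lambda>x. a x + b x) x = hess a x + hess b x"
proof -
  have "nC i (differential (\<lambda>x. a x + b x)) x = nC i (\<lambda>x. differential a x + differential b x) x" for i
    by (rule nC_cong[OF assms(1)])
      (simp add: differential_def pd_eq_dd vec_eq_iff dd_add[OF diffble diffble, OF assms(2) _ assms(3)])
  then show ?thesis
    by (simp add: vec_eq_iff hess_nth nC_add[OF assms(1) smooth_on_differential smooth_on_differential, OF open_S assms(2) open_S assms(3)])
qed

lemma differential_mult:
  assumes "x \<in> S" "smooth_on S a" "smooth_on S b"
  shows "differential (\<lambda>x. a x * b x) x = b x *\<^sub>R differential a x + a x *\<^sub>R differential b x"
  by (simp add: differential_def pd_eq_dd vec_eq_iff dd_mult[OF diffble diffble, OF assms(2) assms(1) assms(3) assms(1)])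

lemma hess_mult:
  assumes x: "x \<in> S" and a: "smooth_on S a" and b: "smooth_on S b"
  shows "hess (\<lambda>x. a x * b x) x = b x *\<^sub>R hess a x + a x *\<^sub>R hess b x
    + outer (differential a x) (differential b x) + outer (differential b x) (differential a x)"
proof -
  note sd = smooth_on_differential[OF open_S a] smooth_on_differential[OF open_S b]
  have "nC i (differential (\<lambda>x. a x * b x)) x = nC i (\<lambda>x. b x *\<^sub>R differential a x + a x *\<^sub>R differential b x) x" for i
    by (rule nC_cong[OF x]) (rule differential_mult[OF _ a b])
  also have "\<dots> i = dd i b x *\<^sub>R differential a x + b x *\<^sub>R nC i (differential a) x + (dd i a x *\<^sub>R differential b x + a x *\<^sub>R nC i (differential b) x)" for i
    by (simp add: nC_add[OF x] smooth_on_scaleR open_S a b sd nC_scaleR[OF x])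
  finally show ?thesis
    by (simp add: vec_eq_iff hess_nth outer_def differential_def pd_eq_dd algebra_simps)
qed

text \<open>For ortho-toric pairs the normal form expresses that both momentum maps have invariant
  Hessians and that the two orthogonality relations can be differentiated.\<close>

lemma orthotoric_normal_hess:
  assumes ab: "orth_pair a b" and x: "x \<in> S"
    and J1: "transpose (J x) ** hess (\<lambda>x. a x + b x) x ** J x = hess (\<lambda>x. a x + b x) x"
    and J2: "transpose (J x) ** hess (\<lambda>x. a x * b x) x ** J x = hess (\<lambda>x. a x * b x) x"
  obtains k where "normal_hess a b x k"
proof -
  note sm = smooth_a[OF ab] smooth_b[OF ab] and sd = smooth_da[OF ab] smooth_db[OF ab]
  note J1' = J1[unfolded hess_add[OF x sm]] and J2' = J2[unfolded hess_mult[OF x sm]]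
  let ?E = "vec4 a b x"
  define H K where "H = hess a x" and "K = hess b x"
  define m n where "m i j = ?E i \<bullet> (H *v ?E j)" and "n i j = ?E i \<bullet> (K *v ?E j)" for i j
  define p q c d where "p = sqnorm a x" and "q = sqnorm b x" and "c = a x" and "d = b x"
  have inv: "(J x *v v) \<bullet> (B *v (J x *v w)) = v \<bullet> (B *v w)" if "transpose (J x) ** B ** J x = B" for B v w
  proof -
    have "v \<bullet> (B *v w) = v \<bullet> (transpose (J x) *v (B *v (J x *v w)))"
      by (subst that[symmetric]) (simp add: matrix_vector_mul_assoc[symmetric] del: transpose_matrix_vector)
    then show ?thesis by (simp add: inner_transpose del: transpose_matrix_vector)
  qed
  have nz: "p \<noteq> 0" "q \<noteq> 0" "c - d \<noteq> 0" using pair_pos[OF ab x] by (auto simp: p_def q_def c_def d_def)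
  have sym: "m i j = m j i" "n i j = n j i" for i j
    unfolding m_def n_def H_def K_def using hess_transpose[OF x sm(1)] hess_transpose[OF x sm(2)]
    by (metis dot_lmul_matrix inner_commute transpose_matrix_vector)+
  have s: "(J x *v ?E i) \<bullet> ((H + K) *v (J x *v ?E j)) = m i j + n i j" for i j
    unfolding inv[OF J1'[folded H_def K_def]] by (simp add: m_def n_def mv.add_left inner_add_right)
  have t: "(J x *v ?E i) \<bullet> ((d *\<^sub>R H + c *\<^sub>R K + outer (differential a x) (differential b x) + outer (differential b x) (differential a x)) *v (J x *v ?E j))
     = d * m i j + c * n i j + (differential a x \<bullet> ?E i) * (differential b x \<bullet> ?E j) + (differential b x \<bullet> ?E i) * (differential a x \<bullet> ?E j)" for i j
    unfolding inv[OF J2'[folded H_def K_def c_def d_def]]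
    by (simp add: m_def n_def mv.add_left inner_add_right mv.scaleR_left outer_eval)
  have E: "differential a x \<bullet> ?E 1 = p" "differential a x \<bullet> ?E 2 = 0" "differential a x \<bullet> ?E 3 = 0" "differential a x \<bullet> ?E 4 = 0"
    "differential b x \<bullet> ?E 1 = 0" "differential b x \<bullet> ?E 2 = 0" "differential b x \<bullet> ?E 3 = q" "differential b x \<bullet> ?E 4 = 0"
    "dJ a x \<bullet> ?E 1 = 0" "dJ a x \<bullet> ?E 2 = p" "dJ a x \<bullet> ?E 3 = 0" "dJ a x \<bullet> ?E 4 = 0"
    "dJ b x \<bullet> ?E 1 = 0" "dJ b x \<bullet> ?E 2 = 0" "dJ b x \<bullet> ?E 3 = 0" "dJ b x \<bullet> ?E 4 = q"
    unfolding vec4_def[OF ab] select4 p_def q_def by (simp_all add: pairings[OF ab x])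
  note JE = J_vec4[OF ab x]
  note simps = JE mv.minus_right inner_minus_left inner_minus_right inner_diff_right mv.add_left mv.scaleR_left outer_eval inner_add_right
    inner_scaleR_right m_def[symmetric] n_def[symmetric] E
  \<comment> \<open>Invariance of the Hessian of \<open>a + b\<close>, entry by entry.\<close>
  have 1: "m 2 2 + n 2 2 = m 1 1 + n 1 1" "m 1 2 + n 1 2 = 0" "m 2 4 + n 2 4 = m 1 3 + n 1 3"
     "- (m 2 3 + n 2 3) = m 1 4 + n 1 4" "m 4 4 + n 4 4 = m 3 3 + n 3 3" "m 3 4 + n 3 4 = 0"
    using s[of 1 1] s[of 1 2] s[of 1 3] s[of 1 4] s[of 3 3] s[of 3 4] sym[of 2 1] sym[of 4 3]
    by (simp_all add: simps)
  \<comment> \<open>Invariance of the Hessian of \<open>a b\<close>. It has the additional term \<open>da db\<close>, which is not invariant.\<close>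
  have 2: "d * m 2 2 + c * n 2 2 = d * m 1 1 + c * n 1 1" "d * m 1 2 + c * n 1 2 = 0" "d * m 2 4 + c * n 2 4 = d * m 1 3 + c * n 1 3 + p * q"
     "- (d * m 2 3 + c * n 2 3) = d * m 1 4 + c * n 1 4" "d * m 4 4 + c * n 4 4 = d * m 3 3 + c * n 3 3" "d * m 3 4 + c * n 3 4 = 0"
    using t[of 1 1] t[of 1 2] t[of 1 3] t[of 1 4] t[of 3 3] t[of 3 4] sym[of 2 1] sym[of 4 3]
    by (simp_all add: simps)
  \<comment> \<open>The derivatives of \<open>\<langle>da, db\<rangle> = 0\<close> and \<open>\<langle>J da, db\<rangle> = 0\<close>.\<close>
  have 3: "m i 3 = - n i 1" "m i 4 = n i 2" for i
  proof -
    have "dd i (\<lambda>x. differential a x \<bullet> (h x *v differential b x)) x = dd i (\<lambda>x. 0) x" for i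
      by (rule dd_cong[OF open_S x]) (use ab in \<open>simp add: orth_pair_def\<close>)
    then have "nC i (differential a) x \<bullet> (h x *v differential b x) + differential a x \<bullet> (h x *v nC i (differential b) x) = 0" for i
      unfolding dd_inner_h[OF x sd] dd_const .
    then have o1: "H *v ?E 3 = - (K *v ?E 1)"
      unfolding vec4_def[OF ab] select4 H_def K_def
      by (simp add: vec_eq_iff matrix_vector_mul_component hess_nth eq_neg_iff_add_eq_0 inner_h_sym[OF x, of "differential a x"])
    have "dd i (\<lambda>x. dJ a x \<bullet> (h x *v differential b x)) x = dd i (\<lambda>x. 0) x" for i
      by (rule dd_cong[OF open_S x]) (use ab in \<open>simp add: orth_pair_def\<close>)
    then have "nC i (dJ a) x \<bullet> (h x *v differential b x) + dJ a x \<bullet> (h x *v nC i (differential b) x) = 0" for i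
      unfolding dd_inner_h[OF x smooth_dJa[OF ab] sd(2)] dd_const .
    moreover have "nC i (dJ a) x = Jc x (nC i (differential a) x)" for i
      unfolding dJ_def[abs_def] by (rule nC_Jc[OF x sd(1)])
    ultimately have "- (nC i (differential a) x \<bullet> (J x *v (h x *v differential b x))) + dJ a x \<bullet> (h x *v nC i (differential b) x) = 0" for i
      by (simp add: inner_Jc)
    then have o2: "H *v ?E 4 = K *v ?E 2"
      unfolding vec4_def[OF ab] select4 H_def K_def
      by (simp add: vec_eq_iff matrix_vector_mul_component hess_nth dJ_def inner_h_sym[OF x, of "Jc x (differential a x)"] h_Jc[OF x])
    show "m i 3 = - n i 1" "m i 4 = n i 2" unfolding m_def n_def o1 o2 by simp_all
  qed
  have ds: "(c - d) * y = 0 \<Longrightarrow> y = 0" for y using nz by simp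
  have e11: "m 2 2 = m 1 1" "n 2 2 = n 1 1"
  proof -
    have "n 2 2 = m 1 1 + n 1 1 - m 2 2" using 1(1) by simp
    with 2(1) have "(c - d) * (m 1 1 - m 2 2) = 0" by (simp add: algebra_simps)
    from ds[OF this] show "m 2 2 = m 1 1" "n 2 2 = n 1 1" using 1(1) by auto
  qed
  have e12: "m 1 2 = 0" "n 1 2 = 0"
  proof -
    have "n 1 2 = - m 1 2" using 1(2) by simp
    with 2(2) have "(c - d) * m 1 2 = 0" by (auto simp: algebra_simps)
    from ds[OF this] show "m 1 2 = 0" "n 1 2 = 0" using 1(2) by auto
  qed
  have e33: "m 4 4 = m 3 3"
  proof -
    have "n 4 4 = m 3 3 + n 3 3 - m 4 4" using 1(5) by simp
    with 2(5) have "(c - d) * (m 3 3 - m 4 4) = 0" by (simp add: algebra_simps)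
    from ds[OF this] show ?thesis by auto
  qed
  have e34: "m 3 4 = 0"
  proof -
    have "n 3 4 = - m 3 4" using 1(6) by simp
    with 2(6) have "(c - d) * m 3 4 = 0" by (auto simp: algebra_simps)
    from ds[OF this] show ?thesis by auto
  qed
  have e13: "(c - d) * (m 1 3 - m 2 4) = p * q"
  proof -
    have "n 2 4 = m 1 3 + n 1 3 - m 2 4" using 1(3) by simp
    with 2(3) show ?thesis by (simp add: algebra_simps)
  qed
  have f: "m 1 4 = 0" "m 2 3 = 0" "m 2 4 = - m 1 3" using 3[of 1] 3[of 2] e12 e11 sym[of 1 2] by auto
  have f13: "m 1 3 = p * q / (2 * (c - d))" using e13 f(3) nz by (simp add: field_simps)
  have "m 3 3 = - n 1 3" "n 2 4 = m 3 3" using 3[of 3] 3[of 4] sym[of 1 3] sym[of 4 2] e33 by auto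
  moreover have "n 2 4 - n 1 3 = 2 * m 1 3" using 1(3) f(3) by simp
  ultimately have f33: "m 3 3 = p * q / (2 * (c - d))" using f13 by simp
  define k where "k = m 1 1 / p\<^sup>2"
  define B where "B = k *\<^sub>R (outer (differential a x) (differential a x) + outer (dJ a x) (dJ a x))
     + (1 / (2 * (c - d))) *\<^sub>R (outer (differential a x) (differential b x) + outer (differential b x) (differential a x)
     - outer (dJ a x) (dJ b x) - outer (dJ b x) (dJ a x)
     + (p / q) *\<^sub>R (outer (differential b x) (differential b x) + outer (dJ b x) (dJ b x)))"
  have HB: "H = B"
  proof (rule bilinear_eqI[OF ab x])
    show "\<forall>i j. ?E i \<bullet> (H *v ?E j) = ?E i \<bullet> (B *v ?E j)"
      unfolding m_def[symmetric] forall_4 B_def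
      using sym(1)[of 2 1] sym(1)[of 3 1] sym(1)[of 4 1] sym(1)[of 3 2] sym(1)[of 4 2] sym(1)[of 4 3]
        e11 e12 e33 e34 f f13 f33 nz
      by (simp add: mv.add_left mv.diff_left mv.scaleR_left outer_eval inner_add_right inner_diff_right E k_def power2_eq_square)
  qed
  have "normal_hess a b x k"
    unfolding normal_hess_def mixed_def hess_nth[symmetric] H_def[symmetric] HB
    by (simp add: B_def vec_eq_iff outer_def p_def q_def c_def d_def algebra_simps)
  then show thesis by (rule that)
qed

context
  fixes a b x k l
  assumes ab: "orth_pair a b" and x: "x \<in> S" and Ha: "normal_hess a b x k" and Hb: "normal_hess b a x l"
begin

lemma nC_da:
  "nC i (differential a) x = k *\<^sub>R (differential a x $ i *\<^sub>R differential a x + dJ a x $ i *\<^sub>R dJ a x) + mixed a b x i"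
  using Ha by (simp add: normal_hess_def)

lemma nC_dJa:
  "nC i (dJ a) x = k *\<^sub>R (differential a x $ i *\<^sub>R dJ a x - dJ a x $ i *\<^sub>R differential a x)
    + (1 / (2 * (a x - b x))) *\<^sub>R (differential a x $ i *\<^sub>R dJ b x + differential b x $ i *\<^sub>R dJ a x
     + dJ a x $ i *\<^sub>R differential b x + dJ b x $ i *\<^sub>R differential a x
     + (sqnorm a x / sqnorm b x) *\<^sub>R (differential b x $ i *\<^sub>R dJ b x - dJ b x $ i *\<^sub>R differential b x))"
proof -
  have "nC i (dJ a) x = Jc x (nC i (differential a) x)"
    unfolding dJ_def[abs_def] by (rule nC_Jc[OF x smooth_da[OF ab]])
  then show ?thesis unfolding nC_da mixed_def by (simp add: J_covector_linear dJ_def Jc_Jc[OF x])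
qed

lemma dd_p: "dd i (sqnorm a) x = 2 * k * sqnorm a x * differential a x $ i + sqnorm a x / (a x - b x) * differential b x $ i"
proof -
  have "dd i (sqnorm a) x = 2 * (nC i (differential a) x \<bullet> (h x *v differential a x))"
    unfolding sqnorm_def[abs_def] dd_inner_h[OF x smooth_da[OF ab] smooth_da[OF ab]]
    by (simp add: inner_h_sym[OF x, of "differential a x"])
  then show ?thesis
    unfolding nC_da mixed_def using pair_pos[OF ab x]
    by (simp add: inner_add_left inner_diff_left pairings[OF ab x] field_simps)
qed

text \<open>The derivatives of \<open>(a - b) |da|\<^sup>2\<close> in the other directions cancel. So this is a function of \<open>a\<close> alone, and
  it will be \<open>F (a)\<close> in the explicit metric.\<close>

lemma differential_F:
  "differential (\<lambda>x. (a x - b x) * sqnorm a x) x = (sqnorm a x * (1 + 2 * k * (a x - b x))) *\<^sub>R differential a x"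
proof -
  have "dd i (\<lambda>x. (a x - b x) * sqnorm a x) x = sqnorm a x * (1 + 2 * k * (a x - b x)) * differential a x $ i" for i
  proof -
    have "dd i (\<lambda>x. (a x - b x) * sqnorm a x) x = (dd i a x - dd i b x) * sqnorm a x + (a x - b x) * dd i (sqnorm a) x"
      using diffble[OF smooth_a[OF ab] x] diffble[OF smooth_b[OF ab] x] diffble[OF smooth_p[OF ab] x]
      by (simp add: dd_mult dd_diff)
    moreover have "dd i a x = differential a x $ i" "dd i b x = differential b x $ i" by (simp_all add: differential_def pd_eq_dd)
    ultimately show ?thesis
      using pair_pos[OF ab x] by (simp add: dd_p) (simp add: field_simps)
  qed
  then show ?thesis by (simp add: differential_def[of "\<lambda>x. (a x - b x) * sqnorm a x"] pd_eq_dd vec_eq_iff)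
qed

end

end

section \<open>Consequences of the normal form\<close>

context kahler_chart
begin

context
  fixes a b x k l
  assumes ab: "orth_pair a b" and x: "x \<in> S" and Ha: "normal_hess a b x k" and Hb: "normal_hess b a x l"
begin

lemma dJ_exterior:
  "dd i (dJ a) x $ j - dd j (dJ a) x $ i = 2 * k * wedge (differential a x) (dJ a x) $ i $ j
    + sqnorm a x / (sqnorm b x * (a x - b x)) * wedge (differential b x) (dJ b x) $ i $ j"
proof -
  define c r where "c = 1 / (2 * (a x - b x))" and "r = sqnorm a x / sqnorm b x"
  have e: "sqnorm a x / (sqnorm b x * (a x - b x)) = 2 * (c * r)"
    using pair_pos[OF ab x] by (simp add: c_def r_def divide_simps)
  show ?thesis
    unfolding d_covector[OF x] nC_dJa[OF ab x Ha Hb] wedge_def c_def[symmetric] r_def[symmetric] e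
    by (simp add: algebra_simps)
qed

text \<open>The exterior derivative of \<open>u J da + v J db\<close> is a combination of \<open>da \<and> J da\<close> and \<open>db \<and> J db\<close>, and the two
  differential equations for \<open>u\<close> and \<open>v\<close> say that both coefficients vanish.\<close>

lemma closed_combination:
  assumes u: "smooth_on S u" "\<And>i. dd i u x = u1 * differential a x $ i"
    and v: "smooth_on S v" "\<And>i. dd i v x = v2 * differential b x $ i"
    and 1: "u1 + 2 * k * u x = v x * (sqnorm b x / (sqnorm a x * (a x - b x)))"
    and 2: "v2 + 2 * l * v x = - u x * (sqnorm a x / (sqnorm b x * (a x - b x)))"
    and dJb: "\<And>i j. dd i (dJ b) x $ j - dd j (dJ b) x $ i = 2 * l * wedge (differential b x) (dJ b x) $ i $ j
       - sqnorm b x / (sqnorm a x * (a x - b x)) * wedge (differential a x) (dJ a x) $ i $ j"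
  shows "dd i (\<lambda>x. u x *\<^sub>R dJ a x + v x *\<^sub>R dJ b x) x $ j = dd j (\<lambda>x. u x *\<^sub>R dJ a x + v x *\<^sub>R dJ b x) x $ i"
proof -
  note sm = smooth_dJa[OF ab] smooth_dJb[OF ab]
  let ?A = "wedge (differential a x) (dJ a x) $ i $ j" and ?B = "wedge (differential b x) (dJ b x) $ i $ j"
  have d: "dd i (\<lambda>x. u x *\<^sub>R dJ a x + v x *\<^sub>R dJ b x) x = (u1 * differential a x $ i) *\<^sub>R dJ a x + u x *\<^sub>R dd i (dJ a) x
     + ((v2 * differential b x $ i) *\<^sub>R dJ b x + v x *\<^sub>R dd i (dJ b) x)" for i
    using diffble[OF u(1) x] diffble[OF v(1) x] diffble[OF sm(1) x] diffble[OF sm(2) x]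
    by (simp add: dd_add dd_scaleR u(2) v(2))
  have "dd i (\<lambda>x. u x *\<^sub>R dJ a x + v x *\<^sub>R dJ b x) x $ j - dd j (\<lambda>x. u x *\<^sub>R dJ a x + v x *\<^sub>R dJ b x) x $ i
     = u1 * ?A + u x * (dd i (dJ a) x $ j - dd j (dJ a) x $ i) + v2 * ?B + v x * (dd i (dJ b) x $ j - dd j (dJ b) x $ i)"
    unfolding d by (simp add: wedge_def algebra_simps)
  also have "\<dots> = (u1 + 2 * k * u x - v x * (sqnorm b x / (sqnorm a x * (a x - b x)))) * ?A
     + (v2 + 2 * l * v x + u x * (sqnorm a x / (sqnorm b x * (a x - b x)))) * ?B"
    unfolding dJ_exterior dJb by (simp add: algebra_simps)
  also have "\<dots> = 0" using 1 2 by simp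
  finally show ?thesis by simp
qed

end

text \<open>The function \<open>F (a)\<close> of the explicit metric. With exchanged arguments it is \<open>G (b)\<close>.\<close>

definition Ffun :: "(real^4 \<Rightarrow> real) \<Rightarrow> (real^4 \<Rightarrow> real) \<Rightarrow> real^4 \<Rightarrow> real" where
  "Ffun a b x = (a x - b x) * sqnorm a x"

text \<open>The differentials of the angular coordinates, solved from the formulas for \<open>J dz\<close> and \<open>J dt\<close>.\<close>

definition zform :: "(real^4 \<Rightarrow> real) \<Rightarrow> (real^4 \<Rightarrow> real) \<Rightarrow> real^4 \<Rightarrow> real^4" where
  "zform a b x = (- 1 / Ffun a b x) *\<^sub>R dJ a x + (- 1 / Ffun b a x) *\<^sub>R dJ b x"

definition tform :: "(real^4 \<Rightarrow> real) \<Rightarrow> (real^4 \<Rightarrow> real) \<Rightarrow> real^4 \<Rightarrow> real^4" where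
  "tform a b x = (a x / Ffun a b x) *\<^sub>R dJ a x + (b x / Ffun b a x) *\<^sub>R dJ b x"

lemma Ffun_nz: "orth_pair a b \<Longrightarrow> x \<in> S \<Longrightarrow> Ffun a b x \<noteq> 0"
  using pair_pos[of a b x] by (simp add: Ffun_def)

lemma smooth_Ffun: "orth_pair a b \<Longrightarrow> smooth_on S (Ffun a b)"
  unfolding Ffun_def[abs_def] by (intro smooth_intros open_S smooth_a smooth_b smooth_p) auto

lemma dd_differential_nth: "dd i a x = differential a x $ i"
  by (simp add: differential_def pd_eq_dd)

lemma zform_closed:
  assumes ab: "orth_pair a b" and x: "x \<in> S" and Ha: "normal_hess a b x k" and Hb: "normal_hess b a x l"
  shows "dd i (zform a b) x $ j = dd j (zform a b) x $ i" "dd i (tform a b) x $ j = dd j (tform a b) x $ i"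
proof -
  note ba = orth_pair_sym[OF ab]
  note nz = pair_pos[OF ab x]
  have F: "smooth_on S (Ffun a b)" "smooth_on S (Ffun b a)" by (rule smooth_Ffun[OF ab], rule smooth_Ffun[OF ba])
  have Fnz: "Ffun a b y \<noteq> 0" "Ffun b a y \<noteq> 0" if "y \<in> S" for y using Ffun_nz[OF ab that] Ffun_nz[OF ba that] .
  have dF: "dd i (Ffun a b) x = sqnorm a x * (1 + 2 * k * (a x - b x)) * differential a x $ i" for i
    unfolding dd_differential_nth Ffun_def[abs_def] differential_F[OF ab x Ha Hb] by simp
  have dG: "dd i (Ffun b a) x = sqnorm b x * (1 + 2 * l * (b x - a x)) * differential b x $ i" for i
    unfolding dd_differential_nth Ffun_def[abs_def] differential_F[OF ba x Hb Ha] by simp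
  have dJb: "dd i (dJ b) x $ j - dd j (dJ b) x $ i = 2 * l * wedge (differential b x) (dJ b x) $ i $ j
       - sqnorm b x / (sqnorm a x * (a x - b x)) * wedge (differential a x) (dJ a x) $ i $ j" for i j
    unfolding dJ_exterior[OF ba x Hb Ha] using nz by (simp add: field_simps)
  define e where "e = a x - b x"
  have e: "a x - b x = e" "b x - a x = - e" and e': "a x = b x + e" and nz': "e \<noteq> 0" "sqnorm a x \<noteq> 0" "sqnorm b x \<noteq> 0"
    using nz by (auto simp: e_def)
  note comb = closed_combination[OF ab x Ha Hb _ _ _ _ _ _ dJb]
  note df = diffble[OF F(1) x] diffble[OF F(2) x] diffble[OF smooth_a[OF ab] x] diffble[OF smooth_b[OF ab] x]
  show "dd i (zform a b) x $ j = dd j (zform a b) x $ i"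
    unfolding zform_def[abs_def]
  proof (rule comb)
    show "smooth_on S (\<lambda>x. - 1 / Ffun a b x)" "smooth_on S (\<lambda>x. - 1 / Ffun b a x)"
      by (intro smooth_intros open_S F Fnz; assumption)+
    show "dd i (\<lambda>x. - 1 / Ffun a b x) x = (sqnorm a x * (1 + 2 * k * (a x - b x)) / (Ffun a b x)\<^sup>2) * differential a x $ i" for i
      unfolding dd_divide[OF differentiable_const df(1) Fnz(1)[OF x]] dd_const dF by simp
    show "dd i (\<lambda>x. - 1 / Ffun b a x) x = (sqnorm b x * (1 + 2 * l * (b x - a x)) / (Ffun b a x)\<^sup>2) * differential b x $ i" for i
      unfolding dd_divide[OF differentiable_const df(2) Fnz(2)[OF x]] dd_const dG by simp
    show "sqnorm a x * (1 + 2 * k * (a x - b x)) / (Ffun a b x)\<^sup>2 + 2 * k * (- 1 / Ffun a b x)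
        = - 1 / Ffun b a x * (sqnorm b x / (sqnorm a x * (a x - b x)))"
      unfolding Ffun_def e unfolding e' using nz' by (simp add: field_simps power2_eq_square)
    show "sqnorm b x * (1 + 2 * l * (b x - a x)) / (Ffun b a x)\<^sup>2 + 2 * l * (- 1 / Ffun b a x)
        = - (- 1 / Ffun a b x) * (sqnorm a x / (sqnorm b x * (a x - b x)))"
      unfolding Ffun_def e unfolding e' using nz' by (simp add: field_simps power2_eq_square)
  qed
  show "dd i (tform a b) x $ j = dd j (tform a b) x $ i"
    unfolding tform_def[abs_def]
  proof (rule comb)
    show "smooth_on S (\<lambda>x. a x / Ffun a b x)" "smooth_on S (\<lambda>x. b x / Ffun b a x)"
      by (intro smooth_intros open_S F Fnz smooth_a[OF ab] smooth_b[OF ab]; assumption)+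
    show "dd i (\<lambda>x. a x / Ffun a b x) x = (1 / Ffun a b x - a x * (sqnorm a x * (1 + 2 * k * (a x - b x))) / (Ffun a b x)\<^sup>2) * differential a x $ i" for i
      unfolding dd_divide[OF df(3) df(1) Fnz(1)[OF x]] dF dd_differential_nth[of i a]
      using Fnz(1)[OF x] by (simp add: field_simps power2_eq_square)
    show "dd i (\<lambda>x. b x / Ffun b a x) x = (1 / Ffun b a x - b x * (sqnorm b x * (1 + 2 * l * (b x - a x))) / (Ffun b a x)\<^sup>2) * differential b x $ i" for i
      unfolding dd_divide[OF df(4) df(2) Fnz(2)[OF x]] dG dd_differential_nth[of i b]
      using Fnz(2)[OF x] by (simp add: field_simps power2_eq_square)
    show "1 / Ffun a b x - a x * (sqnorm a x * (1 + 2 * k * (a x - b x))) / (Ffun a b x)\<^sup>2 + 2 * k * (a x / Ffun a b x)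
        = b x / Ffun b a x * (sqnorm b x / (sqnorm a x * (a x - b x)))"
      unfolding Ffun_def e unfolding e' using nz' by (simp add: field_simps power2_eq_square)
    show "1 / Ffun b a x - b x * (sqnorm b x * (1 + 2 * l * (b x - a x))) / (Ffun b a x)\<^sup>2 + 2 * l * (b x / Ffun b a x)
        = - (a x / Ffun a b x) * (sqnorm a x / (sqnorm b x * (a x - b x)))"
      unfolding Ffun_def e unfolding e' using nz' by (simp add: field_simps power2_eq_square)
  qed
qed

lemma J_invariant_outer: "transpose (J x) ** outer u v ** J x = outer (Jc x u) (Jc x v)"
proof -
  have "transpose B ** outer u v ** B = outer (transpose B *v u) (transpose B *v v)" for B
    by (simp add: vec_eq_iff outer_def matrix_matrix_mult_def matrix_vector_mult_def transpose_def
        sum_product sum_distrib_left sum_distrib_right mult_ac del: transpose_matrix_vector)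
  then show ?thesis by (simp add: J_covector_eq outer_def del: transpose_matrix_vector)
qed

text \<open>The parts of the two Hessians that are not invariant cancel in the Hessians of \<open>a + b\<close> and \<open>a b\<close>.\<close>

lemma normal_hess_killing:
  assumes ab: "orth_pair a b" and x: "x \<in> S" and Ha: "normal_hess a b x k" and Hb: "normal_hess b a x l"
  shows "transpose (J x) ** hess (\<lambda>x. a x + b x) x ** J x = hess (\<lambda>x. a x + b x) x"
    "transpose (J x) ** hess (\<lambda>x. a x * b x) x ** J x = hess (\<lambda>x. a x * b x) x"
proof -
  note sm = smooth_a[OF ab] smooth_b[OF ab]
  define A A' B B' where "A = differential a x" and "A' = dJ a x" and "B = differential b x" and "B' = dJ b x"
  define p q c d where "p = sqnorm a x" and "q = sqnorm b x" and "c = a x" and "d = b x"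
  have nz: "p \<noteq> 0" "q \<noteq> 0" "c - d \<noteq> 0" "d - c \<noteq> 0" using pair_pos[OF ab x] by (auto simp: p_def q_def c_def d_def)
  define O1 O2 where "O1 = outer A A + outer A' A'" and "O2 = outer B B + outer B' B'"
  define N where "N = outer A B + outer B A - outer A' B' - outer B' A'"
  define I where "I = outer A B + outer B A + outer A' B' + outer B' A'"
  have ha: "hess a x = k *\<^sub>R O1 + (1 / (2 * (c - d))) *\<^sub>R (N + (p / q) *\<^sub>R O2)"
    using Ha unfolding normal_hess_def mixed_def
    by (simp add: vec_eq_iff hess_nth O1_def O2_def N_def outer_def A_def A'_def B_def B'_def p_def q_def c_def d_def algebra_simps)
  have hb: "hess b x = l *\<^sub>R O2 + (1 / (2 * (d - c))) *\<^sub>R (N + (q / p) *\<^sub>R O1)"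
    using Hb unfolding normal_hess_def mixed_def
    by (simp add: vec_eq_iff hess_nth O1_def O2_def N_def outer_def A_def A'_def B_def B'_def p_def q_def c_def d_def algebra_simps)
  have Js: "Jc x A = A'" "Jc x B = B'" "Jc x A' = - A" "Jc x B' = - B"
    by (simp_all add: A_def A'_def B_def B'_def dJ_def Jc_Jc[OF x])
  have om: "outer (- u) v = - outer u v" "outer u (- v) = - outer u v" for u v
    by (simp_all add: outer_def vec_eq_iff)
  have inv: "transpose (J x) ** O1 ** J x = O1" "transpose (J x) ** O2 ** J x = O2" "transpose (J x) ** I ** J x = I"
    by (simp_all add: O1_def O2_def I_def mm.add_right mm.add_left J_invariant_outer Js om)
  have lin: "transpose (J x) ** (r *\<^sub>R B1 + s *\<^sub>R B2 + t *\<^sub>R B3) ** J x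
      = r *\<^sub>R (transpose (J x) ** B1 ** J x) + s *\<^sub>R (transpose (J x) ** B2 ** J x) + t *\<^sub>R (transpose (J x) ** B3 ** J x)" for r s t B1 B2 B3
    by (simp add: mm.add_right mm.add_left mm.scaleR_left mm.scaleR_right)
  define s u v where "s = 1 / (2 * (c - d))" and "u = p / q" and "v = q / p"
  have s': "1 / (2 * (d - c)) = - s" "d * s = c * s - 1/2"
    using nz by (simp_all add: s_def divide_simps)
  note atoms = s_def[symmetric] u_def[symmetric] v_def[symmetric] s'(1)
  have e1: "hess (\<lambda>x. a x + b x) x = (k - s * v) *\<^sub>R O1 + (l + s * u) *\<^sub>R O2 + 0 *\<^sub>R I"
    unfolding hess_add[OF x sm] ha hb atoms by (simp add: algebra_simps)
  have e2: "hess (\<lambda>x. a x * b x) x = (d * k - c * s * v) *\<^sub>R O1 + (c * l + d * s * u) *\<^sub>R O2 + (1/2) *\<^sub>R I"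
  proof -
    have "outer A B + outer B A = (1/2) *\<^sub>R I + (1/2) *\<^sub>R N" by (simp add: I_def N_def vec_eq_iff field_simps)
    then have "hess (\<lambda>x. a x * b x) x = d *\<^sub>R hess a x + c *\<^sub>R hess b x + ((1/2) *\<^sub>R I + (1/2) *\<^sub>R N)"
      unfolding hess_mult[OF x sm] c_def d_def A_def B_def by (simp add: algebra_simps)
    also have "\<dots> = (d * k - c * s * v) *\<^sub>R O1 + (c * l + d * s * u) *\<^sub>R O2 + (d * s) *\<^sub>R N - (c * s) *\<^sub>R N + ((1/2) *\<^sub>R I + (1/2) *\<^sub>R N)"
      unfolding ha hb atoms by (simp add: algebra_simps)
    also have "\<dots> = (d * k - c * s * v) *\<^sub>R O1 + (c * l + d * s * u) *\<^sub>R O2 + (1/2) *\<^sub>R I"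
      unfolding s'(2) by (simp add: algebra_simps)
    finally show ?thesis .
  qed
  show "transpose (J x) ** hess (\<lambda>x. a x + b x) x ** J x = hess (\<lambda>x. a x + b x) x"
    unfolding e1 lin inv ..
  show "transpose (J x) ** hess (\<lambda>x. a x * b x) x ** J x = hess (\<lambda>x. a x * b x) x"
    unfolding e2 lin inv ..
qed

text \<open>The Kaehler form is the sum of the eigenforms of \<open>a\<close> and \<open>b\<close>. An invariant 2-form whose
  endomorphism has the gradients of \<open>a\<close> and \<open>b\<close> as eigenvectors is a combination of them.\<close>

definition eigenform :: "(real^4 \<Rightarrow> real) \<Rightarrow> real^4 \<Rightarrow> real^4^4" where
  "eigenform a x = (1 / sqnorm a x) *\<^sub>R wedge (differential a x) (dJ a x)"

text \<open>The diagonal entries \<open>k\<close> and \<open>l\<close> of the Hessians change \<open>da \<and> J da\<close> and \<open>db \<and> J db\<close> only by factors, which the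
  derivatives of the square norms compensate. The remaining terms add up to a formula that involves
  \<open>d (a + b)\<close> only.\<close>

lemma nF_pair_form:
  assumes ab: "orth_pair a b" and x: "x \<in> S" and Ha: "normal_hess a b x k" and Hb: "normal_hess b a x l"
  shows "nF i (\<lambda>x. a x *\<^sub>R eigenform a x + b x *\<^sub>R eigenform b x) x =
    (1/2) *\<^sub>R (wedge (differential a x + differential b x) (Jc x (g x $ i)) - wedge (dJ a x + dJ b x) (g x $ i))"
proof -
  note ba = orth_pair_sym[OF ab]
  note sm = smooth_a[OF ab] smooth_b[OF ab]
  note nz = pair_pos[OF ab x]
  have pnz: "sqnorm a y \<noteq> 0" "sqnorm b y \<noteq> 0" if "y \<in> S" for y using pair_pos[OF ab that] by auto
  define A A' B B' where "A = differential a x" and "A' = dJ a x" and "B = differential b x" and "B' = dJ b x"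
  have sw: "smooth_on S (\<lambda>x. wedge (differential a x) (dJ a x))" "smooth_on S (\<lambda>x. wedge (differential b x) (dJ b x))"
    by (intro smooth_intros open_S smooth_da[OF ab] smooth_db[OF ab] smooth_dJa[OF ab] smooth_dJb[OF ab])+
  have si: "smooth_on S (\<lambda>x. a x / sqnorm a x)" "smooth_on S (\<lambda>x. b x / sqnorm b x)"
    by (intro smooth_intros open_S sm smooth_p[OF ab] smooth_q[OF ab] pnz; assumption)+
  define P Q c where "P = 1 / sqnorm a x" and "Q = 1 / sqnorm b x" and "c = 1 / (2 * (a x - b x))"
  define ac bc where "ac = a x * c" and "bc = b x * c"
  have ac: "ac = bc + 1/2" unfolding ac_def bc_def c_def using nz by (simp add: field_simps)
  have pq: "P * (c * (sqnorm a x / sqnorm b x)) = c * Q" "Q * (c * (sqnorm b x / sqnorm a x)) = c * P"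
    using nz by (simp_all add: P_def Q_def)
  have cm: "1 / (2 * (b x - a x)) = - c" using nz by (simp add: c_def divide_simps)
  have d1: "dd i (\<lambda>x. a x / sqnorm a x) x = P * A $ i - 2 * k * a x * P * A $ i - 2 * ac * P * B $ i"
    unfolding dd_divide[OF diffble[OF sm(1) x] diffble[OF smooth_p[OF ab] x] nz(5)] dd_p[OF ab x Ha Hb] dd_differential_nth[of i a]
      A_def[symmetric] B_def[symmetric]
  proof -
    have "sqnorm a x / (a x - b x) = 2 * c * sqnorm a x" using nz by (simp add: c_def divide_simps)
    then show "(A $ i * sqnorm a x - a x * (2 * k * sqnorm a x * A $ i + sqnorm a x / (a x - b x) * B $ i)) / (sqnorm a x)\<^sup>2
      = P * A $ i - 2 * k * a x * P * A $ i - 2 * ac * P * B $ i"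
      using nz(5) by (simp add: P_def ac_def field_simps power2_eq_square)
  qed
  have d2: "dd i (\<lambda>x. b x / sqnorm b x) x = Q * B $ i - 2 * l * b x * Q * B $ i + 2 * bc * Q * A $ i"
    unfolding dd_divide[OF diffble[OF sm(2) x] diffble[OF smooth_q[OF ab] x] nz(6)] dd_p[OF ba x Hb Ha] dd_differential_nth[of i b]
      A_def[symmetric] B_def[symmetric]
  proof -
    have "sqnorm b x / (b x - a x) = - 2 * c * sqnorm b x" using nz by (simp add: c_def divide_simps) (simp add: algebra_simps)
    then show "(B $ i * sqnorm b x - b x * (2 * l * sqnorm b x * B $ i + sqnorm b x / (b x - a x) * A $ i)) / (sqnorm b x)\<^sup>2
      = Q * B $ i - 2 * l * b x * Q * B $ i + 2 * bc * Q * A $ i"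
      using nz(6) by (simp add: Q_def bc_def field_simps power2_eq_square)
  qed
  have split: "f * (P * (c * (sqnorm a x / sqnorm b x))) = f * c * Q" "f * (Q * (c * (sqnorm b x / sqnorm a x))) = f * c * P" for f
    unfolding pq by simp_all
  have n1: "(a x / sqnorm a x) *\<^sub>R nC i (differential a) x = (a x * k * P) *\<^sub>R (A $ i *\<^sub>R A + A' $ i *\<^sub>R A')
      + ac *\<^sub>R (P *\<^sub>R (A $ i *\<^sub>R B + B $ i *\<^sub>R A - A' $ i *\<^sub>R B' - B' $ i *\<^sub>R A') + Q *\<^sub>R (B $ i *\<^sub>R B + B' $ i *\<^sub>R B'))"
  proof -
    have "(a x / sqnorm a x) *\<^sub>R nC i (differential a) x = (a x * k * P) *\<^sub>R (A $ i *\<^sub>R A + A' $ i *\<^sub>R A')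
      + ((a x * c) * P) *\<^sub>R (A $ i *\<^sub>R B + B $ i *\<^sub>R A - A' $ i *\<^sub>R B' - B' $ i *\<^sub>R A')
      + (a x * (P * (c * (sqnorm a x / sqnorm b x)))) *\<^sub>R (B $ i *\<^sub>R B + B' $ i *\<^sub>R B')"
      unfolding nC_da[OF ab x Ha Hb] mixed_def A_def[symmetric] A'_def[symmetric] B_def[symmetric] B'_def[symmetric] c_def[symmetric]
      by (simp add: P_def scaleR_add_right scaleR_diff_right mult_ac)
    then show ?thesis unfolding split by (simp add: ac_def algebra_simps)
  qed
  have n2: "(b x / sqnorm b x) *\<^sub>R nC i (differential b) x = (b x * l * Q) *\<^sub>R (B $ i *\<^sub>R B + B' $ i *\<^sub>R B')
      - bc *\<^sub>R (Q *\<^sub>R (B $ i *\<^sub>R A + A $ i *\<^sub>R B - B' $ i *\<^sub>R A' - A' $ i *\<^sub>R B') + P *\<^sub>R (A $ i *\<^sub>R A + A' $ i *\<^sub>R A'))"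
  proof -
    have "(b x / sqnorm b x) *\<^sub>R nC i (differential b) x = (b x * l * Q) *\<^sub>R (B $ i *\<^sub>R B + B' $ i *\<^sub>R B')
      - ((b x * c) * Q) *\<^sub>R (B $ i *\<^sub>R A + A $ i *\<^sub>R B - B' $ i *\<^sub>R A' - A' $ i *\<^sub>R B')
      - (b x * (Q * (c * (sqnorm b x / sqnorm a x)))) *\<^sub>R (A $ i *\<^sub>R A + A' $ i *\<^sub>R A')"
      unfolding nC_da[OF ba x Hb Ha] mixed_def A_def[symmetric] A'_def[symmetric] B_def[symmetric] B'_def[symmetric] cm
      by (simp add: Q_def scaleR_add_right scaleR_diff_right mult_ac)
    then show ?thesis unfolding split by (simp add: bc_def algebra_simps)
  qed
  have n3: "(a x / sqnorm a x) *\<^sub>R nC i (dJ a) x = (a x * k * P) *\<^sub>R (A $ i *\<^sub>R A' - A' $ i *\<^sub>R A)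
      + ac *\<^sub>R (P *\<^sub>R (A $ i *\<^sub>R B' + B $ i *\<^sub>R A' + A' $ i *\<^sub>R B + B' $ i *\<^sub>R A) + Q *\<^sub>R (B $ i *\<^sub>R B' - B' $ i *\<^sub>R B))"
  proof -
    have "(a x / sqnorm a x) *\<^sub>R nC i (dJ a) x = (a x * k * P) *\<^sub>R (A $ i *\<^sub>R A' - A' $ i *\<^sub>R A)
      + ((a x * c) * P) *\<^sub>R (A $ i *\<^sub>R B' + B $ i *\<^sub>R A' + A' $ i *\<^sub>R B + B' $ i *\<^sub>R A)
      + (a x * (P * (c * (sqnorm a x / sqnorm b x)))) *\<^sub>R (B $ i *\<^sub>R B' - B' $ i *\<^sub>R B)"
      unfolding nC_dJa[OF ab x Ha Hb] mixed_def A_def[symmetric] A'_def[symmetric] B_def[symmetric] B'_def[symmetric] c_def[symmetric]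
      by (simp add: P_def scaleR_add_right scaleR_diff_right mult_ac)
    then show ?thesis unfolding split by (simp add: ac_def algebra_simps)
  qed
  have n4: "(b x / sqnorm b x) *\<^sub>R nC i (dJ b) x = (b x * l * Q) *\<^sub>R (B $ i *\<^sub>R B' - B' $ i *\<^sub>R B)
      - bc *\<^sub>R (Q *\<^sub>R (B $ i *\<^sub>R A' + A $ i *\<^sub>R B' + B' $ i *\<^sub>R A + A' $ i *\<^sub>R B) + P *\<^sub>R (A $ i *\<^sub>R A' - A' $ i *\<^sub>R A))"
  proof -
    have "(b x / sqnorm b x) *\<^sub>R nC i (dJ b) x = (b x * l * Q) *\<^sub>R (B $ i *\<^sub>R B' - B' $ i *\<^sub>R B)
      - ((b x * c) * Q) *\<^sub>R (B $ i *\<^sub>R A' + A $ i *\<^sub>R B' + B' $ i *\<^sub>R A + A' $ i *\<^sub>R B)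
      - (b x * (Q * (c * (sqnorm b x / sqnorm a x)))) *\<^sub>R (A $ i *\<^sub>R A' - A' $ i *\<^sub>R A)"
      unfolding nC_dJa[OF ba x Hb Ha] mixed_def A_def[symmetric] A'_def[symmetric] B_def[symmetric] B'_def[symmetric] cm
      by (simp add: Q_def scaleR_add_right scaleR_diff_right mult_ac)
    then show ?thesis unfolding split by (simp add: bc_def algebra_simps)
  qed
  have "nF i (\<lambda>x. a x *\<^sub>R eigenform a x + b x *\<^sub>R eigenform b x) x
    = nF i (\<lambda>x. (a x / sqnorm a x) *\<^sub>R wedge (differential a x) (dJ a x) + (b x / sqnorm b x) *\<^sub>R wedge (differential b x) (dJ b x)) x"
    by (simp add: eigenform_def)
  also have "\<dots> = dd i (\<lambda>x. a x / sqnorm a x) x *\<^sub>R wedge A A' + (a x / sqnorm a x) *\<^sub>R (wedge (nC i (differential a) x) A' + wedge A (nC i (dJ a) x))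
     + (dd i (\<lambda>x. b x / sqnorm b x) x *\<^sub>R wedge B B' + (b x / sqnorm b x) *\<^sub>R (wedge (nC i (differential b) x) B' + wedge B (nC i (dJ b) x)))"
    by (simp add: nF_add[OF x] smooth_on_scaleR open_S sw si nF_scaleR[OF x] A_def A'_def B_def B'_def
      nF_wedge[OF x smooth_da[OF ab] smooth_dJa[OF ab]] nF_wedge[OF x smooth_db[OF ab] smooth_dJb[OF ab]])
  finally have L: "nF i (\<lambda>x. a x *\<^sub>R eigenform a x + b x *\<^sub>R eigenform b x) x = \<dots>" .
  have L': "nF i (\<lambda>x. a x *\<^sub>R eigenform a x + b x *\<^sub>R eigenform b x) x =
     dd i (\<lambda>x. a x / sqnorm a x) x *\<^sub>R wedge A A'
     + (wedge ((a x / sqnorm a x) *\<^sub>R nC i (differential a) x) A' + wedge A ((a x / sqnorm a x) *\<^sub>R nC i (dJ a) x))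
     + (dd i (\<lambda>x. b x / sqnorm b x) x *\<^sub>R wedge B B'
     + (wedge ((b x / sqnorm b x) *\<^sub>R nC i (differential b) x) B' + wedge B ((b x / sqnorm b x) *\<^sub>R nC i (dJ b) x)))"
    unfolding L wedge_linear by (simp add: scaleR_add_right)
  have G: "g x $ i = P *\<^sub>R (A $ i *\<^sub>R A + A' $ i *\<^sub>R A') + Q *\<^sub>R (B $ i *\<^sub>R B + B' $ i *\<^sub>R B')"
    by (subst metric_decomp[OF ab x]) (simp add: vec_eq_iff outer_def A_def A'_def B_def B'_def P_def Q_def)
  have JG: "Jc x (P *\<^sub>R (A $ i *\<^sub>R A + A' $ i *\<^sub>R A') + Q *\<^sub>R (B $ i *\<^sub>R B + B' $ i *\<^sub>R B'))
      = P *\<^sub>R (A $ i *\<^sub>R A' - A' $ i *\<^sub>R A) + Q *\<^sub>R (B $ i *\<^sub>R B' - B' $ i *\<^sub>R B)"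
    unfolding J_covector_linear by (simp add: A_def A'_def B_def B'_def dJ_def Jc_Jc[OF x])
  show ?thesis
    unfolding L' d1 d2 n1 n2 n3 n4 G JG A_def[symmetric] A'_def[symmetric] B_def[symmetric] B'_def[symmetric] ac
    unfolding vec_eq_iff[of "_ + (_::real^4^4)"] vec_eq_iff[of "(_ + (_::real^4^4)) $ _"]
    by (simp add: wedge_def algebra_simps)
qed

end

section \<open>Hamiltonian forms with independent Killing fields\<close>

text \<open>The 3-form \<open>u \<and> v \<and> w\<close>.\<close>

definition tri :: "real^4 \<Rightarrow> real^4 \<Rightarrow> real^4 \<Rightarrow> 4 \<Rightarrow> 4 \<Rightarrow> 4 \<Rightarrow> real" where
  "tri u v w i j k = u $ i * (v $ j * w $ k - v $ k * w $ j) + u $ j * (v $ k * w $ i - v $ i * w $ k)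
     + u $ k * (v $ i * w $ j - v $ j * w $ i)"

definition contract3 :: "real^4 \<Rightarrow> real^4 \<Rightarrow> real^4 \<Rightarrow> (4 \<Rightarrow> 4 \<Rightarrow> 4 \<Rightarrow> real) \<Rightarrow> real" where
  "contract3 X Y Z T = (\<Sum>i\<in>UNIV. \<Sum>j\<in>UNIV. \<Sum>k\<in>UNIV. X $ i * Y $ j * Z $ k * T i j k)"

lemma contract3_product: "contract3 X Y Z (\<lambda>i j k. u $ i * v $ j * w $ k) = (u \<bullet> X) * (v \<bullet> Y) * (w \<bullet> Z)"
proof -
  define c where "c j k = v $ j * Y $ j * (w $ k * Z $ k)" for j k
  have "(v \<bullet> Y) * (w \<bullet> Z) = (\<Sum>j\<in>UNIV. \<Sum>k\<in>UNIV. c j k)"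
    by (simp add: inner_vec_def sum_product c_def)
  then have "(u \<bullet> X) * (v \<bullet> Y) * (w \<bullet> Z) = (\<Sum>i\<in>UNIV. u $ i * X $ i * (\<Sum>j\<in>UNIV. \<Sum>k\<in>UNIV. c j k))"
    unfolding mult.assoc by (simp add: inner_vec_def[of u] sum_distrib_right mult.assoc)
  then show ?thesis unfolding contract3_def by (simp add: sum_distrib_left c_def mult_ac)
qed

lemma contract3_diff: "contract3 X Y Z (\<lambda>i j k. S i j k - T i j k) = contract3 X Y Z S - contract3 X Y Z T"
  by (simp add: contract3_def right_diff_distrib sum_subtractf)
lemma contract3_add: "contract3 X Y Z (\<lambda>i j k. S i j k + T i j k) = contract3 X Y Z S + contract3 X Y Z T"
  by (simp add: contract3_def distrib_left sum.distrib)
lemma contract3_scale: "contract3 X Y Z (\<lambda>i j k. c * T i j k) = c * contract3 X Y Z T"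
  by (simp add: contract3_def sum_distrib_left mult_ac)

lemma contract3_tri: "contract3 X Y Z (tri u v w) =
   (u \<bullet> X) * ((v \<bullet> Y) * (w \<bullet> Z) - (v \<bullet> Z) * (w \<bullet> Y)) + (u \<bullet> Y) * ((v \<bullet> Z) * (w \<bullet> X) - (v \<bullet> X) * (w \<bullet> Z))
     + (u \<bullet> Z) * ((v \<bullet> X) * (w \<bullet> Y) - (v \<bullet> Y) * (w \<bullet> X))"
proof -
  have t: "tri u v w = (\<lambda>i j k. (u $ i * v $ j * w $ k - u $ i * w $ j * v $ k) + (w $ i * u $ j * v $ k - v $ i * u $ j * w $ k)
     + (v $ i * w $ j * u $ k - w $ i * v $ j * u $ k))"
    by (simp add: fun_eq_iff tri_def algebra_simps)
  show ?thesis unfolding t contract3_add contract3_diff contract3_product by (simp add: algebra_simps)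
qed

lemma wedge_eval: "X \<bullet> (wedge u v *v Y) = (u \<bullet> X) * (v \<bullet> Y) - (v \<bullet> X) * (u \<bullet> Y)"
  unfolding wedge_outer by (simp add: mv.diff_left inner_diff_right outer_eval)

lemma form_inner_wedge:
  assumes "transpose (matrix_inv g) = matrix_inv g" "alternating \<Psi>"
  shows "form_inner g (wedge u v) \<Psi> = (matrix_inv g *v u) \<bullet> (\<Psi> *v (matrix_inv g *v v))"
proof -
  let ?h = "matrix_inv g" and ?B = "matrix_inv g ** \<Psi> ** matrix_inv g"
  have hu: "(?h *v u) \<bullet> (\<Psi> *v (?h *v v)) = u \<bullet> (?B *v v)" for u v
    by (metis assms(1) inner_transpose matrix_vector_mul_assoc)
  have alt: "v \<bullet> (?B *v u) = - (u \<bullet> (?B *v v))" for u v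
  proof -
    have tp: "transpose \<Psi> = - \<Psi>" using assms(2) by (simp add: alternating_def)
    have "(?h *v v) \<bullet> (\<Psi> *v (?h *v u)) = (transpose \<Psi> *v (?h *v v)) \<bullet> (?h *v u)"
      using inner_transpose[of "?h *v v" "transpose \<Psi>" "?h *v u"] by (simp del: transpose_matrix_vector)
    then show ?thesis unfolding hu[symmetric] tp by (simp add: mv.minus_left inner_commute)
  qed
  have "form_inner g (wedge u v) \<Psi> = (1/2) * (\<Sum>i\<in>UNIV. \<Sum>j\<in>UNIV. wedge u v $ i $ j * ?B $ i $ j)"
    unfolding form_inner_trace assms(1) trace_transpose_mult ..
  also have "(\<Sum>i\<in>UNIV. \<Sum>j\<in>UNIV. wedge u v $ i $ j * ?B $ i $ j)
     = (\<Sum>i\<in>UNIV. \<Sum>j\<in>UNIV. u $ i * v $ j * ?B $ i $ j) - (\<Sum>i\<in>UNIV. \<Sum>j\<in>UNIV. v $ i * u $ j * ?B $ i $ j)"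
    by (simp only: sum_subtractf[symmetric] wedge_def vec_lambda_beta left_diff_distrib mult.assoc mult.commute[of "v $ _" "u $ _"])
  also have "\<dots> = u \<bullet> (?B *v v) - v \<bullet> (?B *v u)"
    by (simp add: inner_vec_def matrix_vector_mult_def sum_distrib_left mult_ac)
  finally show ?thesis unfolding hu using alt[of v u] by simp
qed

context kahler_chart
begin

lemma smooth_form_inner:
  assumes "smooth_on S \<phi>" "smooth_on S \<psi>"
  shows "smooth_on S (\<lambda>x. form_inner (g x) (\<phi> x) (\<psi> x))"
  unfolding form_inner_trace by (intro smooth_intros open_S assms smooth_h)

lemma smooth_omega: "smooth_on S \<omega>"
  by (intro smooth_intros open_S smooth_g smooth_J)

text \<open>The Hessian of \<open>a\<close> in normal form up to an arbitrary symmetric block on the span of \<open>da\<close> and \<open>J da\<close>.\<close>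

definition weak_hess :: "(real^4 \<Rightarrow> real) \<Rightarrow> (real^4 \<Rightarrow> real) \<Rightarrow> real^4 \<Rightarrow> real \<Rightarrow> real \<Rightarrow> real \<Rightarrow> bool" where
  "weak_hess a b x r s t \<longleftrightarrow> (\<forall>i. nC i (differential a) x =
     r *\<^sub>R (differential a x $ i *\<^sub>R differential a x) + s *\<^sub>R (differential a x $ i *\<^sub>R dJ a x + dJ a x $ i *\<^sub>R differential a x)
     + t *\<^sub>R (dJ a x $ i *\<^sub>R dJ a x) + mixed a b x i)"

definition theta :: "(real^4 \<Rightarrow> real) \<Rightarrow> real^4 \<Rightarrow> real^4" where
  "theta a x = (1 / sqnorm a x) *\<^sub>R dJ a x"

lemma smooth_theta: "orth_pair a b \<Longrightarrow> smooth_on S (theta a)"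
  unfolding theta_def[abs_def]
  by (intro smooth_intros open_S smooth_p smooth_dJa) (auto dest: pair_pos)

lemma weak_hess_dd_p:
  assumes ab: "orth_pair a b" and x: "x \<in> S" and H: "weak_hess a b x r s t"
  shows "dd i (sqnorm a) x = 2 * sqnorm a x * (r * differential a x $ i + s * dJ a x $ i) + sqnorm a x / (a x - b x) * differential b x $ i"
proof -
  have "dd i (sqnorm a) x = 2 * (nC i (differential a) x \<bullet> (h x *v differential a x))"
    unfolding sqnorm_def[abs_def] dd_inner_h[OF x smooth_da[OF ab] smooth_da[OF ab]]
    by (simp add: inner_h_sym[OF x, of "differential a x"])
  then show ?thesis
    using H[unfolded weak_hess_def, rule_format, of i] pair_pos[OF ab x]
    by (simp add: mixed_def inner_add_left inner_diff_left pairings[OF ab x] field_simps)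
qed

text \<open>The off-diagonal entry \<open>s\<close> contributes only symmetric terms to the covariant derivative.\<close>

lemma weak_hess_dtheta:
  assumes ab: "orth_pair a b" and x: "x \<in> S" and H: "weak_hess a b x r s t"
  shows "dd i (theta a) x $ j - dd j (theta a) x $ i = (t - r) * wedge (differential a x) (theta a x) $ i $ j
     + 1 / (a x - b x) * wedge (differential b x) (theta b x - theta a x) $ i $ j"
proof -
  note nz = pair_pos[OF ab x]
  define A A' B B' where "A = differential a x" and "A' = dJ a x" and "B = differential b x" and "B' = dJ b x"
  define P Q c where "P = 1 / sqnorm a x" and "Q = 1 / sqnorm b x" and "c = 1 / (2 * (a x - b x))"
  have c: "1 / (a x - b x) = 2 * c" "sqnorm a x / (a x - b x) = 2 * c * sqnorm a x"
    using nz by (simp_all add: c_def divide_simps)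
  have dP: "dd i (\<lambda>x. 1 / sqnorm a x) x = - 2 * P * (r * A $ i + s * A' $ i) - 2 * c * P * B $ i" for i
    unfolding dd_divide[OF differentiable_const diffble[OF smooth_p[OF ab] x] nz(5)] dd_const weak_hess_dd_p[OF ab x H] c
    using nz(5) by (simp add: P_def A_def A'_def B_def field_simps power2_eq_square)
  have pnz: "sqnorm a y \<noteq> 0" if "y \<in> S" for y using pair_pos[OF ab that] by auto
  have sP: "smooth_on S (\<lambda>x. 1 / sqnorm a x)" by (intro smooth_intros open_S smooth_p[OF ab] pnz)
  have "nC i (dJ a) x = Jc x (nC i (differential a) x)" for i
    unfolding dJ_def[abs_def] by (rule nC_Jc[OF x smooth_da[OF ab]])
  then have nJ: "nC i (dJ a) x = r *\<^sub>R (A $ i *\<^sub>R A') + s *\<^sub>R (A' $ i *\<^sub>R A' - A $ i *\<^sub>R A) - t *\<^sub>R (A' $ i *\<^sub>R A)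
     + c *\<^sub>R (A $ i *\<^sub>R B' + B $ i *\<^sub>R A' + A' $ i *\<^sub>R B + B' $ i *\<^sub>R A + (sqnorm a x * Q) *\<^sub>R (B $ i *\<^sub>R B' - B' $ i *\<^sub>R B))" for i
    using H[unfolded weak_hess_def mixed_def, rule_format, of i]
    by (simp add: J_covector_linear dJ_def Jc_Jc[OF x] A_def A'_def B_def B'_def c_def Q_def)
  have nT: "nC i (theta a) x = dd i (\<lambda>x. 1 / sqnorm a x) x *\<^sub>R A' + P *\<^sub>R nC i (dJ a) x" for i
    unfolding theta_def[abs_def] nC_scaleR[OF x sP smooth_dJa[OF ab]] by (simp add: A'_def P_def)
  have PP: "P * (c * (sqnorm a x * Q * y)) = c * Q * y" for y using nz by (simp add: P_def)
  have "P *\<^sub>R nC i (dJ a) x = P *\<^sub>R (r *\<^sub>R (A $ i *\<^sub>R A') + s *\<^sub>R (A' $ i *\<^sub>R A' - A $ i *\<^sub>R A) - t *\<^sub>R (A' $ i *\<^sub>R A)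
     + c *\<^sub>R (A $ i *\<^sub>R B' + B $ i *\<^sub>R A' + A' $ i *\<^sub>R B + B' $ i *\<^sub>R A)) + (c * Q) *\<^sub>R (B $ i *\<^sub>R B' - B' $ i *\<^sub>R B)" for i
    unfolding nJ by (simp add: scaleR_add_right scaleR_diff_right) (simp only: PP)
  note nT' = nT[unfolded this dP]
  show ?thesis
    unfolding d_covector[OF x] nT' c theta_def A_def[symmetric] A'_def[symmetric] B_def[symmetric] B'_def[symmetric]
      P_def[symmetric] Q_def[symmetric]
    by (simp add: wedge_def algebra_simps)
qed

lemma dd2_component:
  assumes "smooth_on S \<theta>" "x \<in> S"
  shows "dd k (\<lambda>x. dd i \<theta> x $ j) x = dd k (dd i \<theta>) x $ j"
  by (rule dd_nth[OF diffble[OF smooth_on_dd[OF assms(1)] assms(2)]])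

text \<open>The remaining entries are pinned down by \<open>d\<^sup>2 = 0\<close>. The equation for the exterior derivative of
  \<open>J da / |da|\<^sup>2\<close> can be differentiated once more and has no solution unless the two diagonal
  entries agree.\<close>

lemma weak_hess_diagonal:
  assumes ab: "orth_pair a b" and sm: "smooth_on S r" "smooth_on S t"
    and Ha: "\<And>x. x \<in> S \<Longrightarrow> weak_hess a b x (r x) (s x) (t x)"
    and Hb: "\<And>x. x \<in> S \<Longrightarrow> weak_hess b a x (r' x) (s' x) (t' x)"
    and x: "x \<in> S"
  shows "r x = t x"
proof -
  note ba = orth_pair_sym[OF ab]
  note nz = pair_pos[OF ab x]
  let ?m = "\<lambda>x. theta b x - theta a x" and ?da = "differential a" and ?db = "differential b"
  define z where "z x = t x - r x" for x
  define e where "e x = 1 / (a x - b x)" for x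
  have sz: "smooth_on S z" unfolding z_def[abs_def] by (intro smooth_intros open_S sm)
  have abnz: "a y - b y \<noteq> 0" if "y \<in> S" for y using pair_pos[OF ab that] by auto
  have se: "smooth_on S e" unfolding e_def[abs_def]
    by (intro smooth_intros open_S smooth_a[OF ab] smooth_b[OF ab] abnz)
  have sth: "smooth_on S (theta a)" "smooth_on S (theta b)" using smooth_theta[OF ab] smooth_theta[OF ba] by auto
  have smm: "smooth_on S ?m" by (intro smooth_intros open_S sth)
  have w: "dd i (theta a) x $ j - dd j (theta a) x $ i = z x * wedge (?da x) (theta a x) $ i $ j + e x * wedge (?db x) (?m x) $ i $ j"
    if "x \<in> S" for i j x
    using weak_hess_dtheta[OF ab that Ha[OF that]] by (simp add: z_def e_def)
  have w': "dd i (theta b) x $ j - dd j (theta b) x $ i = (t' x - r' x) * wedge (?db x) (theta b x) $ i $ j + e x * wedge (?da x) (?m x) $ i $ j"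
    for i j
    using weak_hess_dtheta[OF ba x Hb[OF x]] nz by (simp add: e_def wedge_def divide_simps) (simp add: algebra_simps)
  have dde: "dd i e x = (e x)\<^sup>2 * (?db x $ i - ?da x $ i)" for i
    unfolding e_def[abs_def]
    using diffble[OF smooth_a[OF ab] x] diffble[OF smooth_b[OF ab] x] nz
    by (simp add: dd_divide dd_const dd_diff dd_differential_nth[of i a] dd_differential_nth[of i b] power_divide)
  have ddm: "dd i ?m x = dd i (theta b) x - dd i (theta a) x" for i
    by (rule dd_diff[OF diffble[OF sth(2) x] diffble[OF sth(1) x]])
  note sd = smooth_da[OF ab] smooth_db[OF ab]
  have sww: "smooth_on S (\<lambda>x. wedge (?da x) (theta a x))" "smooth_on S (\<lambda>x. wedge (?db x) (?m x))"
    by (intro smooth_intros open_S sd sth)+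
  have ddw: "dd k (dd i (theta a)) x $ j - dd k (dd j (theta a)) x $ i =
      dd k z x * wedge (?da x) (theta a x) $ i $ j + z x * (wedge (dd k ?da x) (theta a x) + wedge (?da x) (dd k (theta a) x)) $ i $ j
      + (dd k e x * wedge (?db x) (?m x) $ i $ j + e x * (wedge (dd k ?db x) (?m x) + wedge (?db x) (dd k ?m x)) $ i $ j)" for i j k
  proof -
    have d0: "(\<lambda>x. dd i (theta a) x $ j) differentiable (at x)" for i j
      by (intro diffble[OF _ x] smooth_intros open_S sth)
    have "dd k (\<lambda>x. dd i (theta a) x $ j - dd j (theta a) x $ i) x
       = dd k (\<lambda>x. (z x *\<^sub>R wedge (?da x) (theta a x) + e x *\<^sub>R wedge (?db x) (?m x)) $ i $ j) x"
      by (rule dd_cong[OF open_S x]) (simp add: w)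
    also have "\<dots> = dd k (\<lambda>x. z x *\<^sub>R wedge (?da x) (theta a x) + e x *\<^sub>R wedge (?db x) (?m x)) x $ i $ j"
    proof -
      have "smooth_on S (\<lambda>x. z x *\<^sub>R wedge (?da x) (theta a x) + e x *\<^sub>R wedge (?db x) (?m x))"
        by (intro smooth_intros open_S sww sz se)
      from pd_entry[OF x this, unfolded pd_eq_dd] show ?thesis .
    qed
    also have "dd k (\<lambda>x. z x *\<^sub>R wedge (?da x) (theta a x) + e x *\<^sub>R wedge (?db x) (?m x)) x =
      (dd k z x *\<^sub>R wedge (?da x) (theta a x) + z x *\<^sub>R (wedge (dd k ?da x) (theta a x) + wedge (?da x) (dd k (theta a) x)))
      + (dd k e x *\<^sub>R wedge (?db x) (?m x) + e x *\<^sub>R (wedge (dd k ?db x) (?m x) + wedge (?db x) (dd k ?m x)))"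
      unfolding dd_add[OF diffble[OF smooth_on_scaleR[OF open_S sz sww(1)] x] diffble[OF smooth_on_scaleR[OF open_S se sww(2)] x]]
        dd_scaleR[OF diffble[OF sz x] diffble[OF sww(1) x]] dd_scaleR[OF diffble[OF se x] diffble[OF sww(2) x]]
        dd_wedge[OF diffble[OF sd(1) x] diffble[OF sth(1) x]] dd_wedge[OF diffble[OF sd(2) x] diffble[OF smm x]] ..
    finally show ?thesis
      unfolding dd_diff[OF d0 d0] dd2_component[OF sth(1) x] by simp
  qed
  have z3: "tri (differential z x) (?da x) (theta a x) i j k - z x * e x * tri (?da x) (?db x) (theta b x) i j k = 0" for i j k
  proof -
    have c: "dd i (dd j (theta a)) x = dd j (dd i (theta a)) x" for i j
      by (rule dd_commute[OF open_S sth(1) x])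
    have ca: "dd i ?da x $ j = dd j ?da x $ i" "dd i ?db x $ j = dd j ?db x $ i" for i j
      using dd_differential[OF x smooth_a[OF ab]] dd_commute_real[OF open_S smooth_a[OF ab] x]
        dd_differential[OF x smooth_b[OF ab]] dd_commute_real[OF open_S smooth_b[OF ab] x] by simp_all
    have zi: "dd i z x = differential z x $ i" for i by (rule dd_differential_nth)
    let ?w1 = "\<lambda>i j. dd i (theta a) x $ j - dd j (theta a) x $ i" and ?w2 = "\<lambda>i j. dd i (theta b) x $ j - dd j (theta b) x $ i"
    have "0 = (dd k (dd i (theta a)) x $ j - dd k (dd j (theta a)) x $ i) + (dd i (dd j (theta a)) x $ k - dd i (dd k (theta a)) x $ j)
       + (dd j (dd k (theta a)) x $ i - dd j (dd i (theta a)) x $ k)"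
      using c[of i j] c[of j k] c[of k i] by simp
    also have "\<dots> = tri (differential z x) (?da x) (theta a x) i j k
       - z x * (?da x $ i * ?w1 j k + ?da x $ j * ?w1 k i + ?da x $ k * ?w1 i j)
       - (e x)\<^sup>2 * tri (?da x - ?db x) (?db x) (?m x) i j k
       - e x * (?db x $ i * (?w2 j k - ?w1 j k) + ?db x $ j * (?w2 k i - ?w1 k i) + ?db x $ k * (?w2 i j - ?w1 i j))"
      unfolding ddw ddm dde zi wedge_def tri_def
      using ca(1)[of i j] ca(1)[of j k] ca(1)[of k i] ca(2)[of i j] ca(2)[of j k] ca(2)[of k i]
      by (simp add: algebra_simps)
    also have "\<dots> = tri (differential z x) (?da x) (theta a x) i j k - z x * e x * tri (?da x) (?db x) (theta b x) i j k"
      unfolding w[OF x] w' wedge_def tri_def by (simp add: algebra_simps power2_eq_square)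
    finally show ?thesis by simp
  qed
  \<comment> \<open>On these three vectors the first 3-form vanishes and the second one does not.\<close>
  let ?X = "h x *v ?da x" and ?Y = "h x *v ?db x" and ?Z = "h x *v dJ b x"
  have "contract3 ?X ?Y ?Z (\<lambda>i j k. tri (differential z x) (?da x) (theta a x) i j k - z x * e x * tri (?da x) (?db x) (theta b x) i j k) = 0"
    unfolding z3 by (simp add: contract3_def)
  then have "contract3 ?X ?Y ?Z (tri (differential z x) (?da x) (theta a x)) - z x * e x * contract3 ?X ?Y ?Z (tri (?da x) (?db x) (theta b x)) = 0"
    unfolding contract3_diff contract3_scale .
  then have "z x * e x = 0"
    unfolding contract3_tri using nz
    by (simp add: pairings[OF ab x] theta_def)
  then show ?thesis using nz by (simp add: z_def e_def)
qed

text \<open>The differential of \<open>(a - b) |da|\<^sup>2\<close> has a component along \<open>J da\<close> proportional to the off-diagonal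
  entry. Its exterior derivative vanishes only if this component does.\<close>

lemma weak_hess_offdiagonal:
  assumes ab: "orth_pair a b" and sm: "smooth_on S r" "smooth_on S s"
    and Ha: "\<And>x. x \<in> S \<Longrightarrow> weak_hess a b x (r x) (s x) (r x)"
    and x: "x \<in> S"
  shows "s x = 0"
proof -
  note nz = pair_pos[OF ab x]
  let ?da = "differential a" and ?db = "differential b" and ?m = "theta b x - theta a x"
  define f where "f x = sqnorm a x * (1 + 2 * (a x - b x) * r x)" for x
  define y where "y x = 2 * (a x - b x) * (sqnorm a x)\<^sup>2 * s x" for x
  note sa = smooth_a[OF ab] smooth_b[OF ab] smooth_p[OF ab] and sd = smooth_da[OF ab] smooth_db[OF ab]
  have sf: "smooth_on S f" unfolding f_def[abs_def] by (intro smooth_intros open_S sa sm)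
  have sy: "smooth_on S y" unfolding y_def[abs_def] by (intro smooth_intros open_S sa sm)
  note sth = smooth_theta[OF ab]
  have sF: "smooth_on S (Ffun a b)" by (rule smooth_Ffun[OF ab])
  have dF: "differential (Ffun a b) x = f x *\<^sub>R ?da x + y x *\<^sub>R theta a x" if "x \<in> S" for x
  proof -
    note nz = pair_pos[OF ab that]
    have "dd i (Ffun a b) x = (dd i a x - dd i b x) * sqnorm a x + (a x - b x) * dd i (sqnorm a) x" for i
      unfolding Ffun_def[abs_def]
      using diffble[OF sa(1) that] diffble[OF sa(2) that] diffble[OF sa(3) that] by (simp add: dd_mult dd_diff)
    also have "\<dots> i = (?da x $ i - ?db x $ i) * sqnorm a x + (2 * (a x - b x) * sqnorm a x * (r x * ?da x $ i + s x * dJ a x $ i)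
        + sqnorm a x * ?db x $ i)" for i
      unfolding weak_hess_dd_p[OF ab that Ha[OF that]] dd_differential_nth[of i a] dd_differential_nth[of i b] distrib_left
      using nz by simp (simp add: algebra_simps)
    also have "\<dots> i = f x * ?da x $ i + y x * theta a x $ i" for i
      using nz by (simp add: f_def y_def theta_def power2_eq_square algebra_simps)
    finally have "dd i (Ffun a b) x = f x * ?da x $ i + y x * theta a x $ i" for i .
    then show ?thesis by (simp add: differential_def[of "Ffun a b"] pd_eq_dd vec_eq_iff)
  qed
  have "wedge (differential f x) (?da x) + wedge (differential y x) (theta a x)
     + (y x * (1 / (a x - b x))) *\<^sub>R wedge (?db x) ?m = 0"
  proof -
    have d: "dd i (differential (Ffun a b)) x = (dd i f x *\<^sub>R ?da x + f x *\<^sub>R dd i ?da x) + (dd i y x *\<^sub>R theta a x + y x *\<^sub>R dd i (theta a) x)" for i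
    proof -
      have "dd i (differential (Ffun a b)) x = dd i (\<lambda>x. f x *\<^sub>R ?da x + y x *\<^sub>R theta a x) x"
        by (rule dd_cong[OF open_S x]) (rule dF)
      then show ?thesis
        unfolding dd_add[OF diffble[OF smooth_on_scaleR[OF open_S sf sd(1)] x] diffble[OF smooth_on_scaleR[OF open_S sy sth] x]]
          dd_scaleR[OF diffble[OF sf x] diffble[OF sd(1) x]] dd_scaleR[OF diffble[OF sy x] diffble[OF sth x]] .
    qed
    have c: "dd i (differential (Ffun a b)) x $ j = dd j (differential (Ffun a b)) x $ i" "dd i ?da x $ j = dd j ?da x $ i" for i j
      using dd_differential[OF x sa(1)] dd_commute_real[OF open_S sa(1) x]
        dd_differential[OF x sF] dd_commute_real[OF open_S sF x] by simp_all
    have w: "dd i (theta a) x $ j - dd j (theta a) x $ i = 1 / (a x - b x) * wedge (?db x) ?m $ i $ j" for i j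
      using weak_hess_dtheta[OF ab x Ha[OF x]] by simp
    have "(wedge (differential f x) (?da x) + wedge (differential y x) (theta a x)
     + (y x * (1 / (a x - b x))) *\<^sub>R wedge (?db x) ?m) $ i $ j = 0" for i j
    proof -
      have "(wedge (differential f x) (?da x) + wedge (differential y x) (theta a x)
        + (y x * (1 / (a x - b x))) *\<^sub>R wedge (?db x) ?m) $ i $ j
        = wedge (differential f x) (?da x) $ i $ j + wedge (differential y x) (theta a x) $ i $ j
        + y x * (dd i (theta a) x $ j - dd j (theta a) x $ i)"
        unfolding w by simp
      also have "\<dots> = dd i (differential (Ffun a b)) x $ j - dd j (differential (Ffun a b)) x $ i"
        unfolding d dd_differential_nth[of _ f] dd_differential_nth[of _ y] using c(2)[of i j]
        by (simp add: wedge_def algebra_simps)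
      finally show ?thesis using c(1)[of i j] by simp
    qed
    then show ?thesis by (simp add: vec_eq_iff)
  qed
  \<comment> \<open>On this pair of vectors only the last of the three 2-forms is not zero.\<close>
  from arg_cong[OF this, of "\<lambda>B. (h x *v ?db x) \<bullet> (B *v (h x *v dJ b x))"]
  have "y x * (1 / (a x - b x)) = 0"
    unfolding mv.add_left mv.scaleR_left inner_add_right inner_scaleR_right wedge_eval
    using nz by (simp add: pairings[OF ab x] theta_def inner_diff_left)
  then show ?thesis using nz by (simp add: y_def)
qed

end

lemma transpose_outer_mult: "B ** outer u v = outer (B *v u) v"
  by (simp add: vec_eq_iff outer_def matrix_matrix_mult_def matrix_vector_mult_def sum_distrib_right mult.assoc)

lemma outer_linear:
  "outer (- u) v = - outer u v" "outer u (- v) = - outer u v"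
  "outer (u + u') v = outer u v + outer u' v" "outer u (v + v') = outer u v + outer u v'"
  by (simp_all add: outer_def vec_eq_iff algebra_simps)

lemma outer_mult_vec: "outer u v *v w = (v \<bullet> w) *\<^sub>R u"
  by (simp add: vec_eq_iff outer_def matrix_vector_mult_def inner_vec_def sum_distrib_left sum_distrib_right mult_ac)

lemma form_inner_commute:
  assumes "transpose (matrix_inv g) = matrix_inv g"
  shows "form_inner g \<phi> \<psi> = form_inner g \<psi> \<phi>"
proof -
  let ?h = "matrix_inv g"
  have "trace (transpose \<phi> ** (?h ** \<psi> ** ?h)) = trace (transpose (transpose \<phi> ** (?h ** \<psi> ** ?h)))"
    by (simp add: trace_def transpose_def)
  also have "\<dots> = trace ((?h ** transpose \<psi> ** ?h) ** \<phi>)"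
    by (simp add: matrix_transpose_mul assms matrix_mul_assoc)
  also have "\<dots> = trace (?h ** (transpose \<psi> ** ?h ** \<phi>))" by (simp add: matrix_mul_assoc)
  also have "\<dots> = trace ((transpose \<psi> ** ?h ** \<phi>) ** ?h)" by (rule trace_mul_sym)
  finally show ?thesis unfolding form_inner_trace assms by (simp add: matrix_mul_assoc)
qed

text \<open>A hamiltonian 2-form \<open>\<phi>\<close> with trace \<open>\<sigma>\<close> and trace-free part \<open>\<Phi>\<close> in a chart, where the two roots \<open>a\<close> and \<open>b\<close> of
  \<open>t\<^sup>2 - \<sigma> t + \<pi>\<close> are distinct and without critical points.\<close>

locale hamiltonian_chart = kahler_chart S g J
  for S :: "(real^4) set" and g J :: "real^4 \<Rightarrow> real^4^4" +
  fixes \<phi> \<Phi> :: "real^4 \<Rightarrow> real^4^4" and \<sigma> a b :: "real^4 \<Rightarrow> real"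
  assumes smooth_phi: "smooth_on S \<phi>"
    and alt_phi: "\<And>x. x \<in> S \<Longrightarrow> alternating (\<phi> x)"
    and inv_phi: "\<And>x. x \<in> S \<Longrightarrow> transpose (J x) ** \<phi> x ** J x = \<phi> x"
    and closed_phi: "\<And>x. x \<in> S \<Longrightarrow> d_form \<phi> x = 0"
    and sigma_eq: "\<And>x. x \<in> S \<Longrightarrow> \<sigma> x = form_inner (g x) (\<phi> x) (\<omega> x) / 3"
    and Phi_eq: "\<And>x. x \<in> S \<Longrightarrow> \<Phi> x = \<phi> x - (3/2 * \<sigma> x) *\<^sub>R \<omega> x"
    and twistor: "\<And>x. x \<in> S \<Longrightarrow> nabla_form g \<Phi> x \<in> V0 (g x) (J x)"
    and smooth_ab: "smooth_on S a" "smooth_on S b"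
    and distinct: "\<And>x. x \<in> S \<Longrightarrow> a x \<noteq> b x"
    and sum_eq: "\<And>x. x \<in> S \<Longrightarrow> a x + b x = \<sigma> x"
    and prod_eq: "\<And>x. x \<in> S \<Longrightarrow> a x * b x =
      ((\<sigma> x)\<^sup>2 - form_inner (g x) (\<phi> x - \<sigma> x *\<^sub>R \<omega> x) (\<phi> x - \<sigma> x *\<^sub>R \<omega> x)) / 2"
    and nonzero: "\<And>x. x \<in> S \<Longrightarrow> differential a x \<noteq> 0" "\<And>x. x \<in> S \<Longrightarrow> differential b x \<noteq> 0"
begin

text \<open>\<open>\<Psi>\<close> is twice the normalized form, and \<open>Q\<close> is its endomorphism with lowered index.\<close>

definition \<Psi> :: "real^4 \<Rightarrow> real^4^4" where "\<Psi> x = \<phi> x - \<sigma> x *\<^sub>R \<omega> x"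
definition Q :: "real^4 \<Rightarrow> real^4^4" where "Q x = - (transpose (J x) ** \<Psi> x)"

lemma smooth_sigma: "smooth_on S \<sigma>"
proof (rule smooth_on_cong[OF open_S])
  show "smooth_on S (\<lambda>x. form_inner (g x) (\<phi> x) (\<omega> x) / 3)"
    by (intro smooth_on_divide open_S smooth_form_inner smooth_phi smooth_omega smooth_on_const) simp
qed (simp add: sigma_eq)

lemma smooth_Psi: "smooth_on S \<Psi>"
  unfolding \<Psi>_def[abs_def] by (intro smooth_intros open_S smooth_phi smooth_sigma smooth_omega smooth_g smooth_J)

lemma smooth_Phi: "smooth_on S \<Phi>"
proof (rule smooth_on_cong[OF open_S])
  show "smooth_on S (\<lambda>x. \<phi> x - (3/2 * \<sigma> x) *\<^sub>R \<omega> x)"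
    by (intro smooth_intros open_S smooth_phi smooth_sigma smooth_omega smooth_g smooth_J)
qed (simp add: Phi_eq)

lemma smooth_Q: "smooth_on S Q"
  unfolding Q_def[abs_def] by (intro smooth_intros open_S smooth_Psi smooth_J)

lemma alt_omega: "x \<in> S \<Longrightarrow> alternating (\<omega> x)"
  using alternating_kahler_form[OF herm] .

lemma inv_omega: "x \<in> S \<Longrightarrow> transpose (J x) ** \<omega> x ** J x = \<omega> x"
  unfolding kahler_form_eq
  by (metis at_point(4) matrix_mul_assoc)

lemma Psi_props:
  assumes x: "x \<in> S"
  shows "alternating (\<Psi> x)" "transpose (J x) ** \<Psi> x ** J x = \<Psi> x" "form_inner (g x) (\<Psi> x) (\<omega> x) = \<sigma> x"
proof -
  show "alternating (\<Psi> x)"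
  proof (rule alternatingI)
    show "\<Psi> x $ i $ j = - \<Psi> x $ j $ i" for i j
      using alternating_nth[OF alt_phi[OF x], of i j] alternating_nth[OF alt_omega[OF x], of i j] by (simp add: \<Psi>_def)
  qed
  show "transpose (J x) ** \<Psi> x ** J x = \<Psi> x"
    using inv_phi[OF x] inv_omega[OF x]
    by (simp add: \<Psi>_def mm.diff_left mm.diff_right mm.scaleR_left mm.scaleR_right)
  have "\<Psi> x = \<phi> x + (- \<sigma> x) *\<^sub>R \<omega> x" by (simp add: \<Psi>_def)
  then have "form_inner (g x) (\<Psi> x) (\<omega> x) = form_inner (g x) (\<phi> x) (\<omega> x) - \<sigma> x * 2"
    using kahler_norm(1)[OF herm[OF x]] by (simp only: form_inner_add_left form_inner_scaleR_left)
  then show "form_inner (g x) (\<Psi> x) (\<omega> x) = \<sigma> x" by (simp add: sigma_eq[OF x])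
qed

text \<open>The covariant derivative of \<open>\<Phi>\<close> is the twistor tensor of some covector, and the equation \<open>d\<phi> = 0\<close>
  identifies this covector with \<open>d\<sigma>\<close>.\<close>

lemma nF_Psi:
  assumes x: "x \<in> S"
  shows "nF i \<Psi> x = (1/2) *\<^sub>R (wedge (differential \<sigma> x) (Jc x (g x $ i)) - wedge (Jc x (differential \<sigma> x)) (g x $ i))"
proof -
  obtain \<beta> where "nabla_form g \<Phi> x = twistor_tensor (g x) (J x) \<beta>"
    using twistor[OF x] V0_iff[OF herm[OF x]] by blast
  then have tw: "nF i \<Phi> x = twistor_tensor (g x) (J x) \<beta> $ i" for i
    using nabla_form_eq[OF x smooth_Phi, of i] by simp
  have nphi: "nF i \<phi> x = nF i \<Phi> x + (3/2 * differential \<sigma> x $ i) *\<^sub>R \<omega> x" for i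
  proof -
    have s: "smooth_on S (\<lambda>x. 3/2 * \<sigma> x)" by (intro smooth_intros open_S smooth_sigma)
    have s': "smooth_on S (\<lambda>x. (3/2 * \<sigma> x) *\<^sub>R \<omega> x)" by (rule smooth_on_scaleR[OF open_S s smooth_omega])
    have "nF i \<phi> x = nF i (\<lambda>x. \<Phi> x + (3/2 * \<sigma> x) *\<^sub>R \<omega> x) x"
      by (rule nF_cong[OF x]) (simp add: Phi_eq)
    also have "\<dots> = nF i \<Phi> x + dd i (\<lambda>x. 3/2 * \<sigma> x) x *\<^sub>R \<omega> x"
      unfolding nF_add[OF x smooth_Phi s'] nF_scaleR[OF x s smooth_omega] nF_kahler[OF x] by simp
    also have "dd i (\<lambda>x. 3/2 * \<sigma> x) x = 3/2 * dd i \<sigma> x"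
      using dd_linear[OF bounded_linear_mult_right diffble[OF smooth_sigma x]] .
    finally show ?thesis unfolding dd_differential_nth .
  qed
  have "\<beta> = differential \<sigma> x"
  proof (rule twistor_tensor_alternation[OF herm[OF x] refl])
    fix i j k
    show "(twistor_tensor (g x) (J x) \<beta> $ i + (3 / 2 * differential \<sigma> x $ i) *\<^sub>R \<omega> x) $ j $ k +
       (twistor_tensor (g x) (J x) \<beta> $ j + (3 / 2 * differential \<sigma> x $ j) *\<^sub>R \<omega> x) $ k $ i +
       (twistor_tensor (g x) (J x) \<beta> $ k + (3 / 2 * differential \<sigma> x $ k) *\<^sub>R \<omega> x) $ i $ j = 0"
      unfolding tw[symmetric] nphi[symmetric] d_form_eq[OF x smooth_phi alt_phi[OF x], symmetric] closed_phi[OF x] by simp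
  qed
  moreover have "nF i \<Psi> x = nF i \<Phi> x + (1/2 * differential \<sigma> x $ i) *\<^sub>R \<omega> x"
  proof -
    have s: "smooth_on S (\<lambda>x. 1/2 * \<sigma> x)" by (intro smooth_intros open_S smooth_sigma)
    have s': "smooth_on S (\<lambda>x. (1/2 * \<sigma> x) *\<^sub>R \<omega> x)" by (rule smooth_on_scaleR[OF open_S s smooth_omega])
    have "nF i \<Psi> x = nF i (\<lambda>x. \<Phi> x + (1/2 * \<sigma> x) *\<^sub>R \<omega> x) x"
      by (rule nF_cong[OF x]) (simp add: Phi_eq \<Psi>_def algebra_simps flip: scaleR_add_left)
    also have "\<dots> = nF i \<Phi> x + dd i (\<lambda>x. 1/2 * \<sigma> x) x *\<^sub>R \<omega> x"
      unfolding nF_add[OF x smooth_Phi s'] nF_scaleR[OF x s smooth_omega] nF_kahler[OF x] by simp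
    also have "dd i (\<lambda>x. 1/2 * \<sigma> x) x = 1/2 * dd i \<sigma> x"
      using dd_linear[OF bounded_linear_mult_right diffble[OF smooth_sigma x]] .
    finally show ?thesis unfolding dd_differential_nth .
  qed
  ultimately show ?thesis by (simp add: tw twistor_tensor_def)
qed

lemma nF_Q:
  assumes x: "x \<in> S"
  defines "s \<equiv> differential \<sigma> x"
  shows "nF i Q x = (1/2) *\<^sub>R (outer (g x $ i) s + outer s (g x $ i)
     + outer (Jc x (g x $ i)) (Jc x s) + outer (Jc x s) (Jc x (g x $ i)))"
proof -
  have "nF i (\<lambda>x. - 1 *\<^sub>R (transpose (J x) ** \<Psi> x)) x = - 1 *\<^sub>R (transpose (J x) ** nF i \<Psi> x)"
  proof -
    have s: "smooth_on S (\<lambda>x. transpose (J x) ** \<Psi> x)" by (intro smooth_intros open_S smooth_Psi smooth_J)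
    show ?thesis
      using nF_scaleR[OF x smooth_on_const s, of i "-1"] by (simp add: dd_const nF_J_mult[OF x smooth_Psi])
  qed
  then have e: "nF i Q x = - (transpose (J x) ** nF i \<Psi> x)" by (simp add: Q_def[abs_def])
  have w: "transpose (J x) ** wedge u v = - (outer (Jc x u) v - outer (Jc x v) u)" for u v
    unfolding wedge_outer mm.diff_right transpose_outer_mult J_covector_eq by (simp add: outer_linear del: transpose_matrix_vector)
  show ?thesis
    unfolding e nF_Psi[OF x] s_def mm.scaleR_right mm.diff_right w by (simp add: Jc_Jc[OF x] outer_linear algebra_simps)
qed

lemma tJ: "x \<in> S \<Longrightarrow> transpose (J x) ** transpose (J x) = - mat 1"
  using at_point(3) by (metis matrix_transpose_mul tr_minus transpose_mat)

lemma Q_props: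
  assumes x: "x \<in> S"
  shows "transpose (Q x) = Q x" "Q x ** J x = - (transpose (J x) ** Q x)"
proof -
  have P: "transpose (J x) ** \<Psi> x ** J x = \<Psi> x" "transpose (\<Psi> x) = - \<Psi> x"
    using Psi_props[OF x] by (auto simp: alternating_def)
  have PJ: "\<Psi> x ** J x = - (transpose (J x) ** \<Psi> x)"
  proof -
    have "transpose (J x) ** \<Psi> x ** (J x ** J x) = \<Psi> x ** J x" unfolding matrix_mul_assoc P(1) ..
    then show ?thesis unfolding at_point(3)[OF x] by (simp add: mm.minus_right)
  qed
  show "transpose (Q x) = Q x"
    unfolding Q_def by (simp add: tr_minus matrix_transpose_mul P(2) mm.minus_left PJ)
  show "Q x ** J x = - (transpose (J x) ** Q x)"
    unfolding Q_def by (simp add: mm.minus_left mm.minus_right P(1) matrix_mul_assoc tJ[OF x])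
qed

lemma QJ:
  assumes x: "x \<in> S"
  shows "Q x *v (h x *v Jc x v) = Jc x (Q x *v (h x *v v))"
  unfolding h_Jc[OF x] unfolding J_covector_eq using Q_props(2)[OF x]
  by (simp add: matrix_vector_mul_assoc mv.minus_left mm.minus_left matrix_mul_assoc del: transpose_matrix_vector)

text \<open>The pfaffian is \<open>(\<sigma>\<^sup>2 - |\<Psi>|\<^sup>2) / 2\<close>, and \<open>\<langle>\<nabla>\<Psi>, \<Psi>\<rangle> = Q d\<sigma>\<close> by the formula for \<open>\<nabla>\<Psi>\<close>.\<close>

lemma differential_prod:
  assumes x: "x \<in> S"
  shows "b x *\<^sub>R differential a x + a x *\<^sub>R differential b x = \<sigma> x *\<^sub>R differential \<sigma> x - Q x *v (h x *v differential \<sigma> x)"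
proof -
  let ?s = "differential \<sigma> x" and ?Z = "h x *v differential \<sigma> x"
  have P: "transpose (J x) ** \<Psi> x ** J x = \<Psi> x" "transpose (\<Psi> x) = - \<Psi> x" and alt: "alternating (\<Psi> x)"
    using Psi_props[OF x] by (auto simp: alternating_def)
  have key: "form_inner (g x) (nF i \<Psi> x) (\<Psi> x) = (Q x *v ?Z) $ i" for i
  proof -
    have gi: "h x *v (g x $ i) = axis i 1"
    proof -
      have "g x *v axis i 1 = g x $ i"
        using at_point(1)[OF x] by (simp add: vec_eq_iff matrix_vector_mul_component inner_axis pos_def_sym[OF at_point(8)[OF x], of i])
      then show ?thesis by (metis at_point(6)[OF x] matrix_vector_mul_assoc matrix_vector_mul_lid)
    qed
    let ?e = "axis i 1 :: real^4"
    have JJ: "(J x *v u) \<bullet> (\<Psi> x *v (J x *v w)) = u \<bullet> (\<Psi> x *v w)" for u w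
    proof -
      have "u \<bullet> (\<Psi> x *v w) = u \<bullet> (transpose (J x) *v (\<Psi> x *v (J x *v w)))"
        by (subst P(1)[symmetric]) (simp add: matrix_vector_mul_assoc[symmetric] del: transpose_matrix_vector)
      then show ?thesis by (simp add: inner_transpose del: transpose_matrix_vector)
    qed
    have J2: "J x *v (J x *v u) = - u" for u
      by (simp add: matrix_vector_mul_assoc at_point(3)[OF x] mv.minus_left)
    have "form_inner (g x) (nF i \<Psi> x) (\<Psi> x) = (1/2) * (form_inner (g x) (wedge ?s (Jc x (g x $ i))) (\<Psi> x)
        - form_inner (g x) (wedge (Jc x ?s) (g x $ i)) (\<Psi> x))"
    proof -
      have "nF i \<Psi> x = (1/2) *\<^sub>R wedge ?s (Jc x (g x $ i)) + (- 1/2) *\<^sub>R wedge (Jc x ?s) (g x $ i)"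
        unfolding nF_Psi[OF x] by (simp add: scaleR_diff_right)
      then show ?thesis by (simp only: form_inner_add_left form_inner_scaleR_left) simp
    qed
    also have "\<dots> = (1/2) * (?Z \<bullet> (\<Psi> x *v (J x *v ?e)) - (J x *v ?Z) \<bullet> (\<Psi> x *v ?e))"
      unfolding form_inner_wedge[OF at_point(5)[OF x] alt] h_Jc[OF x] gi ..
    also have "(J x *v ?Z) \<bullet> (\<Psi> x *v ?e) = - (?Z \<bullet> (\<Psi> x *v (J x *v ?e)))"
      using JJ[of "J x *v ?Z" ?e] by (simp add: J2)
    also have "?Z \<bullet> (\<Psi> x *v (J x *v ?e)) = (transpose (\<Psi> x) *v ?Z) \<bullet> (J x *v ?e)"
      using inner_transpose[of ?Z "transpose (\<Psi> x)" "J x *v ?e"] by (simp del: transpose_matrix_vector)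
    also have "\<dots> = - ((transpose (J x) *v (\<Psi> x *v ?Z)) \<bullet> ?e)"
      unfolding P(2) using inner_transpose[of ?e "J x" "\<Psi> x *v ?Z"]
      by (simp add: mv.minus_left inner_commute del: transpose_matrix_vector)
    also have "\<dots> = (Q x *v ?Z) $ i"
      by (simp add: Q_def mv.minus_left mm.minus_left matrix_vector_mul_assoc matrix_mul_assoc inner_axis del: transpose_matrix_vector)
    finally show ?thesis by simp
  qed
  have "dd i (\<lambda>x. a x * b x) x = \<sigma> x * ?s $ i - (Q x *v ?Z) $ i" for i
  proof -
    have sf: "smooth_on S (\<lambda>x. form_inner (g x) (\<Psi> x) (\<Psi> x))" by (intro smooth_form_inner smooth_Psi)
    have sq: "smooth_on S (\<lambda>x. \<sigma> x * \<sigma> x)" by (intro smooth_intros open_S smooth_sigma)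
    have "dd i (\<lambda>x. a x * b x) x = dd i (\<lambda>x. (1/2) * (\<sigma> x * \<sigma> x - form_inner (g x) (\<Psi> x) (\<Psi> x))) x"
      by (rule dd_cong[OF open_S x]) (simp add: prod_eq \<Psi>_def power2_eq_square)
    also have "\<dots> = (1/2) * (dd i (\<lambda>x. \<sigma> x * \<sigma> x) x - dd i (\<lambda>x. form_inner (g x) (\<Psi> x) (\<Psi> x)) x)"
      unfolding dd_linear[OF bounded_linear_mult_right diffble[OF smooth_on_diff[OF open_S sq sf] x]]
        dd_diff[OF diffble[OF sq x] diffble[OF sf x]] ..
    also have "\<dots> = \<sigma> x * dd i \<sigma> x - form_inner (g x) (nF i \<Psi> x) (\<Psi> x)"
    proof -
      have "form_inner (g x) (\<Psi> x) (nF i \<Psi> x) = form_inner (g x) (nF i \<Psi> x) (\<Psi> x)"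
        by (rule form_inner_commute[OF at_point(5)[OF x]])
      then show ?thesis
        unfolding dd_form_inner[OF x smooth_Psi smooth_Psi] dd_mult[OF diffble[OF smooth_sigma x] diffble[OF smooth_sigma x]] by simp
    qed
    finally show ?thesis unfolding key dd_differential_nth[of i \<sigma>] .
  qed
  then have "differential (\<lambda>x. a x * b x) x = \<sigma> x *\<^sub>R ?s - Q x *v ?Z"
    by (simp add: differential_def[of "\<lambda>x. a x * b x"] pd_eq_dd vec_eq_iff)
  then show ?thesis using differential_mult[OF x smooth_ab] by simp
qed

text \<open>The formula for \<open>d (a b)\<close> says that \<open>Q (da + db) = a da + b db\<close>. Applying \<open>Q\<close> once more and using
  \<open>Q\<^sup>2 = (a + b) Q - a b\<close> separates the two eigenvectors.\<close>

lemma eigen: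
  assumes x: "x \<in> S"
  shows "Q x *v (h x *v differential a x) = a x *\<^sub>R differential a x"
    "Q x *v (h x *v differential b x) = b x *\<^sub>R differential b x"
proof -
  let ?T = "\<lambda>v. Q x *v (h x *v v)"
  let ?A = "differential a x" and ?B = "differential b x"
  have lin: "?T (u + v) = ?T u + ?T v" "?T (c *\<^sub>R u) = c *\<^sub>R ?T u" "?T (u - v) = ?T u - ?T v" for u v c
    by (simp_all add: mv.add_right mv.scaleR_right mv.diff_right)
  have s: "differential \<sigma> x = ?A + ?B"
  proof -
    have "differential \<sigma> x = differential (\<lambda>x. a x + b x) x"
      by (rule differential_cong[OF open_S x]) (simp add: sum_eq)
    also have "\<dots> = ?A + ?B"
      by (simp add: differential_def pd_eq_dd vec_eq_iff dd_add[OF diffble[OF smooth_ab(1) x] diffble[OF smooth_ab(2) x]])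
    finally show ?thesis .
  qed
  have 1: "?T ?A + ?T ?B = a x *\<^sub>R ?A + b x *\<^sub>R ?B"
  proof -
    have "?T ?A + ?T ?B = \<sigma> x *\<^sub>R (?A + ?B) - (b x *\<^sub>R ?A + a x *\<^sub>R ?B)"
      using differential_prod[OF x] unfolding s lin by (simp add: eq_diff_eq diff_eq_eq add.commute)
    then show ?thesis unfolding sum_eq[OF x, symmetric] by (simp add: algebra_simps)
  qed
  have ch: "Q x ** h x ** Q x = \<sigma> x *\<^sub>R Q x - (a x * b x) *\<^sub>R g x"
  proof -
    have "((\<sigma> x)\<^sup>2 - form_inner (g x) (\<Psi> x) (\<Psi> x)) / 2 = a x * b x"
      using prod_eq[OF x] by (simp add: \<Psi>_def)
    then show ?thesis
      using cayley_hamilton[OF herm[OF x] Psi_props(1,2)[OF x]]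
      unfolding Psi_props(3)[OF x] Q_def[symmetric] by (simp add: algebra_simps)
  qed
  have "?T (?T v) = \<sigma> x *\<^sub>R ?T v - (a x * b x) *\<^sub>R v" for v
  proof -
    have "?T (?T v) = (Q x ** h x ** Q x) *v (h x *v v)" by (simp add: matrix_vector_mul_assoc matrix_mul_assoc)
    also have "\<dots> = \<sigma> x *\<^sub>R ?T v - (a x * b x) *\<^sub>R ((g x ** h x) *v v)"
      unfolding ch by (simp add: mm.diff_left mm.scaleR_left mv.diff_left mv.scaleR_left matrix_vector_mul_assoc)
    finally show ?thesis by (simp add: at_point[OF x])
  qed
  from this[of "?A + ?B"] have 2: "a x *\<^sub>R ?T ?A + b x *\<^sub>R ?T ?B = (a x * a x) *\<^sub>R ?A + (b x * b x) *\<^sub>R ?B"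
    unfolding lin 1 sum_eq[OF x, symmetric] by (simp add: lin algebra_simps)
  have "(a x - b x) *\<^sub>R ?T ?A = a x *\<^sub>R ?T ?A + b x *\<^sub>R ?T ?B - b x *\<^sub>R (?T ?A + ?T ?B)" by (simp add: algebra_simps)
  also have "\<dots> = (a x - b x) *\<^sub>R (a x *\<^sub>R ?A)" unfolding 1 2 by (simp add: algebra_simps)
  finally show TA: "?T ?A = a x *\<^sub>R ?A" unfolding scaleR_cancel_left using distinct[OF x] by simp
  then show "?T ?B = b x *\<^sub>R ?B" using 1 by simp
qed

lemma Q_sym: "x \<in> S \<Longrightarrow> u \<bullet> (h x *v (Q x *v (h x *v v))) = (Q x *v (h x *v u)) \<bullet> (h x *v v)"
  using Q_props(1) at_point(5) by (metis inner_transpose)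

text \<open>Eigenvectors of a symmetric endomorphism for distinct eigenvalues are orthogonal, and \<open>Q\<close> commutes
  with \<open>J\<close>.\<close>

lemma orth_pair: "orth_pair a b"
proof -
  have "differential a x \<bullet> (h x *v differential b x) = 0" "dJ a x \<bullet> (h x *v differential b x) = 0" if x: "x \<in> S" for x
  proof -
    have "v \<bullet> (h x *v differential b x) = 0" if "Q x *v (h x *v v) = a x *\<^sub>R v" for v
    proof -
      have "b x * (v \<bullet> (h x *v differential b x)) = a x * (v \<bullet> (h x *v differential b x))"
        using Q_sym[OF x, of v "differential b x"] unfolding eigen[OF x] that by (simp add: mv.scaleR_right)
      then show ?thesis using distinct[OF x] by simp
    qed
    from this[OF eigen(1)[OF x]] this[of "dJ a x"] show "differential a x \<bullet> (h x *v differential b x) = 0" "dJ a x \<bullet> (h x *v differential b x) = 0"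
      unfolding dJ_def QJ[OF x] eigen[OF x] by (simp_all add: J_covector_linear)
  qed
  then show ?thesis unfolding orth_pair_def using smooth_ab distinct nonzero by blast
qed

text \<open>Differentiating the eigenvector equation determines all entries of the Hessian with one
  argument in the other eigenspace.\<close>

lemma weak_hess:
  assumes x: "x \<in> S"
  defines "E1 \<equiv> h x *v differential a x" and "E2 \<equiv> h x *v dJ a x"
  shows "weak_hess a b x (E1 \<bullet> (hess a x *v E1) / (sqnorm a x)\<^sup>2) (E1 \<bullet> (hess a x *v E2) / (sqnorm a x)\<^sup>2) (E2 \<bullet> (hess a x *v E2) / (sqnorm a x)\<^sup>2)"
proof -
  note ab = orth_pair
  note nz = pair_pos[OF ab x]
  let ?A = "differential a x" and ?B = "differential b x" and ?A' = "dJ a x" and ?B' = "dJ b x"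
  let ?E = "vec4 a b x"
  define N where "N i = nC i (differential a) x" for i
  have s: "differential \<sigma> x = ?A + ?B"
  proof -
    have "differential \<sigma> x = differential (\<lambda>x. a x + b x) x"
      by (rule differential_cong[OF open_S x]) (simp add: sum_eq)
    also have "\<dots> = ?A + ?B"
      by (simp add: differential_def pd_eq_dd vec_eq_iff dd_add[OF diffble[OF smooth_ab(1) x] diffble[OF smooth_ab(2) x]])
    finally show ?thesis .
  qed
  have Js: "Jc x (differential \<sigma> x) = ?A' + ?B'" by (simp add: s J_covector_linear dJ_def)
  have gi: "g x $ i \<bullet> (h x *v v) = v $ i" for i v
  proof -
    have "(g x *v (h x *v v)) $ i = v $ i" by (simp add: matrix_vector_mul_assoc at_point[OF x])
    then show ?thesis by (simp add: matrix_vector_mul_component)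
  qed
  have Jgi: "Jc x (g x $ i) \<bullet> (h x *v v) = - Jc x v $ i" for i v
    using inner_Jc[of "g x $ i" x "h x *v v"] gi[of i "Jc x v"] by (simp add: h_Jc[OF x])
  have eq: "Q x *v (h x *v N i) = ?A $ i *\<^sub>R ?A + a x *\<^sub>R N i
     - (1/2) *\<^sub>R (sqnorm a x *\<^sub>R (g x $ i) + ?A $ i *\<^sub>R (?A + ?B) - ?A' $ i *\<^sub>R (?A' + ?B'))" for i
  proof -
    have "nC i (\<lambda>x. Q x *v (h x *v differential a x)) x = nC i (\<lambda>x. a x *\<^sub>R differential a x) x"
      by (rule nC_cong[OF x]) (rule eigen)
    then have "nF i Q x *v (h x *v ?A) + Q x *v (h x *v N i) = ?A $ i *\<^sub>R ?A + a x *\<^sub>R N i"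
      unfolding nC_QH[OF x smooth_Q smooth_da[OF ab]] nC_scaleR[OF x smooth_ab(1) smooth_da[OF ab]] N_def dd_differential_nth .
    moreover have "nF i Q x *v (h x *v ?A) = (1/2) *\<^sub>R (sqnorm a x *\<^sub>R (g x $ i) + ?A $ i *\<^sub>R (?A + ?B) - ?A' $ i *\<^sub>R (?A' + ?B'))"
      unfolding nF_Q[OF x] Js unfolding s mv.scaleR_left mv.add_left outer_mult_vec gi Jgi dJ_def[symmetric]
      by (simp add: inner_add_left pairings[OF ab x])
    ultimately show ?thesis by (simp add: algebra_simps)
  qed
  have N3: "N i \<bullet> (h x *v ?B) = (sqnorm b x * ?A $ i + sqnorm a x * ?B $ i) / (2 * (a x - b x))" for i
  proof -
    have "(Q x *v (h x *v N i)) \<bullet> (h x *v ?B) = b x * (N i \<bullet> (h x *v ?B))"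
      unfolding Q_sym[OF x, symmetric] eigen[OF x] by (simp add: mv.scaleR_right)
    then have "b x * (N i \<bullet> (h x *v ?B)) = a x * (N i \<bullet> (h x *v ?B)) - (1/2) * (sqnorm a x * ?B $ i + ?A $ i * sqnorm b x)"
      unfolding eq by (simp add: inner_add_left inner_diff_left pairings[OF ab x] gi)
    then show ?thesis using nz by (simp add: field_simps)
  qed
  have N4: "N i \<bullet> (h x *v ?B') = (sqnorm a x * ?B' $ i - sqnorm b x * ?A' $ i) / (2 * (a x - b x))" for i
  proof -
    have "Q x *v (h x *v ?B') = b x *\<^sub>R ?B'" unfolding dJ_def QJ[OF x] eigen[OF x] by (simp add: J_covector_linear)
    then have "(Q x *v (h x *v N i)) \<bullet> (h x *v ?B') = b x * (N i \<bullet> (h x *v ?B'))"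
      unfolding Q_sym[OF x, symmetric] by (simp add: mv.scaleR_right)
    then have "b x * (N i \<bullet> (h x *v ?B')) = a x * (N i \<bullet> (h x *v ?B')) - (1/2) * (sqnorm a x * ?B' $ i - ?A' $ i * sqnorm b x)"
      unfolding eq by (simp add: inner_add_left inner_diff_left pairings[OF ab x] gi)
    then show ?thesis using nz by (simp add: field_simps)
  qed
  define c where "c = 1 / (2 * (a x - b x))"
  have HE: "hess a x *v (h x *v ?B) = c *\<^sub>R (sqnorm b x *\<^sub>R ?A + sqnorm a x *\<^sub>R ?B)"
    "hess a x *v (h x *v ?B') = c *\<^sub>R (sqnorm a x *\<^sub>R ?B' - sqnorm b x *\<^sub>R ?A')"
    by (simp_all add: vec_eq_iff matrix_vector_mul_component hess_nth N_def[symmetric] N3 N4 c_def)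
  have sym: "u \<bullet> (hess a x *v v) = v \<bullet> (hess a x *v u)" for u v
    using hess_transpose[OF x smooth_ab(1)] by (metis inner_transpose inner_commute)
  define r s t where "r = E1 \<bullet> (hess a x *v E1) / (sqnorm a x)\<^sup>2" and "s = E1 \<bullet> (hess a x *v E2) / (sqnorm a x)\<^sup>2"
    and "t = E2 \<bullet> (hess a x *v E2) / (sqnorm a x)\<^sup>2"
  define B where "B = r *\<^sub>R outer ?A ?A + s *\<^sub>R (outer ?A ?A' + outer ?A' ?A) + t *\<^sub>R outer ?A' ?A'
     + c *\<^sub>R (outer ?A ?B + outer ?B ?A - outer ?A' ?B' - outer ?B' ?A' + (sqnorm a x / sqnorm b x) *\<^sub>R (outer ?B ?B + outer ?B' ?B'))"
  have "hess a x = B"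
  proof (rule bilinear_eqI[OF ab x])
    have rst: "E1 \<bullet> (hess a x *v E1) = r * (sqnorm a x)\<^sup>2" "E1 \<bullet> (hess a x *v E2) = s * (sqnorm a x)\<^sup>2"
      "E2 \<bullet> (hess a x *v E1) = s * (sqnorm a x)\<^sup>2" "E2 \<bullet> (hess a x *v E2) = t * (sqnorm a x)\<^sup>2"
      using nz sym[of E2 E1] by (simp_all add: r_def s_def t_def)
    have col3: "u \<bullet> (hess a x *v (h x *v ?B)) = c * (sqnorm b x * (?A \<bullet> u) + sqnorm a x * (?B \<bullet> u))"
      "u \<bullet> (hess a x *v (h x *v ?B')) = c * (sqnorm a x * (?B' \<bullet> u) - sqnorm b x * (?A' \<bullet> u))" for u
      unfolding HE by (simp_all add: inner_add_right inner_diff_right inner_commute)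
    note col3' = col3[unfolded sym[of _ "h x *v _"]]
    have row3: "(h x *v ?B) \<bullet> (hess a x *v u) = c * (sqnorm b x * (?A \<bullet> u) + sqnorm a x * (?B \<bullet> u))"
      "(h x *v ?B') \<bullet> (hess a x *v u) = c * (sqnorm a x * (?B' \<bullet> u) - sqnorm b x * (?A' \<bullet> u))" for u
      using col3[of u] sym by simp_all
    show "\<forall>i j. ?E i \<bullet> (hess a x *v ?E j) = ?E i \<bullet> (B *v ?E j)"
      unfolding forall_4 vec4_def[OF ab] select4 B_def mv.add_left mv.diff_left mv.scaleR_left inner_add_right inner_diff_right inner_scaleR_right outer_eval
        rst[unfolded E1_def E2_def] col3 row3
      using nz by (simp add: pairings[OF ab x] power2_eq_square)
  qed
  then show ?thesis
    unfolding weak_hess_def mixed_def hess_nth[symmetric] r_def[symmetric] s_def[symmetric] t_def[symmetric] c_def[symmetric]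
    by (simp add: B_def vec_eq_iff outer_def algebra_simps)
qed

end

lemma hamiltonian_chart_sym: "hamiltonian_chart S g J \<phi> \<Phi> \<sigma> a b \<Longrightarrow> hamiltonian_chart S g J \<phi> \<Phi> \<sigma> b a"
  unfolding hamiltonian_chart_def hamiltonian_chart_axioms_def by (auto simp: add.commute mult.commute)

context hamiltonian_chart
begin

text \<open>The normal form of the Hessian up to its block on the plane of \<open>da\<close> and \<open>J da\<close> holds on all of \<open>S\<close>, with
  smooth entries, so the arguments with \<open>d\<^sup>2 = 0\<close> apply to this block.\<close>

lemma normal_hess: "x \<in> S \<Longrightarrow> \<exists>k. normal_hess a b x k"
proof -
  assume x: "x \<in> S"
  interpret sw: hamiltonian_chart S g J \<phi> \<Phi> \<sigma> b a by (rule hamiltonian_chart_sym[OF hamiltonian_chart_axioms])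
  note ab = orth_pair
  let ?E1 = "\<lambda>x. h x *v differential a x" and ?E2 = "\<lambda>x. h x *v dJ a x"
  define r s t where "r = (\<lambda>x. ?E1 x \<bullet> (hess a x *v ?E1 x) / (sqnorm a x)\<^sup>2)"
    and "s = (\<lambda>x. ?E1 x \<bullet> (hess a x *v ?E2 x) / (sqnorm a x)\<^sup>2)"
    and "t = (\<lambda>x. ?E2 x \<bullet> (hess a x *v ?E2 x) / (sqnorm a x)\<^sup>2)"
  have hs: "smooth_on S (hess a)"
    unfolding hess_def[abs_def] nC_def \<Gamma>_def christoffel_def
    by (intro smooth_intros open_S smooth_da[OF ab] smooth_h smooth_g smooth_on_vec; unfold pd_eq_dd; intro smooth_intros open_S smooth_g)
  have pnz: "(sqnorm a y)\<^sup>2 \<noteq> 0" if "y \<in> S" for y using pair_pos[OF ab that] by auto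
  have sm: "smooth_on S r" "smooth_on S s" "smooth_on S t"
    unfolding r_def s_def t_def
    by (intro smooth_intros open_S hs smooth_h smooth_da[OF ab] smooth_dJa[OF ab] smooth_p[OF ab] pnz; assumption)+
  have w: "weak_hess a b y (r y) (s y) (t y)" if "y \<in> S" for y
    unfolding r_def s_def t_def by (rule weak_hess[OF that])
  have rt: "r y = t y" if "y \<in> S" for y
    by (rule weak_hess_diagonal[OF ab sm(1,3) w sw.weak_hess that])
  have "s x = 0"
    by (rule weak_hess_offdiagonal[OF ab sm(1,2) _ x]) (use w rt in simp)
  then have "normal_hess a b x (r x)"
    using w[OF x] rt[OF x] unfolding weak_hess_def normal_hess_def by (simp add: algebra_simps)
  then show ?thesis ..
qed

end

section \<open>The explicit metrics\<close>

definition mat4 :: "(4 \<Rightarrow> real) \<Rightarrow> (4 \<Rightarrow> real) \<Rightarrow> (4 \<Rightarrow> real) \<Rightarrow> (4 \<Rightarrow> real) \<Rightarrow> 4 \<Rightarrow> 4 \<Rightarrow> real" where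
  "mat4 a b c d i j = select4 a b c d i j"

lemma mat4: "mat4 a b c d 1 j = a j" "mat4 a b c d 2 j = b j" "mat4 a b c d 3 j = c j" "mat4 a b c d 4 j = d j"
  by (simp_all add: mat4_def select4)

text \<open>In these matrices \<open>f, k\<close> are the values of \<open>F, G\<close> at the coordinates \<open>b + e\<close> and \<open>b\<close>, and \<open>f', k'\<close>
  those of the derivatives; the first index of \<open>ot_dmetric\<close> and \<open>ot_dJ\<close> is the direction of differentiation.\<close>

context
  fixes b e f k f' k' :: real
begin

definition ot_metric :: "4 \<Rightarrow> 4 \<Rightarrow> real" where
  "ot_metric = mat4 (select4 (e / f) 0 0 0) (select4 0 (- e / k) 0 0)
    (select4 0 0 ((f - k) / e) ((f * b - k * (b + e)) / e))
    (select4 0 0 ((f * b - k * (b + e)) / e) ((f * b\<^sup>2 - k * (b + e)\<^sup>2) / e))"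

definition ot_J :: "4 \<Rightarrow> 4 \<Rightarrow> real" where
  "ot_J = mat4 (select4 0 0 (- f / e) (- f * b / e)) (select4 0 0 (k / e) (k * (b + e) / e))
    (select4 ((b + e) / f) (b / k) 0 0) (select4 (- 1 / f) (- 1 / k) 0 0)"

definition ot_dmetric :: "4 \<Rightarrow> 4 \<Rightarrow> 4 \<Rightarrow> real" where
  "ot_dmetric = select4
    (mat4 (select4 (1 / f - e * f' / f\<^sup>2) 0 0 0) (select4 0 (- 1 / k) 0 0)
      (select4 0 0 (f' / e - (f - k) / e\<^sup>2) ((f' * b - k) / e - (f * b - k * (b + e)) / e\<^sup>2))
      (select4 0 0 ((f' * b - k) / e - (f * b - k * (b + e)) / e\<^sup>2) ((f' * b\<^sup>2 - 2 * k * (b + e)) / e - (f * b\<^sup>2 - k * (b + e)\<^sup>2) / e\<^sup>2)))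
    (mat4 (select4 (- 1 / f) 0 0 0) (select4 0 (1 / k + e * k' / k\<^sup>2) 0 0)
      (select4 0 0 (- k' / e + (f - k) / e\<^sup>2) ((f - k' * (b + e)) / e + (f * b - k * (b + e)) / e\<^sup>2))
      (select4 0 0 ((f - k' * (b + e)) / e + (f * b - k * (b + e)) / e\<^sup>2) ((2 * f * b - k' * (b + e)\<^sup>2) / e + (f * b\<^sup>2 - k * (b + e)\<^sup>2) / e\<^sup>2)))
    (\<lambda>_ _. 0) (\<lambda>_ _. 0)"

definition ot_dJ :: "4 \<Rightarrow> 4 \<Rightarrow> 4 \<Rightarrow> real" where
  "ot_dJ = select4
    (mat4 (select4 0 0 (- f' / e + f / e\<^sup>2) (- f' * b / e + f * b / e\<^sup>2)) (select4 0 0 (- k / e\<^sup>2) (k / e - k * (b + e) / e\<^sup>2))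
      (select4 (1 / f - (b + e) * f' / f\<^sup>2) 0 0 0) (select4 (f' / f\<^sup>2) 0 0 0))
    (mat4 (select4 0 0 (- f / e\<^sup>2) (- f / e - f * b / e\<^sup>2)) (select4 0 0 (k' / e + k / e\<^sup>2) (k' * (b + e) / e + k * (b + e) / e\<^sup>2))
      (select4 0 (1 / k - b * k' / k\<^sup>2) 0 0) (select4 0 (k' / k\<^sup>2) 0 0))
    (\<lambda>_ _. 0) (\<lambda>_ _. 0)"

definition ot_christoffel :: "4 \<Rightarrow> 4 \<Rightarrow> 4 \<Rightarrow> real" where
  "ot_christoffel i l j = (ot_dmetric i j l + ot_dmetric j i l - ot_dmetric l i j) / 2"

lemmas ot_defs = ot_metric_def ot_J_def ot_dmetric_def ot_dJ_def

context
  assumes nz: "e \<noteq> 0" "f \<noteq> 0" "k \<noteq> 0"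
begin

lemma ot_J_square: "(\<Sum>m\<in>UNIV. ot_J i m * ot_J m j) = (if i = j then - 1 else 0)"
proof -
  have "\<forall>i j. (\<Sum>m\<in>UNIV. ot_J i m * ot_J m j) = (if i = j then - 1 else 0)"
    unfolding forall_4 sum_4 ot_defs mat4 select4 using nz by (simp add: field_simps)
  then show ?thesis by blast
qed

lemma ot_orthogonal: "(\<Sum>l\<in>UNIV. (\<Sum>m\<in>UNIV. ot_J m i * ot_metric m l) * ot_J l j) = ot_metric i j"
proof -
  have "\<forall>i j. (\<Sum>l\<in>UNIV. (\<Sum>m\<in>UNIV. ot_J m i * ot_metric m l) * ot_J l j) = ot_metric i j"
    unfolding forall_4 sum_4 ot_defs mat4 select4 using nz by (simp add: field_simps power2_eq_square)
  then show ?thesis by blast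
qed

text \<open>The vanishing of \<open>\<nabla> J\<close> with a lowered index, which is an identity of rational functions.\<close>

lemma ot_parallel: "(\<Sum>m\<in>UNIV. ot_metric j m * ot_dJ i m l) + (\<Sum>m\<in>UNIV. ot_christoffel i j m * ot_J m l)
   + (\<Sum>m\<in>UNIV. ot_J m j * ot_christoffel i m l) = 0"
proof -
  have "\<forall>i j l. (\<Sum>m\<in>UNIV. ot_metric j m * ot_dJ i m l) + (\<Sum>m\<in>UNIV. ot_christoffel i j m * ot_J m l)
   + (\<Sum>m\<in>UNIV. ot_J m j * ot_christoffel i m l) = 0"
    unfolding forall_4 sum_4 ot_christoffel_def ot_defs mat4 select4 using nz by (simp add: field_simps power2_eq_square)
  then show ?thesis by blast
qed

lemma ot_nijenhuis: "(\<Sum>l\<in>UNIV. ot_J l i * ot_dJ l m j - ot_J l j * ot_dJ l m i + ot_J m l * (ot_dJ j l i - ot_dJ i l j)) = 0"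
proof -
  have "\<forall>i j m. (\<Sum>l\<in>UNIV. ot_J l i * ot_dJ l m j - ot_J l j * ot_dJ l m i + ot_J m l * (ot_dJ j l i - ot_dJ i l j)) = 0"
    unfolding forall_4 sum_4 ot_defs mat4 select4 using nz by (simp add: field_simps power2_eq_square)
  then show ?thesis by blast
qed

end

end

lemma dd_coordinate_function:
  fixes F :: "real \<Rightarrow> real"
  assumes "F differentiable (at (x $ m))"
  shows "dd i (\<lambda>x. F (x $ m)) x = frechet_derivative F (at (x $ m)) 1 * (if i = m then 1 else 0)"
    "(\<lambda>x. F (x $ m)) differentiable (at x)"
proof -
  have "((\<lambda>x::real^4. x $ m) has_derivative (\<lambda>v. v $ m)) (at x)"
    by (rule bounded_linear_imp_has_derivative[OF bounded_linear_vec_nth])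
  moreover have "(F has_derivative frechet_derivative F (at (x $ m))) (at (x $ m))"
    using assms by (simp only: frechet_derivative_works)
  ultimately have D: "((\<lambda>x. F (x $ m)) has_derivative (\<lambda>v. frechet_derivative F (at (x $ m)) (v $ m))) (at x)"
    by (rule has_derivative_compose)
  then show "(\<lambda>x. F (x $ m)) differentiable (at x)" by (auto simp: differentiable_def)
  have "linear (frechet_derivative F (at (x $ m)))" using assms by (rule linear_frechet_derivative)
  then show "dd i (\<lambda>x. F (x $ m)) x = frechet_derivative F (at (x $ m)) 1 * (if i = m then 1 else 0)"
    unfolding dd_eq[OF D] by (simp add: axis_def linear_0)
qed

lemma dd_coordinate: "dd i (\<lambda>x. x $ m) x = (if i = m then 1 else 0 :: real)" "(\<lambda>x::real^4. x $ m) differentiable (at x)"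
proof -
  have D: "((\<lambda>x::real^4. x $ m) has_derivative (\<lambda>v. v $ m)) (at x)"
    by (rule bounded_linear_imp_has_derivative[OF bounded_linear_vec_nth])
  then show "(\<lambda>x::real^4. x $ m) differentiable (at x)" by (auto simp: differentiable_def)
  show "dd i (\<lambda>x. x $ m) x = (if i = m then 1 else 0 :: real)" unfolding dd_eq[OF D] by (simp add: axis_def)
qed

lemma ot_entries_derivative:
  fixes f k b e :: "real^4 \<Rightarrow> real"
  assumes d: "f differentiable (at x)" "k differentiable (at x)" "b differentiable (at x)" "e differentiable (at x)"
    and nz: "e x \<noteq> 0" "f x \<noteq> 0" "k x \<noteq> 0"
    and D: "\<And>i. dd i f x = f' * (if i = 1 then 1 else 0)" "\<And>i. dd i k x = k' * (if i = 2 then 1 else 0)"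
      "\<And>i. dd i b x = (if i = 2 then 1 else 0)" "\<And>i. dd i e x = (if i = 1 then 1 else 0) - (if i = 2 then 1 else 0)"
  shows "dd i (\<lambda>x. ot_metric (b x) (e x) (f x) (k x) j l) x = ot_dmetric (b x) (e x) (f x) (k x) f' k' i j l"
    "dd i (\<lambda>x. ot_J (b x) (e x) (f x) (k x) j l) x = ot_dJ (b x) (e x) (f x) (k x) f' k' i j l"
proof -
  note [simp] = d
  have "\<forall>i j l. dd i (\<lambda>x. ot_metric (b x) (e x) (f x) (k x) j l) x = ot_dmetric (b x) (e x) (f x) (k x) f' k' i j l"
    unfolding ot_metric_def ot_dmetric_def power2_eq_square forall_4 mat4 select4
    using nz by (simp add: dd_const dd_divide dd_diff dd_add dd_mult dd_minus D) (simp add: field_simps power2_eq_square)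
  then show "dd i (\<lambda>x. ot_metric (b x) (e x) (f x) (k x) j l) x = ot_dmetric (b x) (e x) (f x) (k x) f' k' i j l" by blast
  have "\<forall>i j l. dd i (\<lambda>x. ot_J (b x) (e x) (f x) (k x) j l) x = ot_dJ (b x) (e x) (f x) (k x) f' k' i j l"
    unfolding ot_J_def ot_dJ_def forall_4 mat4 select4 minus_divide_left[symmetric] mult_minus_left
    using nz by (simp add: dd_const dd_divide dd_diff dd_add dd_mult dd_minus D) (simp add: field_simps power2_eq_square)
  then show "dd i (\<lambda>x. ot_J (b x) (e x) (f x) (k x) j l) x = ot_dJ (b x) (e x) (f x) (k x) f' k' i j l" by blast
qed

section \<open>A domain of Euclidean space as a manifold\<close>

lemma id_chart_inv: "x \<in> V \<Longrightarrow> chart_inv (V, id) x = x"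
  unfolding chart_inv_def by (simp add: inv_into_f_eq)

lemma id_chart_img: "chart_img (V, id) = V"
  by (simp add: chart_img_def)

lemma id_overlap: "overlap (V, id) (V, id) = V"
  by (simp add: overlap_def)

lemma id_transition: "x \<in> V \<Longrightarrow> transition (V, id) (V, id) x = x"
  by (simp add: transition_def id_chart_inv)

context
  fixes V :: "(real^4) set" assumes V: "open V"
begin

lemma id_jacobian: "x \<in> V \<Longrightarrow> jacobian (transition (V, id) (V, id)) (at x) = mat 1"
proof -
  assume x: "x \<in> V"
  have "frechet_derivative (transition (V, id) (V, id)) (at x) = frechet_derivative (\<lambda>x. x) (at x)"
    by (rule frechet_derivative_cong_open[OF V x]) (rule id_transition)
  also have "\<dots> = (\<lambda>v. v)" using frechet_derivative_at[OF has_derivative_ident] by metis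
  finally show ?thesis by (simp add: jacobian_def matrix_id_mat_1[unfolded id_def])
qed

lemma id_manifold: "smooth_4manifold V {(V, id)}"
proof -
  have "smooth_on V (transition (V, id) (V, id))"
    by (rule smooth_on_cong[OF V _ smooth_on_id]) (simp add: id_transition)
  moreover have "homeomorphism V V id (chart_inv (V, id))"
    by (rule homeomorphismI) (auto simp: id_chart_inv image_iff intro!: continuous_on_eq[OF continuous_on_id])
  ultimately show ?thesis using V by (simp add: smooth_4manifold_def chart_def id_chart_img id_overlap)
qed

lemma id_fields:
  "bilinear_field {(V, id)} (\<lambda>c. B) \<longleftrightarrow> smooth_on V B"
  "endo_field {(V, id)} (\<lambda>c. B) \<longleftrightarrow> smooth_on V B"
  "vector_field {(V, id)} (\<lambda>c. K) \<longleftrightarrow> smooth_on V K"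
  by (simp_all add: bilinear_field_def endo_field_def vector_field_def id_chart_img id_overlap id_transition id_jacobian Let_def)

lemma id_local_rep: "x \<in> V \<Longrightarrow> local_rep f (V, id) x = f x"
  by (simp add: local_rep_def id_chart_inv)

lemma id_differential: "x \<in> V \<Longrightarrow> differential (local_rep f (V, id)) x = differential f x"
  by (rule differential_cong[OF V]) (simp_all add: id_local_rep)

lemma id_smooth_function: "smooth_function {(V, id)} f \<longleftrightarrow> smooth_on V f"
  using smooth_on_cong[OF V, of f "local_rep f (V, id)"] smooth_on_cong[OF V, of "local_rep f (V, id)" f]
  by (auto simp: smooth_function_def id_chart_img id_local_rep)

end

section \<open>Explicit ortho-toric surfaces\<close>

context
  fixes V :: "(real^4) set" and F G :: "real \<Rightarrow> real"
  assumes V: "open V" and F: "smooth_on ((\<lambda>x. x $ 1) ` V) F" and G: "smooth_on ((\<lambda>x. x $ 2) ` V) G"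
    and pd: "\<And>x. x \<in> V \<Longrightarrow> pos_def (orthotoric_metric F G (x $ 1) (x $ 2) (axis 1 1) (axis 2 1) (axis 3 1) (axis 4 1))"
begin

definition ex_g :: "real^4 \<Rightarrow> real^4^4" where
  "ex_g x = orthotoric_metric F G (x $ 1) (x $ 2) (axis 1 1) (axis 2 1) (axis 3 1) (axis 4 1)"

definition ex_J :: "real^4 \<Rightarrow> real^4^4" where
  "ex_J x = (\<chi> i j. ot_J (x $ 2) (x $ 1 - x $ 2) (F (x $ 1)) (G (x $ 2)) i j)"

text \<open>The first two diagonal entries of the metric are \<open>(\<xi> - \<eta>) / F (\<xi>)\<close> and \<open>- (\<xi> - \<eta>) / G (\<eta>)\<close>; both are positive.
  Division by zero gives zero, so none of these values can vanish.\<close>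

lemma ex_nonzero:
  assumes x: "x \<in> V"
  shows "x $ 1 - x $ 2 \<noteq> 0" "F (x $ 1) \<noteq> 0" "G (x $ 2) \<noteq> 0" "x $ 1 \<noteq> x $ 2"
proof -
  have p: "v \<noteq> 0 \<Longrightarrow> v \<bullet> (ex_g x *v v) > 0" for v using pd[OF x] by (simp add: pos_def_def ex_g_def)
  have e: "axis i 1 \<bullet> (ex_g x *v axis i 1) = ex_g x $ i $ i" for i :: 4
    by (simp add: inner_axis' matrix_vector_mul_component inner_axis)
  have "ex_g x $ 1 $ 1 > 0" "ex_g x $ 2 $ 2 > 0" using p[of "axis 1 1"] p[of "axis 2 1"] unfolding e by simp_all
  then have "(x $ 1 - x $ 2) / F (x $ 1) > 0" "- ((x $ 1 - x $ 2) / G (x $ 2)) > 0"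
    by (simp_all add: ex_g_def orthotoric_metric_def square_def axis_def)
  then show "x $ 1 - x $ 2 \<noteq> 0" "F (x $ 1) \<noteq> 0" "G (x $ 2) \<noteq> 0" "x $ 1 \<noteq> x $ 2" by auto
qed

lemma ex_g_nth:
  assumes x: "x \<in> V"
  shows "ex_g x $ i $ j = ot_metric (x $ 2) (x $ 1 - x $ 2) (F (x $ 1)) (G (x $ 2)) i j"
proof -
  have "\<forall>i j. ex_g x $ i $ j = ot_metric (x $ 2) (x $ 1 - x $ 2) (F (x $ 1)) (G (x $ 2)) i j"
    unfolding forall_4 ot_metric_def mat4 select4 ex_g_def orthotoric_metric_def
    using ex_nonzero[OF x] by (simp add: square_def axis_def) (simp add: field_simps power2_eq_square)
  then show ?thesis by blast
qed

lemma ex_J_nth: "ex_J x $ i $ j = ot_J (x $ 2) (x $ 1 - x $ 2) (F (x $ 1)) (G (x $ 2)) i j"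
  by (simp add: ex_J_def)

lemma smooth_F: "smooth_on V (\<lambda>x. F (x $ 1))" and smooth_G: "smooth_on V (\<lambda>x. G (x $ 2))"
proof -
  show "smooth_on V (\<lambda>x. F (x $ 1))"
    by (rule smooth_on_compose[OF V open_image_vec_nth[OF V] _ F]) (auto intro!: smooth_intros V)
  show "smooth_on V (\<lambda>x. G (x $ 2))"
    by (rule smooth_on_compose[OF V open_image_vec_nth[OF V] _ G]) (auto intro!: smooth_intros V)
qed

lemma smooth_ex_g: "smooth_on V ex_g"
  unfolding ex_g_def[abs_def] orthotoric_metric_def square_def vector_add_component vector_scaleR_component
  using ex_nonzero
  by (intro smooth_intros V smooth_F smooth_G) auto

lemma smooth_ex_J: "smooth_on V ex_J"
proof -
  have "\<forall>i j. smooth_on V (\<lambda>x. ot_J (x $ 2) (x $ 1 - x $ 2) (F (x $ 1)) (G (x $ 2)) i j)"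
    unfolding forall_4 ot_J_def mat4 select4 using ex_nonzero
    by (intro conjI smooth_intros V smooth_F smooth_G) auto
  then show ?thesis unfolding ex_J_def[abs_def] by (intro smooth_on_vec V) blast
qed

lemma ex_hermitian: "x \<in> V \<Longrightarrow> hermitian (ex_g x) (ex_J x)"
proof -
  assume x: "x \<in> V"
  have "ex_J x ** ex_J x = - mat 1"
    by (simp add: vec_eq_iff matrix_matrix_mult_def ex_J_nth ot_J_square[OF ex_nonzero(1-3)[OF x]] mat_def)
  moreover have "transpose (ex_J x) ** ex_g x ** ex_J x = ex_g x"
    by (simp add: vec_eq_iff matrix_matrix_mult_def transpose_def ex_J_nth ex_g_nth[OF x] ot_orthogonal[OF ex_nonzero(1-3)[OF x]])
  ultimately show ?thesis using pd[OF x] by (simp add: hermitian_def ex_g_def)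
qed

lemma ex_chart: "hermitian_chart V ex_g ex_J"
  by unfold_locales (use V smooth_ex_g smooth_ex_J ex_hermitian in auto)

interpretation hermitian_chart V ex_g ex_J by (rule ex_chart)

lemma ex_derivatives:
  assumes x: "x \<in> V"
  defines "f' \<equiv> frechet_derivative F (at (x $ 1)) 1" and "k' \<equiv> frechet_derivative G (at (x $ 2)) 1"
  shows
    "dd i ex_g x $ j $ l = ot_dmetric (x $ 2) (x $ 1 - x $ 2) (F (x $ 1)) (G (x $ 2)) f' k' i j l"
    "dd i ex_J x $ j $ l = ot_dJ (x $ 2) (x $ 1 - x $ 2) (F (x $ 1)) (G (x $ 2)) f' k' i j l"
proof -
  have dF: "F differentiable (at (x $ 1))" "G differentiable (at (x $ 2))"
    using smooth_on_differentiable[OF F] smooth_on_differentiable[OF G] x by auto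
  note c = dd_coordinate_function[OF dF(1)] dd_coordinate_function[OF dF(2)] dd_coordinate
  have de: "dd i (\<lambda>x. x $ 1 - x $ 2) x = (if i = 1 then 1 else 0) - (if i = 2 then 1 else 0 :: real)" for i
    by (simp add: dd_diff c)
  have dd: "(\<lambda>x::real^4. x $ 1 - x $ 2) differentiable (at x)" using c by simp
  note E = ot_entries_derivative[OF c(2,4) c(6) dd ex_nonzero(1-3)[OF x] c(1,3,5) de, folded f'_def k'_def]
    have "dd i ex_g x $ j $ l = dd i (\<lambda>y. ex_g y $ j $ l) x"
      using pd_entry[OF x smooth_ex_g] by (simp add: pd_eq_dd)
    also have "\<dots> = dd i (\<lambda>x. ot_metric (x $ 2) (x $ 1 - x $ 2) (F (x $ 1)) (G (x $ 2)) j l) x"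
      by (rule dd_cong[OF V x]) (rule ex_g_nth)
    finally show "dd i ex_g x $ j $ l = ot_dmetric (x $ 2) (x $ 1 - x $ 2) (F (x $ 1)) (G (x $ 2)) f' k' i j l"
      unfolding E .
    have "dd i ex_J x $ j $ l = dd i (\<lambda>y. ex_J y $ j $ l) x"
      using pd_entry[OF x smooth_ex_J] by (simp add: pd_eq_dd)
    then show "dd i ex_J x $ j $ l = ot_dJ (x $ 2) (x $ 1 - x $ 2) (F (x $ 1)) (G (x $ 2)) f' k' i j l"
      unfolding ex_J_nth E .
qed

lemma ex_parallel: "x \<in> V \<Longrightarrow> nabla_endo ex_g ex_J x = 0"
proof -
  assume x: "x \<in> V"
  define f' k' where "f' = frechet_derivative F (at (x $ 1)) 1" and "k' = frechet_derivative G (at (x $ 2)) 1"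
  note D = ex_derivatives[OF x, folded f'_def k'_def]
  have C: "(ex_g x ** \<Gamma> i x) $ l $ j = ot_christoffel (x $ 2) (x $ 1 - x $ 2) (F (x $ 1)) (G (x $ 2)) f' k' i l j" for i l j
    unfolding lowered_christoffel[OF x] D ot_christoffel_def ..
  have "ex_g x ** dd i ex_J x + (ex_g x ** \<Gamma> i x) ** ex_J x + transpose (ex_J x) ** (ex_g x ** \<Gamma> i x) = 0" for i
  proof -
    have m: "(A ** B) $ j $ l = (\<Sum>m\<in>UNIV. A $ j $ m * B $ m $ l)" "(transpose A ** B) $ j $ l = (\<Sum>m\<in>UNIV. A $ m $ j * B $ m $ l)"
      for A B :: "real^4^4" and j l by (simp_all add: matrix_matrix_mult_def transpose_def)
    have "(ex_g x ** dd i ex_J x + (ex_g x ** \<Gamma> i x) ** ex_J x + transpose (ex_J x) ** (ex_g x ** \<Gamma> i x)) $ j $ l = 0" for j l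
      unfolding vector_add_component m(1)[of "ex_g x" "dd i ex_J x"] m(1)[of "ex_g x ** \<Gamma> i x"] m(2) C D ex_g_nth[OF x] ex_J_nth
      by (rule ot_parallel[OF ex_nonzero(1-3)[OF x]])
    then show ?thesis by (simp add: vec_eq_iff)
  qed
  then show ?thesis unfolding parallel_iff_lowered[OF x] by blast
qed

lemma ex_kahler: "kahler_surface V {(V, id)} (\<lambda>c. ex_g) (\<lambda>c. ex_J)"
proof -
  have "nijenhuis ex_J x = 0" if x: "x \<in> V" for x
  proof -
    note D = ex_derivatives[OF x]
    show ?thesis
      by (simp add: vec_eq_iff nijenhuis_def pd_entry[OF x smooth_ex_J] D)
        (simp add: ex_J_nth ot_nijenhuis[OF ex_nonzero(1-3)[OF x]])
  qed
  then show ?thesis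
    unfolding kahler_surface_def
    using id_manifold[OF V] hermitianD[OF ex_hermitian] ex_parallel smooth_ex_g smooth_ex_J
    by (simp add: id_fields[OF V] id_chart_img)
qed

lemma ex_J_covector:
  assumes x: "x \<in> V"
  shows "J_covector (ex_J x) (axis 1 1) = (F (x $ 1) / (x $ 1 - x $ 2)) *\<^sub>R (axis 3 1 + x $ 2 *\<^sub>R axis 4 1)"
    "J_covector (ex_J x) (axis 2 1) = (G (x $ 2) / (x $ 2 - x $ 1)) *\<^sub>R (axis 3 1 + x $ 1 *\<^sub>R axis 4 1)"
    "J_covector (ex_J x) (axis 3 1) = - (x $ 1 / F (x $ 1)) *\<^sub>R axis 1 1 - (x $ 2 / G (x $ 2)) *\<^sub>R axis 2 1"
    "J_covector (ex_J x) (axis 4 1) = (1 / F (x $ 1)) *\<^sub>R axis 1 1 + (1 / G (x $ 2)) *\<^sub>R axis 2 1"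
  unfolding vec_eq_iff forall_4 J_covector_def vec_lambda_beta sum_4 ex_J_nth ot_J_def mat4 select4
  using ex_nonzero[OF x] by (simp_all add: axis_def) (simp_all add: field_simps)

lemma ex_kahler_form:
  assumes x: "x \<in> V"
  shows "kahler_form (ex_g x) (ex_J x) = wedge (axis 1 1) (axis 3 1 + x $ 2 *\<^sub>R axis 4 1) + wedge (axis 2 1) (axis 3 1 + x $ 1 *\<^sub>R axis 4 1)"
    (is "?L = ?R")
proof -
  define e where "e = x $ 1 - x $ 2"
  have e: "x $ 1 = x $ 2 + e" "e \<noteq> 0" using ex_nonzero[OF x] by (auto simp: e_def)
  have "\<forall>i j. ?L $ i $ j = ?R $ i $ j"
    unfolding forall_4 kahler_form_def vec_lambda_beta sum_4 ex_J_nth ex_g_nth[OF x] ot_J_def ot_metric_def mat4 select4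
    using ex_nonzero(2,3)[OF x] e(2) unfolding e(1)
    by (simp add: axis_def wedge_def) (simp add: field_simps power2_eq_square)
  then show ?thesis by (simp add: vec_eq_iff)
qed

lemma differential_coordinate: "differential (\<lambda>x. x $ m) x = axis m 1"
  by (simp add: differential_def pd_eq_dd dd_coordinate axis_def vec_eq_iff)

lemma ex_momentum:
  assumes x: "x \<in> V"
  shows "ex_J x *v grad ex_g (\<lambda>x. x $ 1 + x $ 2) x = axis 3 1"
    "ex_J x *v grad ex_g (\<lambda>x. x $ 1 * x $ 2) x = axis 4 1"
proof -
  have key: "ex_J x *v (h x *v \<alpha>) = axis i 1" if "Jc x \<alpha> = ex_g x $ i" for \<alpha> and i :: 4
  proof -
    have "ex_g x *v axis i 1 = ex_g x $ i"
      by (simp add: vec_eq_iff matrix_vector_mul_component inner_axis pos_def_sym[OF at_point(8)[OF x], of i])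
    then have "h x *v (ex_g x $ i) = axis i 1" by (metis at_point(6)[OF x] matrix_vector_mul_assoc matrix_vector_mul_lid)
    then show ?thesis using h_Jc[OF x, of \<alpha>] that by simp
  qed
  have d: "differential (\<lambda>x. x $ 1 + x $ 2) x = axis 1 1 + axis 2 1" "differential (\<lambda>x. x $ 1 * x $ 2) x = x $ 2 *\<^sub>R axis 1 1 + x $ 1 *\<^sub>R axis 2 1"
    by (simp_all add: differential_def pd_eq_dd dd_add dd_mult dd_coordinate axis_def vec_eq_iff)
  define e where "e = x $ 1 - x $ 2"
  have e: "x $ 1 = x $ 2 + e" "x $ 2 - (x $ 2 + e) = - e" "e \<noteq> 0" using ex_nonzero[OF x] by (auto simp: e_def)
  have 3: "Jc x (axis 1 1 + axis 2 1) = ex_g x $ 3" "Jc x (x $ 2 *\<^sub>R axis 1 1 + x $ 1 *\<^sub>R axis 2 1) = ex_g x $ 4"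
    unfolding J_covector_linear ex_J_covector[OF x] vec_eq_iff forall_4 ex_g_nth[OF x] ot_metric_def mat4 select4
    using ex_nonzero(2,3)[OF x] e(3) unfolding e(1) e(2) by (simp_all add: axis_def) (simp_all add: field_simps power2_eq_square)
  show "ex_J x *v grad ex_g (\<lambda>x. x $ 1 + x $ 2) x = axis 3 1" "ex_J x *v grad ex_g (\<lambda>x. x $ 1 * x $ 2) x = axis 4 1"
    unfolding grad_def d by (rule key[OF 3(1)], rule key[OF 3(2)])
qed

text \<open>The metric coefficients do not depend on the coordinates \<open>t\<close> and \<open>z\<close>.\<close>

lemma ex_killing:
  assumes m: "m = 3 \<or> m = 4"
  shows "killing_field {(V, id)} (\<lambda>c. ex_g) (\<lambda>c x. axis m 1)"
proof -
  have "lie_metric (\<lambda>x. axis m 1) ex_g x = 0" if x: "x \<in> V" for x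
  proof -
    note D = ex_derivatives[OF x]
    have "dd m ex_g x $ j $ l = 0" for j l
      unfolding D ot_dmetric_def using m by (auto simp: select4)
    then show ?thesis
      by (simp add: vec_eq_iff lie_metric_def pd_entry[OF x smooth_ex_g] axis_def if_distrib[of "\<lambda>c. c * _"] pd_eq_dd[symmetric] cong: if_cong)
        (simp add: pd_eq_dd dd_const)
  qed
  then show ?thesis by (simp add: killing_field_def id_fields[OF V] id_chart_img smooth_on_const)
qed

lemma ex_orthotoric: "orthotoric_by {(V, id)} (\<lambda>c. ex_g) (\<lambda>c. ex_J) (\<lambda>x. x $ 1) (\<lambda>x. x $ 2)"
  unfolding orthotoric_by_def
proof (intro conjI exI)
  show "smooth_function {(V, id)} (\<lambda>x. x $ 1)" "smooth_function {(V, id)} (\<lambda>x. x $ 2)"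
    unfolding id_smooth_function[OF V] by (intro smooth_intros V)+
  show "killing_field {(V, id)} (\<lambda>c. ex_g) (\<lambda>c x. axis 3 1)" "killing_field {(V, id)} (\<lambda>c. ex_g) (\<lambda>c x. axis 4 1)"
    by (rule ex_killing, simp)+
  show "independent_fields {(V, id)} (\<lambda>c x. axis 3 1) (\<lambda>c x. axis 4 1)"
    unfolding independent_fields_def vec_eq_iff forall_4 by (simp add: axis_def)
  have jg: "J_grad (\<lambda>c. ex_g) (\<lambda>c. ex_J) (local_rep f) (V, id) x = ex_J x *v grad ex_g f x" if "x \<in> V" for f x
    by (simp add: J_grad_def grad_def id_differential[OF V that])
  show "momentum_map {(V, id)} (\<lambda>c. ex_g) (\<lambda>c. ex_J) (\<lambda>c x. axis 3 1) (\<lambda>x. x $ 1 + x $ 2)"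
    "momentum_map {(V, id)} (\<lambda>c. ex_g) (\<lambda>c. ex_J) (\<lambda>c x. axis 4 1) (\<lambda>x. x $ 1 * x $ 2)"
    by (simp_all add: momentum_map_def id_chart_img jg ex_momentum)
  have "axis 3 1 \<bullet> (kahler_form (ex_g x) (ex_J x) *v axis 4 1) = 0" if "x \<in> V" for x
    unfolding ex_kahler_form[OF that] by (simp add: inner_axis' matrix_vector_mul_component inner_axis wedge_def) (simp add: axis_def)
  then show "poisson_commute {(V, id)} (\<lambda>c. ex_g) (\<lambda>c. ex_J) (\<lambda>x. x $ 1 + x $ 2) (\<lambda>x. x $ 1 * x $ 2)"
    by (simp add: poisson_commute_def id_chart_img jg ex_momentum)
  have "covector_inner (ex_g x) (axis 1 1) (axis 2 1) = 0" if x: "x \<in> V" for x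
  proof -
    have g2: "ex_g x *v axis 2 1 = ex_g x $ 2 $ 2 *\<^sub>R axis 2 1"
      unfolding vec_eq_iff forall_4 matrix_vector_mul_component ex_g_nth[OF x]
      by (simp add: inner_axis ex_g_nth[OF x] ot_metric_def mat4 select4) (simp add: axis_def)
    have "axis 2 1 = h x *v (ex_g x *v axis 2 1)" by (simp add: matrix_vector_mul_assoc at_point[OF x])
    then have "axis 2 1 = ex_g x $ 2 $ 2 *\<^sub>R (h x *v axis 2 1)" unfolding g2 by (simp add: mv.scaleR_right)
    then have "axis 1 1 \<bullet> (axis 2 1 :: real^4) = ex_g x $ 2 $ 2 * (axis 1 1 \<bullet> (h x *v axis 2 1))"
      by (metis inner_scaleR_right)
    moreover have "ex_g x $ 2 $ 2 \<noteq> 0"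
      using ex_nonzero[OF x] by (simp add: ex_g_nth[OF x] ot_metric_def mat4 select4)
    ultimately show ?thesis by (simp add: covector_inner_def inner_axis_axis)
  qed
  then show "\<forall>c\<in>{(V, id)}. \<forall>x\<in>chart_img c. covector_inner ((\<lambda>c. ex_g) c x) (differential (local_rep (\<lambda>x. x $ 1) c) x)
      (differential (local_rep (\<lambda>x. x $ 2) c) x) = 0"
    by (simp add: id_chart_img id_differential[OF V] differential_coordinate)
qed

lemma ex_form: "orthotoric_form {(V, id)} (\<lambda>c. ex_g) (\<lambda>c. ex_J) V (\<lambda>x. x $ 1) (\<lambda>x. x $ 2) (\<lambda>x. x $ 3) (\<lambda>x. x $ 4) F G"
  unfolding orthotoric_form_def
  by (simp add: Let_def id_differential[OF V] differential_coordinate ex_nonzero ex_J_covector ex_kahler_form)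
    (simp add: ex_g_def)

lemma explicit_orthotoric: "\<exists>(g' :: (real^4, real^4^4) field) J'.
           kahler_surface V {(V, id)} g' J' \<and>
           orthotoric_by {(V, id)} g' J' (\<lambda>x. x $ 1) (\<lambda>x. x $ 2) \<and>
           orthotoric_form {(V, id)} g' J' V
             (\<lambda>x. x $ 1) (\<lambda>x. x $ 2) (\<lambda>x. x $ 3) (\<lambda>x. x $ 4) F G"
  using ex_kahler ex_orthotoric ex_form by blast

end

section \<open>Ortho-toric and hamiltonian data in a chart\<close>

lemma square_outer: "square u = outer u u"
  by (simp add: square_def outer_def)

text \<open>In a unitary frame the square norm is a sum of squares of entries.\<close>

lemma form_inner_pos:
  assumes g: "hermitian g J" and a: "alternating \<Psi>" and nz: "\<Psi> \<noteq> 0"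
  shows "form_inner g \<Psi> \<Psi> > 0"
proof -
  note h = hermitianD[OF g]
  obtain P where P: "frame g J P" using frame_exists[OF g] .
  have "pull P \<Psi> \<noteq> 0"
  proof
    assume "pull P \<Psi> = 0"
    then have "pull P \<Psi> = pull P 0" by (simp add: pull_def)
    then show False using pull_inj P nz by (auto simp: frame_def)
  qed
  then obtain i j where "pull P \<Psi> $ i $ j \<noteq> 0" by (auto simp: vec_eq_iff)
  then have "0 < (\<Sum>i\<in>UNIV. \<Sum>j\<in>UNIV. (pull P \<Psi> $ i $ j)\<^sup>2)"
    by (intro sum_pos2[of _ i] sum_pos2[of _ j] sum_nonneg) auto
  then show ?thesis unfolding frame_form_inner[OF P h(2,3)] std_form_inner by (simp add: power2_eq_square)
qed

context kahler_chart
begin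

lemma J_grad_eq: "J x *v grad g f x = J x *v (h x *v differential f x)"
  by (simp add: grad_def)

lemma poisson_bracket:
  assumes x: "x \<in> S"
  shows "(J x *v (h x *v u)) \<bullet> (\<omega> x *v (J x *v (h x *v v))) = Jc x u \<bullet> (h x *v v)"
proof -
  have "(J x *v (h x *v u)) \<bullet> (\<omega> x *v (J x *v (h x *v v))) = (J x *v (J x *v (h x *v u))) \<bullet> (g x *v (J x *v (h x *v v)))"
    by (simp add: kahler_form_eq matrix_vector_mul_assoc[symmetric] inner_transpose del: transpose_matrix_vector)
  also have "J x *v (J x *v (h x *v u)) = - (h x *v u)"
    by (simp add: matrix_vector_mul_assoc at_point[OF x] mm.minus_left mv.minus_left matrix_mul_assoc)
  also have "- (h x *v u) \<bullet> (g x *v (J x *v (h x *v v))) = - (u \<bullet> (J x *v (h x *v v)))"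
  proof -
    have "(h x *v u) \<bullet> (g x *v w) = u \<bullet> w" for w
      using inner_transpose[of u "h x" "g x *v w"] at_point(5,6)[OF x]
      by (simp add: matrix_vector_mul_assoc del: transpose_matrix_vector)
    then show ?thesis by simp
  qed
  also have "\<dots> = Jc x u \<bullet> (h x *v v)" by (simp add: inner_Jc)
  finally show ?thesis .
qed

lemma differential_add:
  assumes "x \<in> S" "smooth_on S a" "smooth_on S b"
  shows "differential (\<lambda>x. a x + b x) x = differential a x + differential b x"
  by (simp add: differential_def pd_eq_dd vec_eq_iff dd_add[OF diffble[OF assms(2,1)] diffble[OF assms(3,1)]])

text \<open>The combinations \<open>a d (a + b) - d (a b) = (a - b) da\<close> and \<open>b d (a + b) - d (a b) = (b - a) db\<close> are
  not zero.\<close>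

lemma independent_pair:
  assumes a: "smooth_on S a" and b: "smooth_on S b" and x: "x \<in> S"
    and ind: "\<And>r s. r *\<^sub>R differential (\<lambda>x. a x + b x) x + s *\<^sub>R differential (\<lambda>x. a x * b x) x = 0 \<Longrightarrow> r = 0 \<and> s = 0"
  shows "a x \<noteq> b x" "differential a x \<noteq> 0" "differential b x \<noteq> 0"
proof -
  note d = differential_add[OF x a b] differential_mult[OF x a b]
  show "a x \<noteq> b x" using ind[of "a x" "- 1"] unfolding d by (auto simp: algebra_simps)
  show "differential a x \<noteq> 0" using ind[of "a x" "- 1"] unfolding d by auto
  show "differential b x \<noteq> 0" using ind[of "b x" "- 1"] unfolding d by auto
qed

lemma independent_differentials:
  assumes x: "x \<in> S"
    and ind: "\<forall>r s. r *\<^sub>R (J x *v grad g f x) + s *\<^sub>R (J x *v grad g f' x) = 0 \<longrightarrow> r = 0 \<and> s = 0"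
    and z: "r *\<^sub>R differential f x + s *\<^sub>R differential f' x = 0"
  shows "r = 0 \<and> s = 0"
proof -
  have "r *\<^sub>R (J x *v grad g f x) + s *\<^sub>R (J x *v grad g f' x) = J x *v (h x *v (r *\<^sub>R differential f x + s *\<^sub>R differential f' x))"
    by (simp add: J_grad_eq mv.add_right mv.scaleR_right)
  then show ?thesis using ind unfolding z by simp
qed

text \<open>The Poisson bracket of \<open>a + b\<close> and \<open>a b\<close> is \<open>a - b\<close> times that of \<open>a\<close> and \<open>b\<close>.\<close>

lemma orth_pair_orthotoric:
  assumes a: "smooth_on S a" and b: "smooth_on S b"
    and orth: "\<And>x. x \<in> S \<Longrightarrow> covector_inner (g x) (differential a x) (differential b x) = 0"
    and poisson: "\<And>x. x \<in> S \<Longrightarrow> (J x *v grad g (\<lambda>x. a x + b x) x) \<bullet> (\<omega> x *v (J x *v grad g (\<lambda>x. a x * b x) x)) = 0"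
    and ind: "\<And>x. x \<in> S \<Longrightarrow> \<forall>r s. r *\<^sub>R (J x *v grad g (\<lambda>x. a x + b x) x) + s *\<^sub>R (J x *v grad g (\<lambda>x. a x * b x) x) = 0 \<longrightarrow> r = 0 \<and> s = 0"
  shows "orth_pair a b"
proof -
  have "a x \<noteq> b x \<and> differential a x \<noteq> 0 \<and> differential b x \<noteq> 0 \<and>
     differential a x \<bullet> (h x *v differential b x) = 0 \<and> dJ a x \<bullet> (h x *v differential b x) = 0" if x: "x \<in> S" for x
  proof -
    let ?A = "differential a x" and ?B = "differential b x"
    note d = differential_add[OF x a b] differential_mult[OF x a b]
    note i = independent_pair[OF a b x independent_differentials[OF x ind[OF x]]]
    have o: "?A \<bullet> (h x *v ?B) = 0" using orth[OF x] by (simp add: covector_inner_def)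
    have "Jc x (?A + ?B) \<bullet> (h x *v (b x *\<^sub>R ?A + a x *\<^sub>R ?B)) = 0"
      using poisson[OF x] unfolding J_grad_eq poisson_bracket[OF x] d .
    moreover have "Jc x v \<bullet> (h x *v v) = 0" for v
      using inner_Jc_self[OF x, of v] inner_h_sym[OF x, of v "Jc x v"] by simp
    moreover have "Jc x ?B \<bullet> (h x *v ?A) = - (Jc x ?A \<bullet> (h x *v ?B))"
      using inner_h_sym[OF x, of "Jc x ?B" ?A] h_Jc[OF x, of ?B] inner_Jc[of ?A x "h x *v ?B"] by simp
    ultimately have "(a x - b x) * (Jc x ?A \<bullet> (h x *v ?B)) = 0"
      by (simp add: J_covector_linear inner_add_left inner_add_right mv.add_right mv.scaleR_right algebra_simps)
    then have "dJ a x \<bullet> (h x *v ?B) = 0" using i(1) by (simp add: dJ_def)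
    then show ?thesis using i o by simp
  qed
  then show ?thesis using a b by (simp add: orth_pair_def)
qed

lemma killing_invariant:
  assumes x: "x \<in> S" and f: "smooth_on S f"
    and K: "\<And>x. x \<in> S \<Longrightarrow> K x = J x *v grad g f x" and L: "lie_metric K g x = 0"
  shows "transpose (J x) ** hess f x ** J x = hess f x"
proof -
  have "pd i (\<lambda>y. K y $ l) x = pd i (\<lambda>y. (J y *v grad g f y) $ l) x" for i l
    unfolding pd_eq_dd by (rule dd_cong[OF open_S x]) (simp add: K)
  then have "lie_metric (\<lambda>x. J x *v grad g f x) g x = lie_metric K g x"
    by (simp add: lie_metric_def K[OF x])
  then show ?thesis using killing_iff[OF x f] L by simp
qed

context
  fixes a b assumes ab: "orth_pair a b"
begin

lemma tz_combination:
  assumes x: "x \<in> S"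
  shows "tform a b x + b x *\<^sub>R zform a b x = (1 / sqnorm a x) *\<^sub>R dJ a x"
    "tform a b x + a x *\<^sub>R zform a b x = (1 / sqnorm b x) *\<^sub>R dJ b x"
proof -
  note nz = pair_pos[OF ab x]
  define e where "e = a x - b x"
  have e: "a x - b x = e" "b x - a x = - e" "a x = b x + e" "e \<noteq> 0" using nz by (auto simp: e_def)
  have 1: "a x / Ffun a b x - b x / Ffun a b x = 1 / sqnorm a x" "b x / Ffun b a x - a x / Ffun b a x = 1 / sqnorm b x"
    unfolding Ffun_def e(1,2) diff_divide_distrib[symmetric] using nz(5,6) e(4) by simp_all
  have "tform a b x + b x *\<^sub>R zform a b x = (a x / Ffun a b x - b x / Ffun a b x) *\<^sub>R dJ a x"
    by (simp add: tform_def zform_def algebra_simps)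
  then show "tform a b x + b x *\<^sub>R zform a b x = (1 / sqnorm a x) *\<^sub>R dJ a x" unfolding 1 .
  have "tform a b x + a x *\<^sub>R zform a b x = (b x / Ffun b a x - a x / Ffun b a x) *\<^sub>R dJ b x"
    by (simp add: tform_def zform_def algebra_simps)
  then show "tform a b x + a x *\<^sub>R zform a b x = (1 / sqnorm b x) *\<^sub>R dJ b x" unfolding 1 .
qed

text \<open>All formulas of the explicit form restate the orthogonal decompositions of \<open>g\<close> and \<open>\<omega>\<close>.\<close>

lemma explicit_form:
  assumes x: "x \<in> S" and F: "F (a x) = Ffun a b x" and G: "G (b x) = Ffun b a x"
  shows "a x \<noteq> b x" "F (a x) \<noteq> 0" "G (b x) \<noteq> 0"
    "g x = orthotoric_metric F G (a x) (b x) (differential a x) (differential b x) (tform a b x) (zform a b x)"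
    "Jc x (differential a x) = (F (a x) / (a x - b x)) *\<^sub>R (tform a b x + b x *\<^sub>R zform a b x)"
    "Jc x (tform a b x) = - (a x / F (a x)) *\<^sub>R differential a x - (b x / G (b x)) *\<^sub>R differential b x"
    "Jc x (differential b x) = (G (b x) / (b x - a x)) *\<^sub>R (tform a b x + a x *\<^sub>R zform a b x)"
    "Jc x (zform a b x) = (1 / F (a x)) *\<^sub>R differential a x + (1 / G (b x)) *\<^sub>R differential b x"
    "\<omega> x = wedge (differential a x) (tform a b x + b x *\<^sub>R zform a b x) + wedge (differential b x) (tform a b x + a x *\<^sub>R zform a b x)"
proof -
  note nz = pair_pos[OF ab x]
  show "a x \<noteq> b x" "F (a x) \<noteq> 0" "G (b x) \<noteq> 0"
    using nz Ffun_nz[OF ab x] Ffun_nz[OF orth_pair_sym[OF ab] x] F G by auto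
  have JJ: "Jc x (dJ a x) = - differential a x" "Jc x (dJ b x) = - differential b x" by (simp_all add: dJ_def Jc_Jc[OF x])
  show "Jc x (differential a x) = (F (a x) / (a x - b x)) *\<^sub>R (tform a b x + b x *\<^sub>R zform a b x)"
    "Jc x (differential b x) = (G (b x) / (b x - a x)) *\<^sub>R (tform a b x + a x *\<^sub>R zform a b x)"
    unfolding tz_combination[OF x] F G Ffun_def using nz by (simp_all add: dJ_def)
  show "Jc x (tform a b x) = - (a x / F (a x)) *\<^sub>R differential a x - (b x / G (b x)) *\<^sub>R differential b x"
    "Jc x (zform a b x) = (1 / F (a x)) *\<^sub>R differential a x + (1 / G (b x)) *\<^sub>R differential b x"
    unfolding F G by (simp_all add: tform_def zform_def J_covector_linear JJ)
  show "\<omega> x = wedge (differential a x) (tform a b x + b x *\<^sub>R zform a b x) + wedge (differential b x) (tform a b x + a x *\<^sub>R zform a b x)"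
    unfolding tz_combination[OF x] wedge_linear by (rule kahler_decomp[OF ab x])
  have c: "(a x - b x) * (1 / Ffun a b x) = 1 / sqnorm a x" "(a x - b x) * (1 / Ffun b a x) = - (1 / sqnorm b x)"
    "(1 / (a x - b x)) * Ffun a b x = sqnorm a x" "(1 / (a x - b x)) * Ffun b a x = - sqnorm b x"
  proof -
    define e where "e = a x - b x"
    have e: "a x - b x = e" "b x - a x = - e" "e \<noteq> 0" using nz by (auto simp: e_def)
    show "(a x - b x) * (1 / Ffun a b x) = 1 / sqnorm a x" "(a x - b x) * (1 / Ffun b a x) = - (1 / sqnorm b x)"
      "(1 / (a x - b x)) * Ffun a b x = sqnorm a x" "(1 / (a x - b x)) * Ffun b a x = - sqnorm b x"
      unfolding Ffun_def e(1,2) using e(3) nz(5,6) by simp_all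
  qed
  have so: "square (c *\<^sub>R u) = (c * c) *\<^sub>R outer u u" for c u by (simp add: square_def outer_def vec_eq_iff)
  have "orthotoric_metric F G (a x) (b x) (differential a x) (differential b x) (tform a b x) (zform a b x) =
     ((a x - b x) * (1 / Ffun a b x)) *\<^sub>R outer (differential a x) (differential a x) - ((a x - b x) * (1 / Ffun b a x)) *\<^sub>R outer (differential b x) (differential b x)
     + (((1 / (a x - b x)) * Ffun a b x) *\<^sub>R ((1 / sqnorm a x * (1 / sqnorm a x)) *\<^sub>R outer (dJ a x) (dJ a x))
     - ((1 / (a x - b x)) * Ffun b a x) *\<^sub>R ((1 / sqnorm b x * (1 / sqnorm b x)) *\<^sub>R outer (dJ b x) (dJ b x)))"
    unfolding orthotoric_metric_def tz_combination[OF x] F G so by (simp only: square_outer scaleR_diff_right scaleR_scaleR mult.assoc)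
  also have "\<dots> = g x"
    unfolding c by (subst metric_decomp[OF ab x]) (use nz(5,6) in \<open>simp add: algebra_simps\<close>)
  finally show "g x = orthotoric_metric F G (a x) (b x) (differential a x) (differential b x) (tform a b x) (zform a b x)" ..
qed

text \<open>The four differentials span all covectors, so the functions \<open>\<xi>, \<eta>, t, z\<close> are local coordinates.\<close>

lemma tz_independent:
  assumes x: "x \<in> S"
    and v: "differential a x \<bullet> v = 0" "differential b x \<bullet> v = 0" "tform a b x \<bullet> v = 0" "zform a b x \<bullet> v = 0"
  shows "v = 0"
proof -
  have "(tform a b x + b x *\<^sub>R zform a b x) \<bullet> v = 0" "(tform a b x + a x *\<^sub>R zform a b x) \<bullet> v = 0"
    using v by (simp_all add: inner_add_left)
  then have "dJ a x \<bullet> v = 0" "dJ b x \<bullet> v = 0" unfolding tz_combination[OF x] using pair_pos[OF ab x] by simp_all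
  then have "v \<bullet> (g x *v v) = 0"
    by (subst metric_decomp[OF ab x])
      (simp add: mv.add_left mv.scaleR_left inner_add_right outer_eval v inner_commute[of v])
  then show ?thesis using at_point(8)[OF x] unfolding pos_def_def by (metis less_irrefl)
qed

text \<open>The invariant 2-form whose endomorphism has the eigenvalues \<open>a\<close> and \<open>b\<close>.\<close>

definition pair_form :: "real^4 \<Rightarrow> real^4^4" where
  "pair_form x = a x *\<^sub>R eigenform a x + b x *\<^sub>R eigenform b x"

lemma smooth_pair_form: "smooth_on S pair_form"
proof -
  have "sqnorm a y \<noteq> 0" "sqnorm b y \<noteq> 0" if "y \<in> S" for y using pair_pos[OF ab that] by auto
  then show ?thesis
    unfolding pair_form_def[abs_def] eigenform_def
    by (intro smooth_intros open_S smooth_a[OF ab] smooth_b[OF ab] smooth_p[OF ab] smooth_q[OF ab]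
      smooth_da[OF ab] smooth_db[OF ab] smooth_dJa[OF ab] smooth_dJb[OF ab])
qed

lemma alternating_pair_form: "alternating (pair_form x)"
  using alternating_nth[OF alternating_wedge] by (intro alternatingI) (simp add: pair_form_def eigenform_def wedge_def algebra_simps)

lemma pair_form_invariant:
  assumes x: "x \<in> S"
  shows "transpose (J x) ** pair_form x ** J x = pair_form x"
proof -
  have "transpose (J x) ** wedge u (Jc x u) ** J x = wedge u (Jc x u)" for u
    unfolding wedge_outer mm.diff_right mm.diff_left J_invariant_outer Jc_Jc[OF x] by (simp add: outer_linear)
  then show ?thesis
    by (simp add: pair_form_def eigenform_def dJ_def mm.add_left mm.add_right mm.scaleR_left mm.scaleR_right)
qed

lemma pair_form_inner:
  assumes x: "x \<in> S"
  shows "form_inner (g x) (pair_form x) (\<omega> x) = a x + b x"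
    "form_inner (g x) (pair_form x) (pair_form x) = (a x)\<^sup>2 + (b x)\<^sup>2"
proof -
  note nz = pair_pos[OF ab x]
  have w: "form_inner (g x) (wedge u v) (wedge u' v') = (u' \<bullet> (h x *v u)) * (v' \<bullet> (h x *v v)) - (v' \<bullet> (h x *v u)) * (u' \<bullet> (h x *v v))" for u v u' v'
    unfolding form_inner_wedge[OF at_point(5)[OF x] alternating_wedge] wedge_eval ..
  have e: "form_inner (g x) (eigenform a x) (eigenform a x) = 1" "form_inner (g x) (eigenform b x) (eigenform b x) = 1"
    "form_inner (g x) (eigenform a x) (eigenform b x) = 0" "form_inner (g x) (eigenform b x) (eigenform a x) = 0"
    unfolding eigenform_def form_inner_scaleR_left form_inner_scaleR_right w using nz
    by (simp_all add: pairings[OF ab x])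
  have o: "\<omega> x = eigenform a x + eigenform b x" unfolding eigenform_def by (rule kahler_decomp[OF ab x])
  show "form_inner (g x) (pair_form x) (\<omega> x) = a x + b x" "form_inner (g x) (pair_form x) (pair_form x) = (a x)\<^sup>2 + (b x)\<^sup>2"
    unfolding pair_form_def o form_inner_add_left form_inner_add_right form_inner_scaleR_left form_inner_scaleR_right e
    by (simp_all add: power2_eq_square)
qed

lemma pair_form_pfaffian:
  assumes x: "x \<in> S"
  shows "wedge2 (pair_form x) (pair_form x) = a x * b x * wedge2 (\<omega> x) (\<omega> x)"
  using wedge2_square[OF herm[OF x] alternating_pair_form pair_form_invariant[OF x]]
  unfolding pair_form_inner[OF x] by (simp add: power2_eq_square algebra_simps)

context
  fixes x k l
  assumes x: "x \<in> S" and Ha: "normal_hess a b x k" and Hb: "normal_hess b a x l"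
begin

lemma nF_pair_form_eq:
  "nF i pair_form x = (1/2) *\<^sub>R (wedge (differential (\<lambda>x. a x + b x) x) (Jc x (g x $ i)) - wedge (Jc x (differential (\<lambda>x. a x + b x) x)) (g x $ i))"
  unfolding pair_form_def[abs_def] nF_pair_form[OF ab x Ha Hb] differential_add[OF x smooth_a[OF ab] smooth_b[OF ab]]
  by (simp add: J_covector_linear dJ_def)

lemma nF_pair_form_plus:
  assumes s: "smooth_on S s"
  shows "nF i (\<lambda>x. pair_form x + s x *\<^sub>R \<omega> x) x = nF i pair_form x + dd i s x *\<^sub>R \<omega> x"
proof -
  have so: "smooth_on S \<omega>" by (intro smooth_intros open_S smooth_g smooth_J)
  show ?thesis
    unfolding nF_add[OF x smooth_pair_form smooth_on_scaleR[OF open_S s so]] nF_scaleR[OF x s so] nF_kahler[OF x] by simp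
qed

text \<open>The covariant derivative of the pair form is the twistor tensor of \<open>d (a + b)\<close> plus \<open>d (a + b) / 2 \<otimes> \<omega>\<close>. Its
  alternation is \<open>- d (a + b) \<and> \<omega>\<close>.\<close>

lemma pair_form_closed: "d_form (\<lambda>x. pair_form x + (a x + b x) *\<^sub>R \<omega> x) x = 0"
proof -
  have ss: "smooth_on S (\<lambda>x. a x + b x)" by (intro smooth_intros open_S smooth_a[OF ab] smooth_b[OF ab])
  have so: "smooth_on S \<omega>" by (intro smooth_intros open_S smooth_g smooth_J)
  note ao = alternating_kahler_form[OF herm[OF x]]
  have alt: "alternating (pair_form x + (a x + b x) *\<^sub>R \<omega> x)"
  proof (rule alternatingI)
    show "(pair_form x + (a x + b x) *\<^sub>R \<omega> x) $ i $ j = - (pair_form x + (a x + b x) *\<^sub>R \<omega> x) $ j $ i" for i j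
      using alternating_nth[OF alternating_pair_form, of x i j] alternating_nth[OF ao, of i j] by simp
  qed
  have sm: "smooth_on S (\<lambda>x. pair_form x + (a x + b x) *\<^sub>R \<omega> x)"
    by (intro smooth_on_add open_S smooth_pair_form smooth_on_scaleR ss so)
  have Jg: "Jc x (g x $ i) $ j = \<omega> x $ i $ j" for i j
  proof -
    have "Jc x (g x $ i) $ j = - (g x ** J x) $ i $ j" by (simp add: J_covector_def matrix_matrix_mult_def)
    then show ?thesis unfolding g_J[OF x] kahler_form_eq by simp
  qed
  have gs: "g x $ i $ j = g x $ j $ i" for i j using pos_def_sym[OF at_point(8)[OF x]] .
  define s t where "s = differential (\<lambda>x. a x + b x) x" and "t = Jc x s"
  have "d_form (\<lambda>x. pair_form x + (a x + b x) *\<^sub>R \<omega> x) x $ i $ j $ k = 0" for i j k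
    unfolding d_form_eq[OF x sm alt] nF_pair_form_plus[OF ss] nF_pair_form_eq dd_differential_nth s_def[symmetric] t_def[symmetric]
    using alternating_nth[OF ao, of j i] alternating_nth[OF ao, of k j] alternating_nth[OF ao, of i k] gs[of j i] gs[of k j] gs[of i k]
    by (simp add: wedge_def Jg field_simps)
  then show ?thesis by (simp add: vec_eq_iff)
qed

text \<open>Subtracting half of the trace times \<open>\<omega>\<close> leaves exactly the twistor tensor of \<open>d (a + b)\<close>.\<close>

lemma pair_form_twistor:
  "nabla_form g (\<lambda>x. pair_form x - (1/2 * (a x + b x)) *\<^sub>R \<omega> x) x \<in> V0 (g x) (J x)"
proof -
  have ss: "smooth_on S (\<lambda>x. a x + b x)" by (intro smooth_intros open_S smooth_a[OF ab] smooth_b[OF ab])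
  have sh: "smooth_on S (\<lambda>x. - 1/2 * (a x + b x))" by (intro smooth_intros open_S ss)
  have so: "smooth_on S \<omega>" by (intro smooth_intros open_S smooth_g smooth_J)
  have e: "(\<lambda>x. pair_form x - (1/2 * (a x + b x)) *\<^sub>R \<omega> x) = (\<lambda>x. pair_form x + (- 1/2 * (a x + b x)) *\<^sub>R \<omega> x)"
    by (simp add: fun_eq_iff flip: scaleR_minus_left)
  have sm: "smooth_on S (\<lambda>x. pair_form x + (- 1/2 * (a x + b x)) *\<^sub>R \<omega> x)"
    by (intro smooth_on_add open_S smooth_pair_form smooth_on_scaleR sh so)
  have d: "dd i (\<lambda>x. - 1/2 * (a x + b x)) x = - 1/2 * dd i (\<lambda>x. a x + b x) x" for i
    by (rule dd_linear[OF bounded_linear_mult_right diffble[OF ss x]])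
  have "nabla_form g (\<lambda>x. pair_form x - (1/2 * (a x + b x)) *\<^sub>R \<omega> x) x $ i
     = twistor_tensor (g x) (J x) (differential (\<lambda>x. a x + b x) x) $ i" for i
    unfolding e nabla_form_eq[OF x sm] nF_pair_form_plus[OF sh] nF_pair_form_eq unfolding d unfolding dd_differential_nth
    by (simp add: twistor_tensor_def)
  then show ?thesis unfolding V0_iff[OF herm[OF x]] by (auto simp: vec_eq_iff)
qed

end

end

end

section \<open>The discriminant of a hamiltonian form\<close>

context kahler_chart
begin

lemma invariant_kahler: "x \<in> S \<Longrightarrow> transpose (J x) ** \<omega> x ** J x = \<omega> x"
  unfolding kahler_form_eq by (metis at_point(4) matrix_mul_assoc)

context
  fixes \<phi> :: "real^4 \<Rightarrow> real^4^4" and \<sigma> \<pi> :: "real^4 \<Rightarrow> real"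
  assumes smooth_phi: "smooth_on S \<phi>"
    and alt_phi: "\<And>x. x \<in> S \<Longrightarrow> alternating (\<phi> x)"
    and inv_phi: "\<And>x. x \<in> S \<Longrightarrow> transpose (J x) ** \<phi> x ** J x = \<phi> x"
    and sigma_eq: "\<And>x. x \<in> S \<Longrightarrow> \<sigma> x = form_inner (g x) (\<phi> x) (\<omega> x) / 3"
begin

lemma smooth_trace: "smooth_on S \<sigma>"
proof (rule smooth_on_cong[OF open_S])
  show "smooth_on S (\<lambda>x. form_inner (g x) (\<phi> x) (\<omega> x) / 3)"
    by (intro smooth_on_divide open_S smooth_form_inner smooth_phi smooth_omega smooth_on_const) simp
qed (simp add: sigma_eq)

lemma smooth_shifted: "smooth_on S (\<lambda>x. \<phi> x - (c * \<sigma> x) *\<^sub>R \<omega> x)"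
  by (intro smooth_intros open_S smooth_phi smooth_trace smooth_omega smooth_g smooth_J)

lemma alternating_shifted:
  assumes x: "x \<in> S"
  shows "alternating (\<phi> x - c *\<^sub>R \<omega> x)"
proof (rule alternatingI)
  show "(\<phi> x - c *\<^sub>R \<omega> x) $ i $ j = - (\<phi> x - c *\<^sub>R \<omega> x) $ j $ i" for i j
    using alternating_nth[OF alt_phi[OF x], of i j] alternating_nth[OF alternating_kahler_form[OF herm[OF x]], of i j] by simp
qed

lemma invariant_shifted: "x \<in> S \<Longrightarrow> transpose (J x) ** (\<phi> x - c *\<^sub>R \<omega> x) ** J x = \<phi> x - c *\<^sub>R \<omega> x"
  by (simp add: mm.diff_left mm.diff_right mm.scaleR_left mm.scaleR_right invariant_kahler inv_phi)

lemma inner_shifted: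
  assumes x: "x \<in> S"
  shows "form_inner (g x) (\<phi> x - (c * \<sigma> x) *\<^sub>R \<omega> x) (\<omega> x) = (3 - 2 * c) * \<sigma> x"
proof -
  have "\<phi> x - (c * \<sigma> x) *\<^sub>R \<omega> x = \<phi> x + (- (c * \<sigma> x)) *\<^sub>R \<omega> x" by simp
  then have "form_inner (g x) (\<phi> x - (c * \<sigma> x) *\<^sub>R \<omega> x) (\<omega> x) = form_inner (g x) (\<phi> x) (\<omega> x) - c * \<sigma> x * 2"
    using kahler_norm(1)[OF herm[OF x]] by (simp only: form_inner_add_left form_inner_scaleR_left)
  moreover have "form_inner (g x) (\<phi> x) (\<omega> x) = 3 * \<sigma> x" using sigma_eq[OF x] by simp
  ultimately show ?thesis by (simp add: algebra_simps)
qed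

lemma pfaffian_eq:
  assumes x: "x \<in> S" and n: "\<psi> = (1/2) *\<^sub>R (\<phi> x - \<sigma> x *\<^sub>R \<omega> x)"
  shows "4 * wedge2 \<psi> \<psi> / wedge2 (\<omega> x) (\<omega> x)
    = ((\<sigma> x)\<^sup>2 - form_inner (g x) (\<phi> x - \<sigma> x *\<^sub>R \<omega> x) (\<phi> x - \<sigma> x *\<^sub>R \<omega> x)) / 2"
  using wedge2_square[OF herm[OF x] alternating_shifted[OF x] invariant_shifted[OF x], of "\<sigma> x"] inner_shifted[OF x, of 1]
    kahler_norm(2)[OF herm[OF x]]
  unfolding n wedge2_scaleR_left wedge2_scaleR_right by (simp add: field_simps)

text \<open>The discriminant is a multiple of the square norm of the trace-free part. At a zero of the latter
  the discriminant has a critical point, and then \<open>d\<pi>\<close> is a multiple of \<open>d\<sigma>\<close>.\<close>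

lemma discriminant_pos:
  assumes pi_eq: "\<And>x. x \<in> S \<Longrightarrow> \<pi> x = ((\<sigma> x)\<^sup>2 - form_inner (g x) (\<phi> x - \<sigma> x *\<^sub>R \<omega> x) (\<phi> x - \<sigma> x *\<^sub>R \<omega> x)) / 2"
    and x: "x \<in> S"
    and ind: "\<And>r s. r *\<^sub>R differential \<sigma> x + s *\<^sub>R differential \<pi> x = 0 \<Longrightarrow> r = 0 \<and> s = 0"
  shows "(\<sigma> x)\<^sup>2 - 4 * \<pi> x > 0"
proof -
  define \<Phi> where "\<Phi> = (\<lambda>x. \<phi> x - (3/2 * \<sigma> x) *\<^sub>R \<omega> x)"
  have sm: "smooth_on S \<Phi>" unfolding \<Phi>_def by (rule smooth_shifted)
  have D: "(\<sigma> y)\<^sup>2 - 4 * \<pi> y = 2 * form_inner (g y) (\<Phi> y) (\<Phi> y)" if y: "y \<in> S" for y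
  proof -
    have P: "\<phi> y - \<sigma> y *\<^sub>R \<omega> y = \<Phi> y + (1/2 * \<sigma> y) *\<^sub>R \<omega> y" by (simp add: \<Phi>_def vec_eq_iff)
    have o: "form_inner (g y) (\<Phi> y) (\<omega> y) = 0" unfolding \<Phi>_def inner_shifted[OF y] by simp
    have "form_inner (g y) (\<phi> y - \<sigma> y *\<^sub>R \<omega> y) (\<phi> y - \<sigma> y *\<^sub>R \<omega> y) = form_inner (g y) (\<Phi> y) (\<Phi> y) + (\<sigma> y)\<^sup>2 / 2"
      unfolding P form_inner_add_left form_inner_add_right form_inner_scaleR_left form_inner_scaleR_right
        form_inner_commute[OF at_point(5)[OF y], of "\<omega> y" "\<Phi> y"] o kahler_norm(1)[OF herm[OF y]]
      by (simp add: power2_eq_square)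
    then show ?thesis using pi_eq[OF y] by (simp only:) argo
  qed
  have "\<Phi> x \<noteq> 0"
  proof
    assume z: "\<Phi> x = 0"
    have fz: "form_inner (g x) 0 B = 0" "form_inner (g x) B 0 = 0" for B by (simp_all add: form_inner_def)
    have sD: "smooth_on S (\<lambda>y. form_inner (g y) (\<Phi> y) (\<Phi> y))" by (intro smooth_form_inner sm)
    have ss: "smooth_on S (\<lambda>y. \<sigma> y * \<sigma> y)" by (intro smooth_intros open_S smooth_trace)
    have "dd i \<pi> x = 1/2 * \<sigma> x * dd i \<sigma> x" for i
    proof -
      have "dd i \<pi> x = dd i (\<lambda>y. (1/4) * (\<sigma> y * \<sigma> y) - (1/2) * form_inner (g y) (\<Phi> y) (\<Phi> y)) x"
        by (rule dd_cong[OF open_S x]) (use D in \<open>simp add: power2_eq_square field_simps\<close>)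
      also have "\<dots> = dd i (\<lambda>y. (1/4) * (\<sigma> y * \<sigma> y)) x - dd i (\<lambda>y. (1/2) * form_inner (g y) (\<Phi> y) (\<Phi> y)) x"
        by (intro dd_diff diffble[OF _ x] smooth_on_mult open_S smooth_on_const ss sD)
      also have "\<dots> = (1/4) * dd i (\<lambda>y. \<sigma> y * \<sigma> y) x - (1/2) * dd i (\<lambda>y. form_inner (g y) (\<Phi> y) (\<Phi> y)) x"
        unfolding dd_linear[OF bounded_linear_mult_right diffble[OF ss x]] dd_linear[OF bounded_linear_mult_right diffble[OF sD x]] ..
      also have "dd i (\<lambda>y. form_inner (g y) (\<Phi> y) (\<Phi> y)) x = 0"
        unfolding dd_form_inner[OF x sm sm] z fz by simp
      also have "dd i (\<lambda>y. \<sigma> y * \<sigma> y) x = 2 * \<sigma> x * dd i \<sigma> x"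
        using diffble[OF smooth_trace x] by (simp add: dd_mult)
      finally show ?thesis by simp
    qed
    then have "differential \<pi> x = (1/2 * \<sigma> x) *\<^sub>R differential \<sigma> x"
      by (simp add: differential_def pd_eq_dd vec_eq_iff)
    then show False using ind[of "1/2 * \<sigma> x" "-1"] by auto
  qed
  moreover have "alternating (\<Phi> x)" unfolding \<Phi>_def by (rule alternating_shifted[OF x])
  ultimately show ?thesis using form_inner_pos[OF herm[OF x]] D[OF x] by simp
qed

end

end

section \<open>Change of charts\<close>

locale surface =
  fixes M :: "'a::{t2_space,second_countable_topology} set" and A :: "'a chart set" and g J :: "('a, real^4^4) field"
  assumes surface: "kahler_surface M A g J"
begin

lemma manifold: "smooth_4manifold M A" and g_field: "bilinear_field A g" and J_field: "endo_field A J"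
  using surface by (auto simp: kahler_surface_def)

lemma chart_A: "c \<in> A \<Longrightarrow> chart c"
  using manifold by (auto simp: smooth_4manifold_def)

lemma chart_inv_img:
  assumes c: "c \<in> A" and x: "x \<in> chart_img c"
  shows "chart_inv c x \<in> fst c" "snd c (chart_inv c x) = x"
  using chart_A[OF c] x by (auto simp: chart_def homeomorphism_def)

lemma chart_inv_snd:
  assumes c: "c \<in> A" and p: "p \<in> fst c"
  shows "snd c p \<in> chart_img c" "chart_inv c (snd c p) = p"
  using chart_A[OF c] p by (auto simp: chart_def homeomorphism_def chart_img_def)

lemma open_chart_img: "c \<in> A \<Longrightarrow> open (chart_img c)"
  using chart_A by (auto simp: chart_def)

lemma chart_kahler:
  assumes c: "c \<in> A"
  shows "kahler_chart (chart_img c) (g c) (J c)"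
proof unfold_locales
  show "open (chart_img c)" by (rule open_chart_img[OF c])
  show "smooth_on (chart_img c) (g c)" "smooth_on (chart_img c) (J c)"
    using g_field J_field c by (auto simp: bilinear_field_def endo_field_def)
  show "hermitian (g c x) (J c x)" "nabla_endo (g c) (J c) x = 0" if "x \<in> chart_img c" for x
    using surface c that by (auto simp: kahler_surface_def hermitian_def)
qed

lemma overlap_mem: "x \<in> overlap c d \<longleftrightarrow> (\<exists>p. p \<in> fst c \<and> p \<in> fst d \<and> x = snd c p)"
  by (auto simp: overlap_def)

lemma overlap_subset: "overlap c d \<subseteq> chart_img c"
  by (auto simp: overlap_def chart_img_def)

lemma overlapI: "c \<in> A \<Longrightarrow> x \<in> chart_img c \<Longrightarrow> chart_inv c x \<in> fst d \<Longrightarrow> x \<in> overlap c d"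
  unfolding overlap_mem by (rule exI[of _ "chart_inv c x"]) (simp add: chart_inv_img)

lemma open_image_chart:
  assumes c: "c \<in> A" and U: "open U"
  shows "open (snd c ` (U \<inter> fst c))"
proof -
  have "snd c ` (U \<inter> fst c) = chart_img c \<inter> chart_inv c -` U"
  proof (intro subset_antisym subsetI)
    fix x assume "x \<in> snd c ` (U \<inter> fst c)"
    then obtain p where "p \<in> U" "p \<in> fst c" "x = snd c p" by (elim imageE IntE)
    then show "x \<in> chart_img c \<inter> chart_inv c -` U" using chart_inv_snd[OF c, of p] by simp
  next
    fix x assume x: "x \<in> chart_img c \<inter> chart_inv c -` U"
    then have "chart_inv c x \<in> U \<inter> fst c" "x = snd c (chart_inv c x)" using chart_inv_img[OF c, of x] by simp_all
    then show "x \<in> snd c ` (U \<inter> fst c)" by (rule rev_image_eqI)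
  qed
  moreover have "continuous_on (chart_img c) (chart_inv c)" using chart_A[OF c] by (auto simp: chart_def homeomorphism_def)
  ultimately show ?thesis using continuous_open_preimage[OF _ open_chart_img[OF c] U] by simp
qed

lemma open_overlap: "c \<in> A \<Longrightarrow> d \<in> A \<Longrightarrow> open (overlap c d)"
  using open_image_chart[of c "fst d"] chart_A[of d] by (simp add: overlap_def chart_def Int_commute)

lemma transition_mem:
  assumes "c \<in> A" "d \<in> A" "x \<in> overlap c d"
  shows "transition c d x \<in> overlap d c" "transition d c (transition c d x) = x"
    "chart_inv d (transition c d x) = chart_inv c x"
proof -
  obtain p where p: "p \<in> fst c" "p \<in> fst d" "x = snd c p" using assms(3) unfolding overlap_mem by (elim exE conjE)
  have t: "transition c d x = snd d p" using p chart_inv_snd(2)[OF assms(1) p(1)] by (simp add: transition_def)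
  show "transition c d x \<in> overlap d c" unfolding t overlap_mem using p by blast
  show "transition d c (transition c d x) = x" unfolding t using p chart_inv_snd(2)[OF assms(2) p(2)] by (simp add: transition_def)
  show "chart_inv d (transition c d x) = chart_inv c x"
    unfolding t using p chart_inv_snd(2)[OF assms(2) p(2)] chart_inv_snd(2)[OF assms(1) p(1)] by simp
qed

lemma smooth_transition: "c \<in> A \<Longrightarrow> d \<in> A \<Longrightarrow> smooth_on (overlap c d) (transition c d)"
  using manifold by (auto simp: smooth_4manifold_def)

context
  fixes c d :: "'a chart" and x :: "real^4"
  assumes c: "c \<in> A" and d: "d \<in> A" and x: "x \<in> overlap c d"
begin

private abbreviation (input) "y \<equiv> transition c d x"
private abbreviation (input) "P \<equiv> jacobian (transition c d) (at x)"

lemma x_img: "x \<in> chart_img c" and y_img: "y \<in> chart_img d" and y_overlap: "y \<in> overlap d c"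
  using subsetD[OF overlap_subset x] subsetD[OF overlap_subset transition_mem(1)[OF c d x]] transition_mem(1)[OF c d x] by simp_all

lemma jacobian_nth: "P $ j $ i = dd i (transition c d) x $ j"
  by (simp add: jacobian_def matrix_def dd_def)

lemma jacobian_invertible: "invertible P"
proof -
  let ?Q = "jacobian (transition d c) (at y)"
  have D: "transition c d differentiable (at x)" "transition d c differentiable (at y)"
    using smooth_on_differentiable[OF smooth_transition[OF c d] x] smooth_on_differentiable[OF smooth_transition[OF d c] y_overlap] .
  have "dd i (\<lambda>x. transition d c (transition c d x)) x = dd i (\<lambda>x. x) x" for i
    by (rule dd_cong[OF open_overlap[OF c d] x]) (rule transition_mem(2)[OF c d])
  moreover have "dd i (\<lambda>x. x) x = axis i 1" for i :: 4 by (rule dd_eq[OF has_derivative_ident])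
  ultimately have "(\<Sum>j\<in>UNIV. dd i (transition c d) x $ j *\<^sub>R dd j (transition d c) y) = axis i 1" for i
    using dd_compose[OF D] by simp
  then have "(\<Sum>j\<in>UNIV. dd i (transition c d) x $ j *\<^sub>R dd j (transition d c) y) $ k = axis i 1 $ k" for i k
    by simp
  then have "?Q ** P = mat 1"
    by (simp add: vec_eq_iff matrix_matrix_mult_def jacobian_nth mat_def axis_def mult.commute)
      (simp add: jacobian_def matrix_def dd_def mult.commute)
  then show ?thesis using invertible_left_inverse by blast
qed

lemma g_transition: "g c x = pull P (g d y)"
  using g_field c d x by (simp add: bilinear_field_def pull_def Let_def)

lemma J_transition: "J d y ** P = P ** J c x"
  using J_field c d x by (simp add: endo_field_def Let_def)

lemma kahler_form_transition: "kahler_form (g c x) (J c x) = pull P (kahler_form (g d y) (J d y))"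
proof -
  have "pull P (kahler_form (g d y) (J d y)) = transpose (J d y ** P) ** g d y ** P"
    by (simp add: pull_def kahler_form_eq matrix_transpose_mul matrix_mul_assoc)
  also have "\<dots> = transpose (J c x) ** pull P (g d y)"
    unfolding J_transition by (simp add: pull_def matrix_transpose_mul matrix_mul_assoc)
  finally show ?thesis by (simp add: kahler_form_eq g_transition)
qed

lemma g_invertible: "invertible (g d y)"
  using hermitianD(3) hermitian_chart.herm[OF kahler_chart.axioms(1)[OF chart_kahler[OF d]] y_img] by blast

text \<open>The inverse metric is a contravariant tensor.\<close>

lemma h_transition: "P ** matrix_inv (g c x) ** transpose P = matrix_inv (g d y)"
proof -
  let ?Q = "matrix_inv P"
  have 1: "P ** ?Q = mat 1" using matrix_inv_mult[OF jacobian_invertible] by auto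
  have 2: "transpose ?Q ** transpose P = mat 1" using 1 by (metis matrix_transpose_mul transpose_mat)
  have "P ** matrix_inv (g c x) ** transpose P = (P ** ?Q) ** matrix_inv (g d y) ** (transpose ?Q ** transpose P)"
    unfolding g_transition matrix_inv_pull[OF jacobian_invertible g_invertible] by (simp add: matrix_mul_assoc)
  then show ?thesis unfolding 1 2 by simp
qed

lemma inner_transition:
  "(transpose P *v \<alpha>) \<bullet> (matrix_inv (g c x) *v (transpose P *v \<beta>)) = \<alpha> \<bullet> (matrix_inv (g d y) *v \<beta>)"
proof -
  have "(transpose P *v \<alpha>) \<bullet> (matrix_inv (g c x) *v (transpose P *v \<beta>)) = \<alpha> \<bullet> (P *v (matrix_inv (g c x) *v (transpose P *v \<beta>)))"
    using inner_transpose[of _ P \<alpha>] by (metis inner_commute)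
  then show ?thesis by (simp add: matrix_vector_mul_assoc h_transition matrix_mul_assoc del: transpose_matrix_vector)
qed

lemma J_covector_transition: "J_covector (J c x) (transpose P *v \<alpha>) = transpose P *v J_covector (J d y) \<alpha>"
  by (rule J_covector_pull[OF J_transition])

lemma form_inner_transition: "form_inner (g c x) (pull P \<phi>) (pull P \<psi>) = form_inner (g d y) \<phi> \<psi>"
  unfolding g_transition by (rule form_inner_pull[OF jacobian_invertible g_invertible])

lemma differential_transition:
  assumes f: "\<forall>x\<in>overlap c d. f c x = f d (transition c d x)" and df: "f d differentiable (at y)"
  shows "differential (f c) x = transpose P *v differential (f d) y"
proof -
  have D: "transition c d differentiable (at x)"
    using smooth_on_differentiable[OF smooth_transition[OF c d] x] .
  have "dd i (f c) x = (\<Sum>j\<in>UNIV. P $ j $ i * dd j (f d) y)" for i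
  proof -
    have "dd i (f c) x = dd i (\<lambda>x. f d (transition c d x)) x"
      by (rule dd_cong[OF open_overlap[OF c d] x]) (use f in blast)
    then show ?thesis unfolding dd_compose[OF D df] jacobian_nth by simp
  qed
  then show ?thesis
    by (simp add: vec_eq_iff differential_def pd_eq_dd matrix_vector_mult_def transpose_def del: transpose_matrix_vector)
qed

lemma J_grad_transition:
  assumes f: "\<forall>x\<in>overlap c d. f c x = f d (transition c d x)" and df: "f d differentiable (at y)"
  shows "J_grad g J f d y = P *v J_grad g J f c x"
proof -
  have "P *v J_grad g J f c x = (P ** J c x) *v (matrix_inv (g c x) *v (transpose P *v differential (f d) y))"
    by (simp add: J_grad_def grad_def differential_transition[OF f df] matrix_vector_mul_assoc matrix_mul_assoc del: transpose_matrix_vector)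
  also have "\<dots> = J d y *v ((P ** matrix_inv (g c x) ** transpose P) *v differential (f d) y)"
    unfolding J_transition[symmetric] by (simp add: matrix_vector_mul_assoc matrix_mul_assoc del: transpose_matrix_vector)
  finally show ?thesis unfolding h_transition by (simp add: J_grad_def grad_def)
qed

end

lemma local_rep_transition:
  "c \<in> A \<Longrightarrow> d \<in> A \<Longrightarrow> \<forall>x\<in>overlap c d. local_rep f c x = local_rep f d (transition c d x)"
  using transition_mem(3) by (simp add: local_rep_def)

text \<open>Compatible functions on the images of the charts define a function on the surface: its value at a
  point is read off in any chart around it.\<close>

lemma scalar_field:
  assumes f: "\<And>c d x. c \<in> A \<Longrightarrow> d \<in> A \<Longrightarrow> x \<in> overlap c d \<Longrightarrow> f c x = (f d (transition c d x) :: real)"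
  obtains F where "\<And>c x. c \<in> A \<Longrightarrow> x \<in> chart_img c \<Longrightarrow> local_rep F c x = f c x"
proof -
  define ch where "ch p = (SOME c. c \<in> A \<and> p \<in> fst c)" for p
  have ch: "ch p \<in> A \<and> p \<in> fst (ch p)" if "c \<in> A" "p \<in> fst c" for p c
    unfolding ch_def using that by (intro someI[of "\<lambda>c. c \<in> A \<and> p \<in> fst c"]) auto
  define F where "F p = f (ch p) (snd (ch p) p)" for p
  have "local_rep F c x = f c x" if c: "c \<in> A" and x: "x \<in> chart_img c" for c x
  proof -
    let ?p = "chart_inv c x"
    let ?d = "ch ?p"
    have p: "?p \<in> fst c" using chart_inv_img[OF c x] by simp
    note d = ch[OF c p]
    have "x \<in> overlap c ?d" using overlapI[OF c x] d by simp
    from f[OF c _ this] d show ?thesis by (simp add: local_rep_def F_def transition_def)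
  qed
  then show thesis by (rule that)
qed

lemma vector_field_J_grad:
  assumes f: "\<And>c d x. c \<in> A \<Longrightarrow> d \<in> A \<Longrightarrow> x \<in> overlap c d \<Longrightarrow> f c x = f d (transition c d x)"
    and sm: "\<And>c. c \<in> A \<Longrightarrow> smooth_on (chart_img c) (f c)"
  shows "vector_field A (J_grad g J f)"
  unfolding vector_field_def
proof (intro conjI ballI)
  fix c assume c: "c \<in> A"
  interpret kahler_chart "chart_img c" "g c" "J c" by (rule chart_kahler[OF c])
  show "smooth_on (chart_img c) (J_grad g J f c)"
    unfolding J_grad_def grad_def using sm[OF c] by (intro smooth_intros open_S smooth_J smooth_h)
next
  fix c d x assume c: "c \<in> A" and d: "d \<in> A" and x: "x \<in> overlap c d"
  show "J_grad g J f d (transition c d x) = jacobian (transition c d) (at x) *v J_grad g J f c x"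
    by (rule J_grad_transition[OF c d x]) (use f[OF c d] in blast, rule smooth_on_differentiable[OF sm[OF d] y_img[OF c d x]])
qed

end

section \<open>The local form of ortho-toric surfaces\<close>

context surface
begin

lemma local_rep_sum: "local_rep (\<lambda>p. \<xi> p + \<eta> p) c = (\<lambda>x. local_rep \<xi> c x + local_rep \<eta> c x)"
  and local_rep_prod: "local_rep (\<lambda>p. \<xi> p * \<eta> p) c = (\<lambda>x. local_rep \<xi> c x * local_rep \<eta> c x)"
  by (auto simp: local_rep_def)

context
  fixes \<xi> \<eta> :: "'a \<Rightarrow> real"
  assumes ot: "orthotoric_by A g J \<xi> \<eta>"
begin

lemma orthotoric_orth_pair:
  assumes c: "c \<in> A"
  shows "kahler_chart.orth_pair (chart_img c) (g c) (J c) (local_rep \<xi> c) (local_rep \<eta> c)"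
proof -
  interpret kahler_chart "chart_img c" "g c" "J c" by (rule chart_kahler[OF c])
  obtain K L where K: "independent_fields A K L" "momentum_map A g J K (\<lambda>p. \<xi> p + \<eta> p)" "momentum_map A g J L (\<lambda>p. \<xi> p * \<eta> p)"
    using ot by (auto simp: orthotoric_by_def)
  have sm: "smooth_on (chart_img c) (local_rep \<xi> c)" "smooth_on (chart_img c) (local_rep \<eta> c)"
    using ot c by (auto simp: orthotoric_by_def smooth_function_def)
  show ?thesis
  proof (rule orth_pair_orthotoric[OF sm])
    fix x assume x: "x \<in> chart_img c"
    show "covector_inner (g c x) (differential (local_rep \<xi> c) x) (differential (local_rep \<eta> c) x) = 0"
      using ot c x by (auto simp: orthotoric_by_def)
    show "(J c x *v grad (g c) (\<lambda>x. local_rep \<xi> c x + local_rep \<eta> c x) x) \<bullet>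
      (\<omega> x *v (J c x *v grad (g c) (\<lambda>x. local_rep \<xi> c x * local_rep \<eta> c x) x)) = 0"
      using ot c x unfolding orthotoric_by_def poisson_commute_def J_grad_def local_rep_sum local_rep_prod by blast
    show "\<forall>r s. r *\<^sub>R (J c x *v grad (g c) (\<lambda>x. local_rep \<xi> c x + local_rep \<eta> c x) x) +
      s *\<^sub>R (J c x *v grad (g c) (\<lambda>x. local_rep \<xi> c x * local_rep \<eta> c x) x) = 0 \<longrightarrow> r = 0 \<and> s = 0"
      using K c x unfolding independent_fields_def momentum_map_def J_grad_def local_rep_sum local_rep_prod by simp
  qed
qed

lemma orthotoric_normal:
  assumes c: "c \<in> A" and x: "x \<in> chart_img c"
  obtains k l where "kahler_chart.normal_hess (g c) (J c) (local_rep \<xi> c) (local_rep \<eta> c) x k"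
    "kahler_chart.normal_hess (g c) (J c) (local_rep \<eta> c) (local_rep \<xi> c) x l"
proof -
  interpret kahler_chart "chart_img c" "g c" "J c" by (rule chart_kahler[OF c])
  let ?a = "local_rep \<xi> c" and ?b = "local_rep \<eta> c"
  note ab = orthotoric_orth_pair[OF c]
  obtain K L where K: "killing_field A g K" "killing_field A g L" "momentum_map A g J K (\<lambda>p. \<xi> p + \<eta> p)" "momentum_map A g J L (\<lambda>p. \<xi> p * \<eta> p)"
    using ot by (auto simp: orthotoric_by_def)
  have sm: "smooth_on (chart_img c) (\<lambda>x. ?a x + ?b x)" "smooth_on (chart_img c) (\<lambda>x. ?a x * ?b x)"
    by (intro smooth_intros open_S smooth_a[OF ab] smooth_b[OF ab])+
  have 1: "transpose (J c x) ** hess (\<lambda>x. ?a x + ?b x) x ** J c x = hess (\<lambda>x. ?a x + ?b x) x"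
    using K c x by (intro killing_invariant[OF x sm(1), of "K c"]) (auto simp: momentum_map_def J_grad_def local_rep_sum killing_field_def)
  have 2: "transpose (J c x) ** hess (\<lambda>x. ?a x * ?b x) x ** J c x = hess (\<lambda>x. ?a x * ?b x) x"
    using K c x by (intro killing_invariant[OF x sm(2), of "L c"]) (auto simp: momentum_map_def J_grad_def local_rep_prod killing_field_def)
  have c': "(\<lambda>x. ?a x + ?b x) = (\<lambda>x. ?b x + ?a x)" "(\<lambda>x. ?a x * ?b x) = (\<lambda>x. ?b x * ?a x)" by (simp_all add: ac_simps)
  obtain k where k: "normal_hess ?a ?b x k" using orthotoric_normal_hess[OF ab x 1 2] .
  obtain l where l: "normal_hess ?b ?a x l" using orthotoric_normal_hess[OF orth_pair_sym[OF ab] x] 1 2 unfolding c' .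
  show thesis by (rule that[OF k l])
qed

end

end

context surface
begin

context
  fixes c d :: "'a chart" and x :: "real^4"
  assumes c: "c \<in> A" and d: "d \<in> A" and x: "x \<in> overlap c d"
begin

interpretation C: kahler_chart "chart_img c" "g c" "J c" by (rule chart_kahler[OF c])
interpretation D: kahler_chart "chart_img d" "g d" "J d" by (rule chart_kahler[OF d])

context
  fixes f :: "('a, real) field"
  assumes f: "\<forall>x\<in>overlap c d. f c x = f d (transition c d x)" and df: "f d differentiable (at (transition c d x))"
begin

lemma sqnorm_transition: "C.sqnorm (f c) x = D.sqnorm (f d) (transition c d x)"
  unfolding C.sqnorm_def D.sqnorm_def differential_transition[where f=f, OF c d x f df] by (rule inner_transition[OF c d x])

lemma dJ_transition: "C.dJ (f c) x = transpose (jacobian (transition c d) (at x)) *v D.dJ (f d) (transition c d x)"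
  unfolding C.dJ_def D.dJ_def differential_transition[where f=f, OF c d x f df] by (rule J_covector_transition[OF c d x])

lemma eigenform_transition: "C.eigenform (f c) x = pull (jacobian (transition c d) (at x)) (D.eigenform (f d) (transition c d x))"
  unfolding C.eigenform_def D.eigenform_def sqnorm_transition dJ_transition differential_transition[where f=f, OF c d x f df]
  by (simp only: pull_scaleR pull_wedge)

end

context
  fixes a b :: "('a, real) field"
  assumes a: "\<forall>x\<in>overlap c d. a c x = a d (transition c d x)" and da: "a d differentiable (at (transition c d x))"
    and b: "\<forall>x\<in>overlap c d. b c x = b d (transition c d x)" and db: "b d differentiable (at (transition c d x))"
begin

lemma Ffun_transition: "C.Ffun (a c) (b c) x = D.Ffun (a d) (b d) (transition c d x)"
  unfolding C.Ffun_def D.Ffun_def sqnorm_transition[where f=a, OF a da] bspec[OF a x] bspec[OF b x] ..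

end

lemma tform_transition:
  fixes a b :: "('a, real) field"
  assumes a: "\<forall>x\<in>overlap c d. a c x = a d (transition c d x)" and da: "a d differentiable (at (transition c d x))"
    and b: "\<forall>x\<in>overlap c d. b c x = b d (transition c d x)" and db: "b d differentiable (at (transition c d x))"
  shows "C.tform (a c) (b c) x = transpose (jacobian (transition c d) (at x)) *v D.tform (a d) (b d) (transition c d x)"
    "C.zform (a c) (b c) x = transpose (jacobian (transition c d) (at x)) *v D.zform (a d) (b d) (transition c d x)"
  unfolding C.tform_def D.tform_def C.zform_def D.zform_def Ffun_transition[where a=a and b=b, OF a da b db] Ffun_transition[where a=b and b=a, OF b db a da]
    dJ_transition[where f=a, OF a da] dJ_transition[where f=b, OF b db] bspec[OF a x] bspec[OF b x] by (simp_all only: mv.add_right mv.scaleR_right)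

end

text \<open>In a chart around \<open>p\<close>, the functions \<open>t\<close> and \<open>z\<close> are potentials of the two closed forms on a ball. Together with \<open>\<xi>\<close>
  and \<open>\<eta>\<close> they are local coordinates, so \<open>(\<xi> - \<eta>) |d\<xi>|\<^sup>2\<close> and \<open>(\<eta> - \<xi>) |d\<eta>|\<^sup>2\<close> are locally functions of \<open>\<xi>\<close> and of \<open>\<eta>\<close>. The formulas are
  invariant, hence hold in every other chart as well.\<close>

lemma orthotoric_local_form:
  assumes ot: "orthotoric_by A g J \<xi> \<eta>" and p: "p \<in> M"
  shows "\<exists>U t z F G. open U \<and> p \<in> U \<and> U \<subseteq> M \<and>
    smooth_function_on A U t \<and> smooth_function_on A U z \<and>
    open (\<xi> ` U) \<and> smooth_on (\<xi> ` U) F \<and> open (\<eta> ` U) \<and> smooth_on (\<eta> ` U) G \<and>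
    orthotoric_form A g J U \<xi> \<eta> t z F G"
proof -
  have M: "(\<Union>c\<in>A. fst c) = M" using manifold by (simp add: smooth_4manifold_def)
  then obtain c where c: "c \<in> A" "p \<in> fst c" using p by blast
  interpret C: kahler_chart "chart_img c" "g c" "J c" by (rule chart_kahler[OF c(1)])
  define a b x0 where "a = local_rep \<xi> c" and "b = local_rep \<eta> c" and "x0 = snd c p"
  note ab = orthotoric_orth_pair[OF ot c(1), folded a_def b_def]
  note ba = C.orth_pair_sym[OF ab]
  note normal = orthotoric_normal[OF ot c(1), folded a_def b_def]
  have x0: "x0 \<in> chart_img c" unfolding x0_def by (rule chart_inv_snd(1)[OF c])
  obtain r where r: "r > 0" "ball x0 r \<subseteq> chart_img c" using C.open_S x0 open_contains_ball by blast
  note in_B = subsetD[OF r(2)]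
  have Fnz: "C.Ffun a b x \<noteq> 0" "C.Ffun b a x \<noteq> 0" if "x \<in> chart_img c" for x
    using C.Ffun_nz[OF ab that] C.Ffun_nz[OF ba that] .
  have sm: "smooth_on (chart_img c) (C.tform a b)" "smooth_on (chart_img c) (C.zform a b)"
    unfolding C.tform_def[abs_def] C.zform_def[abs_def]
    by (intro smooth_intros C.open_S C.smooth_a[OF ab] C.smooth_b[OF ab] C.smooth_dJa[OF ab] C.smooth_dJb[OF ab]
      C.smooth_Ffun[OF ab] C.smooth_Ffun[OF ba] Fnz; assumption)+
  have closed: "dd i (C.tform a b) x $ j = dd j (C.tform a b) x $ i" "dd i (C.zform a b) x $ j = dd j (C.zform a b) x $ i"
    if x: "x \<in> ball x0 r" for x i j
  proof -
    obtain k l where "C.normal_hess a b x k" "C.normal_hess b a x l" using normal[OF in_B[OF x]] .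
    from C.zform_closed[OF ab in_B[OF x] this]
    show "dd i (C.tform a b) x $ j = dd j (C.tform a b) x $ i" "dd i (C.zform a b) x $ j = dd j (C.zform a b) x $ i" by blast+
  qed
  obtain t0 where t0: "smooth_on (ball x0 r) t0" "\<And>x. x \<in> ball x0 r \<Longrightarrow> differential t0 x = C.tform a b x"
    using poincare[OF smooth_on_subset[OF r(2) sm(1)] closed(1)] by blast
  obtain z0 where z0: "smooth_on (ball x0 r) z0" "\<And>x. x \<in> ball x0 r \<Longrightarrow> differential z0 x = C.zform a b x"
    using poincare[OF smooth_on_subset[OF r(2) sm(2)] closed(2)] by blast
  define \<Psi> where "\<Psi> x = (\<chi> i. select4 (a x) (b x) (t0 x) (z0 x) i)" for x
  have Psi: "\<Psi> x $ 1 = a x" "\<Psi> x $ 2 = b x" "\<Psi> x $ 3 = t0 x" "\<Psi> x $ 4 = z0 x" for x by (simp_all add: \<Psi>_def select4)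
  have smPsi: "smooth_on (ball x0 r) \<Psi>"
  proof -
    have "smooth_on (ball x0 r) (\<lambda>x. \<Psi> x $ i)" for i
      using exhaust_4[of i] t0(1) z0(1) smooth_on_subset[OF r(2) C.smooth_a[OF ab]] smooth_on_subset[OF r(2) C.smooth_b[OF ab]]
      by (elim disjE) (simp_all add: Psi)
    then show ?thesis using smooth_on_vec_iff[OF open_ball] by blast
  qed
  have x0B: "x0 \<in> ball x0 r" using r by simp
  have inj: "v = 0" if z: "frechet_derivative \<Psi> (at x0) v = 0" for v
  proof -
    note D = smooth_on_differentiable[OF smPsi x0B]
    have "differential (\<lambda>x. \<Psi> x $ k) x0 \<bullet> v = 0" for k
    proof -
      have "differential (\<lambda>x. \<Psi> x $ k) x0 \<bullet> v = (\<Sum>i\<in>UNIV. v $ i *\<^sub>R dd i \<Psi> x0) $ k"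
        by (simp add: inner_vec_def differential_def pd_eq_dd dd_nth[OF D] mult.commute)
      then show ?thesis using z unfolding frechet_derivative_dd[OF D] by simp
    qed
    from this[of 1] this[of 2] this[of 3] this[of 4] show ?thesis
      unfolding Psi t0(2)[OF x0B] z0(2)[OF x0B] by (rule C.tz_independent[OF ab x0])
  qed
  obtain U0 where U0: "open U0" "x0 \<in> U0" "U0 \<subseteq> ball x0 r" "\<And>k. open ((\<lambda>x. \<Psi> x $ k) ` U0)"
    and fn: "\<And>k f. smooth_on U0 f \<Longrightarrow> (\<And>x. x \<in> U0 \<Longrightarrow> \<exists>l. differential f x = l *\<^sub>R differential (\<lambda>x. \<Psi> x $ k) x) \<Longrightarrow>
      \<exists>F. smooth_on ((\<lambda>x. \<Psi> x $ k) ` U0) F \<and> (\<forall>x\<in>U0. f x = F (\<Psi> x $ k))"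
    using functions_of_coordinate[OF open_ball x0B smPsi inj] by blast
  have U0S: "U0 \<subseteq> chart_img c" using U0(3) r(2) by blast
  have "\<exists>F. smooth_on ((\<lambda>x. \<Psi> x $ 1) ` U0) F \<and> (\<forall>x\<in>U0. C.Ffun a b x = F (\<Psi> x $ 1))"
  proof (rule fn)
    show "smooth_on U0 (C.Ffun a b)" by (rule smooth_on_subset[OF U0S C.smooth_Ffun[OF ab]])
    fix x assume "x \<in> U0"
    then have x: "x \<in> chart_img c" using U0S by blast
    obtain k l where n: "C.normal_hess a b x k" "C.normal_hess b a x l" using normal[OF x] .
    show "\<exists>l. differential (C.Ffun a b) x = l *\<^sub>R differential (\<lambda>x. \<Psi> x $ 1) x"
      unfolding Psi C.Ffun_def[abs_def] C.differential_F[OF ab x n] by blast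
  qed
  then obtain F where F: "smooth_on (a ` U0) F" "\<And>x. x \<in> U0 \<Longrightarrow> C.Ffun a b x = F (a x)" unfolding Psi by blast
  have "\<exists>F. smooth_on ((\<lambda>x. \<Psi> x $ 2) ` U0) F \<and> (\<forall>x\<in>U0. C.Ffun b a x = F (\<Psi> x $ 2))"
  proof (rule fn)
    show "smooth_on U0 (C.Ffun b a)" by (rule smooth_on_subset[OF U0S C.smooth_Ffun[OF ba]])
    fix x assume "x \<in> U0"
    then have x: "x \<in> chart_img c" using U0S by blast
    obtain k l where n: "C.normal_hess a b x k" "C.normal_hess b a x l" using normal[OF x] .
    show "\<exists>l. differential (C.Ffun b a) x = l *\<^sub>R differential (\<lambda>x. \<Psi> x $ 2) x"
      unfolding Psi C.Ffun_def[abs_def] C.differential_F[OF ba x n(2,1)] by blast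
  qed
  then obtain G where G: "smooth_on (b ` U0) G" "\<And>x. x \<in> U0 \<Longrightarrow> C.Ffun b a x = G (b x)" unfolding Psi by blast
  define U where "U = fst c \<inter> snd c -` U0"
  define t z where "t = t0 \<circ> snd c" and "z = z0 \<circ> snd c"
  have "continuous_on (fst c) (snd c)" "open (fst c)" using chart_A[OF c(1)] by (auto simp: chart_def homeomorphism_def)
  then have U: "open U" "p \<in> U" "U \<subseteq> M"
    using continuous_open_preimage[of "fst c" "snd c" U0] U0(1,2) c M by (auto simp: U_def x0_def)
  have val: "local_rep f c (snd c q) = f q" if "q \<in> U" for f q
    using chart_inv_snd(2)[OF c(1)] that by (simp add: local_rep_def U_def)
  have U_img: "U0 = snd c ` U"
  proof (intro subset_antisym subsetI)
    fix x assume x: "x \<in> U0"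
    then have "x \<in> chart_img c" using U0S by blast
    from chart_inv_img[OF c(1) this] x have "chart_inv c x \<in> U" "x = snd c (chart_inv c x)" by (simp_all add: U_def)
    then show "x \<in> snd c ` U" by (rule rev_image_eqI)
  qed (auto simp: U_def)
  have img: "\<xi> ` U = a ` U0" "\<eta> ` U = b ` U0"
    unfolding U_img image_image a_def b_def by (auto simp: val)
  have rep: "local_rep t d = (\<lambda>y. t0 (transition d c y))" "local_rep z d = (\<lambda>y. z0 (transition d c y))" for d
    by (auto simp: local_rep_def t_def z_def transition_def)
  have pos: "transition d c (snd d q) = snd c q" "snd d q \<in> overlap d c" "snd c q \<in> U0" "snd d q \<in> chart_img d"
    if "d \<in> A" "q \<in> U \<inter> fst d" for d q
    using that chart_inv_snd[OF that(1), of q] by (auto simp: transition_def overlap_def U_def)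
  have smf: "smooth_on (snd d ` (U \<inter> fst d)) (\<lambda>y. f (transition d c y))" if d: "d \<in> A" and f: "smooth_on (ball x0 r) f" for d and f :: "real^4 \<Rightarrow> real"
  proof (rule smooth_on_compose[OF open_image_chart[OF d U(1)] U0(1)])
    show "smooth_on U0 f" by (rule smooth_on_subset[OF U0(3) f])
    show "smooth_on (snd d ` (U \<inter> fst d)) (transition d c)"
      by (rule smooth_on_subset[OF _ smooth_transition[OF d c(1)]]) (use pos(2)[OF d] in blast)
    show "transition d c x \<in> U0" if "x \<in> snd d ` (U \<inter> fst d)" for x
      using that pos(1,3)[OF d] by (elim imageE) simp
  qed
  have smt: "smooth_function_on A U t" "smooth_function_on A U z"
    unfolding smooth_function_on_def rep using smf t0(1) z0(1) by blast+
  have form: "orthotoric_form A g J U \<xi> \<eta> t z F G"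
    unfolding orthotoric_form_def
  proof (intro ballI)
    fix d q assume d: "d \<in> A" and q: "q \<in> U \<inter> fst d"
    interpret D: kahler_chart "chart_img d" "g d" "J d" by (rule chart_kahler[OF d])
    note pq = pos[OF d q]
    define y where "y = snd d q"
    have tr: "transition d c y = snd c q" and y: "y \<in> overlap d c" "y \<in> chart_img d" using pq by (simp_all add: y_def)
    have xB: "snd c q \<in> ball x0 r" "snd c q \<in> chart_img c" using pq(3) U0(3) U0S by blast+
    note ab' = orthotoric_orth_pair[OF ot d]
    have v: "local_rep \<xi> d y = \<xi> q" "local_rep \<eta> d y = \<eta> q" "a (snd c q) = \<xi> q" "b (snd c q) = \<eta> q"
      using chart_inv_snd(2)[OF d, of q] q val[of q] by (auto simp: local_rep_def y_def a_def b_def)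
    have dc: "local_rep \<xi> c differentiable (at (transition d c y))" "local_rep \<eta> c differentiable (at (transition d c y))"
      unfolding tr using C.diffble[OF C.smooth_a[OF ab] xB(2)] C.diffble[OF C.smooth_b[OF ab] xB(2)] by (simp_all add: a_def b_def)
    note inv = local_rep_transition[OF d c(1)]
    have FG: "F (local_rep \<xi> d y) = D.Ffun (local_rep \<xi> d) (local_rep \<eta> d) y" "G (local_rep \<eta> d y) = D.Ffun (local_rep \<eta> d) (local_rep \<xi> d) y"
      unfolding Ffun_transition[where a="local_rep \<xi>" and b="local_rep \<eta>", OF d c(1) y(1) inv dc(1) inv dc(2)] Ffun_transition[where a="local_rep \<eta>" and b="local_rep \<xi>", OF d c(1) y(1) inv dc(2) inv dc(1)]
      unfolding tr a_def[symmetric] b_def[symmetric] F(2)[OF pq(3)] G(2)[OF pq(3)] v by (rule refl)+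
    have dt: "differential (local_rep t d) y = D.tform (local_rep \<xi> d) (local_rep \<eta> d) y"
      "differential (local_rep z d) y = D.zform (local_rep \<xi> d) (local_rep \<eta> d) y"
    proof -
      have e: "local_rep t c x = t0 x" "local_rep z c x = z0 x" if "x \<in> chart_img c" for x
        using chart_inv_img(2)[OF c(1) that] by (simp_all add: local_rep_def t_def z_def)
      have e': "t0 x = local_rep t c x" "z0 x = local_rep z c x" if "x \<in> ball x0 r" for x
        using e[OF in_B[OF that]] by simp_all
      have s: "smooth_on (ball x0 r) (local_rep t c)" "smooth_on (ball x0 r) (local_rep z c)"
        by (rule smooth_on_cong[OF open_ball e'(1) t0(1)], assumption) (rule smooth_on_cong[OF open_ball e'(2) z0(1)], assumption)
      have dif: "local_rep t c differentiable (at (transition d c y))" "local_rep z c differentiable (at (transition d c y))"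
        unfolding tr using smooth_on_differentiable[OF s(1) xB(1)] smooth_on_differentiable[OF s(2) xB(1)] .
      have der: "differential (local_rep t c) (snd c q) = C.tform a b (snd c q)" "differential (local_rep z c) (snd c q) = C.zform a b (snd c q)"
        using differential_cong[OF open_ball xB(1), of t0, OF e'(1)] differential_cong[OF open_ball xB(1), of z0, OF e'(2)] t0(2)[OF xB(1)] z0(2)[OF xB(1)] by simp_all
      show "differential (local_rep t d) y = D.tform (local_rep \<xi> d) (local_rep \<eta> d) y"
        unfolding tform_transition[where a="local_rep \<xi>" and b="local_rep \<eta>", OF d c(1) y(1) inv dc(1) inv dc(2)] differential_transition[where f="local_rep t", OF d c(1) y(1) inv dif(1)]
        unfolding tr der a_def b_def ..
      show "differential (local_rep z d) y = D.zform (local_rep \<xi> d) (local_rep \<eta> d) y"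
        unfolding tform_transition[where a="local_rep \<xi>" and b="local_rep \<eta>", OF d c(1) y(1) inv dc(1) inv dc(2)] differential_transition[where f="local_rep z", OF d c(1) y(1) inv dif(2)]
        unfolding tr der a_def b_def ..
    qed
    note ex = D.explicit_form[where F=F and G=G, OF ab' y(2) FG, folded dt, unfolded v]
    show "let x = snd d q; a = \<xi> q; b = \<eta> q;
            d\<xi> = differential (local_rep \<xi> d) x; d\<eta> = differential (local_rep \<eta> d) x;
            dt = differential (local_rep t d) x; dz = differential (local_rep z d) x
        in a \<noteq> b \<and> F a \<noteq> 0 \<and> G b \<noteq> 0 \<and>
           g d x = orthotoric_metric F G a b d\<xi> d\<eta> dt dz \<and>
           J_covector (J d x) d\<xi> = (F a / (a - b)) *\<^sub>R (dt + b *\<^sub>R dz) \<and>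
           J_covector (J d x) dt = - (a / F a) *\<^sub>R d\<xi> - (b / G b) *\<^sub>R d\<eta> \<and>
           J_covector (J d x) d\<eta> = (G b / (b - a)) *\<^sub>R (dt + a *\<^sub>R dz) \<and>
           J_covector (J d x) dz = (1 / F a) *\<^sub>R d\<xi> + (1 / G b) *\<^sub>R d\<eta> \<and>
           kahler_form (g d x) (J d x) = wedge d\<xi> (dt + b *\<^sub>R dz) + wedge d\<eta> (dt + a *\<^sub>R dz)"
      unfolding Let_def y_def[symmetric] by (intro conjI ex)
  qed
  show ?thesis
    using U smt form U0(4)[of 1] U0(4)[of 2] F(1) G(1) unfolding Psi img[symmetric]
    by (intro exI[of _ U] exI[of _ t] exI[of _ z] exI[of _ F] exI[of _ G] conjI)
qed

end

section \<open>The hamiltonian form of an ortho-toric surface\<close>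

lemma nabla_form_cong:
  assumes "open S" "x \<in> S" "\<And>y. y \<in> S \<Longrightarrow> \<phi> y = \<psi> y"
  shows "nabla_form g \<phi> x = nabla_form g \<psi> x"
proof -
  have "pd i (\<lambda>y. \<phi> y $ j $ k) x = pd i (\<lambda>y. \<psi> y $ j $ k) x" for i j k
    unfolding pd_eq_dd by (rule dd_cong[OF assms(1,2)]) (simp add: assms(3))
  then show ?thesis using assms(2,3) by (simp add: nabla_form_def)
qed

context surface
begin

lemma bilinear_field_cong:
  assumes B: "bilinear_field A B" and eq: "\<And>c x. c \<in> A \<Longrightarrow> x \<in> chart_img c \<Longrightarrow> B c x = C c x"
  shows "bilinear_field A C"
  unfolding bilinear_field_def Let_def
proof (intro conjI ballI)
  fix c assume c: "c \<in> A"
  show "smooth_on (chart_img c) (C c)"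
    using B c by (intro smooth_on_cong[OF open_chart_img[OF c] eq[OF c]]) (auto simp: bilinear_field_def)
next
  fix c d x assume c: "c \<in> A" and d: "d \<in> A" and x: "x \<in> overlap c d"
  show "C c x = transpose (jacobian (transition c d) (at x)) ** C d (transition c d x) ** jacobian (transition c d) (at x)"
    using B c d x unfolding eq[OF c x_img[OF c d x], symmetric] eq[OF d y_img[OF c d x], symmetric]
    by (simp add: bilinear_field_def Let_def)
qed

lemma bilinear_field_add_kahler:
  assumes B: "bilinear_field A B" and sm: "\<And>c. c \<in> A \<Longrightarrow> smooth_on (chart_img c) (f c)"
    and f: "\<And>c d. c \<in> A \<Longrightarrow> d \<in> A \<Longrightarrow> \<forall>x\<in>overlap c d. f c x = (f d (transition c d x) :: real)"
  shows "bilinear_field A (\<lambda>c x. B c x + f c x *\<^sub>R kahler_form (g c x) (J c x))"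
  unfolding bilinear_field_def Let_def
proof (intro conjI ballI)
  fix c assume c: "c \<in> A"
  interpret kahler_chart "chart_img c" "g c" "J c" by (rule chart_kahler[OF c])
  show "smooth_on (chart_img c) (\<lambda>x. B c x + f c x *\<^sub>R kahler_form (g c x) (J c x))"
    using B c sm[OF c] by (intro smooth_on_add smooth_on_scaleR open_S smooth_omega) (auto simp: bilinear_field_def)
next
  fix c d x assume c: "c \<in> A" and d: "d \<in> A" and x: "x \<in> overlap c d"
  let ?P = "jacobian (transition c d) (at x)"
  have 1: "B c x = pull ?P (B d (transition c d x))" using B c d x by (simp add: bilinear_field_def Let_def pull_def)
  show "B c x + f c x *\<^sub>R kahler_form (g c x) (J c x) = transpose ?P **
    (B d (transition c d x) + f d (transition c d x) *\<^sub>R kahler_form (g d (transition c d x)) (J d (transition c d x))) ** ?P"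
    unfolding 1 kahler_form_transition[OF c d x] bspec[OF f[OF c d] x]
    unfolding pull_def[symmetric] pull_add pull_scaleR ..
qed

context
  fixes \<xi> \<eta> :: "'a \<Rightarrow> real"
  assumes ot: "orthotoric_by A g J \<xi> \<eta>"
begin

text \<open>The form \<open>pair_field + trace_field \<omega>\<close> is hamiltonian with trace \<open>\<xi> + \<eta>\<close> and pfaffian \<open>\<xi> \<eta>\<close>. So its associated
  fields are the given Killing fields.\<close>

definition pair_field :: "('a, real^4^4) field" where
  "pair_field c = kahler_chart.pair_form (g c) (J c) (local_rep \<xi> c) (local_rep \<eta> c)"

definition trace_field :: "('a, real) field" where
  "trace_field c x = local_rep \<xi> c x + local_rep \<eta> c x"

definition orthotoric_2form :: "('a, real^4^4) field" where
  "orthotoric_2form c x = pair_field c x + trace_field c x *\<^sub>R kahler_form (g c x) (J c x)"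

lemma smooth_reps:
  assumes c: "c \<in> A"
  shows "smooth_on (chart_img c) (local_rep \<xi> c)" "smooth_on (chart_img c) (local_rep \<eta> c)" "smooth_on (chart_img c) (trace_field c)"
proof -
  show s: "smooth_on (chart_img c) (local_rep \<xi> c)" "smooth_on (chart_img c) (local_rep \<eta> c)"
    using ot c by (auto simp: orthotoric_by_def smooth_function_def)
  show "smooth_on (chart_img c) (trace_field c)"
    unfolding trace_field_def[abs_def] by (intro smooth_intros open_chart_img[OF c] s)
qed

lemma bilinear_pair_field: "bilinear_field A pair_field"
  unfolding bilinear_field_def Let_def
proof (intro conjI ballI)
  fix c assume c: "c \<in> A"
  interpret kahler_chart "chart_img c" "g c" "J c" by (rule chart_kahler[OF c])
  show "smooth_on (chart_img c) (pair_field c)"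
    unfolding pair_field_def by (rule smooth_pair_form[OF orthotoric_orth_pair[OF ot c]])
next
  fix c d x assume c: "c \<in> A" and d: "d \<in> A" and x: "x \<in> overlap c d"
  interpret C: kahler_chart "chart_img c" "g c" "J c" by (rule chart_kahler[OF c])
  interpret D: kahler_chart "chart_img d" "g d" "J d" by (rule chart_kahler[OF d])
  note inv = local_rep_transition[OF c d]
  note df = smooth_on_differentiable[OF smooth_reps(1)[OF d] y_img[OF c d x]] smooth_on_differentiable[OF smooth_reps(2)[OF d] y_img[OF c d x]]
  show "pair_field c x = transpose (jacobian (transition c d) (at x)) ** pair_field d (transition c d x) ** jacobian (transition c d) (at x)"
    unfolding pair_field_def C.pair_form_def[OF orthotoric_orth_pair[OF ot c]] D.pair_form_def[OF orthotoric_orth_pair[OF ot d]]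
      eigenform_transition[where f="local_rep \<xi>", OF c d x inv df(1)] eigenform_transition[where f="local_rep \<eta>", OF c d x inv df(2)]
      bspec[OF inv x]
    unfolding pull_def[symmetric] pull_add pull_scaleR ..
qed

lemma trace_field_transition:
  "c \<in> A \<Longrightarrow> d \<in> A \<Longrightarrow> \<forall>x\<in>overlap c d. trace_field c x = trace_field d (transition c d x)"
  using local_rep_transition[of c d \<xi>] local_rep_transition[of c d \<eta>] by (simp add: trace_field_def)

lemma bilinear_orthotoric_2form: "bilinear_field A orthotoric_2form"
  unfolding orthotoric_2form_def[abs_def]
  by (rule bilinear_field_add_kahler[OF bilinear_pair_field smooth_reps(3) trace_field_transition])

context
  fixes c x
  assumes c: "c \<in> A" and x: "x \<in> chart_img c"
begin

interpretation kahler_chart "chart_img c" "g c" "J c" by (rule chart_kahler[OF c])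

lemma sigma_orthotoric: "sigma g J orthotoric_2form c x = trace_field c x"
  unfolding sigma_def Let_def orthotoric_2form_def pair_field_def form_inner_add_left form_inner_scaleR_left
    pair_form_inner[OF orthotoric_orth_pair[OF ot c] x] kahler_norm(1)[OF herm[OF x]]
  by (simp add: trace_field_def)

lemma trace_free_orthotoric:
  "trace_free_part g J orthotoric_2form c x = pair_field c x + (- 1/2 * trace_field c x) *\<^sub>R \<omega> x"
  unfolding trace_free_part_def sigma_orthotoric orthotoric_2form_def by (simp add: vec_eq_iff field_simps)

lemma pfaffian_orthotoric: "pfaffian g J orthotoric_2form c x = local_rep \<xi> c x * local_rep \<eta> c x"
proof -
  have n: "normalized_form g J orthotoric_2form c x = (1/2) *\<^sub>R pair_field c x"
    unfolding normalized_form_def trace_free_orthotoric sigma_orthotoric by (simp add: vec_eq_iff field_simps)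
  show ?thesis
    unfolding pfaffian_def Let_def n unfolding pair_field_def wedge2_scaleR_left wedge2_scaleR_right pair_form_pfaffian[OF orthotoric_orth_pair[OF ot c] x]
    using kahler_norm(2)[OF herm[OF x]] by simp
qed

end

lemma orthotoric_2form_at:
  assumes c: "c \<in> A" and x: "x \<in> chart_img c"
  shows "alternating (orthotoric_2form c x)" "d_form (orthotoric_2form c) x = 0"
  "transpose (J c x) ** orthotoric_2form c x ** J c x = orthotoric_2form c x"
  "anti_selfdual (g c x) (J c x) (trace_free_part g J orthotoric_2form c x)"
  "nabla_form (g c) (trace_free_part g J orthotoric_2form c) x \<in> V0 (g c x) (J c x)"
proof -
  interpret kahler_chart "chart_img c" "g c" "J c" by (rule chart_kahler[OF c])
  note ab = orthotoric_orth_pair[OF ot c]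
  obtain k l where n: "normal_hess (local_rep \<xi> c) (local_rep \<eta> c) x k" "normal_hess (local_rep \<eta> c) (local_rep \<xi> c) x l"
    using orthotoric_normal[OF ot c x] .
  have alt: "alternating (pair_field c x + s *\<^sub>R \<omega> x)" for s
  proof (rule alternatingI)
    show "(pair_field c x + s *\<^sub>R \<omega> x) $ i $ j = - (pair_field c x + s *\<^sub>R \<omega> x) $ j $ i" for i j
      using alternating_nth[OF alternating_pair_form[OF ab], of x i j] alternating_nth[OF alternating_kahler_form[OF herm[OF x]], of i j]
      by (simp add: pair_field_def)
  qed
  have inv: "transpose (J c x) ** (pair_field c x + s *\<^sub>R \<omega> x) ** J c x = pair_field c x + s *\<^sub>R \<omega> x" for s
    by (simp add: mm.add_left mm.add_right mm.scaleR_left mm.scaleR_right invariant_kahler[OF x] pair_form_invariant[OF ab x] pair_field_def)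
  show "alternating (orthotoric_2form c x)" "transpose (J c x) ** orthotoric_2form c x ** J c x = orthotoric_2form c x"
    unfolding orthotoric_2form_def by (rule alt, rule inv)
  show "d_form (orthotoric_2form c) x = 0"
    using pair_form_closed[OF ab x n] by (simp add: orthotoric_2form_def[abs_def] pair_field_def trace_field_def)
  show "anti_selfdual (g c x) (J c x) (trace_free_part g J orthotoric_2form c x)"
  proof (rule anti_selfdualI[OF herm[OF x]])
    show "form_inner (g c x) (trace_free_part g J orthotoric_2form c x) (\<omega> x) = 0"
      unfolding trace_free_orthotoric[OF c x] pair_field_def form_inner_add_left form_inner_scaleR_left
        pair_form_inner[OF ab x] kahler_norm(1)[OF herm[OF x]] by (simp add: trace_field_def)
  qed (unfold trace_free_orthotoric[OF c x], rule alt, rule inv)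
  have "nabla_form (g c) (trace_free_part g J orthotoric_2form c) x
     = nabla_form (g c) (\<lambda>y. pair_field c y - (1/2 * trace_field c y) *\<^sub>R \<omega> y) x"
    by (rule nabla_form_cong[OF open_S x]) (simp add: trace_free_orthotoric[OF c])
  then show "nabla_form (g c) (trace_free_part g J orthotoric_2form c) x \<in> V0 (g c x) (J c x)"
    using pair_form_twistor[OF ab x n] by (simp add: pair_field_def trace_field_def)
qed

lemma hamiltonian_orthotoric_2form: "hamiltonian_form A g J orthotoric_2form"
proof -
  have "bilinear_field A (\<lambda>c x. pair_field c x + (- 1/2 * trace_field c x) *\<^sub>R kahler_form (g c x) (J c x))"
  proof (rule bilinear_field_add_kahler[OF bilinear_pair_field])
    show "smooth_on (chart_img c) (\<lambda>x. - 1/2 * trace_field c x)" if c: "c \<in> A" for c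
      by (intro smooth_intros open_chart_img[OF c] smooth_reps(3)[OF c])
    show "\<forall>x\<in>overlap c d. - 1/2 * trace_field c x = - 1/2 * trace_field d (transition c d x)" if "c \<in> A" "d \<in> A" for c d
      using trace_field_transition[OF that] by simp
  qed
  then have "bilinear_field A (trace_free_part g J orthotoric_2form)"
    by (rule bilinear_field_cong) (simp add: trace_free_orthotoric)
  then show ?thesis
    using bilinear_orthotoric_2form orthotoric_2form_at by (simp add: hamiltonian_form_def twistor_form_def)
qed

lemma independent_orthotoric_2form:
  "independent_fields A (associated_field1 g J orthotoric_2form) (associated_field2 g J orthotoric_2form)"
proof -
  obtain K L where K: "independent_fields A K L" "momentum_map A g J K (\<lambda>p. \<xi> p + \<eta> p)" "momentum_map A g J L (\<lambda>p. \<xi> p * \<eta> p)"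
    using ot by (auto simp: orthotoric_by_def)
  have "associated_field1 g J orthotoric_2form c x = K c x \<and> associated_field2 g J orthotoric_2form c x = L c x"
    if c: "c \<in> A" and x: "x \<in> chart_img c" for c x
  proof -
    have "differential (sigma g J orthotoric_2form c) x = differential (local_rep (\<lambda>p. \<xi> p + \<eta> p) c) x"
      by (rule differential_cong[OF open_chart_img[OF c] x]) (simp add: sigma_orthotoric[OF c] trace_field_def local_rep_sum)
    moreover have "differential (pfaffian g J orthotoric_2form c) x = differential (local_rep (\<lambda>p. \<xi> p * \<eta> p) c) x"
      by (rule differential_cong[OF open_chart_img[OF c] x]) (simp add: pfaffian_orthotoric[OF c] local_rep_prod)
    ultimately show ?thesis
      using K(2,3) c x by (simp add: associated_field1_def associated_field2_def momentum_map_def J_grad_def grad_def)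
  qed
  then show ?thesis using K(1) by (simp add: independent_fields_def)
qed

end

end

section \<open>Ortho-toric coordinates of a hamiltonian form\<close>

context surface
begin

context
  fixes \<phi> :: "('a, real^4^4) field"
  assumes H: "hamiltonian_form A g J \<phi>"
    and ind: "independent_fields A (associated_field1 g J \<phi>) (associated_field2 g J \<phi>)"
begin

abbreviation (input) trace_of :: "('a, real) field" where "trace_of \<equiv> sigma g J \<phi>"
abbreviation (input) pfaffian_of :: "('a, real) field" where "pfaffian_of \<equiv> pfaffian g J \<phi>"

lemma hamiltonian_field: "bilinear_field A \<phi>" using H by (simp add: hamiltonian_form_def)

context
  fixes c assumes c: "c \<in> A"
begin

interpretation kahler_chart "chart_img c" "g c" "J c" by (rule chart_kahler[OF c])

lemma hamiltonian_at:
  "smooth_on (chart_img c) (\<phi> c)"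
  "x \<in> chart_img c \<Longrightarrow> alternating (\<phi> c x)"
  "x \<in> chart_img c \<Longrightarrow> transpose (J c x) ** \<phi> c x ** J c x = \<phi> c x"
  "x \<in> chart_img c \<Longrightarrow> trace_of c x = form_inner (g c x) (\<phi> c x) (\<omega> x) / 3"
  "x \<in> chart_img c \<Longrightarrow> d_form (\<phi> c) x = 0"
  "x \<in> chart_img c \<Longrightarrow> nabla_form (g c) (trace_free_part g J \<phi> c) x \<in> V0 (g c x) (J c x)"
  using H c kahler_norm(1)[OF herm]
  by (auto simp: hamiltonian_form_def bilinear_field_def twistor_form_def sigma_def Let_def)

lemma pfaffian_at:
  assumes x: "x \<in> chart_img c"
  shows "pfaffian_of c x = ((trace_of c x)\<^sup>2
    - form_inner (g c x) (\<phi> c x - trace_of c x *\<^sub>R \<omega> x) (\<phi> c x - trace_of c x *\<^sub>R \<omega> x)) / 2"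
  unfolding pfaffian_def[of g J \<phi>] Let_def
  by (rule pfaffian_eq[OF hamiltonian_at(1-4) x])
    (simp_all add: normalized_form_def trace_free_part_def vec_eq_iff field_simps)

lemma smooth_sigma: "smooth_on (chart_img c) (trace_of c)"
  by (rule smooth_trace[OF hamiltonian_at(1-4)])

lemma smooth_pfaffian: "smooth_on (chart_img c) (pfaffian_of c)"
proof (rule smooth_on_cong[OF open_S])
  have s: "smooth_on (chart_img c) (\<lambda>x. \<phi> c x - trace_of c x *\<^sub>R \<omega> x)"
    by (intro smooth_intros open_S hamiltonian_at(1) smooth_sigma smooth_omega smooth_g smooth_J)
  show "smooth_on (chart_img c) (\<lambda>x. ((trace_of c x)\<^sup>2
    - form_inner (g c x) (\<phi> c x - trace_of c x *\<^sub>R \<omega> x) (\<phi> c x - trace_of c x *\<^sub>R \<omega> x)) / 2)"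
    unfolding power2_eq_square
    by (intro smooth_on_divide smooth_on_diff smooth_on_mult open_S smooth_form_inner s smooth_sigma smooth_on_const) simp
qed (simp add: pfaffian_at)

lemma independent_invariants:
  assumes x: "x \<in> chart_img c" and z: "r *\<^sub>R differential (trace_of c) x + s *\<^sub>R differential (pfaffian_of c) x = 0"
  shows "r = 0 \<and> s = 0"
proof (rule independent_differentials[OF x _ z])
  show "\<forall>r s. r *\<^sub>R (J c x *v grad (g c) (trace_of c) x) + s *\<^sub>R (J c x *v grad (g c) (pfaffian_of c) x) = 0 \<longrightarrow> r = 0 \<and> s = 0"
    using ind c x by (simp add: independent_fields_def associated_field1_def associated_field2_def J_grad_def)
qed

lemma discriminant_at: "x \<in> chart_img c \<Longrightarrow> (trace_of c x)\<^sup>2 - 4 * pfaffian_of c x > 0"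
  by (rule discriminant_pos[OF hamiltonian_at(1-4) pfaffian_at]) (assumption | rule independent_invariants)+

end

lemma sigma_transition:
  assumes c: "c \<in> A" and d: "d \<in> A"
  shows "\<forall>x\<in>overlap c d. trace_of c x = trace_of d (transition c d x)"
    "\<forall>x\<in>overlap c d. pfaffian_of c x = pfaffian_of d (transition c d x)"
proof -
  have p: "\<phi> c x = pull (jacobian (transition c d) (at x)) (\<phi> d (transition c d x))" if "x \<in> overlap c d" for x
    using hamiltonian_field c d that by (simp add: bilinear_field_def Let_def pull_def)
  have s: "trace_of c x = trace_of d (transition c d x)" if x: "x \<in> overlap c d" for x
    unfolding hamiltonian_at(4)[OF c x_img[OF c d x]] hamiltonian_at(4)[OF d y_img[OF c d x]] p[OF x]
      kahler_form_transition[OF c d x] form_inner_transition[OF c d x] ..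
  then show "\<forall>x\<in>overlap c d. trace_of c x = trace_of d (transition c d x)" by blast
  have "pfaffian_of c x = pfaffian_of d (transition c d x)" if x: "x \<in> overlap c d" for x
    unfolding pfaffian_at[OF c x_img[OF c d x]] pfaffian_at[OF d y_img[OF c d x]] p[OF x]
      kahler_form_transition[OF c d x] s[OF x] pull_scaleR[symmetric] pull_diff[symmetric] form_inner_transition[OF c d x] ..
  then show "\<forall>x\<in>overlap c d. pfaffian_of c x = pfaffian_of d (transition c d x)" by blast
qed

text \<open>The coordinates \<open>\<xi>\<close> and \<open>\<eta>\<close> are the roots of \<open>t\<^sup>2 - \<sigma> t + \<pi>\<close>, which depend smoothly on the point because the
  discriminant is positive.\<close>

lemma hamiltonian_orthotoric: "orthotoric A g J"
proof -
  let ?\<sigma> = trace_of and ?\<pi> = pfaffian_of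
  define s where "s c x = sqrt ((?\<sigma> c x)\<^sup>2 - 4 * ?\<pi> c x)" for c x
  have tr: "f c x = f d (transition c d x)" if "f = (\<lambda>c x. (?\<sigma> c x + e * s c x) / 2)" "c \<in> A" "d \<in> A" "x \<in> overlap c d" for c d x e f
    using sigma_transition[OF that(2,3)] that(1,4) by (simp add: s_def)
  obtain \<xi> where xi: "\<And>c x. c \<in> A \<Longrightarrow> x \<in> chart_img c \<Longrightarrow> local_rep \<xi> c x = (?\<sigma> c x + 1 * s c x) / 2"
    using scalar_field[of "\<lambda>c x. (?\<sigma> c x + 1 * s c x) / 2", OF tr[OF refl]] by blast
  obtain \<eta> where eta: "\<And>c x. c \<in> A \<Longrightarrow> x \<in> chart_img c \<Longrightarrow> local_rep \<eta> c x = (?\<sigma> c x + (-1) * s c x) / 2"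
    using scalar_field[of "\<lambda>c x. (?\<sigma> c x + (-1) * s c x) / 2", OF tr[OF refl]] by blast
  define a b where "a = local_rep \<xi>" and "b = local_rep \<eta>"
  have ab_eq: "a c x + b c x = ?\<sigma> c x" "a c x * b c x = ?\<pi> c x" if c: "c \<in> A" and x: "x \<in> chart_img c" for c x
  proof -
    have "(s c x)\<^sup>2 = (?\<sigma> c x)\<^sup>2 - 4 * ?\<pi> c x" using discriminant_at[OF c x] by (simp add: s_def)
    then show "a c x * b c x = ?\<pi> c x" unfolding a_def b_def xi[OF c x] eta[OF c x] by (simp add: power2_eq_square field_simps)
    show "a c x + b c x = ?\<sigma> c x" unfolding a_def b_def xi[OF c x] eta[OF c x] by (simp add: field_simps)
  qed
  have sm_s: "smooth_on (chart_img c) (s c)" if c: "c \<in> A" for c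
    unfolding s_def[abs_def] power2_eq_square
    by (rule smooth_on_sqrt[OF open_chart_img[OF c]])
      (intro smooth_intros open_chart_img[OF c] smooth_sigma[OF c] smooth_pfaffian[OF c],
       use discriminant_at[OF c] in \<open>simp add: power2_eq_square\<close>)
  have sm: "smooth_on (chart_img c) (a c)" "smooth_on (chart_img c) (b c)" if c: "c \<in> A" for c
  proof -
    have e: "smooth_on (chart_img c) (\<lambda>x. (?\<sigma> c x + e * s c x) / 2)" for e
      by (intro smooth_intros open_chart_img[OF c] smooth_sigma[OF c] sm_s[OF c]) simp
    show "smooth_on (chart_img c) (a c)"
      by (rule smooth_on_cong[OF open_chart_img[OF c] _ e[of 1]]) (simp add: a_def xi[OF c])
    show "smooth_on (chart_img c) (b c)"
      by (rule smooth_on_cong[OF open_chart_img[OF c] _ e[of "-1"]]) (simp add: b_def eta[OF c])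
  qed
  have diff_eq: "differential (\<lambda>x. a c x + b c x) x = differential (?\<sigma> c) x"
    "differential (\<lambda>x. a c x * b c x) x = differential (?\<pi> c) x" if c: "c \<in> A" and x: "x \<in> chart_img c" for c x
    by (rule differential_cong[OF open_chart_img[OF c] x], rule ab_eq[OF c], assumption)+
  have pair: "kahler_chart.orth_pair (chart_img c) (g c) (J c) (a c) (b c) \<and> (\<forall>x\<in>chart_img c.
      (\<exists>k. kahler_chart.normal_hess (g c) (J c) (a c) (b c) x k) \<and> (\<exists>l. kahler_chart.normal_hess (g c) (J c) (b c) (a c) x l))"
    if c: "c \<in> A" for c
  proof -
    interpret kahler_chart "chart_img c" "g c" "J c" by (rule chart_kahler[OF c])
    interpret hamiltonian_chart "chart_img c" "g c" "J c" "\<phi> c" "trace_free_part g J \<phi> c" "?\<sigma> c" "a c" "b c"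
    proof unfold_locales
      fix x assume x: "x \<in> chart_img c"
      note i = independent_pair[OF sm[OF c] x independent_invariants[OF c x, folded diff_eq[OF c x]]]
      show "a c x \<noteq> b c x" "differential (a c) x \<noteq> 0" "differential (b c) x \<noteq> 0" by (rule i; assumption)+
      show "a c x + b c x = ?\<sigma> c x" by (rule ab_eq[OF c x])
      show "a c x * b c x = ((?\<sigma> c x)\<^sup>2 - form_inner (g c x) (\<phi> c x - ?\<sigma> c x *\<^sub>R \<omega> x) (\<phi> c x - ?\<sigma> c x *\<^sub>R \<omega> x)) / 2"
        unfolding ab_eq[OF c x] by (rule pfaffian_at[OF c x])
    qed (use hamiltonian_at[OF c] sm[OF c] in \<open>simp_all add: trace_free_part_def\<close>)
    interpret sw: hamiltonian_chart "chart_img c" "g c" "J c" "\<phi> c" "trace_free_part g J \<phi> c" "?\<sigma> c" "b c" "a c"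
      by (rule hamiltonian_chart_sym[OF hamiltonian_chart_axioms])
    show ?thesis using orth_pair normal_hess sw.normal_hess by blast
  qed
  define K L where "K = J_grad g J (local_rep (\<lambda>p. \<xi> p + \<eta> p))" and "L = J_grad g J (local_rep (\<lambda>p. \<xi> p * \<eta> p))"
  have K: "K c x = J c x *v grad (g c) (\<lambda>x. a c x + b c x) x" and L: "L c x = J c x *v grad (g c) (\<lambda>x. a c x * b c x) x" for c x
    by (simp_all add: K_def L_def J_grad_def local_rep_sum local_rep_prod a_def b_def)
  have vf: "vector_field A K" "vector_field A L"
  proof -
    have "smooth_on (chart_img c) (\<lambda>x. a c x + b c x)" "smooth_on (chart_img c) (\<lambda>x. a c x * b c x)" if c: "c \<in> A" for c
      by (intro smooth_intros open_chart_img[OF c] sm[OF c])+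
    then show "vector_field A K" "vector_field A L"
      unfolding K_def L_def by (auto intro!: vector_field_J_grad bspec[OF local_rep_transition] simp: local_rep_sum local_rep_prod a_def b_def)
  qed
  have at: "lie_metric (K c) (g c) x = 0 \<and> lie_metric (L c) (g c) x = 0 \<and>
      K c x \<bullet> (kahler_form (g c x) (J c x) *v L c x) = 0 \<and>
      covector_inner (g c x) (differential (a c) x) (differential (b c) x) = 0" if c: "c \<in> A" and x: "x \<in> chart_img c" for c x
  proof -
    interpret kahler_chart "chart_img c" "g c" "J c" by (rule chart_kahler[OF c])
    obtain k l where ab: "orth_pair (a c) (b c)" and n: "normal_hess (a c) (b c) x k" "normal_hess (b c) (a c) x l"
      using pair[OF c] x by blast
    have sp: "smooth_on (chart_img c) (\<lambda>x. a c x + b c x)" "smooth_on (chart_img c) (\<lambda>x. a c x * b c x)"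
      by (intro smooth_intros open_S sm[OF c])+
    have k: "lie_metric (K c) (g c) x = 0" "lie_metric (L c) (g c) x = 0"
      unfolding K[abs_def] L[abs_def] killing_iff[OF x sp(1)] killing_iff[OF x sp(2)] by (rule normal_hess_killing[OF ab x n])+
    have "K c x \<bullet> (\<omega> x *v L c x) = 0"
      unfolding K L J_grad_eq poisson_bracket[OF x] differential_add[OF x sm[OF c]] differential_mult[OF x sm[OF c]] J_covector_linear dJ_def[symmetric]
      by (simp add: inner_add_left mv.add_right mv.scaleR_right inner_add_right pairings[OF ab x])
    then show ?thesis using k pairings(3)[OF ab x] by (simp add: covector_inner_def)
  qed
  have "independent_fields A K L"
    using ind unfolding independent_fields_def associated_field1_def associated_field2_def
    by (simp add: J_grad_def grad_def K L diff_eq)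
  moreover have "smooth_function A \<xi>" "smooth_function A \<eta>" using sm by (auto simp: smooth_function_def a_def b_def)
  moreover have "killing_field A g K" "killing_field A g L" using vf at by (auto simp: killing_field_def)
  moreover have "poisson_commute A g J (\<lambda>p. \<xi> p + \<eta> p) (\<lambda>p. \<xi> p * \<eta> p)"
    using at by (simp add: poisson_commute_def K_def L_def)
  moreover have "momentum_map A g J K (\<lambda>p. \<xi> p + \<eta> p)" "momentum_map A g J L (\<lambda>p. \<xi> p * \<eta> p)"
    by (simp_all add: momentum_map_def K_def L_def)
  ultimately have "orthotoric_by A g J \<xi> \<eta>"
    using at unfolding orthotoric_by_def a_def b_def by blast
  then show ?thesis unfolding orthotoric_def by blast
qed

end

end

theorem theorem1:
  fixes M :: "'a::{t2_space,second_countable_topology} set"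
    and A :: "'a chart set"
    and g J :: "('a, real^4^4) field"
  assumes "kahler_surface M A g J"
  shows
    "(orthotoric A g J \<longleftrightarrow>
        (\<exists>\<phi>. hamiltonian_form A g J \<phi> \<and>
             independent_fields A (associated_field1 g J \<phi>) (associated_field2 g J \<phi>)))
     \<and>
     (\<forall>\<xi> \<eta>. orthotoric_by A g J \<xi> \<eta> \<longrightarrow>
        (\<forall>p\<in>M. \<exists>U t z F G. open U \<and> p \<in> U \<and> U \<subseteq> M \<and>
           smooth_function_on A U t \<and> smooth_function_on A U z \<and>
           open (\<xi> ` U) \<and> smooth_on (\<xi> ` U) F \<and> open (\<eta> ` U) \<and> smooth_on (\<eta> ` U) G \<and>
           orthotoric_form A g J U \<xi> \<eta> t z F G))
     \<and>
     (\<forall>(V :: (real^4) set) F G.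
        open V \<longrightarrow> smooth_on ((\<lambda>x. x $ 1) ` V) F \<longrightarrow> smooth_on ((\<lambda>x. x $ 2) ` V) G \<longrightarrow>
        (\<forall>x\<in>V. pos_def (orthotoric_metric F G (x $ 1) (x $ 2)
                          (axis 1 1) (axis 2 1) (axis 3 1) (axis 4 1))) \<longrightarrow>
        (\<exists>(g' :: (real^4, real^4^4) field) J'.
           kahler_surface V {(V, id)} g' J' \<and>
           orthotoric_by {(V, id)} g' J' (\<lambda>x. x $ 1) (\<lambda>x. x $ 2) \<and>
           orthotoric_form {(V, id)} g' J' V
             (\<lambda>x. x $ 1) (\<lambda>x. x $ 2) (\<lambda>x. x $ 3) (\<lambda>x. x $ 4) F G))"
proof (intro conjI allI impI ballI)
  interpret surface M A g J using assms by unfold_locales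
  show "orthotoric A g J \<longleftrightarrow> (\<exists>\<phi>. hamiltonian_form A g J \<phi> \<and>
      independent_fields A (associated_field1 g J \<phi>) (associated_field2 g J \<phi>))"
    using hamiltonian_orthotoric_2form independent_orthotoric_2form hamiltonian_orthotoric unfolding orthotoric_def by blast
  fix \<xi> \<eta> p assume "orthotoric_by A g J \<xi> \<eta>" "p \<in> M"
  then show "\<exists>U t z F G. open U \<and> p \<in> U \<and> U \<subseteq> M \<and>
      smooth_function_on A U t \<and> smooth_function_on A U z \<and>
      open (\<xi> ` U) \<and> smooth_on (\<xi> ` U) F \<and> open (\<eta> ` U) \<and> smooth_on (\<eta> ` U) G \<and>
      orthotoric_form A g J U \<xi> \<eta> t z F G"
    by (rule orthotoric_local_form)
next
  fix V :: "(real^4) set" and F G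
  assume "open V" "smooth_on ((\<lambda>x. x $ 1) ` V) F" "smooth_on ((\<lambda>x. x $ 2) ` V) G"
    and "\<forall>x\<in>V. pos_def (orthotoric_metric F G (x $ 1) (x $ 2) (axis 1 1) (axis 2 1) (axis 3 1) (axis 4 1))"
  then show "\<exists>(g' :: (real^4, real^4^4) field) J'.
      kahler_surface V {(V, id)} g' J' \<and>
      orthotoric_by {(V, id)} g' J' (\<lambda>x. x $ 1) (\<lambda>x. x $ 2) \<and>
      orthotoric_form {(V, id)} g' J' V (\<lambda>x. x $ 1) (\<lambda>x. x $ 2) (\<lambda>x. x $ 3) (\<lambda>x. x $ 4) F G"
    by (intro explicit_orthotoric) auto
qed

end
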